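(* Let $u\in K$ be the primal solution (the unique minimizer of $I$) and let $\mu=z\otimes\mathrm{d}x+\mu^s\in(\mathrm{ba}(\Omega))^d$ be a dual solution (a maximizer of $D$), with $z\in(L^1(\Omega))^d$ and singular part $\mu^s$. Define $\rho_I^2(v):=I(v)-I(u)$ for $v\in K$ and $\rho_{-D}^2(\nu):=-D(\nu)+D(\mu)$ for $\nu\in K^*$. Then: (i) For every $v\in K$, $$\rho_I^2(v)=\tfrac12\|\nabla v-\nabla u\|_{2,\Omega}^2+\Big(\tfrac{|z|}{\zeta}-1,\ \zeta^2-\nabla u\cdot\nabla v\Big)_{\{|\nabla u|=\zeta\}}+|\zeta\mu^s|(\Omega)-\langle\mu^s,\nabla v\rangle_{(L^\infty(\Omega))^d}.$$ (ii) For every $\nu=y\otimes\mathrm{d}x+\nu^s\in K^*$, where $y\in(L^1(\Omega))^d$ and $\nu^s\in(\mathrm{ba}(\Omega))^d$ is the singular part of $\nu$, $$\rho_{-D}^2(\nu)=\big(D_t^2\phi^*\{y,z\}(y-z),\,y-z\big)_\Omega+|\zeta\nu^s|(\Omega)-\langle\nu^s,\nabla u\rangle_{(L^\infty(\Omega))^d},$$ where, for a.e. $x\in\Omega$ and all $t,s\in\mathbb{R}^d$, $$D_t^2\phi^*\{t,s\}(x):=\int_0^1(1-\lambda)\,D_t^2\phi^*(x,\lambda t+(1-\lambda)s)\,\mathrm{d}\lambda .$$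
   Context: Let $\Omega\subseteq\mathbb{R}^d$, $d\in\mathbb{N}$, be a bounded simplicial Lipschitz domain (polyhedral, i.e. exactly decomposable into simplices) whose boundary is divided into two disjoint relatively open parts $\Gamma_D$ with $|\Gamma_D|>0$ (surface measure) and $\Gamma_N$, $\partial\Omega=\overline\Gamma_D\cup\overline\Gamma_N$. Write $(v,w)_\omega=\int_\omega v\cdot w$, $\|\cdot\|_{p,\omega}$ for the $L^p(\omega)$-norm (Euclidean norm for vectors). Traces are not denoted explicitly. $W^{1,\infty}_D(\Omega)=\{v\in W^{1,\infty}(\Omega): v=0\text{ a.e. on }\Gamma_D\}$. $W^{-1,1}(\Gamma_N)$ denotes the dual of $W^{1,\infty}(\Gamma_N)$ and $\langle\cdot,\cdot\rangle_{\Gamma_N}$ the duality pairing. Data: $f\in L^1(\Omega)$, $g\in W^{-1,1}(\Gamma_N)$, $\zeta\in L^\infty(\Omega)$ with $\operatorname{ess\,inf}_\Omega\zeta>0$, $u_D\in W^{1,\infty}(\Gamma_D)$ such that there is a (fixed) $\widehat u_D\in W^{1,\infty}(\Omega)$ with $\widehat u_D=u_D$ on $\Gamma_D$ and $\|\nabla\widehat u_D/\zeta\|_{\infty,\Omega}<1$. For a.e. $x\in\Omega$ and $s\in\mathbb{R}^d$: $\phi^*(x,s)=\frac12|s|^2$ if $|s|\le\zeta(x)$ and $\phi^*(x,s)=\zeta(x)|s|-\frac12\zeta(x)^2$ if $|s|>\zeta(x)$. Its (generalized) Hessian in the second argument is $D_t^2\phi^*(x,t)=\mathrm{I}_{d\times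 d}$ if $|t|\le\zeta(x)$ and $D_t^2\phi^*(x,t)=\frac{\zeta(x)}{|t|}\big(\mathrm{I}_{d\times d}-\frac{t\otimes t}{|t|^2}\big)$ if $|t|>\zeta(x)$. Primal problem: $K=\{v\in W^{1,\infty}(\Omega): |\nabla v|\le\zeta\text{ a.e. in }\Omega,\ v=u_D\text{ a.e. on }\Gamma_D\}$, and $I:W^{1,\infty}(\Omega)\to\mathbb{R}\cup\{+\infty\}$, $I(v)=\frac12\|\nabla v\|_{2,\Omega}^2-(f,v)_\Omega-\langle g,v\rangle_{\Gamma_N}$ if $v\in K$, $I(v)=+\infty$ otherwise. $I$ has a unique minimizer $u\in K$ (standing fact). Finitely additive measures: $(\mathrm{ba}(\Omega))^d$ is the space of finitely additive $\mathbb{R}^d$-valued set functions $\nu$ on the Lebesgue measurable subsets of $\Omega$ that vanish on Lebesgue null sets and have finite total variation $|\nu|(\Omega)=\sup\sum_i|\nu(A_i)|$ (supremum over countable measurable partitions $(A_i)$ of $\Omega$). It is isometrically isomorphic to $((L^\infty(\Omega))^d)^*$ via $\langle\nu,y\rangle_{(L^\infty(\Omega))^d}=\int_\Omega y\cdot\mathrm{d}\nu$. For $y\in(L^1(\Omega))^d$, $y\otimes\mathrm{d}x$ is the element $\widehat y\mapsto\int_\Omega y\cdot\widehat y\,\mathrm{d}x$. Every $\nu\in(\mathrm{ba}(\Omega))^d$ decomposes uniquely as $\nu=y\otimes\mathrm{d}x+\nu^s$ with $y\in(L^1(\Omega))^d$ and $\nu^s\in(\mathrm{ba}(\Omega))^d$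 singular (Lebesgue/Yosida–Hewitt decomposition: there are decreasing measurable sets $E_n$ with $|E_n|\to0$ and $|\nu^s|(\Omega\setminus E_n)=0$ for all $n$). $\zeta\nu^s\in(\mathrm{ba}(\Omega))^d$ is $(\zeta\nu^s)(A)=\int_A\zeta\,\mathrm{d}\nu^s$. Dual functional: $K^*=\{\nu\in(\mathrm{ba}(\Omega))^d:\langle\nu,\nabla v\rangle_{(L^\infty(\Omega))^d}=(f,v)_\Omega+\langle g,v\rangle_{\Gamma_N}\ \forall v\in W^{1,\infty}_D(\Omega)\}$, and for $\nu=y\otimes\mathrm{d}x+\nu^s$, $D(\nu)=-\int_\Omega\phi^*(\cdot,y)\,\mathrm{d}x-|\zeta\nu^s|(\Omega)+\langle\nu,\nabla\widehat u_D\rangle_{(L^\infty(\Omega))^d}-(f,\widehat u_D)_\Omega-\langle g,\widehat u_D\rangle_{\Gamma_N}$ if $\nu\in K^*$, and $D(\nu)=-\infty$ otherwise. $D$ is the Fenchel dual functional of $I$. *)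

theory Defs
  imports "HOL-Analysis.Analysis" "HOL-Probability.Essential_Supremum"
begin

text \<open>Near every boundary point the domain is, in suitable Cartesian coordinates
  (\<open>e\<close> is the vertical direction), the strict epigraph of a Lipschitz function on the
  hyperplane orthogonal to \<open>e\<close>.\<close>

definition lipschitz_domain :: "'a::euclidean_space set \<Rightarrow> bool" where
  "lipschitz_domain \<Omega> \<longleftrightarrow>
     open \<Omega> \<and> connected \<Omega> \<and> \<Omega> \<noteq> {} \<and>
     (\<forall>p\<in>frontier \<Omega>. \<exists>e r h L \<gamma>. norm e = 1 \<and> 0 < r \<and> 0 < h \<and>
        L-lipschitz_on {y. y \<bullet> e = 0} \<gamma> \<and>
        (\<forall>y t. y \<bullet> e = 0 \<and> norm y < r \<and> \<bar>t\<bar> < h \<longrightarrow>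
           (p + y + t *\<^sub>R e \<in> \<Omega> \<longleftrightarrow> \<gamma> y < (t::real))))"

definition simplicial :: "'a::euclidean_space set \<Rightarrow> bool" where
  "simplicial \<Omega> \<longleftrightarrow>
     (\<exists>\<T>. triangulation \<T> \<and> (\<forall>T\<in>\<T>. int DIM('a) simplex T) \<and> \<Union>\<T> = closure \<Omega>)"

text \<open>The surface measure is the Hausdorff measure of dimension \<open>DIM('a) - 1\<close>. The usual
  normalising factor is omitted: only null sets and positivity are used. For \<open>k = 0\<close> the
  convention \<open>0 ^ 0 = 1\<close> gives the counting measure, whence the separate clause for \<open>{}\<close>.\<close>

definition hausdorff_premeasure :: "nat \<Rightarrow> real \<Rightarrow> 'a::metric_space set \<Rightarrow> ennreal" where
  "hausdorff_premeasure k \<delta> A =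
     (INF U\<in>{U :: nat \<Rightarrow> 'a set. A \<subseteq> (\<Union>i. U i) \<and> (\<forall>i. bounded (U i) \<and> diameter (U i) \<le> \<delta>)}.
        \<Sum>i. if U i = {} then 0 else ennreal (diameter (U i) ^ k))"

definition hausdorff_measure :: "nat \<Rightarrow> 'a::metric_space set \<Rightarrow> ennreal" where
  "hausdorff_measure k A = (SUP \<delta>\<in>{0<..}. hausdorff_premeasure k \<delta> A)"

definition surface_measure :: "'a::euclidean_space set \<Rightarrow> ennreal" where
  "surface_measure A = hausdorff_measure (DIM('a) - 1) A"

definition surface_ae :: "'a::euclidean_space set \<Rightarrow> ('a \<Rightarrow> bool) \<Rightarrow> bool" where
  "surface_ae \<Gamma> P \<longleftrightarrow> surface_measure {x \<in> \<Gamma>. \<not> P x} = 0"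

definition boundary_parts :: "'a::euclidean_space set \<Rightarrow> 'a set \<Rightarrow> 'a set \<Rightarrow> bool" where
  "boundary_parts \<Omega> \<Gamma>D \<Gamma>N \<longleftrightarrow>
     openin (top_of_set (frontier \<Omega>)) \<Gamma>D \<and> openin (top_of_set (frontier \<Omega>)) \<Gamma>N \<and>
     \<Gamma>D \<inter> \<Gamma>N = {} \<and> frontier \<Omega> = closure \<Gamma>D \<union> closure \<Gamma>N \<and> 0 < surface_measure \<Gamma>D"

text \<open>Elements of Lebesgue and Sobolev spaces are represented by functions on the whole space,
  of which only the values almost everywhere on \<open>\<Omega>\<close> matter.\<close>

definition Linf :: "'a::euclidean_space set \<Rightarrow> ('a \<Rightarrow> 'b::euclidean_space) set" where
  "Linf \<Omega> = {v \<in> borel_measurable (lebesgue_on \<Omega>).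
     esssup (lebesgue_on \<Omega>) (\<lambda>x. ereal (norm (v x))) < \<infinity>}"

text \<open>As in Gilbarg and Trudinger, first order weak derivatives are tested with continuously
  differentiable functions \<open>\<psi>\<close> (here with gradient \<open>\<psi>'\<close>) of compact support in \<open>\<Omega>\<close>.\<close>

definition test_function :: "'a::euclidean_space set \<Rightarrow> ('a \<Rightarrow> real) \<Rightarrow> ('a \<Rightarrow> 'a) \<Rightarrow> bool" where
  "test_function \<Omega> \<psi> \<psi>' \<longleftrightarrow>
     (\<forall>x. GDERIV \<psi> x :> \<psi>' x) \<and> continuous_on UNIV \<psi>' \<and>
     compact (closure {x. \<psi> x \<noteq> 0}) \<and> closure {x. \<psi> x \<noteq> 0} \<subseteq> \<Omega>"

definition weak_gradient :: "'a::euclidean_space set \<Rightarrow> ('a \<Rightarrow> real) \<Rightarrow> ('a \<Rightarrow> 'a) \<Rightarrow> bool" where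
  "weak_gradient \<Omega> v G \<longleftrightarrow>
     (\<forall>\<psi> \<psi>'. test_function \<Omega> \<psi> \<psi>' \<longrightarrow>
        (LINT x|lebesgue_on \<Omega>. v x *\<^sub>R \<psi>' x) = - (LINT x|lebesgue_on \<Omega>. \<psi> x *\<^sub>R G x))"

definition W1inf :: "'a::euclidean_space set \<Rightarrow> ('a \<Rightarrow> real) set" where
  "W1inf \<Omega> = {v \<in> Linf \<Omega>. \<exists>G\<in>Linf \<Omega>. weak_gradient \<Omega> v G}"

definition grad :: "'a::euclidean_space set \<Rightarrow> ('a \<Rightarrow> real) \<Rightarrow> 'a \<Rightarrow> 'a" where
  "grad \<Omega> v = (SOME G. G \<in> Linf \<Omega> \<and> weak_gradient \<Omega> v G)"

text \<open>On a bounded Lipschitz domain every function in \<open>W1inf \<Omega>\<close> has exactly one representative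
  that is continuous up to the boundary; its boundary values are the trace. (Outside
  \<open>closure \<Omega>\<close> the function below is arbitrary.)\<close>

definition boundary_trace :: "'a::euclidean_space set \<Rightarrow> ('a \<Rightarrow> real) \<Rightarrow> 'a \<Rightarrow> real" where
  "boundary_trace \<Omega> v = (SOME w. continuous_on (closure \<Omega>) w \<and> (AE x in lebesgue_on \<Omega>. w x = v x))"

definition W1inf_D :: "'a::euclidean_space set \<Rightarrow> 'a set \<Rightarrow> ('a \<Rightarrow> real) set" where
  "W1inf_D \<Omega> \<Gamma>D = {v \<in> W1inf \<Omega>. surface_ae \<Gamma>D (\<lambda>x. boundary_trace \<Omega> v x = 0)}"

text \<open>\<open>W\<^sup>1\<^sup>,\<^sup>\<infinity>\<close> on a relatively open part \<open>\<Gamma>\<close> of a Lipschitz boundary: in Lipschitz charts, bounded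
  functions with bounded weak gradient are, up to null sets, the bounded functions that are
  locally Lipschitz with one constant \<open>L\<close>. Lipschitz continuity is required only
  locally, so that no Euclidean shortcuts across gaps or slits of \<open>\<Gamma>\<close> enter. The norm is
  equivalent to the usual one, hence gives the same dual space.\<close>

definition W1inf_surface_bounds :: "'a::euclidean_space set \<Rightarrow> ('a \<Rightarrow> real) \<Rightarrow> real \<Rightarrow> real \<Rightarrow> bool" where
  "W1inf_surface_bounds \<Gamma> w B L \<longleftrightarrow> 0 \<le> B \<and> 0 \<le> L \<and>
     (\<exists>w'. surface_ae \<Gamma> (\<lambda>x. w' x = w x) \<and> (\<forall>x\<in>\<Gamma>. \<bar>w' x\<bar> \<le> B) \<and>
        (\<forall>x\<in>\<Gamma>. \<exists>\<epsilon>>0. L-lipschitz_on (\<Gamma> \<inter> ball x \<epsilon>) w'))"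

definition W1inf_surface :: "'a::euclidean_space set \<Rightarrow> ('a \<Rightarrow> real) set" where
  "W1inf_surface \<Gamma> = {w. \<exists>B L. W1inf_surface_bounds \<Gamma> w B L}"

definition W1inf_surface_norm :: "'a::euclidean_space set \<Rightarrow> ('a \<Rightarrow> real) \<Rightarrow> real" where
  "W1inf_surface_norm \<Gamma> w = Inf {B + L | B L. W1inf_surface_bounds \<Gamma> w B L}"

text \<open>\<open>W\<^sup>-\<^sup>1\<^sup>,\<^sup>1\<close>, the dual of the preceding space. Boundedness forces \<open>g w\<close> to depend only on the
  values of \<open>w\<close> almost everywhere on \<open>\<Gamma>\<close>; the duality pairing is application.\<close>

definition W1inf_surface_dual :: "'a::euclidean_space set \<Rightarrow> (('a \<Rightarrow> real) \<Rightarrow> real) set" where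
  "W1inf_surface_dual \<Gamma> = {g.
     (\<forall>v\<in>W1inf_surface \<Gamma>. \<forall>w\<in>W1inf_surface \<Gamma>. g (\<lambda>x. v x + w x) = g v + g w) \<and>
     (\<forall>c. \<forall>w\<in>W1inf_surface \<Gamma>. g (\<lambda>x. c * w x) = c * g w) \<and>
     (\<exists>C. \<forall>w\<in>W1inf_surface \<Gamma>. \<bar>g w\<bar> \<le> C * W1inf_surface_norm \<Gamma> w)}"

text \<open>\<open>total_variation \<Omega> \<nu> A\<close> is \<open>|\<nu>|(A)\<close>; finite partitions are padded with empty sets.\<close>

definition total_variation ::
  "'a::euclidean_space set \<Rightarrow> ('a set \<Rightarrow> 'a) \<Rightarrow> 'a set \<Rightarrow> ennreal" where
  "total_variation \<Omega> \<nu> A =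
     (SUP P\<in>{P :: nat \<Rightarrow> 'a set. range P \<subseteq> sets (lebesgue_on \<Omega>) \<and> disjoint_family P \<and>
        (\<Union>i. P i) = A}. \<Sum>i. ennreal (norm (\<nu> (P i))))"

text \<open>Set functions are normalised to vanish on sets that are not measurable subsets of \<open>\<Omega>\<close>,
  so that equality of set functions is equality in \<open>ba\<close>.\<close>

definition ba :: "'a::euclidean_space set \<Rightarrow> ('a set \<Rightarrow> 'a) set" where
  "ba \<Omega> = {\<nu>.
     (\<forall>A. A \<notin> sets (lebesgue_on \<Omega>) \<longrightarrow> \<nu> A = 0) \<and>
     (\<forall>A\<in>sets (lebesgue_on \<Omega>). \<forall>B\<in>sets (lebesgue_on \<Omega>).
        A \<inter> B = {} \<longrightarrow> \<nu> (A \<union> B) = \<nu> A + \<nu> B) \<and>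
     (\<forall>A\<in>null_sets (lebesgue_on \<Omega>). \<nu> A = 0) \<and>
     total_variation \<Omega> \<nu> \<Omega> < \<infinity>}"

text \<open>\<open>ba_integral \<Omega> \<nu> y\<close> is \<open>\<integral>\<^sub>\<Omega> y \<cdot> d\<nu>\<close>, the duality pairing of \<open>ba\<close> with \<open>L\<^sup>\<infinity>\<close>. It is the limit
  of the integrals of simple functions converging to \<open>y\<close> in \<open>L\<^sup>\<infinity>\<close>.\<close>

definition ba_integral_simple ::
  "'a::euclidean_space set \<Rightarrow> ('a set \<Rightarrow> 'a) \<Rightarrow> ('a \<Rightarrow> 'a) \<Rightarrow> real" where
  "ba_integral_simple \<Omega> \<nu> s = (\<Sum>c\<in>s ` \<Omega>. c \<bullet> \<nu> {x \<in> \<Omega>. s x = c})"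

definition ba_integral ::
  "'a::euclidean_space set \<Rightarrow> ('a set \<Rightarrow> 'a) \<Rightarrow> ('a \<Rightarrow> 'a) \<Rightarrow> real" where
  "ba_integral \<Omega> \<nu> y = (THE J. \<exists>s :: nat \<Rightarrow> 'a \<Rightarrow> 'a.
     (\<forall>n. simple_function (lebesgue_on \<Omega>) (s n)) \<and>
     (\<lambda>n. esssup (lebesgue_on \<Omega>) (\<lambda>x. ereal (norm (s n x - y x)))) \<longlonglongrightarrow> 0 \<and>
     (\<lambda>n. ba_integral_simple \<Omega> \<nu> (s n)) \<longlonglongrightarrow> J)"

text \<open>\<open>y \<otimes> dx\<close>, as a set function.\<close>

definition ac_ba :: "'a::euclidean_space set \<Rightarrow> ('a \<Rightarrow> 'a) \<Rightarrow> 'a set \<Rightarrow> 'a" where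
  "ac_ba \<Omega> y A = (if A \<in> sets (lebesgue_on \<Omega>) then (LINT x:A|lebesgue_on \<Omega>. y x) else 0)"

definition ba_singular :: "'a::euclidean_space set \<Rightarrow> ('a set \<Rightarrow> 'a) \<Rightarrow> bool" where
  "ba_singular \<Omega> \<nu> \<longleftrightarrow> \<nu> \<in> ba \<Omega> \<and>
     (\<exists>E :: nat \<Rightarrow> 'a set. range E \<subseteq> sets (lebesgue_on \<Omega>) \<and> decseq E \<and>
        (\<lambda>n. emeasure lebesgue (E n)) \<longlonglongrightarrow> 0 \<and>
        (\<forall>n. total_variation \<Omega> \<nu> (\<Omega> - E n) = 0))"

definition ba_decomposition ::
  "'a::euclidean_space set \<Rightarrow> ('a set \<Rightarrow> 'a) \<Rightarrow> ('a \<Rightarrow> 'a) \<Rightarrow> ('a set \<Rightarrow> 'a) \<Rightarrow> bool" where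
  "ba_decomposition \<Omega> \<nu> y \<nu>s \<longleftrightarrow>
     integrable (lebesgue_on \<Omega>) y \<and> ba_singular \<Omega> \<nu>s \<and> \<nu> = (\<lambda>A. ac_ba \<Omega> y A + \<nu>s A)"

definition ba_density :: "'a::euclidean_space set \<Rightarrow> ('a set \<Rightarrow> 'a) \<Rightarrow> 'a \<Rightarrow> 'a" where
  "ba_density \<Omega> \<nu> = (SOME y. \<exists>\<nu>s. ba_decomposition \<Omega> \<nu> y \<nu>s)"

definition ba_singular_part :: "'a::euclidean_space set \<Rightarrow> ('a set \<Rightarrow> 'a) \<Rightarrow> 'a set \<Rightarrow> 'a" where
  "ba_singular_part \<Omega> \<nu> = (THE \<nu>s. \<exists>y. ba_decomposition \<Omega> \<nu> y \<nu>s)"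

text \<open>\<open>(\<zeta>\<nu>)(A) = \<integral>\<^sub>A \<zeta> d\<nu>\<close>, computed componentwise.\<close>

definition ba_scale ::
  "'a::euclidean_space set \<Rightarrow> ('a \<Rightarrow> real) \<Rightarrow> ('a set \<Rightarrow> 'a) \<Rightarrow> 'a set \<Rightarrow> 'a" where
  "ba_scale \<Omega> \<zeta> \<nu> A =
     (if A \<in> sets (lebesgue_on \<Omega>)
      then (\<Sum>b\<in>Basis. ba_integral \<Omega> \<nu> (\<lambda>x. (indicator A x * \<zeta> x) *\<^sub>R b) *\<^sub>R b) else 0)"

text \<open>\<open>|\<zeta>\<nu>|(\<Omega>)\<close>, which is finite for \<open>\<nu> \<in> ba \<Omega>\<close> and \<open>\<zeta> \<in> L\<^sup>\<infinity>\<close>.\<close>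

definition weighted_variation ::
  "'a::euclidean_space set \<Rightarrow> ('a \<Rightarrow> real) \<Rightarrow> ('a set \<Rightarrow> 'a) \<Rightarrow> real" where
  "weighted_variation \<Omega> \<zeta> \<nu> = enn2real (total_variation \<Omega> (ba_scale \<Omega> \<zeta> \<nu>) \<Omega>)"

definition phi_star :: "('a::euclidean_space \<Rightarrow> real) \<Rightarrow> 'a \<Rightarrow> 'a \<Rightarrow> real" where
  "phi_star \<zeta> x s =
     (if norm s \<le> \<zeta> x then 1/2 * (norm s)\<^sup>2 else \<zeta> x * norm s - 1/2 * (\<zeta> x)\<^sup>2)"

definition outer_product :: "real ^ 'd \<Rightarrow> real ^ 'd \<Rightarrow> real ^ 'd ^ 'd" where
  "outer_product s t = (\<chi> i j. s $ i * t $ j)"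

definition phi_star_hessian ::
  "(real ^ 'd \<Rightarrow> real) \<Rightarrow> real ^ 'd \<Rightarrow> real ^ 'd \<Rightarrow> real ^ 'd ^ 'd" where
  "phi_star_hessian \<zeta> x t =
     (if norm t \<le> \<zeta> x then mat 1
      else (\<zeta> x / norm t) *\<^sub>R (mat 1 - (1 / (norm t)\<^sup>2) *\<^sub>R outer_product t t))"

definition phi_star_hessian_mean ::
  "(real ^ 'd \<Rightarrow> real) \<Rightarrow> real ^ 'd \<Rightarrow> real ^ 'd \<Rightarrow> real ^ 'd \<Rightarrow> real ^ 'd ^ 'd" where
  "phi_star_hessian_mean \<zeta> x t s =
     (LINT l:{0..1}|lborel. (1 - l) *\<^sub>R phi_star_hessian \<zeta> x (l *\<^sub>R t + (1 - l) *\<^sub>R s))"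

text \<open>The load \<open>(f, v)\<^sub>\<Omega> + \<langle>g, v\<rangle>\<close>, the latter pairing being taken on \<open>\<Gamma>\<^sub>N\<close>.\<close>

definition load ::
  "'a::euclidean_space set \<Rightarrow> ('a \<Rightarrow> real) \<Rightarrow> (('a \<Rightarrow> real) \<Rightarrow> real) \<Rightarrow> ('a \<Rightarrow> real) \<Rightarrow> real" where
  "load \<Omega> f g v = (LINT x|lebesgue_on \<Omega>. f x * v x) + g (boundary_trace \<Omega> v)"

definition primal_set ::
  "'a::euclidean_space set \<Rightarrow> 'a set \<Rightarrow> ('a \<Rightarrow> real) \<Rightarrow> ('a \<Rightarrow> real) \<Rightarrow> ('a \<Rightarrow> real) set" where
  "primal_set \<Omega> \<Gamma>D \<zeta> uD = {v \<in> W1inf \<Omega>.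
     (AE x in lebesgue_on \<Omega>. norm (grad \<Omega> v x) \<le> \<zeta> x) \<and>
     surface_ae \<Gamma>D (\<lambda>x. boundary_trace \<Omega> v x = uD x)}"

definition primal_energy ::
  "'a::euclidean_space set \<Rightarrow> 'a set \<Rightarrow> ('a \<Rightarrow> real) \<Rightarrow> ('a \<Rightarrow> real) \<Rightarrow> ('a \<Rightarrow> real) \<Rightarrow>
     (('a \<Rightarrow> real) \<Rightarrow> real) \<Rightarrow> ('a \<Rightarrow> real) \<Rightarrow> ereal" where
  "primal_energy \<Omega> \<Gamma>D \<zeta> uD f g v =
     (if v \<in> primal_set \<Omega> \<Gamma>D \<zeta> uD
      then ereal (1/2 * (LINT x|lebesgue_on \<Omega>. (norm (grad \<Omega> v x))\<^sup>2) - load \<Omega> f g v)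
      else \<infinity>)"

definition dual_set ::
  "'a::euclidean_space set \<Rightarrow> 'a set \<Rightarrow> ('a \<Rightarrow> real) \<Rightarrow> (('a \<Rightarrow> real) \<Rightarrow> real) \<Rightarrow>
     ('a set \<Rightarrow> 'a) set" where
  "dual_set \<Omega> \<Gamma>D f g =
     {\<nu> \<in> ba \<Omega>. \<forall>v\<in>W1inf_D \<Omega> \<Gamma>D. ba_integral \<Omega> \<nu> (grad \<Omega> v) = load \<Omega> f g v}"

text \<open>\<open>uhat\<close> is the fixed extension of the Dirichlet data to \<open>\<Omega>\<close>.\<close>

definition dual_energy ::
  "'a::euclidean_space set \<Rightarrow> 'a set \<Rightarrow> ('a \<Rightarrow> real) \<Rightarrow> ('a \<Rightarrow> real) \<Rightarrow> ('a \<Rightarrow> real) \<Rightarrow>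
     (('a \<Rightarrow> real) \<Rightarrow> real) \<Rightarrow> ('a set \<Rightarrow> 'a) \<Rightarrow> ereal" where
  "dual_energy \<Omega> \<Gamma>D \<zeta> uhat f g \<nu> =
     (if \<nu> \<in> dual_set \<Omega> \<Gamma>D f g
      then ereal (- (LINT x|lebesgue_on \<Omega>. phi_star \<zeta> x (ba_density \<Omega> \<nu> x))
                  - weighted_variation \<Omega> \<zeta> (ba_singular_part \<Omega> \<nu>)
                  + ba_integral \<Omega> \<nu> (grad \<Omega> uhat) - load \<Omega> f g uhat)
      else -\<infinity>)"

end

theory Submission
  imports Defs "HOL-Library.Function_Algebras"
begin

text \<open>The two error identities are consequences of the optimality conditions
  \<open>optimality\<close>: almost everywhere \<open>grad \<Omega> u x = flux \<zeta> x (z x)\<close>, where \<open>flux \<zeta> x\<close> is the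
  gradient of \<open>\<phi>\<^sup>*(x, \<cdot>)\<close>, and \<open>|\<zeta>\<mu>\<^sup>s|(\<Omega>) = \<langle>\<mu>\<^sup>s, \<nabla>u\<rangle>\<close>. For the primal identity
  (\<open>primal_error_identity\<close>) feasibility of \<open>\<mu>\<close> turns the difference of the loads of \<open>v\<close> and
  \<open>u\<close> into \<open>\<langle>\<mu>, \<nabla>v - \<nabla>u\<rangle>\<close>. Completing the square in the density part leaves \<open>\<integral> (z - \<nabla>u) \<cdot>
  (\<nabla>u - \<nabla>v)\<close>, and this integrand lives on the contact set \<open>|\<nabla>u| = \<zeta>\<close>: where \<open>|z| \<le> \<zeta>\<close> the
  flux of \<open>z\<close> is \<open>z\<close> itself, elsewhere \<open>z\<close> is the multiple \<open>|z|/\<zeta>\<close> of \<open>\<nabla>u\<close>. For the dual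
  identity (\<open>dual_gap\<close>) all linear terms combine to \<open>\<langle>\<nu> - \<mu>, \<nabla>u\<rangle>\<close>. What remains of the
  density part is the Bregman distance \<open>\<phi>\<^sup>*(y) - \<phi>\<^sup>*(z) - flux(z) \<cdot> (y - z)\<close>, and Taylor's
  formula with integral remainder (\<open>phi_star_Taylor\<close>) writes it with the mean Hessian; \<open>\<phi>\<^sup>*\<close>
  is once continuously differentiable and twice away from a sphere, which a nondegenerate
  segment meets at most twice.

  The optimality conditions come from strong duality \<open>D(\<mu>) \<ge> I(u)\<close>: as \<open>I(u) - D(\<mu>)\<close>
  is the sum of the integrated defect in Fenchel's inequality and of \<open>|\<zeta>\<mu>\<^sup>s|(\<Omega>) - \<langle>\<mu>\<^sup>s,
  \<nabla>u\<rangle>\<close>, both nonnegative, both vanish. Since \<open>\<mu>\<close> maximises \<open>D\<close>, one \<open>\<nu> \<in> ba\<close> with \<open>D(\<nu>) \<ge>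
  I(u)\<close> is enough, and \<open>multiplier\<close> provides it. Minimality of \<open>u\<close> says that the linear
  functional \<open>\<nabla>w \<mapsto> (f, w) + \<langle>g, w\<rangle>\<close> on gradients of functions vanishing on \<open>\<Gamma>\<^sub>D\<close> is bounded
  on the convex set \<open>{G. |\<nabla>uhat + G| \<le> \<zeta>}\<close> by the convex function \<open>1/2 \<parallel>\<nabla>uhat + G\<parallel>\<^sup>2 -
  load(uhat) - I(u)\<close>, where \<open>uhat\<close> is the given extension of the Dirichlet data. As
  \<open>|\<nabla>uhat|\<close> stays uniformly below \<open>\<zeta>\<close>, this set contains a ball of \<open>L\<^sup>\<infinity>\<close>, so
  \<open>Hahn_Banach_convex_majorant\<close> extends the functional to all bounded fields under the same
  majorant. The majorant also makes the extension bounded, so that it is integration against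
  some \<open>\<nu> \<in> ba\<close> (\<open>functional_representation\<close>). That the load is determined by the gradient
  at all follows from the majorant as well.

  It remains to read off \<open>D(\<nu>) \<ge> I(u)\<close> from the bound \<open>\<langle>\<nu>, H\<rangle> - 1/2 \<parallel>H\<parallel>\<^sup>2 \<le> \<langle>\<nu>,
  \<nabla>uhat\<rangle> - load(uhat) - I(u)\<close>, valid for all \<open>|H| \<le> \<zeta>\<close>. Write \<open>\<nu> = y \<otimes> dx + \<nu>\<^sup>s\<close>
  (\<open>Yosida_Hewitt_decomposition\<close>) with \<open>\<nu>\<^sup>s\<close> concentrated on decreasing sets \<open>E\<^sub>n\<close> of
  vanishing volume. In \<open>conjugate_le\<close> the field \<open>H\<close> is the flux of \<open>y\<close> off \<open>E\<^sub>n\<close>, where it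
  realises \<open>\<phi>\<^sup>*(y)\<close>, and is free on \<open>E\<^sub>n\<close>, where it exhausts \<open>|\<zeta>\<nu>\<^sup>s|(\<Omega>)\<close>; the two choices do
  not disturb each other in the limit.

  All of this uses that gradients, traces and the load depend linearly on the
  function, although gradients and traces are chosen arbitrarily among the functions that
  qualify. For gradients this is the fundamental lemma of the calculus of variations. For
  traces it rests on \<open>W1inf_continuous_representative\<close>: on a Lipschitz domain a function
  with bounded weak gradient has a representative that is continuous on the closure.
  Mollification bounds differences along segments inside the domain, and near a boundary
  point any two points of the domain are joined by three such segments of comparable total
  length.\<close>

section \<open>Finitely additive measures as the dual of essentially bounded fields\<close>

locale finite_domain =
  fixes \<Omega> :: "'a::euclidean_space set"
  assumes measurable_domain: "\<Omega> \<in> sets lebesgue"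
    and finite_volume: "emeasure lebesgue \<Omega> < \<infinity>"
    and positive_volume: "emeasure lebesgue \<Omega> \<noteq> 0"
begin

sublocale finite_measure "lebesgue_on \<Omega>"
  using measurable_domain finite_volume
  by (intro finite_measureI) (simp add: emeasure_restrict_space)

lemma AE_const_D: "AE x in lebesgue_on \<Omega>. P \<Longrightarrow> P"
  using positive_volume measurable_domain
  by (cases P) (auto simp: AE_iff_measurable[OF _ refl] emeasure_restrict_space)

lemma AE_bound_nonneg: "AE x in lebesgue_on \<Omega>. norm (y x) \<le> C \<Longrightarrow> 0 \<le> C"
  by (rule AE_const_D) (auto elim!: eventually_mono intro: order_trans[OF norm_ge_zero])

lemma esssup_le_ereal_iff:
  assumes "y \<in> borel_measurable (lebesgue_on \<Omega>)"
  shows "esssup (lebesgue_on \<Omega>) (\<lambda>x. ereal (norm (y x))) \<le> ereal C \<longleftrightarrow>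
    (AE x in lebesgue_on \<Omega>. norm (y x) \<le> C)"
proof
  have "AE x in lebesgue_on \<Omega>. ereal (norm (y x)) \<le> esssup (lebesgue_on \<Omega>) (\<lambda>x. ereal (norm (y x)))"
    by (rule esssup_AE)
  moreover assume "esssup (lebesgue_on \<Omega>) (\<lambda>x. ereal (norm (y x))) \<le> ereal C"
  ultimately show "AE x in lebesgue_on \<Omega>. norm (y x) \<le> C"
    by (auto elim!: eventually_mono dest: order_trans)
next
  assume "AE x in lebesgue_on \<Omega>. norm (y x) \<le> C"
  then show "esssup (lebesgue_on \<Omega>) (\<lambda>x. ereal (norm (y x))) \<le> ereal C"
    using assms by (intro esssup_I) auto
qed

lemma Linf_iff:
  "y \<in> Linf \<Omega> \<longleftrightarrow> y \<in> borel_measurable (lebesgue_on \<Omega>) \<and> (\<exists>C. AE x in lebesgue_on \<Omega>. norm (y x) \<le> C)"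
proof (cases "y \<in> borel_measurable (lebesgue_on \<Omega>)")
  case True
  let ?e = "esssup (lebesgue_on \<Omega>) (\<lambda>x. ereal (norm (y x)))"
  have "?e < \<infinity> \<longleftrightarrow> (\<exists>C. ?e \<le> ereal C)"
  proof
    assume "?e < \<infinity>"
    then show "\<exists>C. ?e \<le> ereal C" by (cases ?e) auto
  next
    assume "\<exists>C. ?e \<le> ereal C"
    then show "?e < \<infinity>" by (auto simp: less_ereal.simps intro: order.strict_trans1)
  qed
  with True show ?thesis by (simp add: Linf_def esssup_le_ereal_iff)
qed (simp add: Linf_def)

lemma Linf_measurable [dest]: "y \<in> Linf \<Omega> \<Longrightarrow> y \<in> borel_measurable (lebesgue_on \<Omega>)"
  by (simp add: Linf_iff)

lemma Linf_boundE:
  assumes "y \<in> Linf \<Omega>"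
  obtains C where "0 \<le> C" "AE x in lebesgue_on \<Omega>. norm (y x) \<le> C"
  using assms AE_bound_nonneg by (auto simp: Linf_iff)

lemma LinfI: "y \<in> borel_measurable (lebesgue_on \<Omega>) \<Longrightarrow> AE x in lebesgue_on \<Omega>. norm (y x) \<le> C \<Longrightarrow> y \<in> Linf \<Omega>"
  by (auto simp: Linf_iff)

lemma Linf_add:
  assumes "y \<in> Linf \<Omega>" "w \<in> Linf \<Omega>"
  shows "(\<lambda>x. y x + w x) \<in> Linf \<Omega>"
proof -
  obtain C D where "AE x in lebesgue_on \<Omega>. norm (y x) \<le> C" "AE x in lebesgue_on \<Omega>. norm (w x) \<le> D"
    using assms by (auto simp: Linf_iff)
  then have "AE x in lebesgue_on \<Omega>. norm (y x + w x) \<le> C + D"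
    by eventually_elim (meson add_mono norm_triangle_ineq order_trans)
  with assms show ?thesis by (intro LinfI[of _ "C + D"] borel_measurable_add) auto
qed

lemma Linf_scaleR:
  assumes "y \<in> Linf \<Omega>"
  shows "(\<lambda>x. c *\<^sub>R y x) \<in> Linf \<Omega>"
proof -
  obtain C where "AE x in lebesgue_on \<Omega>. norm (y x) \<le> C" using assms by (auto simp: Linf_iff)
  then have "AE x in lebesgue_on \<Omega>. norm (c *\<^sub>R y x) \<le> \<bar>c\<bar> * C"
    by eventually_elim (simp add: mult_left_mono)
  with assms show ?thesis by (intro LinfI) auto
qed

lemma Linf_minus: "y \<in> Linf \<Omega> \<Longrightarrow> (\<lambda>x. - y x) \<in> Linf \<Omega>"
  using Linf_scaleR[of y "-1"] by simp

lemma Linf_diff: "y \<in> Linf \<Omega> \<Longrightarrow> w \<in> Linf \<Omega> \<Longrightarrow> (\<lambda>x. y x - w x) \<in> Linf \<Omega>"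
  using Linf_add[OF _ Linf_minus, of y w] by simp

lemma Linf_const [simp]: "(\<lambda>x. c) \<in> Linf \<Omega>"
  by (rule LinfI[of _ "norm c"]) auto

lemma Linf_mult:
  fixes \<phi> :: "'a \<Rightarrow> real" and y :: "'a \<Rightarrow> 'b::euclidean_space"
  assumes "\<phi> \<in> Linf \<Omega>" "y \<in> Linf \<Omega>"
  shows "(\<lambda>x. \<phi> x *\<^sub>R y x) \<in> Linf \<Omega>"
proof -
  obtain C D where "0 \<le> C" "AE x in lebesgue_on \<Omega>. norm (\<phi> x) \<le> C" "AE x in lebesgue_on \<Omega>. norm (y x) \<le> D"
    using Linf_boundE[OF assms(1)] Linf_boundE[OF assms(2)] by metis
  then have "AE x in lebesgue_on \<Omega>. norm (\<phi> x *\<^sub>R y x) \<le> C * D"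
    by (auto elim!: eventually_elim2 intro!: mult_mono)
  with assms show ?thesis by (intro LinfI[of _ "C * D"] borel_measurable_scaleR) auto
qed

lemma Linf_indicator [simp]:
  "A \<in> sets (lebesgue_on \<Omega>) \<Longrightarrow> (indicator A :: 'a \<Rightarrow> real) \<in> Linf \<Omega>"
  by (rule LinfI[of _ 1]) (auto simp: indicator_def)

lemma Linf_sum:
  "(\<And>i. i \<in> I \<Longrightarrow> y i \<in> Linf \<Omega>) \<Longrightarrow> (\<lambda>x. \<Sum>i\<in>I. y i x) \<in> Linf \<Omega>"
  by (induction I rule: infinite_finite_induct) (auto intro: Linf_add)

lemma Linf_restrict:
  "A \<in> sets (lebesgue_on \<Omega>) \<Longrightarrow> y \<in> Linf \<Omega> \<Longrightarrow> (\<lambda>x. indicator A x *\<^sub>R y x) \<in> Linf \<Omega>"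
  by (rule Linf_mult) auto

lemma simple_function_Linf: "simple_function (lebesgue_on \<Omega>) s \<Longrightarrow> s \<in> Linf \<Omega>" for s :: "'a \<Rightarrow> 'a"
proof (rule LinfI)
  assume s: "simple_function (lebesgue_on \<Omega>) s"
  then show "s \<in> borel_measurable (lebesgue_on \<Omega>)" by (rule borel_measurable_simple_function)
  have "finite (s ` \<Omega>)" using simple_functionD(1)[OF s] by simp
  then show "AE x in lebesgue_on \<Omega>. norm (s x) \<le> Max (norm ` s ` \<Omega>)"
    by (intro AE_I2 Max_ge) auto
qed

text \<open>Rounding each coordinate down to a grid of mesh \<open>\<delta>\<close> takes only finitely many
  values on a bounded range and moves a point by at most \<open>DIM('a) * \<delta>\<close>.\<close>

lemma Linf_uniform_approximation:
  assumes y: "y \<in> Linf \<Omega>" and e: "0 < e"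
  obtains s :: "'a \<Rightarrow> 'a" where "simple_function (lebesgue_on \<Omega>) s" "AE x in lebesgue_on \<Omega>. norm (s x - y x) \<le> e"
proof -
  obtain C where C: "0 \<le> C" "AE x in lebesgue_on \<Omega>. norm (y x) \<le> C" using y by (rule Linf_boundE)
  define \<delta> where "\<delta> = e / DIM('a)"
  have \<delta>: "0 < \<delta>" using e by (simp add: \<delta>_def)
  define k where "k x b = \<lfloor>(if norm (y x) \<le> C then y x \<bullet> b else 0) / \<delta>\<rfloor>" for x b
  define s where "s x = (\<Sum>b\<in>Basis. (\<delta> * of_int (k x b)) *\<^sub>R b)" for x
  have [measurable]: "y \<in> borel_measurable (lebesgue_on \<Omega>)" using y by blast
  have "s \<in> borel_measurable (lebesgue_on \<Omega>)"
    unfolding s_def k_def by measurable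
  moreover have "finite (s ` \<Omega>)"
  proof -
    \<comment> \<open>All grid indices lie between \<open>- N\<close> and \<open>N\<close>.\<close>
    define N where "N = \<lceil>C / \<delta>\<rceil> + 1"
    have "k x b \<in> {-N..N}" if "b \<in> Basis" for x b
    proof -
      define t where "t = (if norm (y x) \<le> C then y x \<bullet> b else 0)"
      have "\<bar>t\<bar> \<le> C" using that C(1) Basis_le_norm[of b "y x"] by (auto simp: t_def)
      then have "- (C / \<delta>) \<le> t / \<delta>" "t / \<delta> \<le> C / \<delta>"
        using \<delta> by (auto simp: divide_simps)
      then have "- N \<le> \<lfloor>t / \<delta>\<rfloor>" "\<lfloor>t / \<delta>\<rfloor> \<le> N" unfolding N_def by linarith+
      then show ?thesis by (simp add: k_def t_def)
    qed
    then have "s ` \<Omega> \<subseteq> (\<lambda>m. \<Sum>b\<in>Basis. (\<delta> * of_int (m b)) *\<^sub>R b) ` (Basis \<rightarrow>\<^sub>E {-N..N})"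
      by (intro image_subsetI image_eqI[where x = "restrict (k x) Basis" for x])
         (auto simp: s_def)
    moreover have "finite ((Basis :: 'a set) \<rightarrow>\<^sub>E {-N..N})" by (intro finite_PiE) auto
    ultimately show ?thesis using finite_surj by blast
  qed
  ultimately have "simple_function (lebesgue_on \<Omega>) s"
    by (intro simple_function_borel_measurable) auto
  moreover have "AE x in lebesgue_on \<Omega>. norm (s x - y x) \<le> e"
    using C(2)
  proof eventually_elim
    fix x assume x: "norm (y x) \<le> C"
    have "s x - y x = (\<Sum>b\<in>Basis. (\<delta> * of_int (k x b) - y x \<bullet> b) *\<^sub>R b)"
      by (subst euclidean_representation[of "y x", symmetric])
         (simp add: s_def sum_subtractf[symmetric] scaleR_diff_left)
    also have "norm \<dots> \<le> (\<Sum>b\<in>(Basis::'a set). norm ((\<delta> * of_int (k x b) - y x \<bullet> b) *\<^sub>R b))"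
      by (rule norm_sum)
    also have "\<dots> \<le> (\<Sum>b\<in>(Basis::'a set). \<delta>)"
    proof (intro sum_mono)
      fix b :: 'a assume b: "b \<in> Basis"
      have "of_int (k x b) \<le> (y x \<bullet> b) / \<delta>" "(y x \<bullet> b) / \<delta> < of_int (k x b) + 1"
        using x by (simp_all add: k_def)
      then have "\<delta> * of_int (k x b) \<le> y x \<bullet> b" "y x \<bullet> b \<le> \<delta> * of_int (k x b) + \<delta>"
        using \<delta> by (simp_all add: field_simps)
      then show "norm ((\<delta> * of_int (k x b) - y x \<bullet> b) *\<^sub>R b) \<le> \<delta>" using b by simp
    qed
    finally show "norm (s x - y x) \<le> e" by (simp add: \<delta>_def)
  qed
  ultimately show thesis using that by blast
qed

lemma baD:
  assumes "\<nu> \<in> ba \<Omega>"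
  shows "A \<notin> sets (lebesgue_on \<Omega>) \<Longrightarrow> \<nu> A = 0"
    and "A \<in> sets (lebesgue_on \<Omega>) \<Longrightarrow> B \<in> sets (lebesgue_on \<Omega>) \<Longrightarrow> A \<inter> B = {} \<Longrightarrow> \<nu> (A \<union> B) = \<nu> A + \<nu> B"
    and "A \<in> null_sets (lebesgue_on \<Omega>) \<Longrightarrow> \<nu> A = 0"
    and "total_variation \<Omega> \<nu> \<Omega> < \<infinity>"
  using assms unfolding ba_def by auto

lemma ba_empty: "\<nu> \<in> ba \<Omega> \<Longrightarrow> \<nu> {} = 0"
  by (rule baD(3)) auto

lemma ba_UN:
  assumes "\<nu> \<in> ba \<Omega>" "finite I" "A ` I \<subseteq> sets (lebesgue_on \<Omega>)" "disjoint_family_on A I"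
  shows "\<nu> (\<Union>i\<in>I. A i) = (\<Sum>i\<in>I. \<nu> (A i))"
  using assms(2-)
proof (induction I rule: finite_induct)
  case empty then show ?case using ba_empty[OF assms(1)] by simp
next
  case (insert i I)
  have "\<nu> (A i \<union> (\<Union>i\<in>I. A i)) = \<nu> (A i) + \<nu> (\<Union>i\<in>I. A i)"
    using insert by (intro baD(2)[OF assms(1)]) (auto simp: disjoint_family_on_def)
  then show ?case using insert by (auto simp: disjoint_family_on_def)
qed

text \<open>The total variation is a supremum over sequences of sets; a finite family is
  numbered and padded with empty sets.\<close>

lemma sum_norm_le_total_variation:
  assumes "finite I" "A ` I \<subseteq> sets (lebesgue_on \<Omega>)" "disjoint_family_on A I" "(\<Union>i\<in>I. A i) = B"
    and "\<nu> {} = 0"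
  shows "ennreal (\<Sum>i\<in>I. norm (\<nu> (A i))) \<le> total_variation \<Omega> \<nu> B"
proof -
  obtain h where h: "bij_betw h {..<card I} I"
    using assms(1) by (metis ex_bij_betw_nat_finite atLeast0LessThan)
  define P where "P k = (if k < card I then A (h k) else {})" for k
  have "range P \<subseteq> sets (lebesgue_on \<Omega>)"
    using assms(2) h by (auto simp: P_def bij_betw_def)
  moreover have "disjoint_family P"
    unfolding disjoint_family_on_def
  proof (intro ballI impI)
    fix k l :: nat assume "k \<noteq> l"
    then show "P k \<inter> P l = {}"
      using assms(3) h by (auto simp: P_def disjoint_family_on_def bij_betw_def inj_on_def set_eq_iff) blast
  qed
  moreover have "(\<Union>k. P k) = B"
  proof -
    have "(\<Union>k. P k) = (\<Union>k\<in>{..<card I}. A (h k))" by (auto simp: P_def split: if_splits)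
    also have "\<dots> = (\<Union>i\<in>h ` {..<card I}. A i)" by auto
    also have "\<dots> = B" using h assms(4) by (simp only: bij_betw_def)
    finally show ?thesis .
  qed
  ultimately have "(\<Sum>k. ennreal (norm (\<nu> (P k)))) \<le> total_variation \<Omega> \<nu> B"
    unfolding total_variation_def by (intro SUP_upper) auto
  moreover have "(\<Sum>k. ennreal (norm (\<nu> (P k)))) = (\<Sum>k<card I. ennreal (norm (\<nu> (P k))))"
    using assms(5) by (intro suminf_finite) (auto simp: P_def)
  moreover have "(\<Sum>k<card I. ennreal (norm (\<nu> (P k)))) = (\<Sum>i\<in>I. ennreal (norm (\<nu> (A i))))"
    by (subst sum.reindex_bij_betw[OF h, symmetric]) (simp add: P_def)
  ultimately show ?thesis by simp
qed

text \<open>The integral of a simple function may be computed from any finite partition on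
  which the function is constant. Common refinements then give additivity.\<close>

lemma simple_integral_partition:
  assumes \<nu>: "\<nu> \<in> ba \<Omega>" and "finite I" and A: "A ` I \<subseteq> sets (lebesgue_on \<Omega>)" "disjoint_family_on A I" "(\<Union>i\<in>I. A i) = \<Omega>"
    and s: "\<And>i x. i \<in> I \<Longrightarrow> x \<in> A i \<Longrightarrow> s x = c i"
  shows "ba_integral_simple \<Omega> \<nu> s = (\<Sum>i\<in>I. c i \<bullet> \<nu> (A i))"
proof -
  define I' where "I' = {i \<in> I. A i \<noteq> {}}"
  have I': "finite I'" "I' \<subseteq> I" using assms(2) by (auto simp: I'_def)
  have im: "s ` \<Omega> = c ` I'"
  proof
    show "s ` \<Omega> \<subseteq> c ` I'" using A(3) s by (auto simp: I'_def)
    show "c ` I' \<subseteq> s ` \<Omega>"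
    proof
      fix d assume "d \<in> c ` I'"
      then obtain i x where "i \<in> I" "x \<in> A i" "d = c i" by (auto simp: I'_def)
      then have "x \<in> \<Omega>" "s x = d" using A(3) s by auto
      then show "d \<in> s ` \<Omega>" by auto
    qed
  qed
  have "ba_integral_simple \<Omega> \<nu> s = (\<Sum>d\<in>s ` \<Omega>. \<Sum>i\<in>{i\<in>I'. c i = d}. c i \<bullet> \<nu> (A i))"
    unfolding ba_integral_simple_def
  proof (rule sum.cong[OF refl])
    fix d
    have "{x \<in> \<Omega>. s x = d} = (\<Union>i\<in>{i\<in>I'. c i = d}. A i)"
    proof (intro set_eqI iffI)
      fix x assume "x \<in> {x \<in> \<Omega>. s x = d}"
      then obtain i where "i \<in> I" "x \<in> A i" "s x = d" using A(3) by auto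
      moreover from this have "c i = d" using s by auto
      ultimately show "x \<in> (\<Union>i\<in>{i\<in>I'. c i = d}. A i)" by (auto simp: I'_def)
    next
      fix x assume "x \<in> (\<Union>i\<in>{i\<in>I'. c i = d}. A i)"
      then show "x \<in> {x \<in> \<Omega>. s x = d}" using A(3) s I' by auto
    qed
    moreover have "\<nu> (\<Union>i\<in>{i\<in>I'. c i = d}. A i) = (\<Sum>i\<in>{i\<in>I'. c i = d}. \<nu> (A i))"
      using I' A(1) by (intro ba_UN[OF \<nu>] disjoint_family_on_mono[OF _ A(2)]) auto
    ultimately show "d \<bullet> \<nu> {x \<in> \<Omega>. s x = d} = (\<Sum>i\<in>{i\<in>I'. c i = d}. c i \<bullet> \<nu> (A i))"
      by (simp add: inner_sum_right)
  qed
  also have "\<dots> = (\<Sum>i\<in>I'. c i \<bullet> \<nu> (A i))"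
    using I' im by (intro sum.group) auto
  also have "\<dots> = (\<Sum>i\<in>I. c i \<bullet> \<nu> (A i))"
    using assms(2) ba_empty[OF \<nu>] by (intro sum.mono_neutral_left) (auto simp: I'_def)
  finally show ?thesis .
qed

lemma simple_function_level_set:
  "simple_function (lebesgue_on \<Omega>) s \<Longrightarrow> {x \<in> \<Omega>. s x = c} \<in> sets (lebesgue_on \<Omega>)"
  using simple_functionD(2)[of "lebesgue_on \<Omega>" s "{c}"] by (simp add: vimage_def Int_def conj_commute)

lemma simple_integral_add:
  assumes \<nu>: "\<nu> \<in> ba \<Omega>" and s: "simple_function (lebesgue_on \<Omega>) s" and t: "simple_function (lebesgue_on \<Omega>) t"
  shows "ba_integral_simple \<Omega> \<nu> (\<lambda>x. s x + t x) = ba_integral_simple \<Omega> \<nu> s + ba_integral_simple \<Omega> \<nu> t"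
proof -
  define A where "A = (\<lambda>(c, d). {x \<in> \<Omega>. s x = c} \<inter> {x \<in> \<Omega>. t x = d})"
  let ?I = "s ` \<Omega> \<times> t ` \<Omega>"
  have fin: "finite ?I" using simple_functionD(1)[OF s] simple_functionD(1)[OF t] by simp
  have A: "A ` ?I \<subseteq> sets (lebesgue_on \<Omega>)"
    using simple_function_level_set[OF s] simple_function_level_set[OF t] by (auto simp: A_def simp del: sets_restrict_space_iff)
  have dis: "disjoint_family_on A ?I" "(\<Union>i\<in>?I. A i) = \<Omega>"
    by (auto simp: A_def disjoint_family_on_def)
  note part = simple_integral_partition[OF \<nu> fin A dis]
  have "ba_integral_simple \<Omega> \<nu> (\<lambda>x. s x + t x) = (\<Sum>i\<in>?I. (fst i + snd i) \<bullet> \<nu> (A i))"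
    by (rule part) (auto simp: A_def)
  moreover have "ba_integral_simple \<Omega> \<nu> s = (\<Sum>i\<in>?I. fst i \<bullet> \<nu> (A i))"
    by (rule part) (auto simp: A_def)
  moreover have "ba_integral_simple \<Omega> \<nu> t = (\<Sum>i\<in>?I. snd i \<bullet> \<nu> (A i))"
    by (rule part) (auto simp: A_def)
  ultimately show ?thesis by (simp add: inner_add_left sum.distrib)
qed

lemma level_sets_partition:
  assumes "simple_function (lebesgue_on \<Omega>) s"
  shows "finite (s ` \<Omega>)" "(\<lambda>c. {x \<in> \<Omega>. s x = c}) ` (s ` \<Omega>) \<subseteq> sets (lebesgue_on \<Omega>)"
    "disjoint_family_on (\<lambda>c. {x \<in> \<Omega>. s x = c}) (s ` \<Omega>)" "(\<Union>c\<in>s ` \<Omega>. {x \<in> \<Omega>. s x = c}) = \<Omega>"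
  using simple_functionD(1)[OF assms] simple_function_level_set[OF assms]
  by (auto simp: disjoint_family_on_def simp del: sets_restrict_space_iff)

lemma simple_integral_scaleR:
  assumes \<nu>: "\<nu> \<in> ba \<Omega>" and s: "simple_function (lebesgue_on \<Omega>) s"
  shows "ba_integral_simple \<Omega> \<nu> (\<lambda>x. r *\<^sub>R s x) = r * ba_integral_simple \<Omega> \<nu> s"
proof -
  have "ba_integral_simple \<Omega> \<nu> (\<lambda>x. r *\<^sub>R s x) = (\<Sum>c\<in>s ` \<Omega>. (r *\<^sub>R c) \<bullet> \<nu> {x \<in> \<Omega>. s x = c})"
    by (rule simple_integral_partition[OF \<nu> level_sets_partition[OF s]]) auto
  then show ?thesis by (simp add: ba_integral_simple_def sum_distrib_left)
qed

lemma simple_integral_bound: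
  assumes \<nu>: "\<nu> \<in> ba \<Omega>" and s: "simple_function (lebesgue_on \<Omega>) s"
    and C: "AE x in lebesgue_on \<Omega>. norm (s x) \<le> C"
  shows "\<bar>ba_integral_simple \<Omega> \<nu> s\<bar> \<le> enn2real (total_variation \<Omega> \<nu> \<Omega>) * C"
proof -
  have "0 \<le> C" using C by (rule AE_bound_nonneg)
  have "\<bar>ba_integral_simple \<Omega> \<nu> s\<bar> \<le> (\<Sum>c\<in>s ` \<Omega>. C * norm (\<nu> {x \<in> \<Omega>. s x = c}))"
    unfolding ba_integral_simple_def
  proof (rule order_trans[OF sum_abs sum_mono])
    fix c assume "c \<in> s ` \<Omega>"
    show "\<bar>c \<bullet> \<nu> {x \<in> \<Omega>. s x = c}\<bar> \<le> C * norm (\<nu> {x \<in> \<Omega>. s x = c})"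
    proof (cases "norm c \<le> C")
      case True
      then show ?thesis
        by (meson Cauchy_Schwarz_ineq2 mult_right_mono norm_ge_zero order_trans)
    next
      case False
      have "AE x in lebesgue_on \<Omega>. x \<notin> {x \<in> \<Omega>. s x = c}"
        using C False by (auto elim!: eventually_mono)
      then have "{x \<in> \<Omega>. s x = c} \<in> null_sets (lebesgue_on \<Omega>)"
        using simple_function_level_set[OF s] by (subst AE_iff_null_sets) (auto simp del: sets_restrict_space_iff)
      then have "\<nu> {x \<in> \<Omega>. s x = c} = 0" by (rule baD(3)[OF \<nu>])
      then show ?thesis by simp
    qed
  qed
  also have "\<dots> = C * (\<Sum>c\<in>s ` \<Omega>. norm (\<nu> {x \<in> \<Omega>. s x = c}))" by (simp add: sum_distrib_left)
  also have "\<dots> \<le> C * enn2real (total_variation \<Omega> \<nu> \<Omega>)"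
  proof (rule mult_left_mono[OF _ \<open>0 \<le> C\<close>])
    have "ennreal (\<Sum>c\<in>s ` \<Omega>. norm (\<nu> {x \<in> \<Omega>. s x = c})) \<le> total_variation \<Omega> \<nu> \<Omega>"
      by (rule sum_norm_le_total_variation[where A="\<lambda>c. {x \<in> \<Omega>. s x = c}", OF level_sets_partition[OF s]]) (rule ba_empty[OF \<nu>])
    then have "enn2real (ennreal (\<Sum>c\<in>s ` \<Omega>. norm (\<nu> {x \<in> \<Omega>. s x = c}))) \<le> enn2real (total_variation \<Omega> \<nu> \<Omega>)"
      using baD(4)[OF \<nu>] by (intro enn2real_mono) auto
    then show "(\<Sum>c\<in>s ` \<Omega>. norm (\<nu> {x \<in> \<Omega>. s x = c})) \<le> enn2real (total_variation \<Omega> \<nu> \<Omega>)"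
      by (simp add: sum_nonneg)
  qed
  finally show ?thesis by (simp add: mult.commute)
qed

lemma simple_integral_diff_bound:
  assumes \<nu>: "\<nu> \<in> ba \<Omega>" and s: "simple_function (lebesgue_on \<Omega>) s" and t: "simple_function (lebesgue_on \<Omega>) t"
    and "AE x in lebesgue_on \<Omega>. norm (s x - y x) \<le> d" "AE x in lebesgue_on \<Omega>. norm (t x - y x) \<le> e"
  shows "\<bar>ba_integral_simple \<Omega> \<nu> s - ba_integral_simple \<Omega> \<nu> t\<bar> \<le> enn2real (total_variation \<Omega> \<nu> \<Omega>) * (d + e)"
proof -
  have t': "simple_function (lebesgue_on \<Omega>) (\<lambda>x. (-1) *\<^sub>R t x)"
    using simple_function_compose1[OF t] .
  have "ba_integral_simple \<Omega> \<nu> s - ba_integral_simple \<Omega> \<nu> t = ba_integral_simple \<Omega> \<nu> (\<lambda>x. s x + (-1) *\<^sub>R t x)"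
    using simple_integral_add[OF \<nu> s t'] simple_integral_scaleR[OF \<nu> t, of "-1"] by simp
  moreover have "simple_function (lebesgue_on \<Omega>) (\<lambda>x. s x + (-1) *\<^sub>R t x)"
    using s t' by (rule simple_function_compose2)
  moreover have "AE x in lebesgue_on \<Omega>. norm (s x + (-1) *\<^sub>R t x) \<le> d + e"
    using assms(4,5)
  proof eventually_elim
    fix x assume "norm (s x - y x) \<le> d" "norm (t x - y x) \<le> e"
    then show "norm (s x + (-1) *\<^sub>R t x) \<le> d + e"
      using norm_triangle_ineq4[of "s x - y x" "t x - y x"] by simp
  qed
  ultimately show ?thesis using simple_integral_bound[OF \<nu>] by simp
qed

text \<open>The integral is defined by convergence of essential suprema; this is the form in
  which it can be used with almost everywhere bounds.\<close>

lemma esssup_tendsto_0_iff: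
  fixes y :: "'a \<Rightarrow> 'a"
  assumes s: "\<And>n. simple_function (lebesgue_on \<Omega>) (s n)" and y: "y \<in> borel_measurable (lebesgue_on \<Omega>)"
  shows "(\<lambda>n. esssup (lebesgue_on \<Omega>) (\<lambda>x. ereal (norm (s n x - y x)))) \<longlonglongrightarrow> 0 \<longleftrightarrow>
     (\<forall>e>0. \<forall>\<^sub>F n in sequentially. AE x in lebesgue_on \<Omega>. norm (s n x - y x) \<le> (e::real))" (is "?X \<longlonglongrightarrow> 0 \<longleftrightarrow> _")
proof
  have m: "(\<lambda>x. s n x - y x) \<in> borel_measurable (lebesgue_on \<Omega>)" for n
    by (intro borel_measurable_diff y borel_measurable_simple_function[OF s])
  {
    assume lim: "?X \<longlonglongrightarrow> 0"
    show "\<forall>e>0. \<forall>\<^sub>F n in sequentially. AE x in lebesgue_on \<Omega>. norm (s n x - y x) \<le> (e::real)"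
    proof (intro allI impI)
      fix e :: real assume "0 < e"
      then have "\<forall>\<^sub>F n in sequentially. ?X n < ereal e" by (intro order_tendstoD(2)[OF lim]) auto
      then show "\<forall>\<^sub>F n in sequentially. AE x in lebesgue_on \<Omega>. norm (s n x - y x) \<le> e"
      proof (rule eventually_mono)
        fix n assume "?X n < ereal e"
        then have "?X n \<le> ereal e" by (rule less_imp_le)
        then show "AE x in lebesgue_on \<Omega>. norm (s n x - y x) \<le> e" by (simp only: esssup_le_ereal_iff[OF m])
      qed
    qed
  next
    assume *: "\<forall>e>0. \<forall>\<^sub>F n in sequentially. AE x in lebesgue_on \<Omega>. norm (s n x - y x) \<le> (e::real)"
    show "?X \<longlonglongrightarrow> 0"
    proof (rule order_tendstoI)
      fix a :: ereal assume a: "a < 0"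
      have "0 \<le> ?X n" for n
      proof (cases "?X n")
        case (real r)
        then have "AE x in lebesgue_on \<Omega>. norm (s n x - y x) \<le> r"
          using esssup_le_ereal_iff[OF m, of n r] by simp
        then show ?thesis using real AE_bound_nonneg by auto
      next
        case MInf
        then have "AE x in lebesgue_on \<Omega>. norm (s n x - y x) \<le> -1"
          using esssup_le_ereal_iff[OF m, of n "-1"] by simp
        from AE_bound_nonneg[OF this] show ?thesis by simp
      qed simp
      then show "\<forall>\<^sub>F n in sequentially. a < ?X n" using a by (intro always_eventually) (auto intro: less_le_trans)
    next
      fix a :: ereal assume "0 < a"
      then obtain e where e: "0 < ereal e" "ereal e < a" by (metis ereal_dense2 zero_ereal_def)
      then have "\<forall>\<^sub>F n in sequentially. AE x in lebesgue_on \<Omega>. norm (s n x - y x) \<le> e" using * by auto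
      then show "\<forall>\<^sub>F n in sequentially. ?X n < a"
      proof (rule eventually_mono)
        fix n assume "AE x in lebesgue_on \<Omega>. norm (s n x - y x) \<le> e"
        then have "?X n \<le> ereal e" by (simp only: esssup_le_ereal_iff[OF m])
        then show "?X n < a" using e(2) by (rule le_less_trans)
      qed
    qed
  }
qed

text \<open>The definition of the integral is meaningful: simple integrals are Lipschitz with
  respect to the supremum norm with the total variation as constant, so approximating
  sequences give Cauchy sequences, and two such sequences have the same limit.\<close>

lemma ba_integral_tendsto:
  assumes \<nu>: "\<nu> \<in> ba \<Omega>" and y: "y \<in> Linf \<Omega>"
    and s: "\<And>n. simple_function (lebesgue_on \<Omega>) (s n)"
    and lim: "\<And>e. 0 < e \<Longrightarrow> \<forall>\<^sub>F n in sequentially. AE x in lebesgue_on \<Omega>. norm (s n x - y x) \<le> e"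
  shows "(\<lambda>n. ba_integral_simple \<Omega> \<nu> (s n)) \<longlonglongrightarrow> ba_integral \<Omega> \<nu> y"
proof -
  let ?S = "ba_integral_simple \<Omega> \<nu>" and ?T = "enn2real (total_variation \<Omega> \<nu> \<Omega>)"
  have close: "\<forall>\<^sub>F n in sequentially. \<forall>\<^sub>F m in sequentially. \<bar>?S (p n) - ?S (q m)\<bar> < e"
    if "\<And>n. simple_function (lebesgue_on \<Omega>) (p n)" "\<And>n. simple_function (lebesgue_on \<Omega>) (q n)"
      "\<And>e. 0 < e \<Longrightarrow> \<forall>\<^sub>F n in sequentially. AE x in lebesgue_on \<Omega>. norm (p n x - y x) \<le> e"
      "\<And>e. 0 < e \<Longrightarrow> \<forall>\<^sub>F n in sequentially. AE x in lebesgue_on \<Omega>. norm (q n x - y x) \<le> e" "0 < e" for p q e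
  proof -
    \<comment> \<open>The summand \<open>1\<close> covers the case of total variation zero.\<close>
    define d where "d = e / (2 * ?T + 1)"
    have T: "0 \<le> ?T" by simp
    then have d: "0 < d" "(2 * ?T + 1) * d = e"
      using \<open>0 < e\<close> unfolding d_def by (auto intro!: divide_pos_pos add_nonneg_pos simp: add_nonneg_pos[THEN less_imp_neq, symmetric])
    then have d2: "?T * (d + d) < e" by (simp add: algebra_simps)
    show ?thesis
      using that(3)[OF d(1)]
    proof eventually_elim
      fix n assume n: "AE x in lebesgue_on \<Omega>. norm (p n x - y x) \<le> d"
      show "\<forall>\<^sub>F m in sequentially. \<bar>?S (p n) - ?S (q m)\<bar> < e"
        using that(4)[OF d(1)]
      proof eventually_elim
        fix m assume m: "AE x in lebesgue_on \<Omega>. norm (q m x - y x) \<le> d"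
        show "\<bar>?S (p n) - ?S (q m)\<bar> < e"
          using simple_integral_diff_bound[OF \<nu> that(1,2) n m] d2 by linarith
      qed
    qed
  qed
  have "Cauchy (\<lambda>n. ?S (s n))"
  proof (rule metric_CauchyI)
    fix e :: real assume "0 < e"
    then have "\<forall>\<^sub>F n in sequentially. \<forall>\<^sub>F m in sequentially. \<bar>?S (s n) - ?S (s m)\<bar> < e/2"
      using close[of s s "e/2"] s lim by auto
    then obtain n N where N: "\<And>m. m \<ge> N \<Longrightarrow> \<bar>?S (s n) - ?S (s m)\<bar> < e/2"
      unfolding eventually_sequentially by blast
    show "\<exists>N. \<forall>m\<ge>N. \<forall>k\<ge>N. dist (?S (s m)) (?S (s k)) < e"
    proof (intro exI allI impI)
      fix m k assume "N \<le> m" "N \<le> k"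
      then show "dist (?S (s m)) (?S (s k)) < e" using N[of m] N[of k] by (simp add: dist_real_def abs_if split: if_splits)
    qed
  qed
  then have "convergent (\<lambda>n. ?S (s n))" by (rule Cauchy_convergent)
  then obtain J where J: "(\<lambda>n. ?S (s n)) \<longlonglongrightarrow> J" unfolding convergent_def by blast
  have "ba_integral \<Omega> \<nu> y = J"
    unfolding ba_integral_def
  proof (rule the_equality)
    show "\<exists>s. (\<forall>n. simple_function (lebesgue_on \<Omega>) (s n)) \<and>
        (\<lambda>n. esssup (lebesgue_on \<Omega>) (\<lambda>x. ereal (norm (s n x - y x)))) \<longlonglongrightarrow> 0 \<and> (\<lambda>n. ?S (s n)) \<longlonglongrightarrow> J"
    proof (intro exI[of _ s] conjI allI)
      show "(\<lambda>n. esssup (lebesgue_on \<Omega>) (\<lambda>x. ereal (norm (s n x - y x)))) \<longlonglongrightarrow> 0"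
        unfolding esssup_tendsto_0_iff[OF s Linf_measurable[OF y]] using lim by blast
    qed (rule s J)+
    fix J' assume "\<exists>s. (\<forall>n. simple_function (lebesgue_on \<Omega>) (s n)) \<and>
        (\<lambda>n. esssup (lebesgue_on \<Omega>) (\<lambda>x. ereal (norm (s n x - y x)))) \<longlonglongrightarrow> 0 \<and> (\<lambda>n. ?S (s n)) \<longlonglongrightarrow> J'"
    then obtain t where t: "\<And>n. simple_function (lebesgue_on \<Omega>) (t n)"
       and t0: "(\<lambda>n. esssup (lebesgue_on \<Omega>) (\<lambda>x. ereal (norm (t n x - y x)))) \<longlonglongrightarrow> 0"
       and tJ: "(\<lambda>n. ?S (t n)) \<longlonglongrightarrow> J'" by blast
    have tl: "\<And>e. 0 < e \<Longrightarrow> \<forall>\<^sub>F n in sequentially. AE x in lebesgue_on \<Omega>. norm (t n x - y x) \<le> e"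
      using t0 unfolding esssup_tendsto_0_iff[OF t Linf_measurable[OF y]] by blast
    have "\<bar>J' - J\<bar> \<le> e" if "0 < e" for e
    proof -
      have "\<forall>\<^sub>F n in sequentially. \<forall>\<^sub>F m in sequentially. \<bar>?S (t n) - ?S (s m)\<bar> < e"
      proof (rule close)
        show "simple_function (lebesgue_on \<Omega>) (t n)" "simple_function (lebesgue_on \<Omega>) (s n)" for n by (rule t s)+
        show "\<forall>\<^sub>F n in sequentially. AE x in lebesgue_on \<Omega>. norm (t n x - y x) \<le> e" if "0 < e" for e by (rule tl[OF that])
        show "\<forall>\<^sub>F n in sequentially. AE x in lebesgue_on \<Omega>. norm (s n x - y x) \<le> e" if "0 < e" for e by (rule lim[OF that])
      qed (rule that)
      then have "\<forall>\<^sub>F n in sequentially. \<bar>?S (t n) - J\<bar> \<le> e"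
      proof (rule eventually_mono)
        fix n assume *: "\<forall>\<^sub>F m in sequentially. \<bar>?S (t n) - ?S (s m)\<bar> < e"
        have "(\<lambda>m. \<bar>?S (t n) - ?S (s m)\<bar>) \<longlonglongrightarrow> \<bar>?S (t n) - J\<bar>"
          by (intro tendsto_intros J)
        then show "\<bar>?S (t n) - J\<bar> \<le> e"
          by (rule tendsto_upperbound) (use * in \<open>auto elim: eventually_mono\<close>)
      qed
      moreover have "(\<lambda>n. \<bar>?S (t n) - J\<bar>) \<longlonglongrightarrow> \<bar>J' - J\<bar>"
        by (intro tendsto_intros tJ)
      ultimately show ?thesis by (intro tendsto_upperbound[where F=sequentially]) auto
    qed
    then have "\<bar>J' - J\<bar> \<le> 0" by (rule field_le_epsilon) simp
    then show "J' = J" by simp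
  qed
  with J show ?thesis by simp
qed

lemma Linf_simple_sequence:
  assumes y: "y \<in> Linf \<Omega>"
  obtains s :: "nat \<Rightarrow> 'a \<Rightarrow> 'a" where "\<And>n. simple_function (lebesgue_on \<Omega>) (s n)"
    and "\<And>n. AE x in lebesgue_on \<Omega>. norm (s n x - y x) \<le> 1 / Suc n"
    and "\<And>e. 0 < e \<Longrightarrow> \<forall>\<^sub>F n in sequentially. AE x in lebesgue_on \<Omega>. norm (s n x - y x) \<le> e"
proof -
  have "\<exists>s :: 'a \<Rightarrow> 'a. simple_function (lebesgue_on \<Omega>) s \<and> (AE x in lebesgue_on \<Omega>. norm (s x - y x) \<le> 1 / Suc n)" for n :: nat
    using Linf_uniform_approximation[OF y, of "1 / Suc n"] by (metis of_nat_0_less_iff zero_less_Suc zero_less_divide_1_iff)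
  then obtain s :: "nat \<Rightarrow> 'a \<Rightarrow> 'a" where s: "\<And>n. simple_function (lebesgue_on \<Omega>) (s n)"
      "\<And>n. AE x in lebesgue_on \<Omega>. norm (s n x - y x) \<le> 1 / Suc n" by metis
  moreover have "\<forall>\<^sub>F n in sequentially. AE x in lebesgue_on \<Omega>. norm (s n x - y x) \<le> e" if "0 < e" for e
  proof -
    have "\<forall>\<^sub>F n in sequentially. 1 / Suc n < e"
      using that LIMSEQ_inverse_real_of_nat by (auto dest: order_tendstoD(2) simp: inverse_eq_divide)
    then show ?thesis
    proof eventually_elim
      fix n assume "1 / real (Suc n) < e"
      with s(2)[of n] show "AE x in lebesgue_on \<Omega>. norm (s n x - y x) \<le> e"
        by (auto elim!: eventually_mono)
    qed
  qed
  ultimately show thesis using that by blast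
qed

text \<open>Fields are functions rather than equivalence classes, so linearity can only be
  required on \<open>Linf \<Omega>\<close>. The bound by almost everywhere bounds \<open>C\<close> instead of a norm makes
  the functional insensitive to null sets.\<close>

definition bounded_functional :: "real \<Rightarrow> (('a \<Rightarrow> 'a) \<Rightarrow> real) \<Rightarrow> bool" where
  "bounded_functional K l \<longleftrightarrow>
     (\<forall>y\<in>Linf \<Omega>. \<forall>w\<in>Linf \<Omega>. l (\<lambda>x. y x + w x) = l y + l w) \<and>
     (\<forall>c. \<forall>y\<in>Linf \<Omega>. l (\<lambda>x. c *\<^sub>R y x) = c * l y) \<and>
     (\<forall>y\<in>Linf \<Omega>. \<forall>C. (AE x in lebesgue_on \<Omega>. norm (y x) \<le> C) \<longrightarrow> \<bar>l y\<bar> \<le> K * C)"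

lemma bounded_functionalD:
  assumes "bounded_functional K l"
  shows "y \<in> Linf \<Omega> \<Longrightarrow> w \<in> Linf \<Omega> \<Longrightarrow> l (\<lambda>x. y x + w x) = l y + l w"
    and "y \<in> Linf \<Omega> \<Longrightarrow> l (\<lambda>x. c *\<^sub>R y x) = c * l y"
    and "y \<in> Linf \<Omega> \<Longrightarrow> AE x in lebesgue_on \<Omega>. norm (y x) \<le> C \<Longrightarrow> \<bar>l y\<bar> \<le> K * C"
  using assms unfolding bounded_functional_def by blast+

lemma functional_0: "bounded_functional K l \<Longrightarrow> l (\<lambda>x. 0) = 0"
  using bounded_functionalD(2)[of K l "\<lambda>x. 0" 0] by simp

lemma functional_diff:
  assumes "bounded_functional K l" "y \<in> Linf \<Omega>" "w \<in> Linf \<Omega>"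
  shows "l (\<lambda>x. y x - w x) = l y - l w"
proof -
  have "l (\<lambda>x. y x + (-1) *\<^sub>R w x) = l y + l (\<lambda>x. (-1) *\<^sub>R w x)"
    using assms by (intro bounded_functionalD(1)[OF assms(1)] Linf_scaleR)
  then show ?thesis using bounded_functionalD(2)[OF assms(1,3), of "-1"] by simp
qed

lemma functional_AE_cong:
  assumes "bounded_functional K l" "y \<in> Linf \<Omega>" "w \<in> Linf \<Omega>" "AE x in lebesgue_on \<Omega>. y x = w x"
  shows "l y = l w"
proof -
  have "\<bar>l (\<lambda>x. y x - w x)\<bar> \<le> K * 0"
    using assms(4) by (intro bounded_functionalD(3)[OF assms(1)] Linf_diff assms) auto
  then show ?thesis using functional_diff[OF assms(1-3)] by simp
qed

lemma functional_sum:
  assumes "bounded_functional K l" "\<And>i. i \<in> I \<Longrightarrow> y i \<in> Linf \<Omega>"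
  shows "l (\<lambda>x. \<Sum>i\<in>I. y i x) = (\<Sum>i\<in>I. l (y i))"
  using assms(2)
proof (induction I rule: infinite_finite_induct)
  case (insert i I)
  then have "l (\<lambda>x. y i x + (\<Sum>i\<in>I. y i x)) = l (y i) + l (\<lambda>x. \<Sum>i\<in>I. y i x)"
    by (intro bounded_functionalD(1)[OF assms(1)] Linf_sum) auto
  with insert show ?case by simp
qed (auto simp: functional_0[OF assms(1)])

lemma functional_indicator:
  assumes l: "bounded_functional K l" and A: "A \<in> sets (lebesgue_on \<Omega>)"
  shows "l (\<lambda>x. indicator A x *\<^sub>R c) = (\<Sum>b\<in>Basis. (c \<bullet> b) * l (\<lambda>x. indicator A x *\<^sub>R b))"
proof -
  have ind: "(\<lambda>x. indicator A x *\<^sub>R b) \<in> Linf \<Omega>" for b :: 'a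
    using A by (intro Linf_restrict) auto
  have "(\<lambda>x. indicator A x *\<^sub>R c) = (\<lambda>x. \<Sum>b\<in>Basis. (c \<bullet> b) *\<^sub>R (indicator A x *\<^sub>R b))"
  proof
    fix x
    have "indicator A x *\<^sub>R c = indicator A x *\<^sub>R (\<Sum>b\<in>Basis. (c \<bullet> b) *\<^sub>R b)"
      by (simp add: euclidean_representation)
    also have "\<dots> = (\<Sum>b\<in>Basis. (c \<bullet> b) *\<^sub>R (indicator A x *\<^sub>R b))"
      by (simp add: scaleR_sum_right mult.commute)
    finally show "indicator A x *\<^sub>R c = (\<Sum>b\<in>Basis. (c \<bullet> b) *\<^sub>R (indicator A x *\<^sub>R b))" .
  qed
  then have "l (\<lambda>x. indicator A x *\<^sub>R c) = l (\<lambda>x. \<Sum>b\<in>Basis. (c \<bullet> b) *\<^sub>R (indicator A x *\<^sub>R b))"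
    by (simp only:)
  also have "\<dots> = (\<Sum>b\<in>Basis. l (\<lambda>x. (c \<bullet> b) *\<^sub>R (indicator A x *\<^sub>R b)))"
    by (rule functional_sum[OF l Linf_scaleR[OF ind]])
  finally show ?thesis by (simp only: bounded_functionalD(2)[OF l ind])
qed

lemma functional_simple:
  assumes l: "bounded_functional K l" and s: "simple_function (lebesgue_on \<Omega>) s"
  shows "l s = (\<Sum>c\<in>s ` \<Omega>. \<Sum>b\<in>Basis. (c \<bullet> b) * l (\<lambda>x. indicator {x \<in> \<Omega>. s x = c} x *\<^sub>R b))"
proof -
  note ls = simple_function_level_set[OF s]
  have ind: "(\<lambda>x. indicator {x \<in> \<Omega>. s x = c} x *\<^sub>R c) \<in> Linf \<Omega>" for c
    by (intro Linf_restrict ls Linf_const)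
  have "l s = l (\<lambda>x. \<Sum>c\<in>s ` \<Omega>. indicator {x \<in> \<Omega>. s x = c} x *\<^sub>R c)"
  proof (rule functional_AE_cong[OF l simple_function_Linf[OF s] Linf_sum[OF ind]])
    show "AE x in lebesgue_on \<Omega>. s x = (\<Sum>c\<in>s ` \<Omega>. indicator {x \<in> \<Omega>. s x = c} x *\<^sub>R c)"
    proof (rule AE_I2)
      fix x assume x: "x \<in> space (lebesgue_on \<Omega>)"
      have "(\<Sum>c\<in>s ` \<Omega>. indicator {x \<in> \<Omega>. s x = c} x *\<^sub>R c) = (\<Sum>c\<in>s ` \<Omega>. if c = s x then s x else 0)"
        using x by (intro sum.cong) (auto simp: indicator_def)
      also have "\<dots> = s x" using x simple_functionD(1)[OF s] by simp
      finally show "s x = (\<Sum>c\<in>s ` \<Omega>. indicator {x \<in> \<Omega>. s x = c} x *\<^sub>R c)" by simp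
    qed
  qed
  also have "\<dots> = (\<Sum>c\<in>s ` \<Omega>. l (\<lambda>x. indicator {x \<in> \<Omega>. s x = c} x *\<^sub>R c))"
    by (rule functional_sum[OF l ind])
  also have "\<dots> = (\<Sum>c\<in>s ` \<Omega>. \<Sum>b\<in>Basis. (c \<bullet> b) * l (\<lambda>x. indicator {x \<in> \<Omega>. s x = c} x *\<^sub>R b))"
    by (intro sum.cong refl functional_indicator[OF l ls])
  finally show ?thesis .
qed

lemma functional_tendsto:
  assumes l: "bounded_functional K l" and y: "y \<in> Linf \<Omega>" and s: "\<And>n. s n \<in> Linf \<Omega>"
    and close: "\<And>n. AE x in lebesgue_on \<Omega>. norm (s n x - y x) \<le> 1 / Suc n"
  shows "(\<lambda>n. l (s n)) \<longlonglongrightarrow> l y"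
proof (rule LIM_zero_cancel, rule Lim_null_comparison)
  show "\<forall>\<^sub>F n in sequentially. norm (l (s n) - l y) \<le> K * (1 / Suc n)"
  proof (intro always_eventually allI)
    fix n
    have "\<bar>l (\<lambda>x. s n x - y x)\<bar> \<le> K * (1 / Suc n)"
      by (intro bounded_functionalD(3)[OF l] Linf_diff s y close)
    then show "norm (l (s n) - l y) \<le> K * (1 / Suc n)"
      by (simp add: functional_diff[OF l s y])
  qed
  show "(\<lambda>n. K * (1 / real (Suc n))) \<longlonglongrightarrow> 0"
    using tendsto_mult_right_zero[OF LIMSEQ_inverse_real_of_nat, of K] by (simp add: inverse_eq_divide)
qed

text \<open>Simple functions are dense in the supremum norm, so a bounded functional is
  determined by its values on \<open>indicator A x *\<^sub>R b\<close>.\<close>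

lemma functional_eqI:
  assumes l: "bounded_functional K l" and l': "bounded_functional K' l'"
    and eq: "\<And>A b. A \<in> sets (lebesgue_on \<Omega>) \<Longrightarrow> b \<in> Basis \<Longrightarrow>
      l (\<lambda>x. indicator A x *\<^sub>R b) = l' (\<lambda>x. indicator A x *\<^sub>R b)"
    and y: "y \<in> Linf \<Omega>"
  shows "l y = l' y"
proof -
  obtain s :: "nat \<Rightarrow> 'a \<Rightarrow> 'a" where s: "\<And>n. simple_function (lebesgue_on \<Omega>) (s n)"
    and close: "\<And>n. AE x in lebesgue_on \<Omega>. norm (s n x - y x) \<le> 1 / Suc n"
    using Linf_simple_sequence[OF y] by metis
  have "l (s n) = l' (s n)" for n
    using eq simple_function_level_set[OF s]
    by (simp add: functional_simple[OF l s] functional_simple[OF l' s] del: sets_restrict_space_iff)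
  moreover have "(\<lambda>n. l (s n)) \<longlonglongrightarrow> l y"
    by (rule functional_tendsto[OF l y simple_function_Linf[OF s] close])
  moreover have "(\<lambda>n. l' (s n)) \<longlonglongrightarrow> l' y"
    by (rule functional_tendsto[OF l' y simple_function_Linf[OF s] close])
  ultimately show ?thesis using LIMSEQ_unique by simp
qed

lemma ba_integral_simple_function:
  assumes \<nu>: "\<nu> \<in> ba \<Omega>" and s: "simple_function (lebesgue_on \<Omega>) s"
  shows "ba_integral \<Omega> \<nu> s = ba_integral_simple \<Omega> \<nu> s"
proof -
  have "(\<lambda>n. ba_integral_simple \<Omega> \<nu> s) \<longlonglongrightarrow> ba_integral \<Omega> \<nu> s"
    by (rule ba_integral_tendsto[OF \<nu> simple_function_Linf[OF s] s]) auto
  then show ?thesis using LIMSEQ_unique tendsto_const by blast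
qed

lemma ba_integral_indicator:
  assumes \<nu>: "\<nu> \<in> ba \<Omega>" and A: "A \<in> sets (lebesgue_on \<Omega>)"
  shows "ba_integral \<Omega> \<nu> (\<lambda>x. indicator A x *\<^sub>R c) = c \<bullet> \<nu> A"
proof -
  have s: "simple_function (lebesgue_on \<Omega>) (\<lambda>x. indicator A x *\<^sub>R c)"
    using A by (intro simple_function_compose1[where g="\<lambda>t. t *\<^sub>R c"] simple_function_indicator)
  have sub: "A \<subseteq> \<Omega>" using sets.sets_into_space[OF A] by simp
  have "ba_integral_simple \<Omega> \<nu> (\<lambda>x. indicator A x *\<^sub>R c) =
      (\<Sum>i\<in>UNIV. (if i then c else 0) \<bullet> \<nu> (if i then A else \<Omega> - A))"
  proof (rule simple_integral_partition[OF \<nu>])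
    have "\<Omega> - A \<in> sets (lebesgue_on \<Omega>)" using sets.compl_sets[OF A] by simp
    then show "(\<lambda>i. if i then A else \<Omega> - A) ` UNIV \<subseteq> sets (lebesgue_on \<Omega>)" using A by auto
  qed (use sub in \<open>auto simp: disjoint_family_on_def indicator_def split: if_splits\<close>)
  then show ?thesis by (simp add: ba_integral_simple_function[OF \<nu> s] UNIV_bool)
qed

lemma ba_integral_functional:
  assumes \<nu>: "\<nu> \<in> ba \<Omega>"
  shows "bounded_functional (enn2real (total_variation \<Omega> \<nu> \<Omega>)) (ba_integral \<Omega> \<nu>)"
  unfolding bounded_functional_def
proof (intro conjI ballI allI impI)
  let ?S = "ba_integral_simple \<Omega> \<nu>" and ?T = "enn2real (total_variation \<Omega> \<nu> \<Omega>)"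
  fix y :: "'a \<Rightarrow> 'a" assume y: "y \<in> Linf \<Omega>"
  obtain s where s: "\<And>n. simple_function (lebesgue_on \<Omega>) (s n)"
    and s1: "\<And>n. AE x in lebesgue_on \<Omega>. norm (s n x - y x) \<le> 1 / Suc n"
    and s2: "\<And>e. 0 < e \<Longrightarrow> \<forall>\<^sub>F n in sequentially. AE x in lebesgue_on \<Omega>. norm (s n x - y x) \<le> e"
    by (rule Linf_simple_sequence[OF y]) (rule that)
  have Sy: "(\<lambda>n. ?S (s n)) \<longlonglongrightarrow> ba_integral \<Omega> \<nu> y" by (rule ba_integral_tendsto[OF \<nu> y s s2])
  {
    fix w :: "'a \<Rightarrow> 'a" assume w: "w \<in> Linf \<Omega>"
    obtain t where t: "\<And>n. simple_function (lebesgue_on \<Omega>) (t n)"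
      and t1: "\<And>n. AE x in lebesgue_on \<Omega>. norm (t n x - w x) \<le> 1 / Suc n"
      and t2: "\<And>e. 0 < e \<Longrightarrow> \<forall>\<^sub>F n in sequentially. AE x in lebesgue_on \<Omega>. norm (t n x - w x) \<le> e"
      by (rule Linf_simple_sequence[OF w]) (rule that)
    have "(\<lambda>n. ?S (\<lambda>x. s n x + t n x)) \<longlonglongrightarrow> ba_integral \<Omega> \<nu> (\<lambda>x. y x + w x)"
    proof (rule ba_integral_tendsto[OF \<nu> Linf_add[OF y w]])
      show "simple_function (lebesgue_on \<Omega>) (\<lambda>x. s n x + t n x)" for n
        using s t by (rule simple_function_compose2)
      fix e :: real assume "0 < e"
      then have "0 < e / 2" by simp
      from s2[OF this] t2[OF this]
      show "\<forall>\<^sub>F n in sequentially. AE x in lebesgue_on \<Omega>. norm (s n x + t n x - (y x + w x)) \<le> e"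
      proof (rule eventually_elim2)
        fix n assume "AE x in lebesgue_on \<Omega>. norm (s n x - y x) \<le> e/2" "AE x in lebesgue_on \<Omega>. norm (t n x - w x) \<le> e/2"
        then show "AE x in lebesgue_on \<Omega>. norm (s n x + t n x - (y x + w x)) \<le> e"
        proof eventually_elim
          fix x assume "norm (s n x - y x) \<le> e/2" "norm (t n x - w x) \<le> e/2"
          then show "norm (s n x + t n x - (y x + w x)) \<le> e"
            using norm_triangle_ineq[of "s n x - y x" "t n x - w x"] by (simp add: algebra_simps)
        qed
      qed
    qed
    moreover have "(\<lambda>n. ?S (s n) + ?S (t n)) \<longlonglongrightarrow> ba_integral \<Omega> \<nu> y + ba_integral \<Omega> \<nu> w"
      by (intro tendsto_add Sy ba_integral_tendsto[OF \<nu> w t t2])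
    ultimately show "ba_integral \<Omega> \<nu> (\<lambda>x. y x + w x) = ba_integral \<Omega> \<nu> y + ba_integral \<Omega> \<nu> w"
      using LIMSEQ_unique by (simp add: simple_integral_add[OF \<nu> s t])
  next
    fix c :: real
    have "(\<lambda>n. ?S (\<lambda>x. c *\<^sub>R s n x)) \<longlonglongrightarrow> ba_integral \<Omega> \<nu> (\<lambda>x. c *\<^sub>R y x)"
    proof (rule ba_integral_tendsto[OF \<nu> Linf_scaleR[OF y]])
      show "simple_function (lebesgue_on \<Omega>) (\<lambda>x. c *\<^sub>R s n x)" for n
        using s by (rule simple_function_compose1)
      fix e :: real assume "0 < e"
      then have "0 < e / (\<bar>c\<bar> + 1)" by simp
      from s2[OF this]
      show "\<forall>\<^sub>F n in sequentially. AE x in lebesgue_on \<Omega>. norm (c *\<^sub>R s n x - c *\<^sub>R y x) \<le> e"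
      proof (rule eventually_mono)
        fix n assume "AE x in lebesgue_on \<Omega>. norm (s n x - y x) \<le> e / (\<bar>c\<bar> + 1)"
        then show "AE x in lebesgue_on \<Omega>. norm (c *\<^sub>R s n x - c *\<^sub>R y x) \<le> e"
        proof eventually_elim
          fix x assume "norm (s n x - y x) \<le> e / (\<bar>c\<bar> + 1)"
          then have "(\<bar>c\<bar> + 1) * norm (s n x - y x) \<le> e" by (simp add: field_simps)
          moreover have "norm (c *\<^sub>R s n x - c *\<^sub>R y x) = \<bar>c\<bar> * norm (s n x - y x)"
            by (simp flip: scaleR_diff_right)
          ultimately show "norm (c *\<^sub>R s n x - c *\<^sub>R y x) \<le> e"
            by (simp add: algebra_simps) (smt (verit) norm_ge_zero)
        qed
      qed
    qed
    moreover have "(\<lambda>n. c * ?S (s n)) \<longlonglongrightarrow> c * ba_integral \<Omega> \<nu> y"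
      by (intro tendsto_mult_left Sy)
    ultimately show "ba_integral \<Omega> \<nu> (\<lambda>x. c *\<^sub>R y x) = c * ba_integral \<Omega> \<nu> y"
      using LIMSEQ_unique by (simp add: simple_integral_scaleR[OF \<nu> s])
  next
    fix C assume C: "AE x in lebesgue_on \<Omega>. norm (y x) \<le> C"
    have "\<bar>?S (s n)\<bar> \<le> ?T * (C + 1 / Suc n)" for n
    proof (rule simple_integral_bound[OF \<nu> s])
      show "AE x in lebesgue_on \<Omega>. norm (s n x) \<le> C + 1 / Suc n"
        using C s1[of n]
      proof eventually_elim
        fix x assume "norm (y x) \<le> C" "norm (s n x - y x) \<le> 1 / Suc n"
        then show "norm (s n x) \<le> C + 1 / Suc n"
          using norm_triangle_ineq[of "y x" "s n x - y x"] by simp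
      qed
    qed
    moreover have "(\<lambda>n. \<bar>?S (s n)\<bar>) \<longlonglongrightarrow> \<bar>ba_integral \<Omega> \<nu> y\<bar>" by (intro tendsto_rabs Sy)
    moreover have "(\<lambda>n. ?T * (C + 1 / Suc n)) \<longlonglongrightarrow> ?T * (C + 0)"
      using LIMSEQ_inverse_real_of_nat by (intro tendsto_intros) (simp add: inverse_eq_divide)
    ultimately show "\<bar>ba_integral \<Omega> \<nu> y\<bar> \<le> ?T * C"
      by (intro LIMSEQ_le[of "\<lambda>n. \<bar>?S (s n)\<bar>" _ "\<lambda>n. ?T * (C + 1 / Suc n)"]) auto
  }
qed

lemmas ba_integral_add = bounded_functionalD(1)[OF ba_integral_functional]
lemmas ba_integral_scaleR = bounded_functionalD(2)[OF ba_integral_functional]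
lemmas ba_integral_bound = bounded_functionalD(3)[OF ba_integral_functional]
lemmas ba_integral_diff = functional_diff[OF ba_integral_functional]
lemmas ba_integral_AE_cong = functional_AE_cong[OF ba_integral_functional]

text \<open>The dual of \<open>L\<^sup>\<infinity>\<close> is \<open>ba\<close>. The total variation is controlled by testing with the
  unit fields that on each set of a partition point in the direction of its mass.\<close>

lemma functional_representation:
  assumes l: "bounded_functional K l"
    and rep: "\<And>A b. A \<in> sets (lebesgue_on \<Omega>) \<Longrightarrow> b \<in> Basis \<Longrightarrow> l (\<lambda>x. indicator A x *\<^sub>R b) = \<nu> A \<bullet> b"
    and out: "\<And>A. A \<notin> sets (lebesgue_on \<Omega>) \<Longrightarrow> \<nu> A = 0"
  shows "\<nu> \<in> ba \<Omega>" "total_variation \<Omega> \<nu> \<Omega> \<le> ennreal K" "\<And>y. y \<in> Linf \<Omega> \<Longrightarrow> ba_integral \<Omega> \<nu> y = l y"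
proof -
  have ind: "(\<lambda>x. indicator A x *\<^sub>R c) \<in> Linf \<Omega>" if "A \<in> sets (lebesgue_on \<Omega>)" for A and c :: 'a
    using that by (intro Linf_restrict) auto
  have lA: "l (\<lambda>x. indicator A x *\<^sub>R c) = c \<bullet> \<nu> A" if "A \<in> sets (lebesgue_on \<Omega>)" for A c
  proof -
    have "l (\<lambda>x. indicator A x *\<^sub>R c) = (\<Sum>b\<in>Basis. (c \<bullet> b) * l (\<lambda>x. indicator A x *\<^sub>R b))"
      by (rule functional_indicator[OF l that])
    also have "\<dots> = (\<Sum>b\<in>Basis. (c \<bullet> b) * (\<nu> A \<bullet> b))"
      using that by (intro sum.cong refl arg_cong2[where f="(*)"] rep)
    finally show ?thesis by (simp only: euclidean_inner[of c "\<nu> A"])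
  qed
  have add: "\<nu> (A \<union> B) = \<nu> A + \<nu> B"
    if AB: "A \<in> sets (lebesgue_on \<Omega>)" "B \<in> sets (lebesgue_on \<Omega>)" "A \<inter> B = {}" for A B
  proof (rule euclidean_eqI)
    fix b :: 'a assume b: "b \<in> Basis"
    have "(\<lambda>x. indicator (A \<union> B) x *\<^sub>R b) = (\<lambda>x. indicator A x *\<^sub>R b + indicator B x *\<^sub>R b)"
      using AB(3) by (auto simp: indicator_def fun_eq_iff)
    then have "l (\<lambda>x. indicator (A \<union> B) x *\<^sub>R b) = l (\<lambda>x. indicator A x *\<^sub>R b) + l (\<lambda>x. indicator B x *\<^sub>R b)"
      using bounded_functionalD(1)[OF l ind[OF AB(1)] ind[OF AB(2)]] by simp
    then show "\<nu> (A \<union> B) \<bullet> b = (\<nu> A + \<nu> B) \<bullet> b"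
      using rep[OF AB(1) b] rep[OF AB(2) b] rep[OF sets.Un[OF AB(1,2)] b] by (simp add: inner_add_left)
  qed
  have null: "\<nu> A = 0" if A: "A \<in> null_sets (lebesgue_on \<Omega>)" for A
  proof (rule euclidean_eqI)
    fix b :: 'a assume b: "b \<in> Basis"
    have As: "A \<in> sets (lebesgue_on \<Omega>)" using A by (rule null_setsD2)
    have "AE x in lebesgue_on \<Omega>. indicator A x *\<^sub>R b = 0"
      using AE_not_in[OF A] by eventually_elim auto
    then have "l (\<lambda>x. indicator A x *\<^sub>R b) = l (\<lambda>x. 0)"
      using ind[OF As] by (intro functional_AE_cong[OF l]) auto
    then show "\<nu> A \<bullet> b = 0 \<bullet> b" using rep[OF As b] functional_0[OF l] by simp
  qed
  have tv: "total_variation \<Omega> \<nu> \<Omega> \<le> ennreal K"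
    unfolding total_variation_def
  proof (rule SUP_least)
    fix P :: "nat \<Rightarrow> 'a set"
    assume "P \<in> {P. range P \<subseteq> sets (lebesgue_on \<Omega>) \<and> disjoint_family P \<and> (\<Union>i. P i) = \<Omega>}"
    then have P: "\<And>i. P i \<in> sets (lebesgue_on \<Omega>)" "disjoint_family P" by auto
    have "(\<Sum>i<n. norm (\<nu> (P i))) \<le> K" for n
    proof -
      let ?y = "\<lambda>x. \<Sum>i<n. indicator (P i) x *\<^sub>R sgn (\<nu> (P i))"
      have "l ?y = (\<Sum>i<n. l (\<lambda>x. indicator (P i) x *\<^sub>R sgn (\<nu> (P i))))"
        by (rule functional_sum[OF l ind[OF P(1)]])
      also have "\<dots> = (\<Sum>i<n. sgn (\<nu> (P i)) \<bullet> \<nu> (P i))"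
        by (intro sum.cong refl lA P(1))
      also have "\<dots> = (\<Sum>i<n. norm (\<nu> (P i)))"
      proof (intro sum.cong refl)
        fix i
        show "sgn (\<nu> (P i)) \<bullet> \<nu> (P i) = norm (\<nu> (P i))"
          by (cases "\<nu> (P i) = 0") (simp_all add: sgn_div_norm dot_square_norm power2_eq_square)
      qed
      finally have "(\<Sum>i<n. norm (\<nu> (P i))) = l ?y" ..
      also have "\<dots> \<le> K * 1"
      proof (rule order_trans[OF abs_ge_self bounded_functionalD(3)[OF l]])
        show "?y \<in> Linf \<Omega>" by (intro Linf_sum ind P)
        show "AE x in lebesgue_on \<Omega>. norm (?y x) \<le> 1"
        proof (rule AE_I2)
          fix x
          show "norm (?y x) \<le> 1"
          proof (cases "\<exists>i<n. x \<in> P i")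
            case True
            then obtain i where i: "i < n" "x \<in> P i" by auto
            have "?y x = (\<Sum>j<n. if j = i then sgn (\<nu> (P i)) else 0)"
            proof (rule sum.cong[OF refl])
              fix j assume "j \<in> {..<n}"
              show "indicator (P j) x *\<^sub>R sgn (\<nu> (P j)) = (if j = i then sgn (\<nu> (P i)) else 0)"
                using P(2) i(2) by (auto simp: disjoint_family_on_def indicator_def)
            qed
            also have "\<dots> = sgn (\<nu> (P i))" using i by simp
            finally show ?thesis by (simp add: norm_sgn)
          next
            case False
            then have "?y x = 0" by (intro sum.neutral) (auto simp: indicator_def)
            then show ?thesis by simp
          qed
        qed
      qed
      finally show ?thesis by simp
    qed
    then have "(\<Sum>i<n. ennreal (norm (\<nu> (P i)))) \<le> ennreal K" for n
      by (simp add: ennreal_leI)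
    then show "(\<Sum>i. ennreal (norm (\<nu> (P i)))) \<le> ennreal K"
      by (intro suminf_le_const) auto
  qed
  show \<nu>: "\<nu> \<in> ba \<Omega>"
    unfolding ba_def using out add null le_less_trans[OF tv] by auto
  show "total_variation \<Omega> \<nu> \<Omega> \<le> ennreal K" by (rule tv)
  show "ba_integral \<Omega> \<nu> y = l y" if "y \<in> Linf \<Omega>" for y
    using rep by (intro functional_eqI[OF ba_integral_functional[OF \<nu>] l _ that])
      (simp add: ba_integral_indicator[OF \<nu>] inner_commute del: sets_restrict_space_iff)
qed

text \<open>Closure of \<open>ba\<close> under addition and linearity of the pairing in the measure both
  follow from \<open>functional_representation\<close>, applied to the sum of the two functionals.\<close>

lemma ba_add:
  assumes "\<nu> \<in> ba \<Omega>" "\<kappa> \<in> ba \<Omega>"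
  shows "(\<lambda>A. \<nu> A + \<kappa> A) \<in> ba \<Omega>"
    and "y \<in> Linf \<Omega> \<Longrightarrow> ba_integral \<Omega> (\<lambda>A. \<nu> A + \<kappa> A) y = ba_integral \<Omega> \<nu> y + ba_integral \<Omega> \<kappa> y"
proof -
  let ?K = "enn2real (total_variation \<Omega> \<nu> \<Omega>) + enn2real (total_variation \<Omega> \<kappa> \<Omega>)"
  have "bounded_functional ?K (\<lambda>y. ba_integral \<Omega> \<nu> y + ba_integral \<Omega> \<kappa> y)"
    unfolding bounded_functional_def
  proof (intro conjI ballI allI impI)
    fix y :: "'a \<Rightarrow> 'a" and C assume "y \<in> Linf \<Omega>" "AE x in lebesgue_on \<Omega>. norm (y x) \<le> C"
    then show "\<bar>ba_integral \<Omega> \<nu> y + ba_integral \<Omega> \<kappa> y\<bar> \<le> ?K * C"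
      using ba_integral_bound[OF assms(1), of y C] ba_integral_bound[OF assms(2), of y C]
      by (simp add: distrib_right)
  qed (simp_all add: ba_integral_add[OF assms(1)] ba_integral_add[OF assms(2)]
        ba_integral_scaleR[OF assms(1)] ba_integral_scaleR[OF assms(2)] distrib_left)
  note l = this
  have r: "ba_integral \<Omega> \<nu> (\<lambda>x. indicator A x *\<^sub>R b) + ba_integral \<Omega> \<kappa> (\<lambda>x. indicator A x *\<^sub>R b) = (\<nu> A + \<kappa> A) \<bullet> b"
    if "A \<in> sets (lebesgue_on \<Omega>)" for A b
    unfolding ba_integral_indicator[OF assms(1) that] ba_integral_indicator[OF assms(2) that]
    by (simp only: inner_add_right inner_commute[of _ b])
  have out: "\<nu> A + \<kappa> A = 0" if "A \<notin> sets (lebesgue_on \<Omega>)" for A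
    unfolding baD(1)[OF assms(1) that] baD(1)[OF assms(2) that] by simp
  show "(\<lambda>A. \<nu> A + \<kappa> A) \<in> ba \<Omega>" by (rule functional_representation(1)[OF l r out])
  show "ba_integral \<Omega> (\<lambda>A. \<nu> A + \<kappa> A) y = ba_integral \<Omega> \<nu> y + ba_integral \<Omega> \<kappa> y" if "y \<in> Linf \<Omega>"
    by (rule functional_representation(3)[OF l r out that])
qed

lemma ba_minus:
  assumes "\<nu> \<in> ba \<Omega>"
  shows "(\<lambda>A. - \<nu> A) \<in> ba \<Omega>"
proof -
  let ?K = "enn2real (total_variation \<Omega> \<nu> \<Omega>)"
  have "bounded_functional ?K (\<lambda>y. - ba_integral \<Omega> \<nu> y)"
    unfolding bounded_functional_def
    using ba_integral_bound[OF assms]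
    by (simp add: ba_integral_add[OF assms] ba_integral_scaleR[OF assms])
  note l = this
  have r: "- ba_integral \<Omega> \<nu> (\<lambda>x. indicator A x *\<^sub>R b) = - \<nu> A \<bullet> b"
    if "A \<in> sets (lebesgue_on \<Omega>)" for A b
    unfolding ba_integral_indicator[OF assms(1) that] by (simp add: inner_commute)
  have out: "- \<nu> A = 0" if "A \<notin> sets (lebesgue_on \<Omega>)" for A
    unfolding baD(1)[OF assms(1) that] by simp
  show ?thesis by (rule functional_representation(1)[OF l r out])
qed

lemma integrable_inner_Linf:
  assumes z: "integrable (lebesgue_on \<Omega>) z" and y: "y \<in> Linf \<Omega>"
  shows "integrable (lebesgue_on \<Omega>) (\<lambda>x. z x \<bullet> y x)"
proof -
  obtain C where C: "0 \<le> C" "AE x in lebesgue_on \<Omega>. norm (y x) \<le> C" using y by (rule Linf_boundE)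
  show ?thesis
  proof (rule Bochner_Integration.integrable_bound)
    show "integrable (lebesgue_on \<Omega>) (\<lambda>x. C * norm (z x))" using z by simp
    show "(\<lambda>x. z x \<bullet> y x) \<in> borel_measurable (lebesgue_on \<Omega>)"
      using borel_measurable_integrable[OF z] Linf_measurable[OF y] by (rule borel_measurable_inner)
    show "AE x in lebesgue_on \<Omega>. norm (z x \<bullet> y x) \<le> norm (C * norm (z x))"
      using C(2)
    proof eventually_elim
      fix x assume x: "norm (y x) \<le> C"
      have "norm (z x \<bullet> y x) \<le> norm (z x) * norm (y x)" by (simp add: Cauchy_Schwarz_ineq2)
      also have "\<dots> \<le> norm (z x) * C" using x by (intro mult_left_mono) auto
      finally show "norm (z x \<bullet> y x) \<le> norm (C * norm (z x))" using C(1) by (simp add: mult.commute)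
    qed
  qed
qed

lemma ac_ba_pairing:
  assumes z: "integrable (lebesgue_on \<Omega>) z"
  shows "ac_ba \<Omega> z \<in> ba \<Omega>"
    and "y \<in> Linf \<Omega> \<Longrightarrow> ba_integral \<Omega> (ac_ba \<Omega> z) y = (LINT x|lebesgue_on \<Omega>. z x \<bullet> y x)"
proof -
  let ?K = "LINT x|lebesgue_on \<Omega>. norm (z x)"
  have "bounded_functional ?K (\<lambda>y. LINT x|lebesgue_on \<Omega>. z x \<bullet> y x)"
    unfolding bounded_functional_def
  proof (intro conjI ballI allI impI)
    fix y :: "'a \<Rightarrow> 'a" and C assume y: "y \<in> Linf \<Omega>" and C: "AE x in lebesgue_on \<Omega>. norm (y x) \<le> C"
    have "\<bar>LINT x|lebesgue_on \<Omega>. z x \<bullet> y x\<bar> \<le> (LINT x|lebesgue_on \<Omega>. \<bar>z x \<bullet> y x\<bar>)"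
      by (rule integral_abs_bound)
    also have "\<dots> \<le> (LINT x|lebesgue_on \<Omega>. norm (z x) * C)"
    proof (rule integral_mono_AE)
      show "AE x in lebesgue_on \<Omega>. \<bar>z x \<bullet> y x\<bar> \<le> norm (z x) * C"
        using C
      proof eventually_elim
        fix x assume "norm (y x) \<le> C"
        then show "\<bar>z x \<bullet> y x\<bar> \<le> norm (z x) * C"
          by (meson Cauchy_Schwarz_ineq2 mult_left_mono norm_ge_zero order_trans)
      qed
    qed (use z integrable_inner_Linf[OF z y] in auto)
    finally show "\<bar>LINT x|lebesgue_on \<Omega>. z x \<bullet> y x\<bar> \<le> ?K * C" by simp
  qed (simp_all add: inner_add_right integrable_inner_Linf[OF z])
  note l = this
  have 1: "(LINT x|lebesgue_on \<Omega>. z x \<bullet> indicator A x *\<^sub>R b) = ac_ba \<Omega> z A \<bullet> b"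
    if A: "A \<in> sets (lebesgue_on \<Omega>)" for A and b :: 'a
  proof -
    have "ac_ba \<Omega> z A \<bullet> b = (LINT x|lebesgue_on \<Omega>. indicator A x *\<^sub>R z x) \<bullet> b"
      using A by (simp only: ac_ba_def set_lebesgue_integral_def if_True)
    also have "\<dots> = (LINT x|lebesgue_on \<Omega>. (indicator A x *\<^sub>R z x) \<bullet> b)"
      by (rule integral_inner_left[symmetric]) (rule integrable_mult_indicator[OF A z])
    finally have "ac_ba \<Omega> z A \<bullet> b = (LINT x|lebesgue_on \<Omega>. (indicator A x *\<^sub>R z x) \<bullet> b)" .
    then show ?thesis by (simp add: inner_commute)
  qed
  have out: "ac_ba \<Omega> z A = 0" if "A \<notin> sets (lebesgue_on \<Omega>)" for A
    using that by (simp only: ac_ba_def if_False)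
  show "ac_ba \<Omega> z \<in> ba \<Omega>" by (rule functional_representation(1)[OF l 1 out])
  show "ba_integral \<Omega> (ac_ba \<Omega> z) y = (LINT x|lebesgue_on \<Omega>. z x \<bullet> y x)" if "y \<in> Linf \<Omega>"
    by (rule functional_representation(3)[OF l 1 out that])
qed

text \<open>Nullity on a set in the sense of total variation becomes vanishing on its subsets:
  a subset and its complement form a partition.\<close>

lemma total_variation_eq_0_iff:
  assumes \<nu>: "\<nu> \<in> ba \<Omega>" and A: "A \<in> sets (lebesgue_on \<Omega>)"
  shows "total_variation \<Omega> \<nu> A = 0 \<longleftrightarrow> (\<forall>B\<in>sets (lebesgue_on \<Omega>). B \<subseteq> A \<longrightarrow> \<nu> B = 0)"
proof (intro iffI ballI impI)
  fix B assume 0: "total_variation \<Omega> \<nu> A = 0" and B: "B \<in> sets (lebesgue_on \<Omega>)" "B \<subseteq> A"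
  have "ennreal (\<Sum>i\<in>UNIV. norm (\<nu> (if i then B else A - B))) \<le> total_variation \<Omega> \<nu> A"
  proof (rule sum_norm_le_total_variation)
    show "(\<lambda>i. if i then B else A - B) ` UNIV \<subseteq> sets (lebesgue_on \<Omega>)"
      using sets.Diff[OF A B(1)] B(1) by auto
  qed (use B(2) ba_empty[OF \<nu>] in \<open>auto simp: disjoint_family_on_def split: if_splits\<close>)
  then have "norm (\<nu> B) + norm (\<nu> (A - B)) \<le> 0"
    using 0 by (simp add: UNIV_bool add.commute)
  then have "norm (\<nu> B) \<le> 0" using norm_ge_zero[of "\<nu> (A - B)"] by linarith
  then show "\<nu> B = 0" by simp
next
  assume *: "\<forall>B\<in>sets (lebesgue_on \<Omega>). B \<subseteq> A \<longrightarrow> \<nu> B = 0"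
  have "total_variation \<Omega> \<nu> A \<le> 0"
    unfolding total_variation_def
  proof (rule SUP_least)
    fix P :: "nat \<Rightarrow> 'a set"
    assume "P \<in> {P. range P \<subseteq> sets (lebesgue_on \<Omega>) \<and> disjoint_family P \<and> (\<Union>i. P i) = A}"
    then have "\<nu> (P i) = 0" for i using * by blast
    then show "(\<Sum>i. ennreal (norm (\<nu> (P i)))) \<le> 0" by simp
  qed
  then show "total_variation \<Omega> \<nu> A = 0" by simp
qed

lemma ba_integral_restrict_eq_0:
  assumes \<nu>: "\<nu> \<in> ba \<Omega>" and A: "A \<in> sets (lebesgue_on \<Omega>)" and 0: "total_variation \<Omega> \<nu> A = 0"
    and y: "y \<in> Linf \<Omega>"
  shows "ba_integral \<Omega> \<nu> (\<lambda>x. indicator A x *\<^sub>R y x) = 0"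
proof -
  let ?K = "enn2real (total_variation \<Omega> \<nu> \<Omega>)"
  have 1: "bounded_functional ?K (\<lambda>y. ba_integral \<Omega> \<nu> (\<lambda>x. indicator A x *\<^sub>R y x))"
    unfolding bounded_functional_def
  proof (intro conjI ballI allI impI)
    fix y :: "'a \<Rightarrow> 'a" and C assume y: "y \<in> Linf \<Omega>" and C: "AE x in lebesgue_on \<Omega>. norm (y x) \<le> C"
    have "0 \<le> C" by (rule AE_bound_nonneg[OF C])
    with C have "AE x in lebesgue_on \<Omega>. norm (indicator A x *\<^sub>R y x) \<le> C"
      by (auto elim!: eventually_mono simp: indicator_def)
    then show "\<bar>ba_integral \<Omega> \<nu> (\<lambda>x. indicator A x *\<^sub>R y x)\<bar> \<le> ?K * C"
      by (rule ba_integral_bound[OF \<nu> Linf_restrict[OF A y]])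
  next
    fix y w :: "'a \<Rightarrow> 'a" assume y: "y \<in> Linf \<Omega>" and w: "w \<in> Linf \<Omega>"
    show "ba_integral \<Omega> \<nu> (\<lambda>x. indicator A x *\<^sub>R (y x + w x)) =
        ba_integral \<Omega> \<nu> (\<lambda>x. indicator A x *\<^sub>R y x) + ba_integral \<Omega> \<nu> (\<lambda>x. indicator A x *\<^sub>R w x)"
      using ba_integral_add[OF \<nu> Linf_restrict[OF A y] Linf_restrict[OF A w]] by (simp add: scaleR_add_right)
  next
    fix c and y :: "'a \<Rightarrow> 'a" assume y: "y \<in> Linf \<Omega>"
    show "ba_integral \<Omega> \<nu> (\<lambda>x. indicator A x *\<^sub>R c *\<^sub>R y x) = c * ba_integral \<Omega> \<nu> (\<lambda>x. indicator A x *\<^sub>R y x)"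
      using ba_integral_scaleR[OF \<nu> Linf_restrict[OF A y], of c] by (simp add: mult.commute)
  qed
  have 2: "bounded_functional 0 (\<lambda>y. 0)" by (simp add: bounded_functional_def)
  show ?thesis
  proof (rule functional_eqI[OF 1 2 _ y])
    fix B and b :: 'a assume B: "B \<in> sets (lebesgue_on \<Omega>)" and "b \<in> Basis"
    have "ba_integral \<Omega> \<nu> (\<lambda>x. indicator A x *\<^sub>R indicator B x *\<^sub>R b) = ba_integral \<Omega> \<nu> (\<lambda>x. indicator (A \<inter> B) x *\<^sub>R b)"
      by (simp add: indicator_inter_arith)
    also have "\<dots> = b \<bullet> \<nu> (A \<inter> B)" by (rule ba_integral_indicator[OF \<nu> sets.Int[OF A B]])
    also have "\<nu> (A \<inter> B) = 0"
      using 0 total_variation_eq_0_iff[OF \<nu> A] sets.Int[OF A B] by blast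
    finally show "ba_integral \<Omega> \<nu> (\<lambda>x. indicator A x *\<^sub>R indicator B x *\<^sub>R b) = 0" by simp
  qed
qed

text \<open>A bound \<open>K\<close> for the pairing on fields with \<open>|G| \<le> \<zeta>\<close> scales to a bound for the
  pairing composed with multiplication by \<open>\<zeta>\<close>, which is the functional belonging to \<open>\<zeta>\<nu>\<close>.\<close>

lemma weighted_functional:
  assumes \<nu>: "\<nu> \<in> ba \<Omega>" and \<zeta>: "\<zeta> \<in> Linf \<Omega>" "AE x in lebesgue_on \<Omega>. 0 \<le> \<zeta> x"
    and K: "\<And>G. G \<in> Linf \<Omega> \<Longrightarrow> AE x in lebesgue_on \<Omega>. norm (G x) \<le> \<zeta> x \<Longrightarrow> ba_integral \<Omega> \<nu> G \<le> K"
  shows "bounded_functional K (\<lambda>H. ba_integral \<Omega> \<nu> (\<lambda>x. \<zeta> x *\<^sub>R H x))"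
  unfolding bounded_functional_def
proof (intro conjI ballI allI impI)
  fix H w :: "'a \<Rightarrow> 'a" assume H: "H \<in> Linf \<Omega>" and w: "w \<in> Linf \<Omega>"
  show "ba_integral \<Omega> \<nu> (\<lambda>x. \<zeta> x *\<^sub>R (H x + w x)) =
      ba_integral \<Omega> \<nu> (\<lambda>x. \<zeta> x *\<^sub>R H x) + ba_integral \<Omega> \<nu> (\<lambda>x. \<zeta> x *\<^sub>R w x)"
    using ba_integral_add[OF \<nu> Linf_mult[OF \<zeta>(1) H] Linf_mult[OF \<zeta>(1) w]] by (simp add: scaleR_add_right)
next
  fix c and H :: "'a \<Rightarrow> 'a" assume H: "H \<in> Linf \<Omega>"
  show "ba_integral \<Omega> \<nu> (\<lambda>x. \<zeta> x *\<^sub>R c *\<^sub>R H x) = c * ba_integral \<Omega> \<nu> (\<lambda>x. \<zeta> x *\<^sub>R H x)"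
    using ba_integral_scaleR[OF \<nu> Linf_mult[OF \<zeta>(1) H], of c] by (simp add: mult.commute)
next
  fix H :: "'a \<Rightarrow> 'a" and C assume H: "H \<in> Linf \<Omega>" and C: "AE x in lebesgue_on \<Omega>. norm (H x) \<le> C"
  let ?l = "\<lambda>H. ba_integral \<Omega> \<nu> (\<lambda>x. \<zeta> x *\<^sub>R H x)"
  have "0 \<le> C" by (rule AE_bound_nonneg[OF C])
  then consider "C = 0" | "0 < C" by linarith
  then show "\<bar>?l H\<bar> \<le> K * C"
  proof cases
    case 1
    have "?l H = ba_integral \<Omega> \<nu> (\<lambda>x. 0)"
      using C 1 by (intro ba_integral_AE_cong[OF \<nu> Linf_mult[OF \<zeta>(1) H]]) auto
    then show ?thesis using functional_0[OF ba_integral_functional[OF \<nu>]] 1 by simp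
  next
    case 2
    have le: "r * ?l H \<le> K" if r: "\<bar>r\<bar> = 1 / C" for r
    proof -
      have "ba_integral \<Omega> \<nu> (\<lambda>x. r *\<^sub>R \<zeta> x *\<^sub>R H x) \<le> K"
      proof (rule K)
        show "(\<lambda>x. r *\<^sub>R \<zeta> x *\<^sub>R H x) \<in> Linf \<Omega>" by (intro Linf_scaleR Linf_mult \<zeta> H)
        show "AE x in lebesgue_on \<Omega>. norm (r *\<^sub>R \<zeta> x *\<^sub>R H x) \<le> \<zeta> x"
          using C \<zeta>(2)
        proof eventually_elim
          fix x assume x: "norm (H x) \<le> C" "0 \<le> \<zeta> x"
          then have "\<zeta> x * norm (H x) \<le> \<zeta> x * C" by (intro mult_left_mono)
          moreover have "norm (r *\<^sub>R \<zeta> x *\<^sub>R H x) = (\<zeta> x * norm (H x)) / C" using x r by (simp add: abs_mult)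
          ultimately show "norm (r *\<^sub>R \<zeta> x *\<^sub>R H x) \<le> \<zeta> x" using 2 by (simp add: divide_le_eq)
        qed
      qed
      then show ?thesis using ba_integral_scaleR[OF \<nu> Linf_mult[OF \<zeta>(1) H], of r] by simp
    qed
    have "1 / C * ?l H \<le> K" "- (1 / C) * ?l H \<le> K" using 2 by (intro le; simp)+
    then show ?thesis using 2 by (simp add: field_simps abs_if)
  qed
qed

lemma ba_scale_out: "A \<notin> sets (lebesgue_on \<Omega>) \<Longrightarrow> ba_scale \<Omega> \<zeta> \<nu> A = 0"
  by (simp add: ba_scale_def)

lemma ba_scale_inner:
  assumes "A \<in> sets (lebesgue_on \<Omega>)" "b \<in> Basis"
  shows "ba_integral \<Omega> \<nu> (\<lambda>x. \<zeta> x *\<^sub>R indicator A x *\<^sub>R b) = ba_scale \<Omega> \<zeta> \<nu> A \<bullet> b"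
  using assms by (simp add: ba_scale_def mult.commute del: sets_restrict_space_iff)

text \<open>Together the two bounds say that \<open>|\<zeta>\<nu>|(\<Omega>)\<close> is the supremum of \<open>\<langle>\<nu>, G\<rangle>\<close> over fields
  with \<open>|G| \<le> \<zeta>\<close>: such fields are the products \<open>\<zeta>H\<close> with \<open>|H| \<le> 1\<close>, and the variation of
  \<open>\<zeta>\<nu>\<close> is its norm as a functional.\<close>

lemma
  assumes \<nu>: "\<nu> \<in> ba \<Omega>" and \<zeta>: "\<zeta> \<in> Linf \<Omega>" "AE x in lebesgue_on \<Omega>. 0 \<le> \<zeta> x"
  shows ba_integral_le_weighted_variation:
      "G \<in> Linf \<Omega> \<Longrightarrow> AE x in lebesgue_on \<Omega>. norm (G x) \<le> \<zeta> x \<Longrightarrow> ba_integral \<Omega> \<nu> G \<le> weighted_variation \<Omega> \<zeta> \<nu>"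
    and weighted_variation_le:
      "(\<And>G. G \<in> Linf \<Omega> \<Longrightarrow> AE x in lebesgue_on \<Omega>. norm (G x) \<le> \<zeta> x \<Longrightarrow> ba_integral \<Omega> \<nu> G \<le> K)
        \<Longrightarrow> weighted_variation \<Omega> \<zeta> \<nu> \<le> K"
proof -
  note rep = functional_representation[OF weighted_functional[OF assms] ba_scale_inner ba_scale_out]
  obtain C where C: "0 \<le> C" "AE x in lebesgue_on \<Omega>. norm (\<zeta> x) \<le> C" using \<zeta>(1) by (rule Linf_boundE)
  have b: "ba_integral \<Omega> \<nu> G \<le> enn2real (total_variation \<Omega> \<nu> \<Omega>) * C"
    if "G \<in> Linf \<Omega>" "AE x in lebesgue_on \<Omega>. norm (G x) \<le> \<zeta> x" for G
  proof -
    have "AE x in lebesgue_on \<Omega>. norm (G x) \<le> C" using that(2) C(2) by eventually_elim auto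
    from ba_integral_bound[OF \<nu> that(1) this] show ?thesis by simp
  qed
  note sc = rep(1)[OF b] rep(3)[OF b]
  {
    assume G: "G \<in> Linf \<Omega>" and le: "AE x in lebesgue_on \<Omega>. norm (G x) \<le> \<zeta> x"
    \<comment> \<open>Where \<open>\<zeta>\<close> vanishes so does \<open>G\<close>, and \<open>H\<close> may be zero there.\<close>
    define H where "H x = indicator {x \<in> space (lebesgue_on \<Omega>). norm (G x) \<le> \<zeta> x \<and> \<zeta> x \<noteq> 0} x *\<^sub>R (G x /\<^sub>R \<zeta> x)" for x
    have [measurable]: "G \<in> borel_measurable (lebesgue_on \<Omega>)" "\<zeta> \<in> borel_measurable (lebesgue_on \<Omega>)"
      using G \<zeta>(1) by blast+
    have Hm: "H \<in> borel_measurable (lebesgue_on \<Omega>)" unfolding H_def by measurable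
    have H1: "AE x in lebesgue_on \<Omega>. norm (H x) \<le> 1"
      using \<zeta>(2) by eventually_elim (auto simp: H_def indicator_def field_simps)
    have H: "H \<in> Linf \<Omega>" by (rule LinfI[OF Hm H1])
    have "AE x in lebesgue_on \<Omega>. G x = \<zeta> x *\<^sub>R H x"
      using le AE_space by eventually_elim (auto simp: H_def indicator_def)
    then have "ba_integral \<Omega> \<nu> G = ba_integral \<Omega> \<nu> (\<lambda>x. \<zeta> x *\<^sub>R H x)"
      by (intro ba_integral_AE_cong[OF \<nu> G Linf_mult[OF \<zeta>(1) H]])
    also have "\<dots> = ba_integral \<Omega> (ba_scale \<Omega> \<zeta> \<nu>) H" using sc(2) H by simp
    also have "\<dots> \<le> weighted_variation \<Omega> \<zeta> \<nu>"
      using ba_integral_bound[OF sc(1) H H1] by (simp add: weighted_variation_def)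
    finally show "ba_integral \<Omega> \<nu> G \<le> weighted_variation \<Omega> \<zeta> \<nu>" .
  }
  assume K: "\<And>G. G \<in> Linf \<Omega> \<Longrightarrow> AE x in lebesgue_on \<Omega>. norm (G x) \<le> \<zeta> x \<Longrightarrow> ba_integral \<Omega> \<nu> G \<le> K"
  have "0 \<le> K" using K[of "\<lambda>x. 0"] \<zeta>(2) functional_0[OF ba_integral_functional[OF \<nu>]] by simp
  moreover have "total_variation \<Omega> (ba_scale \<Omega> \<zeta> \<nu>) \<Omega> \<le> ennreal K" by (rule rep(2)[OF K])
  ultimately show "weighted_variation \<Omega> \<zeta> \<nu> \<le> K"
    unfolding weighted_variation_def by (metis enn2real_ennreal enn2real_mono ennreal_less_top)
qed

end

section \<open>The Yosida--Hewitt decomposition\<close>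

text \<open>The outer measure generated by a nonnegative finitely additive set function \<open>\<tau>\<close> is
  countably additive and lies below \<open>\<tau>\<close>. It is absolutely continuous, hence has a density
  \<open>h\<close>. A countable cover that nearly realises the outer measure of the space shows that \<open>\<tau>\<close>
  exceeds the outer measure only slightly on a finite union of its members, and the
  complement of such a union has small measure.\<close>

lemma (in finite_measure) countably_additive_minorant:
  fixes \<tau> :: "'a set \<Rightarrow> real"
  assumes nonneg: "\<And>A. A \<in> sets M \<Longrightarrow> 0 \<le> \<tau> A"
    and add: "\<And>A B. A \<in> sets M \<Longrightarrow> B \<in> sets M \<Longrightarrow> A \<inter> B = {} \<Longrightarrow> \<tau> (A \<union> B) = \<tau> A + \<tau> B"
    and null: "\<And>A. A \<in> null_sets M \<Longrightarrow> \<tau> A = 0"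
  shows "\<exists>h. integrable M h \<and> (\<forall>A\<in>sets M. (LINT x:A|M. h x) \<le> \<tau> A) \<and>
    (\<forall>e>0. \<exists>F\<in>sets M. measure M F < e \<and> \<tau> (space M - F) < (LINT x:space M - F|M. h x) + e)"
proof -
  let ?f = "\<lambda>A. ennreal (\<tau> A)"
  define \<kappa> where "\<kappa> = outer_measure (sets M) ?f"
  have empty: "\<tau> {} = 0" by (rule null) simp
  have mono: "\<tau> A \<le> \<tau> B" if "A \<in> sets M" "B \<in> sets M" "A \<subseteq> B" for A B
    using add[of A "B - A"] nonneg[of "B - A"] that by (simp add: Un_absorb1)
  have pos: "positive (sets M) ?f" by (simp add: positive_def empty)
  have inc: "increasing (sets M) ?f" using mono by (auto simp: increasing_def intro: ennreal_leI)
  have additive: "additive (sets M) ?f"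
    using add nonneg by (auto simp: additive_def ennreal_plus[symmetric] simp del: ennreal_plus)
  have \<kappa>_le: "\<kappa> A \<le> ?f A" if "A \<in> sets M" for A
  proof -
    have "\<kappa> A \<le> (\<Sum>i. ?f (if i = (0::nat) then A else {}))"
      unfolding \<kappa>_def using that by (intro sets.outer_measure_le[OF pos inc]) auto
    also have "\<dots> = ?f A" by (subst suminf_finite[of "{0}"]) (auto simp: empty)
    finally show ?thesis .
  qed
  have ms: "measure_space (space M) (sets M) \<kappa>"
  proof (rule measure_down)
    show "measure_space (space M) (lambda_system (space M) (Pow (space M)) \<kappa>) \<kappa>"
      unfolding \<kappa>_def
      by (rule sigma_algebra.caratheodory_lemma[OF sigma_algebra_Pow sets.outer_measure_space_outer_measure[OF pos inc]])
    show "sets M \<subseteq> lambda_system (space M) (Pow (space M)) \<kappa>"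
      unfolding \<kappa>_def by (rule sets.algebra_subset_lambda_system[OF pos inc additive])
  qed (rule sets.sigma_algebra_axioms)
  define N where "N = measure_of (space M) (sets M) \<kappa>"
  have N: "sets N = sets M" "space N = space M" by (simp_all add: N_def)
  have eN: "emeasure N A = \<kappa> A" if "A \<in> sets M" for A
    using ms that unfolding measure_space_def
    by (intro emeasure_measure_of[OF N_def]) (auto simp: sets.space_closed N)
  have "absolutely_continuous M N"
  proof (unfold absolutely_continuous_def, rule subsetI)
    fix A assume A: "A \<in> null_sets M"
    then have "emeasure N A \<le> ?f A" using eN \<kappa>_le by (simp add: null_setsD2)
    then show "A \<in> null_sets N" using null[OF A] A N(1) by (auto simp: null_sets_def)
  qed
  then obtain g where g: "g \<in> borel_measurable M" "density M g = N"
    using Radon_Nikodym N(1) by blast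
  have dens: "\<kappa> A = (\<integral>\<^sup>+x\<in>A. g x \<partial>M)" if "A \<in> sets M" for A
    using that g eN by (metis emeasure_density)
  have fin: "(\<integral>\<^sup>+x. g x \<partial>M) \<noteq> \<infinity>"
  proof -
    have "(\<integral>\<^sup>+x. g x \<partial>M) = (\<integral>\<^sup>+x\<in>space M. g x \<partial>M)" by (intro nn_integral_cong) auto
    then have "(\<integral>\<^sup>+x. g x \<partial>M) \<le> ?f (space M)" using dens[of "space M"] \<kappa>_le[of "space M"] by simp
    then show ?thesis using neq_top_trans[OF ennreal_neq_top] by simp
  qed
  have AEg: "AE x in M. g x = ennreal (enn2real (g x))"
    using nn_integral_PInf_AE[OF g(1) fin] by eventually_elim (simp add: top.not_eq_extremum)
  define h where "h x = enn2real (g x)" for x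
  have hm[measurable]: "h \<in> borel_measurable M" unfolding h_def using g(1) by measurable
  have h0: "0 \<le> h x" for x by (simp add: h_def)
  have h: "integrable M h"
  proof (rule integrableI_nonneg)
    have "(\<integral>\<^sup>+x. ennreal (h x) \<partial>M) = (\<integral>\<^sup>+x. g x \<partial>M)"
      using AEg by (intro nn_integral_cong_AE) (auto simp: h_def elim: eventually_mono)
    then show "(\<integral>\<^sup>+x. ennreal (h x) \<partial>M) < \<infinity>" using fin by (simp add: top.not_eq_extremum)
  qed (auto simp: h0)
  have \<kappa>h: "\<kappa> A = ennreal (LINT x:A|M. h x)" if A: "A \<in> sets M" for A
  proof -
    have "\<kappa> A = (\<integral>\<^sup>+x. ennreal (indicator A x *\<^sub>R h x) \<partial>M)"
      unfolding dens[OF A] using AEg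
      by (intro nn_integral_cong_AE) (auto simp: h_def indicator_def elim: eventually_mono)
    also have "\<dots> = ennreal (LINT x:A|M. h x)"
      unfolding set_lebesgue_integral_def
      using h0 by (intro nn_integral_eq_integral integrable_mult_indicator A h) auto
    finally show ?thesis .
  qed
  have I0: "0 \<le> (LINT x:A|M. h x)" for A
    unfolding set_lebesgue_integral_def using h0 by (intro Bochner_Integration.integral_nonneg) auto
  have "\<exists>F\<in>sets M. measure M F < e \<and> \<tau> (space M - F) < (LINT x:space M - F|M. h x) + e" if e: "0 < e" for e
  proof -
    have "\<kappa> (space M) < \<kappa> (space M) + ennreal e"
      using e I0 by (simp add: \<kappa>h ennreal_plus[symmetric] ennreal_less_iff del: ennreal_plus)
    then obtain A where A: "range A \<subseteq> sets M" "disjoint_family A" "space M \<subseteq> (\<Union>i. A i)"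
      and sum: "(\<Sum>i. ?f (A i)) < \<kappa> (space M) + ennreal e"
      unfolding \<kappa>_def by (blast dest: sets.outer_measure_close)
    define G where "G n = (\<Union>i<n. A i)" for n
    have Gm: "G n \<in> sets M" for n using A(1) by (auto simp: G_def)
    have "(\<lambda>n. measure M (space M - G n)) \<longlonglongrightarrow> measure M (\<Inter>n. space M - G n)"
    proof (rule finite_Lim_measure_decseq)
      show "range (\<lambda>n. space M - G n) \<subseteq> sets M" using Gm by auto
      show "decseq (\<lambda>n. space M - G n)"
        unfolding decseq_def G_def by (auto dest: less_le_trans)
    qed
    also have "(\<Inter>n. space M - G n) = {}"
    proof (intro equals0I)
      fix x assume x: "x \<in> (\<Inter>n. space M - G n)"
      then have "x \<in> space M" by blast
      then obtain i where "x \<in> A i" using A(3) by blast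
      then have "x \<in> G (Suc i)" unfolding G_def by blast
      with x show False by blast
    qed
    finally have "(\<lambda>n. measure M (space M - G n)) \<longlonglongrightarrow> 0" by simp
    then have "\<forall>\<^sub>F n in sequentially. measure M (space M - G n) < e" by (rule order_tendstoD(2)) (rule e)
    then obtain n where n: "measure M (space M - G n) < e" by (auto simp: eventually_sequentially)
    have Gs: "G n \<subseteq> space M" by (rule sets.sets_into_space[OF Gm])
    have \<tau>G: "\<tau> (G k) = (\<Sum>i<k. \<tau> (A i))" for k
    proof (induction k)
      case 0 then show ?case by (simp add: G_def empty)
    next
      case (Suc k)
      have "G (Suc k) = G k \<union> A k" by (auto simp: G_def less_Suc_eq)
      moreover have "G k \<inter> A k = {}"
      proof (intro equals0I)
        fix x assume "x \<in> G k \<inter> A k"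
        then obtain i where "i < k" "x \<in> A i \<inter> A k" by (auto simp: G_def)
        then show False using A(2) unfolding disjoint_family_on_def by (metis UNIV_I empty_iff less_irrefl)
      qed
      ultimately show ?case using Suc add[OF Gm[of k], of "A k"] A(1) by auto
    qed
    have "\<kappa> (space M - G n) \<le> (\<Sum>i. ?f (A (i + n)))"
      unfolding \<kappa>_def
    proof (rule sets.outer_measure_le[OF pos inc])
      show "range (\<lambda>i. A (i + n)) \<subseteq> sets M" using A(1) by auto
      show "space M - G n \<subseteq> (\<Union>i. A (i + n))"
      proof
        fix x assume x: "x \<in> space M - G n"
        then obtain i where i: "x \<in> A i" using A(3) by auto
        with x have "n \<le> i" by (auto simp: G_def not_less[symmetric])
        then show "x \<in> (\<Union>i. A (i + n))" using i by (auto intro!: exI[of _ "i - n"])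
      qed
    qed
    then have "ennreal (\<tau> (G n)) + \<kappa> (space M - G n) \<le> (\<Sum>i<n. ?f (A i)) + (\<Sum>i. ?f (A (i + n)))"
      using A(1) nonneg by (intro add_mono) (auto simp: \<tau>G image_subset_iff)
    also have "\<dots> = (\<Sum>i. ?f (A i))" by (subst (2) suminf_offset[of _ n]) (auto simp: add.commute)
    also note sum
    also have "\<kappa> (space M) = ennreal ((LINT x:G n|M. h x) + (LINT x:space M - G n|M. h x))"
    proof -
      have "(LINT x:space M|M. h x) = (LINT x:G n \<union> (space M - G n)|M. h x)"
        using Gs by (simp add: Un_absorb1)
      also have "\<dots> = (LINT x:G n|M. h x) + (LINT x:space M - G n|M. h x)"
      proof (rule set_integral_Un)
        show "set_integrable M (G n) h" "set_integrable M (space M - G n) h"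
          unfolding set_integrable_def using Gm by (auto intro!: integrable_mult_indicator h simp del: real_scaleR_def)
      qed auto
      finally show ?thesis by (simp add: \<kappa>h)
    qed
    finally have "\<tau> (G n) + (LINT x:space M - G n|M. h x) < (LINT x:G n|M. h x) + (LINT x:space M - G n|M. h x) + e"
      using Gm e I0 nonneg[OF Gm] by (simp add: \<kappa>h ennreal_plus[symmetric] ennreal_less_iff del: ennreal_plus)
    then have "\<tau> (G n) < (LINT x:G n|M. h x) + e" by simp
    moreover have "space M - (space M - G n) = G n" using Gs by auto
    ultimately show ?thesis using n Gm by (intro bexI[of _ "space M - G n"]) auto
  qed
  moreover have "(LINT x:A|M. h x) \<le> \<tau> A" if "A \<in> sets M" for A
    using \<kappa>_le[OF that] nonneg[OF that] by (simp add: \<kappa>h[OF that])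
  ultimately show ?thesis using h by blast
qed

text \<open>The exceptional sets of \<open>countably_additive_minorant\<close> for the errors \<open>(1/2)\<^sup>n\<close>
  have summable measures, so their tail unions \<open>E n\<close> decrease to measure zero. A set that
  misses \<open>E n\<close> misses all later exceptional sets, and on it the defect is below every
  \<open>(1/2)\<^sup>i\<close>.\<close>

lemma (in finite_measure) positive_charge_decomposition:
  fixes \<tau> :: "'a set \<Rightarrow> real"
  assumes nonneg: "\<And>A. A \<in> sets M \<Longrightarrow> 0 \<le> \<tau> A"
    and add: "\<And>A B. A \<in> sets M \<Longrightarrow> B \<in> sets M \<Longrightarrow> A \<inter> B = {} \<Longrightarrow> \<tau> (A \<union> B) = \<tau> A + \<tau> B"
    and null: "\<And>A. A \<in> null_sets M \<Longrightarrow> \<tau> A = 0"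
  shows "\<exists>h E. integrable M h \<and> range E \<subseteq> sets M \<and> decseq E \<and> (\<lambda>n. measure M (E n)) \<longlonglongrightarrow> 0 \<and>
    (\<forall>n. \<forall>A\<in>sets M. A \<inter> E n = {} \<longrightarrow> \<tau> A = (LINT x:A|M. h x))"
proof -
  obtain h where h: "integrable M h"
    and le: "\<And>A. A \<in> sets M \<Longrightarrow> (LINT x:A|M. h x) \<le> \<tau> A"
    and ex: "\<And>e. 0 < e \<Longrightarrow> \<exists>F\<in>sets M. measure M F < e \<and> \<tau> (space M - F) < (LINT x:space M - F|M. h x) + e"
  proof -
    have "\<exists>h. integrable M h \<and> (\<forall>A\<in>sets M. (LINT x:A|M. h x) \<le> \<tau> A) \<and>
      (\<forall>e>0. \<exists>F\<in>sets M. measure M F < e \<and> \<tau> (space M - F) < (LINT x:space M - F|M. h x) + e)"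
      by (rule countably_additive_minorant) (rule nonneg add null; assumption)+
    then show thesis using that by blast
  qed
  have "\<exists>F. F \<in> sets M \<and> measure M F < (1/2)^n \<and> \<tau> (space M - F) < (LINT x:space M - F|M. h x) + (1/2)^n" for n :: nat
    using ex[of "(1/2)^n"] by auto
  then obtain F where Fm: "\<And>n. F n \<in> sets M" and F1: "\<And>n. measure M (F n) < (1/2)^n"
    and F2: "\<And>n. \<tau> (space M - F n) < (LINT x:space M - F n|M. h x) + (1/2)^n" by metis
  define E where "E n = (\<Union>i. F (i + n))" for n
  have Em: "E n \<in> sets M" for n using Fm by (auto simp: E_def)
  have "decseq E"
  proof (rule antimonoI, rule subsetI)
    fix m n :: nat and x assume "m \<le> n" "x \<in> E n"
    then obtain i where "x \<in> F (i + n)" by (auto simp: E_def)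
    then have "x \<in> F ((i + (n - m)) + m)" using \<open>m \<le> n\<close> by simp
    then show "x \<in> E m" unfolding E_def by blast
  qed
  moreover have "(\<lambda>n. measure M (E n)) \<longlonglongrightarrow> 0"
  proof (rule tendsto_sandwich[OF _ _ tendsto_const])
    have sg: "summable (\<lambda>i. (1/2::real)^(i + n))" for n
      using summable_geometric[of "1/2::real"] by (subst summable_iff_shift) auto
    have "measure M (E n) \<le> 2 * (1/2)^n" for n
    proof -
      have sF: "summable (\<lambda>i. measure M (F (i + n)))"
        using F1 by (intro summable_comparison_test'[OF sg, of 0]) (auto intro: less_imp_le)
      have "measure M (E n) \<le> (\<Sum>i. measure M (F (i + n)))"
        unfolding E_def using Fm sF by (intro finite_measure_subadditive_countably) auto
      also have "\<dots> \<le> (\<Sum>i. (1/2)^(i + n))"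
        using F1 by (intro suminf_le sF sg) (auto intro: less_imp_le)
      also have "\<dots> = 2 * (1/2)^n"
        using suminf_mult2[of "\<lambda>i. (1/2::real)^i" "(1/2)^n"] suminf_geometric[of "1/2::real"] summable_geometric[of "1/2::real"]
        by (simp add: power_add)
      finally show ?thesis .
    qed
    then show "\<forall>\<^sub>F n in sequentially. measure M (E n) \<le> 2 * (1/2)^n" by simp
    show "(\<lambda>n. 2 * (1/2::real)^n) \<longlonglongrightarrow> 0"
      by (intro tendsto_mult_right_zero LIMSEQ_realpow_zero) auto
  qed simp
  moreover have "\<tau> A = (LINT x:A|M. h x)" if A: "A \<in> sets M" "A \<inter> E n = {}" for n A
  proof -
    have "\<tau> A - (LINT x:A|M. h x) \<le> (1/2)^(i + n)" for i
    proof -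
      define B where "B = space M - F (i + n)"
      have B: "B \<in> sets M" using Fm by (auto simp: B_def)
      have "A \<subseteq> B" using A sets.sets_into_space[OF A(1)] by (auto simp: B_def E_def)
      then have eq: "A \<union> (B - A) = B" by auto
      have "\<tau> (A \<union> (B - A)) = \<tau> A + \<tau> (B - A)" by (rule add) (use A(1) B in auto)
      then have "\<tau> B = \<tau> A + \<tau> (B - A)" by (simp only: eq)
      moreover have "(LINT x:B|M. h x) = (LINT x:A|M. h x) + (LINT x:B - A|M. h x)"
      proof -
        have "(LINT x:A \<union> (B - A)|M. h x) = (LINT x:A|M. h x) + (LINT x:B - A|M. h x)"
          using integrable_mult_indicator[OF A(1) h] integrable_mult_indicator[OF sets.Diff[OF B A(1)] h]
          by (intro set_integral_Un) (auto simp: set_integrable_def)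
        then show ?thesis by (simp only: eq)
      qed
      moreover have "(LINT x:B - A|M. h x) \<le> \<tau> (B - A)" using le[of "B - A"] A(1) B by simp
      moreover have "\<tau> B < (LINT x:B|M. h x) + (1/2)^(i + n)" using F2 by (simp add: B_def)
      ultimately show ?thesis by simp
    qed
    moreover have "(\<lambda>i. (1/2::real)^(i + n)) \<longlonglongrightarrow> 0"
      by (intro LIMSEQ_ignore_initial_segment LIMSEQ_realpow_zero) auto
    ultimately have "\<tau> A - (LINT x:A|M. h x) \<le> 0" by (intro LIMSEQ_le_const) auto
    with le[OF A(1)] show ?thesis by simp
  qed
  ultimately show ?thesis using h Em by (intro exI[of _ h] exI[of _ E]) blast
qed

text \<open>The positive part \<open>p A = sup {\<tau> B | B \<subseteq> A}\<close> is a nonnegative charge above \<open>\<tau>\<close>, so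
  that \<open>\<tau> = p - (p - \<tau>)\<close> is a difference of two nonnegative charges, each of which
  decomposes.\<close>

lemma (in finite_measure) bounded_charge_decomposition:
  fixes \<tau> :: "'a set \<Rightarrow> real"
  assumes bound: "\<And>A. A \<in> sets M \<Longrightarrow> \<tau> A \<le> C"
    and add: "\<And>A B. A \<in> sets M \<Longrightarrow> B \<in> sets M \<Longrightarrow> A \<inter> B = {} \<Longrightarrow> \<tau> (A \<union> B) = \<tau> A + \<tau> B"
    and null: "\<And>A. A \<in> null_sets M \<Longrightarrow> \<tau> A = 0"
  shows "\<exists>h E. integrable M h \<and> range E \<subseteq> sets M \<and> decseq E \<and> (\<lambda>n. measure M (E n)) \<longlonglongrightarrow> 0 \<and>
    (\<forall>n. \<forall>A\<in>sets M. A \<inter> E n = {} \<longrightarrow> \<tau> A = (LINT x:A|M. h x))"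
proof -
  define p where "p A = (SUP B\<in>{B \<in> sets M. B \<subseteq> A}. \<tau> B)" for A
  have empty: "\<tau> {} = 0" by (rule null) simp
  have bdd: "bdd_above (\<tau> ` {B \<in> sets M. B \<subseteq> A})" for A using bound by (intro bdd_aboveI[of _ C]) auto
  have upper: "\<tau> B \<le> p A" if "B \<in> sets M" "B \<subseteq> A" for A B
    unfolding p_def using that by (intro cSUP_upper bdd) auto
  have least: "p A \<le> c" if "\<And>B. B \<in> sets M \<Longrightarrow> B \<subseteq> A \<Longrightarrow> \<tau> B \<le> c" for A c
    unfolding p_def using that by (intro cSUP_least) auto
  have p_add: "p (A \<union> B) = p A + p B" if AB: "A \<in> sets M" "B \<in> sets M" "A \<inter> B = {}" for A B
  proof (rule antisym)
    show "p (A \<union> B) \<le> p A + p B"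
    proof (rule least)
      fix S assume S: "S \<in> sets M" "S \<subseteq> A \<union> B"
      then have "S = (S \<inter> A) \<union> (S \<inter> B)" by auto
      then have "\<tau> S = \<tau> (S \<inter> A) + \<tau> (S \<inter> B)"
        using add[of "S \<inter> A" "S \<inter> B"] AB S(1) by auto
      also have "\<dots> \<le> p A + p B" using AB S(1) by (intro add_mono upper) auto
      finally show "\<tau> S \<le> p A + p B" .
    qed
    have "\<tau> S \<le> p (A \<union> B) - p B" if S: "S \<in> sets M" "S \<subseteq> A" for S
    proof -
      have "p B \<le> p (A \<union> B) - \<tau> S"
      proof (rule least)
        fix T assume T: "T \<in> sets M" "T \<subseteq> B"
        have "\<tau> (S \<union> T) = \<tau> S + \<tau> T" using add[of S T] S T AB(3) by auto
        moreover have "\<tau> (S \<union> T) \<le> p (A \<union> B)" using S T by (intro upper) auto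
        ultimately show "\<tau> T \<le> p (A \<union> B) - \<tau> S" by simp
      qed
      then show ?thesis by simp
    qed
    then have "p A \<le> p (A \<union> B) - p B" by (rule least)
    then show "p A + p B \<le> p (A \<union> B)" by simp
  qed
  have p_null: "p A = 0" if A: "A \<in> null_sets M" for A
  proof (rule antisym)
    show "p A \<le> 0"
    proof (rule least)
      fix B assume "B \<in> sets M" "B \<subseteq> A"
      then have "B \<in> null_sets M" using A null_sets_subset by blast
      then show "\<tau> B \<le> 0" using null by simp
    qed
    show "0 \<le> p A" using upper[of "{}" A] empty by simp
  qed
  have "\<exists>h E. integrable M h \<and> range E \<subseteq> sets M \<and> decseq E \<and> (\<lambda>n. measure M (E n)) \<longlonglongrightarrow> 0 \<and>
      (\<forall>n. \<forall>A\<in>sets M. A \<inter> E n = {} \<longrightarrow> p A = (LINT x:A|M. h x))"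
  proof (rule positive_charge_decomposition)
    show "0 \<le> p A" for A using upper[of "{}" A] empty by simp
  qed (rule p_add p_null; assumption)+
  then obtain h1 E1 where P1: "integrable M h1 \<and> range E1 \<subseteq> sets M \<and> decseq E1 \<and> (\<lambda>n. measure M (E1 n)) \<longlonglongrightarrow> 0 \<and>
      (\<forall>n. \<forall>A\<in>sets M. A \<inter> E1 n = {} \<longrightarrow> p A = (LINT x:A|M. h1 x))"
    by (elim exE)
  then have 1: "integrable M h1" "range E1 \<subseteq> sets M" "decseq E1" "(\<lambda>n. measure M (E1 n)) \<longlonglongrightarrow> 0"
    and 11: "\<And>n A. A \<in> sets M \<Longrightarrow> A \<inter> E1 n = {} \<Longrightarrow> p A = (LINT x:A|M. h1 x)"
    by blast+
  have "\<exists>h E. integrable M h \<and> range E \<subseteq> sets M \<and> decseq E \<and> (\<lambda>n. measure M (E n)) \<longlonglongrightarrow> 0 \<and>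
      (\<forall>n. \<forall>A\<in>sets M. A \<inter> E n = {} \<longrightarrow> p A - \<tau> A = (LINT x:A|M. h x))"
  proof (rule positive_charge_decomposition)
    show "0 \<le> p A - \<tau> A" if "A \<in> sets M" for A using upper[of A A] that by simp
    show "p (A \<union> B) - \<tau> (A \<union> B) = p A - \<tau> A + (p B - \<tau> B)"
      if "A \<in> sets M" "B \<in> sets M" "A \<inter> B = {}" for A B
      using p_add[OF that] add[OF that] by simp
    show "p A - \<tau> A = 0" if "A \<in> null_sets M" for A using p_null[OF that] null[OF that] by simp
  qed
  then obtain h2 E2 where P2: "integrable M h2 \<and> range E2 \<subseteq> sets M \<and> decseq E2 \<and> (\<lambda>n. measure M (E2 n)) \<longlonglongrightarrow> 0 \<and>
      (\<forall>n. \<forall>A\<in>sets M. A \<inter> E2 n = {} \<longrightarrow> p A - \<tau> A = (LINT x:A|M. h2 x))"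
    by (elim exE)
  then have 2: "integrable M h2" "range E2 \<subseteq> sets M" "decseq E2" "(\<lambda>n. measure M (E2 n)) \<longlonglongrightarrow> 0"
    and 22: "\<And>n A. A \<in> sets M \<Longrightarrow> A \<inter> E2 n = {} \<Longrightarrow> p A - \<tau> A = (LINT x:A|M. h2 x)"
    by blast+
  show ?thesis
  proof (intro exI[of _ "\<lambda>x. h1 x - h2 x"] exI[of _ "\<lambda>n. E1 n \<union> E2 n"] conjI allI ballI impI)
    show "integrable M (\<lambda>x. h1 x - h2 x)" using 1 2 by simp
    show "range (\<lambda>n. E1 n \<union> E2 n) \<subseteq> sets M" using 1 2 by auto
    show "decseq (\<lambda>n. E1 n \<union> E2 n)" using 1(3) 2(3) unfolding decseq_def by blast
    show "(\<lambda>n. measure M (E1 n \<union> E2 n)) \<longlonglongrightarrow> 0"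
    proof (rule tendsto_sandwich[OF _ _ tendsto_const])
      show "\<forall>\<^sub>F n in sequentially. measure M (E1 n \<union> E2 n) \<le> measure M (E1 n) + measure M (E2 n)"
        using 1(2) 2(2) by (intro always_eventually allI measure_Un_le) auto
      show "(\<lambda>n. measure M (E1 n) + measure M (E2 n)) \<longlonglongrightarrow> 0"
        using tendsto_add[OF 1(4) 2(4)] by simp
    qed simp
    fix n A assume A: "A \<in> sets M" "A \<inter> (E1 n \<union> E2 n) = {}"
    then have "A \<inter> E1 n = {}" "A \<inter> E2 n = {}" by auto
    then have "\<tau> A = (LINT x:A|M. h1 x) - (LINT x:A|M. h2 x)" using 11[OF A(1)] 22[OF A(1)] by force
    also have "\<dots> = (LINT x:A|M. h1 x - h2 x)"
      using integrable_mult_indicator[OF A(1) 1(1)] integrable_mult_indicator[OF A(1) 2(1)]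
      by (intro set_integral_diff(2)[symmetric]) (auto simp: set_integrable_def)
    finally show "\<tau> A = (LINT x:A|M. h1 x - h2 x)" .
  qed
qed

text \<open>Test with the part of \<open>B\<close> where \<open>w\<close> is positive, then with the part where it is
  negative.\<close>

lemma AE_eq_0_if_set_integrals_0:
  fixes w :: "'a \<Rightarrow> real"
  assumes w: "integrable M w" and B: "B \<in> sets M"
    and 0: "\<And>A. A \<in> sets M \<Longrightarrow> A \<subseteq> B \<Longrightarrow> (LINT x:A|M. w x) = 0"
  shows "AE x in M. x \<in> B \<longrightarrow> w x = 0"
proof -
  have *: "AE x in M. x \<in> B \<longrightarrow> v x \<le> 0"
    if v: "integrable M v" and v0: "\<And>A. A \<in> sets M \<Longrightarrow> A \<subseteq> B \<Longrightarrow> (LINT x:A|M. v x) = 0" for v :: "'a \<Rightarrow> real"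
  proof -
    have [measurable]: "v \<in> borel_measurable M" "B \<in> sets M" using v B by auto
    define A where "A = {x \<in> space M. x \<in> B \<and> 0 < v x}"
    have A: "A \<in> sets M" unfolding A_def by measurable
    have "AE x in M. indicator A x *\<^sub>R v x = 0"
    proof (rule integral_nonneg_eq_0_iff_AE[THEN iffD1])
      show "integrable M (\<lambda>x. indicator A x *\<^sub>R v x)" by (rule integrable_mult_indicator[OF A v])
      show "AE x in M. 0 \<le> indicator A x *\<^sub>R v x" by (auto simp: A_def indicator_def)
      show "(LINT x|M. indicator A x *\<^sub>R v x) = 0"
        using v0[OF A] by (auto simp: A_def set_lebesgue_integral_def)
    qed
    then show ?thesis using AE_space by eventually_elim (auto simp: A_def indicator_def)
  qed
  have "AE x in M. x \<in> B \<longrightarrow> w x \<le> 0"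
    by (rule *[OF w]) (rule 0)
  moreover have "AE x in M. x \<in> B \<longrightarrow> - w x \<le> 0"
  proof (rule *)
    show "(LINT x:A|M. - w x) = 0" if "A \<in> sets M" "A \<subseteq> B" for A
      using 0[OF that] by (simp add: set_lebesgue_integral_def)
  qed (use w in simp)
  ultimately show ?thesis by eventually_elim auto
qed

context finite_domain
begin

lemma measure_domain_eq: "A \<in> sets (lebesgue_on \<Omega>) \<Longrightarrow> emeasure lebesgue A = ennreal (measure (lebesgue_on \<Omega>) A)"
  using sets.sets_into_space[of A "lebesgue_on \<Omega>"] measurable_domain
  by (subst emeasure_eq_measure[symmetric]) (simp add: emeasure_restrict_space)

text \<open>Each coordinate of \<open>\<nu>\<close> is a bounded charge, and the exceptional sets of the
  finitely many coordinates are united.\<close>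

theorem Yosida_Hewitt_decomposition:
  assumes \<nu>: "\<nu> \<in> ba \<Omega>"
  obtains y \<nu>s where "ba_decomposition \<Omega> \<nu> y \<nu>s"
proof -
  define P where "P b h E \<longleftrightarrow> integrable (lebesgue_on \<Omega>) h \<and> range E \<subseteq> sets (lebesgue_on \<Omega>) \<and> decseq E \<and>
      (\<lambda>n. measure (lebesgue_on \<Omega>) (E n)) \<longlonglongrightarrow> 0 \<and>
      (\<forall>n. \<forall>A\<in>sets (lebesgue_on \<Omega>). A \<inter> E n = {} \<longrightarrow> \<nu> A \<bullet> b = (LINT x:A|lebesgue_on \<Omega>. h x))"
    for b :: 'a and h :: "'a \<Rightarrow> real" and E :: "nat \<Rightarrow> 'a set"
  have "\<exists>h E. P b h E" if b: "b \<in> Basis" for b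
  proof -
    have "\<nu> A \<bullet> b \<le> enn2real (total_variation \<Omega> \<nu> \<Omega>) * 1" if A: "A \<in> sets (lebesgue_on \<Omega>)" for A
    proof -
      have "AE x in lebesgue_on \<Omega>. norm (indicator A x *\<^sub>R b) \<le> 1"
        using b by (auto simp: indicator_def)
      from ba_integral_bound[OF \<nu> Linf_restrict[OF A Linf_const] this] show ?thesis
        unfolding ba_integral_indicator[OF \<nu> A] by (simp add: inner_commute)
    qed
    then show ?thesis
      unfolding P_def
    proof (rule bounded_charge_decomposition)
      show "\<nu> (A \<union> B) \<bullet> b = \<nu> A \<bullet> b + \<nu> B \<bullet> b"
        if "A \<in> sets (lebesgue_on \<Omega>)" "B \<in> sets (lebesgue_on \<Omega>)" "A \<inter> B = {}" for A B
        by (simp only: baD(2)[OF \<nu> that] inner_add_left)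
      show "\<nu> A \<bullet> b = 0" if "A \<in> null_sets (lebesgue_on \<Omega>)" for A
        by (simp only: baD(3)[OF \<nu> that] inner_zero_left)
    qed
  qed
  then obtain h E where P: "\<And>b. b \<in> Basis \<Longrightarrow> P b (h b) (E b)" by metis
  have h: "\<And>b. b \<in> Basis \<Longrightarrow> integrable (lebesgue_on \<Omega>) (h b)"
    and Em: "\<And>b. b \<in> Basis \<Longrightarrow> range (E b) \<subseteq> sets (lebesgue_on \<Omega>)"
    and dec: "\<And>b. b \<in> Basis \<Longrightarrow> decseq (E b)"
    and lim: "\<And>b. b \<in> Basis \<Longrightarrow> (\<lambda>n. measure (lebesgue_on \<Omega>) (E b n)) \<longlonglongrightarrow> 0"
    and eq: "\<And>b n A. b \<in> Basis \<Longrightarrow> A \<in> sets (lebesgue_on \<Omega>) \<Longrightarrow> A \<inter> E b n = {} \<Longrightarrow>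
      \<nu> A \<bullet> b = (LINT x:A|lebesgue_on \<Omega>. h b x)"
    using P unfolding P_def by blast+
  define y where "y x = (\<Sum>b\<in>Basis. h b x *\<^sub>R b)" for x
  define F where "F n = (\<Union>b\<in>Basis. E b n)" for n
  define \<nu>s where "\<nu>s A = \<nu> A + - ac_ba \<Omega> y A" for A
  have y: "integrable (lebesgue_on \<Omega>) y"
    unfolding y_def using h by (intro Bochner_Integration.integrable_sum) auto
  have Fm: "F n \<in> sets (lebesgue_on \<Omega>)" for n
    unfolding F_def using Em by (intro sets.finite_UN) auto
  have \<nu>s: "\<nu>s \<in> ba \<Omega>"
    unfolding \<nu>s_def by (rule ba_add(1)[OF \<nu> ba_minus[OF ac_ba_pairing(1)[OF y]]])
  have "total_variation \<Omega> \<nu>s (\<Omega> - F n) = 0" for n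
  proof -
    have m: "\<Omega> - F n \<in> sets (lebesgue_on \<Omega>)" using sets.compl_sets[OF Fm] by simp
    have "\<nu>s B = 0" if B: "B \<in> sets (lebesgue_on \<Omega>)" "B \<subseteq> \<Omega> - F n" for B
    proof -
      have "ac_ba \<Omega> y B = \<nu> B"
      proof (rule euclidean_eqI)
        fix b :: 'a assume b: "b \<in> Basis"
        have yb: "y x \<bullet> b = h b x" for x
          using b by (simp add: y_def inner_sum_left inner_Basis if_distrib sum.delta cong: if_cong)
        have "ac_ba \<Omega> y B \<bullet> b = (LINT x|lebesgue_on \<Omega>. indicator B x *\<^sub>R y x) \<bullet> b"
          using B(1) by (simp only: ac_ba_def set_lebesgue_integral_def if_True)
        also have "\<dots> = (LINT x|lebesgue_on \<Omega>. (indicator B x *\<^sub>R y x) \<bullet> b)"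
          by (rule integral_inner_left[symmetric]) (rule integrable_mult_indicator[OF B(1) y])
        also have "\<dots> = (LINT x:B|lebesgue_on \<Omega>. h b x)"
          unfolding set_lebesgue_integral_def by (simp add: yb)
        also have "\<dots> = \<nu> B \<bullet> b"
          using B b by (intro eq[symmetric, of _ _ n]) (auto simp: F_def)
        finally show "ac_ba \<Omega> y B \<bullet> b = \<nu> B \<bullet> b" .
      qed
      then show ?thesis by (simp add: \<nu>s_def)
    qed
    then show ?thesis using total_variation_eq_0_iff[OF \<nu>s m] by blast
  qed
  moreover have "decseq F" using dec unfolding F_def decseq_def by blast
  moreover have "(\<lambda>n. emeasure lebesgue (F n)) \<longlonglongrightarrow> 0"
  proof -
    have "(\<lambda>n. measure (lebesgue_on \<Omega>) (F n)) \<longlonglongrightarrow> 0"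
    proof (rule tendsto_sandwich[OF _ _ tendsto_const])
      show "\<forall>\<^sub>F n in sequentially. measure (lebesgue_on \<Omega>) (F n) \<le> (\<Sum>b\<in>Basis. measure (lebesgue_on \<Omega>) (E b n))"
        unfolding F_def using Em by (intro always_eventually allI measure_UNION_le) auto
      show "(\<lambda>n. \<Sum>b\<in>Basis. measure (lebesgue_on \<Omega>) (E b n)) \<longlonglongrightarrow> 0"
        by (intro tendsto_null_sum lim)
    qed simp
    then show ?thesis
      unfolding measure_domain_eq[OF Fm] by (simp add: ennreal_tendsto_0_iff)
  qed
  ultimately have "ba_singular \<Omega> \<nu>s"
    unfolding ba_singular_def using \<nu>s Fm by blast
  then have "ba_decomposition \<Omega> \<nu> y \<nu>s"
    unfolding ba_decomposition_def using y by (simp add: \<nu>s_def)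
  then show thesis by (rule that)
qed

text \<open>Off the exceptional sets of both singular parts the two densities have the same
  set integrals, and these exceptional sets shrink to a null set. Hence the densities agree,
  and then so do the singular parts.\<close>

lemma ba_decomposition_unique:
  assumes 1: "ba_decomposition \<Omega> \<nu> y \<nu>s" and 2: "ba_decomposition \<Omega> \<nu> y' \<nu>s'"
  shows "AE x in lebesgue_on \<Omega>. y x = y' x" "\<nu>s = \<nu>s'"
proof -
  have y: "integrable (lebesgue_on \<Omega>) y" "integrable (lebesgue_on \<Omega>) y'"
    and s: "ba_singular \<Omega> \<nu>s" "ba_singular \<Omega> \<nu>s'"
    and e: "ac_ba \<Omega> y A + \<nu>s A = ac_ba \<Omega> y' A + \<nu>s' A" for A
    using 1 2 unfolding ba_decomposition_def by (auto simp: fun_eq_iff)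
  obtain E where E: "range E \<subseteq> sets (lebesgue_on \<Omega>)" "(\<lambda>n. emeasure lebesgue (E n)) \<longlonglongrightarrow> 0"
    "\<And>n. total_variation \<Omega> \<nu>s (\<Omega> - E n) = 0" and \<nu>s: "\<nu>s \<in> ba \<Omega>"
    using s(1) unfolding ba_singular_def by blast
  obtain E' where E': "range E' \<subseteq> sets (lebesgue_on \<Omega>)" "(\<lambda>n. emeasure lebesgue (E' n)) \<longlonglongrightarrow> 0"
    "\<And>n. total_variation \<Omega> \<nu>s' (\<Omega> - E' n) = 0" and \<nu>s': "\<nu>s' \<in> ba \<Omega>"
    using s(2) unfolding ba_singular_def by blast
  define F where "F n = E n \<union> E' n" for n
  have m: "E n \<in> sets (lebesgue_on \<Omega>)" "E' n \<in> sets (lebesgue_on \<Omega>)" "F n \<in> sets (lebesgue_on \<Omega>)" for n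
    using E(1) E'(1) unfolding F_def by (auto intro: sets.Un simp del: sets_restrict_space_iff)
  have c: "\<Omega> - B \<in> sets (lebesgue_on \<Omega>)" if "B \<in> sets (lebesgue_on \<Omega>)" for B
    using sets.compl_sets[OF that] by simp
  have zero: "AE x in lebesgue_on \<Omega>. x \<in> \<Omega> - F n \<longrightarrow> (y x - y' x) \<bullet> b = 0" for n b
  proof (rule AE_eq_0_if_set_integrals_0)
    show "integrable (lebesgue_on \<Omega>) (\<lambda>x. (y x - y' x) \<bullet> b)" using y by auto
    show "\<Omega> - F n \<in> sets (lebesgue_on \<Omega>)" by (rule c[OF m(3)])
    fix A assume A: "A \<in> sets (lebesgue_on \<Omega>)" "A \<subseteq> \<Omega> - F n"
    have "\<nu>s A = 0" using E(3)[of n] total_variation_eq_0_iff[OF \<nu>s c[OF m(1)]] A unfolding F_def by blast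
    moreover have "\<nu>s' A = 0" using E'(3)[of n] total_variation_eq_0_iff[OF \<nu>s' c[OF m(2)]] A unfolding F_def by blast
    ultimately have "ac_ba \<Omega> y A = ac_ba \<Omega> y' A" using e[of A] by simp
    then have eqA: "(LINT x|lebesgue_on \<Omega>. indicator A x *\<^sub>R y x) = (LINT x|lebesgue_on \<Omega>. indicator A x *\<^sub>R y' x)"
      using A(1) by (simp only: ac_ba_def set_lebesgue_integral_def if_True)
    have i: "integrable (lebesgue_on \<Omega>) (\<lambda>x. indicator A x *\<^sub>R y x)" "integrable (lebesgue_on \<Omega>) (\<lambda>x. indicator A x *\<^sub>R y' x)"
      by (rule integrable_mult_indicator[OF A(1) y(1)], rule integrable_mult_indicator[OF A(1) y(2)])
    have "(LINT x:A|lebesgue_on \<Omega>. (y x - y' x) \<bullet> b) =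
        (LINT x|lebesgue_on \<Omega>. (indicator A x *\<^sub>R y x - indicator A x *\<^sub>R y' x) \<bullet> b)"
      unfolding set_lebesgue_integral_def by (intro Bochner_Integration.integral_cong) (auto simp: scaleR_diff_right[symmetric] simp del: scaleR_diff_right)
    also have "\<dots> = (LINT x|lebesgue_on \<Omega>. indicator A x *\<^sub>R y x - indicator A x *\<^sub>R y' x) \<bullet> b"
      using i by (intro integral_inner_left) auto
    also have "\<dots> = 0" using i eqA by simp
    finally show "(LINT x:A|lebesgue_on \<Omega>. (y x - y' x) \<bullet> b) = 0" .
  qed
  have "AE x in lebesgue_on \<Omega>. \<forall>n. \<forall>b\<in>Basis. x \<in> \<Omega> - F n \<longrightarrow> (y x - y' x) \<bullet> b = 0"
    by (intro AE_all_countable[THEN iffD2] allI AE_ball_countable[OF countable_finite[OF finite_Basis], THEN iffD2] ballI zero)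
  moreover have "AE x in lebesgue_on \<Omega>. \<exists>n. x \<in> \<Omega> - F n"
  proof -
    have "(\<Inter>n. F n) \<in> null_sets (lebesgue_on \<Omega>)"
    proof (rule null_setsI)
      show "(\<Inter>n. F n) \<in> sets (lebesgue_on \<Omega>)" using m(3) by (intro sets.countable_INT) (auto simp del: sets_restrict_space_iff)
      have em: "emeasure (lebesgue_on \<Omega>) B = emeasure lebesgue B" if "B \<in> sets (lebesgue_on \<Omega>)" for B
        using that by (simp add: measure_domain_eq emeasure_eq_measure del: sets_restrict_space_iff)
      have "emeasure (lebesgue_on \<Omega>) (\<Inter>n. F n) \<le> emeasure lebesgue (E n) + emeasure lebesgue (E' n)" for n
      proof -
        have "emeasure (lebesgue_on \<Omega>) (\<Inter>n. F n) \<le> emeasure (lebesgue_on \<Omega>) (F n)"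
          using m by (intro emeasure_mono) (auto simp del: sets_restrict_space_iff)
        also have "\<dots> \<le> emeasure (lebesgue_on \<Omega>) (E n) + emeasure (lebesgue_on \<Omega>) (E' n)"
          unfolding F_def by (rule emeasure_subadditive[OF m(1) m(2)])
        finally show ?thesis by (simp only: em m)
      qed
      moreover have "(\<lambda>n. emeasure lebesgue (E n) + emeasure lebesgue (E' n)) \<longlonglongrightarrow> 0 + 0"
        by (intro tendsto_add E E')
      ultimately have "emeasure (lebesgue_on \<Omega>) (\<Inter>n. F n) \<le> 0 + 0" by (intro LIMSEQ_le_const) auto
      then show "emeasure (lebesgue_on \<Omega>) (\<Inter>n. F n) = 0" by simp
    qed
    then show ?thesis using AE_space by (auto dest!: AE_not_in elim!: eventually_elim2)
  qed
  ultimately show AE: "AE x in lebesgue_on \<Omega>. y x = y' x"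
  proof eventually_elim
    fix x assume *: "\<forall>n. \<forall>b\<in>Basis. x \<in> \<Omega> - F n \<longrightarrow> (y x - y' x) \<bullet> b = 0" "\<exists>n. x \<in> \<Omega> - F n"
    show "y x = y' x"
      by (rule euclidean_eqI) (use * in \<open>auto simp: inner_diff_left\<close>)
  qed
  show "\<nu>s = \<nu>s'"
  proof
    fix A
    have "ac_ba \<Omega> y A = ac_ba \<Omega> y' A"
    proof (cases "A \<in> sets (lebesgue_on \<Omega>)")
      case True
      have "(LINT x:A|lebesgue_on \<Omega>. y x) = (LINT x:A|lebesgue_on \<Omega>. y' x)"
        unfolding set_lebesgue_integral_def
        using AE borel_measurable_integrable[OF integrable_mult_indicator[OF True y(1)]]
          borel_measurable_integrable[OF integrable_mult_indicator[OF True y(2)]]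
        by (intro integral_cong_AE) (auto elim: eventually_mono)
      then show ?thesis by (simp add: ac_ba_def)
    qed (simp add: ac_ba_def)
    then show "\<nu>s A = \<nu>s' A" using e[of A] by simp
  qed
qed

lemma
  assumes "ba_decomposition \<Omega> \<nu> y \<nu>s"
  shows ba_singular_part_eq: "ba_singular_part \<Omega> \<nu> = \<nu>s"
    and AE_ba_density_eq: "AE x in lebesgue_on \<Omega>. ba_density \<Omega> \<nu> x = y x"
proof -
  show "ba_singular_part \<Omega> \<nu> = \<nu>s"
    unfolding ba_singular_part_def
  proof (rule the_equality)
    show "\<exists>y. ba_decomposition \<Omega> \<nu> y \<nu>s" by (rule exI[of _ y]) (rule assms)
    show "\<kappa> = \<nu>s" if "\<exists>y. ba_decomposition \<Omega> \<nu> y \<kappa>" for \<kappa>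
      using that by (elim exE) (rule ba_decomposition_unique(2)[OF _ assms])
  qed
  have "\<exists>\<nu>s. ba_decomposition \<Omega> \<nu> (ba_density \<Omega> \<nu>) \<nu>s"
    unfolding ba_density_def by (rule someI_ex[of "\<lambda>y. \<exists>\<nu>s. ba_decomposition \<Omega> \<nu> y \<nu>s"]) (rule exI[of _ y], rule exI[of _ \<nu>s], rule assms)
  then show "AE x in lebesgue_on \<Omega>. ba_density \<Omega> \<nu> x = y x"
    by (elim exE) (rule ba_decomposition_unique(1)[OF _ assms])
qed

end

section \<open>Mollification\<close>

text \<open>The square of the positive part is continuously differentiable, which is the
  smoothness that test functions are required to have.\<close>

definition bump :: "real \<Rightarrow> 'a::euclidean_space \<Rightarrow> real" where
  "bump r x = (max 0 (r\<^sup>2 - x \<bullet> x))\<^sup>2"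

definition mollifier :: "real \<Rightarrow> 'a::euclidean_space \<Rightarrow> real" where
  "mollifier r x = bump r x / (LINT y|lborel. bump r (y::'a))"

lemma DERIV_positive_part_square: "DERIV (\<lambda>s::real. (max 0 s)\<^sup>2) s :> 2 * max 0 s"
proof -
  consider "0 < s" | "s < 0" | "s = 0" by linarith
  then show ?thesis
  proof cases
    case 1
    have "DERIV (\<lambda>s::real. s\<^sup>2) s :> 2 * max 0 s" using 1 by (auto intro!: derivative_eq_intros)
    moreover have "\<forall>\<^sub>F x in nhds s. (max 0 x)\<^sup>2 = x\<^sup>2"
      using eventually_nhds_in_open[of "{0<..}" s] 1 by (auto elim!: eventually_mono)
    ultimately show ?thesis by (subst DERIV_cong_ev[OF refl _ refl])
  next
    case 2
    have "DERIV (\<lambda>s::real. 0) s :> 2 * max 0 s" using 2 by (auto intro!: derivative_eq_intros)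
    moreover have "\<forall>\<^sub>F x in nhds s. (max 0 x)\<^sup>2 = 0"
      using eventually_nhds_in_open[of "{..<0}" s] 2 by (auto elim!: eventually_mono)
    ultimately show ?thesis by (subst DERIV_cong_ev[OF refl _ refl])
  next
    case 3
    have "((\<lambda>h::real. ((max 0 h)\<^sup>2) / h) \<longlongrightarrow> 0) (at 0)"
    proof (rule Lim_null_comparison)
      show "\<forall>\<^sub>F h::real in at 0. norm ((max 0 h)\<^sup>2 / h) \<le> \<bar>h\<bar>"
        by (intro always_eventually allI) (auto simp: max_def power2_eq_square)
      show "((\<lambda>h::real. \<bar>h\<bar>) \<longlongrightarrow> 0) (at 0)" by (rule tendsto_rabs_zero) (rule tendsto_ident_at)
    qed
    then show ?thesis using 3 by (simp add: DERIV_def)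
  qed
qed

lemma bump_nonneg: "0 \<le> bump r x" by (simp add: bump_def)

lemma positive_part_eq_0:
  assumes "0 \<le> r" "x \<notin> ball (0::'a::euclidean_space) r"
  shows "max 0 (r\<^sup>2 - x \<bullet> x) = 0"
  using assms power_mono[of r "norm x" 2] by (simp add: power2_norm_eq_inner)

lemma bump_eq_0: "0 \<le> r \<Longrightarrow> x \<notin> ball 0 r \<Longrightarrow> bump r x = 0"
  unfolding bump_def by (subst positive_part_eq_0) auto

lemma bump_pos: "0 < r \<Longrightarrow> x \<in> ball 0 r \<Longrightarrow> 0 < bump r x"
  by (auto simp: bump_def max_def power2_norm_eq_inner[symmetric] not_le intro!: power_strict_mono)

lemma continuous_bump [continuous_intros]: "continuous_on S f \<Longrightarrow> continuous_on S (\<lambda>x. bump r (f x))"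
  unfolding bump_def by (intro continuous_intros)

lemma GDERIV_bump: "GDERIV (bump r) x :> (- 4 * max 0 (r\<^sup>2 - x \<bullet> x)) *\<^sub>R x"
proof -
  have "GDERIV (\<lambda>x. r\<^sup>2 - x \<bullet> x) x :> - (2 *\<^sub>R x)"
    unfolding gderiv_def by (auto intro!: derivative_eq_intros simp: inner_commute)
  from GDERIV_DERIV_compose[OF this DERIV_positive_part_square]
  show ?thesis unfolding bump_def by simp
qed

lemma integrable_bump:
  assumes "0 \<le> r"
  shows "integrable lborel (bump r :: 'a::euclidean_space \<Rightarrow> real)"
proof -
  have "integrable lborel (\<lambda>x::'a. indicator (cball 0 r) x *\<^sub>R bump r x)"
    by (intro borel_integrable_compact continuous_intros) auto
  also have "(\<lambda>x::'a. indicator (cball 0 r) x *\<^sub>R bump r x) = bump r"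
  proof
    fix x :: 'a
    show "indicator (cball 0 r) x *\<^sub>R bump r x = bump r x"
      using bump_eq_0[OF assms, of x] by (auto simp: indicator_def)
  qed
  finally show ?thesis .
qed

lemma integral_bump_pos:
  assumes "0 < r"
  shows "0 < (LINT y|lborel. bump r (y::'a::euclidean_space))"
proof -
  have "(LINT y|lborel. bump r (y::'a)) \<noteq> 0"
  proof
    assume "(LINT y|lborel. bump r (y::'a)) = 0"
    then have "AE y in lborel. bump r (y::'a) = 0"
      using integral_nonneg_eq_0_iff_AE[OF integrable_bump[where 'a='a, of r]] assms by (simp add: bump_nonneg)
    then have "AE y in lborel. (y::'a) \<notin> ball 0 r"
    proof (rule eventually_mono)
      fix y :: 'a assume "bump r y = 0"
      then show "y \<notin> ball 0 r" using bump_pos[OF assms, of y] by auto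
    qed
    then have "ball (0::'a) r \<in> null_sets lborel" by (subst AE_iff_null_sets) auto
    then have "negligible (ball (0::'a) r)"
      by (simp add: negligible_iff_null_sets null_sets_completionI)
    then show False using assms open_not_negligible[of "ball (0::'a) r"] by simp
  qed
  moreover have "0 \<le> (LINT y|lborel. bump r (y::'a))" by (simp add: bump_nonneg)
  ultimately show ?thesis by simp
qed

lemma mollifier_nonneg: "0 \<le> mollifier r x"
  unfolding mollifier_def using bump_nonneg by (intro divide_nonneg_nonneg Bochner_Integration.integral_nonneg) auto

lemma mollifier_eq_0: "0 \<le> r \<Longrightarrow> x \<notin> ball 0 r \<Longrightarrow> mollifier r x = 0"
  by (simp add: mollifier_def bump_eq_0)

lemma continuous_mollifier [continuous_intros]: "continuous_on S f \<Longrightarrow> continuous_on S (\<lambda>x. mollifier r (f x))"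
  unfolding mollifier_def divide_inverse by (intro continuous_intros)

lemma measurable_mollifier [measurable]: "mollifier r \<in> borel_measurable borel"
  by (intro borel_measurable_continuous_onI continuous_mollifier continuous_on_id)

lemma integrable_mollifier: "0 \<le> r \<Longrightarrow> integrable lborel (mollifier r :: 'a::euclidean_space \<Rightarrow> real)"
  unfolding mollifier_def by (intro integrable_divide integrable_bump)

lemma integral_mollifier: "0 < r \<Longrightarrow> (LINT x|lborel. mollifier r (x::'a::euclidean_space)) = 1"
  unfolding mollifier_def using integral_bump_pos[where 'a='a, of r] by simp

definition mollifier_grad :: "real \<Rightarrow> 'a::euclidean_space \<Rightarrow> 'a" where
  "mollifier_grad r x = (- 4 * max 0 (r\<^sup>2 - x \<bullet> x) / (LINT y|lborel. bump r (y::'a))) *\<^sub>R x"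

lemma GDERIV_mollifier: "GDERIV (mollifier r) x :> mollifier_grad r x"
proof -
  let ?c = "inverse (LINT y|lborel. bump r (y::'a))"
  have "GDERIV (\<lambda>x. ?c * bump r x) x :> ?c *\<^sub>R ((- 4 * max 0 (r\<^sup>2 - x \<bullet> x)) *\<^sub>R x) + bump r x *\<^sub>R 0"
    by (intro GDERIV_mult GDERIV_const GDERIV_bump)
  then show ?thesis
    unfolding mollifier_def mollifier_grad_def by (simp add: divide_inverse mult.commute)
qed

lemma continuous_mollifier_grad [continuous_intros]:
  "continuous_on S f \<Longrightarrow> continuous_on S (\<lambda>x. mollifier_grad r (f x))"
  unfolding mollifier_grad_def divide_inverse by (intro continuous_intros)

lemma mollifier_grad_eq_0: "0 \<le> r \<Longrightarrow> x \<notin> ball 0 r \<Longrightarrow> mollifier_grad r x = 0"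
  unfolding mollifier_grad_def by (subst positive_part_eq_0) auto

lemma mollifier_grad_bounded:
  assumes "0 \<le> r"
  obtains B where "0 \<le> B" "\<And>x::'a::euclidean_space. norm (mollifier_grad r x) \<le> B"
proof -
  have "compact (mollifier_grad r ` cball (0::'a) r)"
    by (intro compact_continuous_image continuous_intros) auto
  then obtain B where B: "\<And>x. x \<in> cball (0::'a) r \<Longrightarrow> norm (mollifier_grad r x) \<le> B"
    by (meson bounded_iff compact_imp_bounded imageI)
  have B0: "0 \<le> B" using order_trans[OF norm_ge_zero B[of 0]] assms by simp
  have "norm (mollifier_grad r x) \<le> B" for x :: 'a
    using B[of x] B0 mollifier_grad_eq_0[OF assms, of x] by (cases "x \<in> ball 0 r") auto
  with B0 show thesis by (rule that)
qed

lemma GDERIV_translate: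
  assumes "\<And>x. GDERIV f x :> f' x"
  shows "GDERIV (\<lambda>y. f (y - a)) x :> f' (x - a)"
proof -
  have "((\<lambda>y. f (y - a)) has_derivative (\<lambda>h. f' (x - a) \<bullet> h)) (at x)"
  proof -
    have "((\<lambda>y. y - a) has_derivative (\<lambda>h. h)) (at x)" by (auto intro!: derivative_eq_intros)
    from has_derivative_compose[OF this assms[of "x - a", unfolded gderiv_def]]
    show ?thesis by (simp add: inner_commute)
  qed
  then show ?thesis by (simp add: gderiv_def inner_commute)
qed

text \<open>A translated mollifier is a test function as soon as its supporting ball lies in
  the domain; this is how weak gradients enter mollification.\<close>

lemma test_function_mollifier:
  assumes "0 < r" "cball x r \<subseteq> \<Omega>"
  shows "test_function \<Omega> (\<lambda>y. mollifier r (y - x)) (\<lambda>y. mollifier_grad r (y - x))"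
proof -
  have sub: "closure {y. mollifier r (y - x) \<noteq> 0} \<subseteq> cball x r"
  proof (rule closure_minimal)
    show "{y. mollifier r (y - x) \<noteq> 0} \<subseteq> cball x r"
      using mollifier_eq_0[of r] assms(1) by (force simp: dist_norm norm_minus_commute)
  qed simp
  moreover have "compact (closure {y. mollifier r (y - x) \<noteq> 0})"
    using sub compact_cball bounded_subset by (meson bounded_cball closed_closure compact_eq_bounded_closed)
  ultimately show ?thesis
    unfolding test_function_def using assms(2)
    by (auto intro!: GDERIV_translate GDERIV_mollifier continuous_intros)
qed

lemma nn_integral_lborel_translate:
  assumes [measurable]: "f \<in> borel_measurable borel"
  shows "(\<integral>\<^sup>+x. f (c + x) \<partial>lborel) = (\<integral>\<^sup>+x. f x \<partial>(lborel :: 'a::euclidean_space measure))"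
proof -
  have "(\<integral>\<^sup>+x. f x \<partial>(lborel :: 'a measure)) = (\<integral>\<^sup>+x. f x \<partial>distr lborel borel ((+) c))"
    by (simp add: lborel_distr_plus)
  also have "\<dots> = (\<integral>\<^sup>+x. f (c + x) \<partial>lborel)" by (rule nn_integral_distr) auto
  finally show ?thesis ..
qed

lemma integral_lborel_translate:
  fixes f :: "'a::euclidean_space \<Rightarrow> real"
  assumes [measurable]: "f \<in> borel_measurable borel"
  shows "(LINT x|lborel. f (c + x)) = (LINT x|lborel. f x)"
proof -
  have "(LINT x|lborel. f x) = (LINT x|distr lborel borel ((+) c). f x)"
    by (simp add: lborel_distr_plus)
  also have "\<dots> = (LINT x|lborel. f (c + x))" by (rule integral_distr) auto
  finally show ?thesis ..
qed

text \<open>Averaging over translates preserves the integral, by Tonelli and translation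
  invariance. It gives the \<open>L\<^sup>1\<close>-contraction property of mollification.\<close>

lemma nn_integral_mollified:
  fixes w :: "'a::euclidean_space \<Rightarrow> ennreal"
  assumes [measurable]: "w \<in> borel_measurable borel" and r: "0 < r"
  shows "(\<integral>\<^sup>+x. \<integral>\<^sup>+t. w (x + t) * ennreal (mollifier r t) \<partial>lborel \<partial>lborel) = (\<integral>\<^sup>+x. w x \<partial>lborel)"
proof -
  have "(\<integral>\<^sup>+x. \<integral>\<^sup>+t. w (x + t) * ennreal (mollifier r t) \<partial>lborel \<partial>lborel) =
      (\<integral>\<^sup>+t. \<integral>\<^sup>+x. w (x + t) * ennreal (mollifier r t) \<partial>lborel \<partial>lborel)"
    by (rule lborel_pair.Fubini'[symmetric]) measurable
  also have "\<dots> = (\<integral>\<^sup>+t. (\<integral>\<^sup>+x. w x \<partial>lborel) * ennreal (mollifier r t) \<partial>(lborel :: 'a measure))"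
  proof (rule nn_integral_cong)
    fix t :: 'a
    have "(\<integral>\<^sup>+x. w (x + t) * ennreal (mollifier r t) \<partial>lborel) = (\<integral>\<^sup>+x. w (t + x) \<partial>lborel) * ennreal (mollifier r t)"
      by (subst nn_integral_multc) (auto simp: add.commute)
    then show "(\<integral>\<^sup>+x. w (x + t) * ennreal (mollifier r t) \<partial>lborel) = (\<integral>\<^sup>+x. w x \<partial>lborel) * ennreal (mollifier r t)"
      by (simp add: nn_integral_lborel_translate)
  qed
  also have "\<dots> = (\<integral>\<^sup>+x. w x \<partial>lborel) * (\<integral>\<^sup>+t. ennreal (mollifier r (t::'a)) \<partial>lborel)"
    by (rule nn_integral_cmult) measurable
  also have "(\<integral>\<^sup>+t. ennreal (mollifier r (t::'a)) \<partial>lborel) = ennreal 1"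
    using r integral_mollifier[where 'a='a, OF r]
    by (subst nn_integral_eq_integral) (auto simp: integrable_mollifier mollifier_nonneg)
  finally show ?thesis by simp
qed

lemma integrable_translate_mollifier:
  fixes v :: "'a::euclidean_space \<Rightarrow> real"
  assumes [measurable]: "v \<in> borel_measurable borel" and r: "0 \<le> r" and bound: "\<And>x. \<bar>v x\<bar> \<le> C"
  shows "integrable lborel (\<lambda>t. v (x + t) * mollifier r t)"
proof (rule Bochner_Integration.integrable_bound)
  show "integrable lborel (\<lambda>t::'a. C * mollifier r t)" by (intro integrable_mult_right integrable_mollifier r)
  show "AE t in lborel. norm (v (x + t) * mollifier r t) \<le> norm (C * mollifier r t)"
  proof (rule AE_I2)
    fix t
    show "norm (v (x + t) * mollifier r t) \<le> norm (C * mollifier r t)"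
      using mult_right_mono[OF order_trans[OF bound[of "x + t"] abs_ge_self[of C]] abs_ge_zero[of "mollifier r t"]]
      by (simp add: abs_mult)
  qed
qed measurable

text \<open>A measurable function is an almost everywhere limit of continuous ones. Truncating
  these at height \<open>C\<close> and multiplying by a cutoff makes the convergence dominated.\<close>

lemma continuous_L1_approximation:
  fixes v :: "'a::euclidean_space \<Rightarrow> real"
  assumes [measurable]: "v \<in> borel_measurable borel" and bound: "\<And>x. \<bar>v x\<bar> \<le> C"
    and R: "\<And>x. x \<notin> ball 0 R \<Longrightarrow> v x = 0" and e: "0 < e"
  obtains g where "continuous_on UNIV g" "\<And>x. \<bar>g x\<bar> \<le> C" "\<And>x. x \<notin> cball 0 (R + 1) \<Longrightarrow> g x = 0"
    "(LINT x|lborel. \<bar>v x - g x\<bar>) < e"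
proof -
  have C0: "0 \<le> C" using order_trans[OF abs_ge_zero bound] .
  have "v measurable_on UNIV"
    using assms(1) by (intro lebesgue_measurable_imp_measurable_on_real measurable_completion) auto
  then obtain N g where N: "negligible N" and gc: "\<And>n. continuous_on UNIV (g n)"
    and lim: "\<And>x. x \<notin> N \<Longrightarrow> (\<lambda>n. g n x) \<longlonglongrightarrow> v x"
    unfolding measurable_on_def by auto
  define \<theta> where "\<theta> x = max 0 (min 1 (R + 1 - norm x))" for x :: 'a
  define G where "G n x = \<theta> x * max (- C) (min C (g n x))" for n x
  have Gc: "continuous_on UNIV (G n)" for n
    unfolding G_def \<theta>_def by (intro continuous_intros gc)
  have \<theta>: "0 \<le> \<theta> x" "\<theta> x \<le> 1" "x \<notin> cball 0 (R + 1) \<Longrightarrow> \<theta> x = 0" "x \<in> ball 0 R \<Longrightarrow> \<theta> x = 1" for x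
    by (auto simp: \<theta>_def)
  have Gb: "\<bar>G n x\<bar> \<le> C" for n x
  proof -
    have "\<bar>max (- C) (min C (g n x))\<bar> \<le> C" using C0 by auto
    then have "\<theta> x * \<bar>max (- C) (min C (g n x))\<bar> \<le> 1 * C" using \<theta> by (intro mult_mono) auto
    then show ?thesis using \<theta>(1) by (simp add: G_def abs_mult)
  qed
  have G0: "G n x = 0" if "x \<notin> cball 0 (R + 1)" for n x using \<theta>(3)[OF that] by (simp add: G_def)
  have Glim: "(\<lambda>n. G n x) \<longlonglongrightarrow> v x" if "x \<notin> N" for x
  proof -
    have "(\<lambda>n. G n x) \<longlonglongrightarrow> \<theta> x * max (- C) (min C (v x))"
      unfolding G_def by (intro tendsto_intros lim that)
    also have "max (- C) (min C (v x)) = v x" using bound[of x] by auto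
    also have "\<theta> x * v x = v x" using \<theta>(4)[of x] R[of x] by (cases "x \<in> ball 0 R") auto
    finally show ?thesis .
  qed
  have [measurable]: "G n \<in> borel_measurable borel" for n
    by (rule borel_measurable_continuous_onI[OF Gc])
  have "(\<lambda>n. LINT x|lborel. \<bar>v x - G n x\<bar>) \<longlonglongrightarrow> (LINT x|(lborel :: 'a measure). (0::real))"
  proof (rule integral_dominated_convergence[where w="\<lambda>x. indicator (cball (0::'a) (R + 1)) x *\<^sub>R (2 * C)"])
    show "integrable lborel (\<lambda>x. indicator (cball (0::'a) (R + 1)) x *\<^sub>R (2 * C))"
      by (intro borel_integrable_compact) auto
    have "AE x in lborel. x \<notin> N"
      using N AE_not_in[of N lebesgue] by (simp add: negligible_iff_null_sets AE_completion_iff)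
    then show "AE x in lborel. (\<lambda>n. \<bar>v x - G n x\<bar>) \<longlonglongrightarrow> 0"
    proof eventually_elim
      fix x assume "x \<notin> N"
      from tendsto_diff[OF tendsto_const Glim[OF this], of "v x"]
      show "(\<lambda>n. \<bar>v x - G n x\<bar>) \<longlonglongrightarrow> 0" by (intro tendsto_rabs_zero) simp
    qed
    show "AE x in lborel. norm \<bar>v x - G n x\<bar> \<le> indicator (cball 0 (R + 1)) x *\<^sub>R (2 * C)" for n
    proof (rule AE_I2)
      fix x
      show "norm \<bar>v x - G n x\<bar> \<le> indicator (cball 0 (R + 1)) x *\<^sub>R (2 * C)"
      proof (cases "x \<in> cball 0 (R + 1)")
        case True
        then show ?thesis using bound[of x] Gb[of n x] abs_triangle_ineq4[of "v x" "G n x"] by simp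
      next
        case False
        then have "x \<notin> ball 0 R" by auto
        with False show ?thesis using R[of x] G0[of x n] by simp
      qed
    qed
  qed auto
  then have "\<forall>\<^sub>F n in sequentially. (LINT x|lborel. \<bar>v x - G n x\<bar>) < e"
    using e by (intro order_tendstoD(2)) auto
  then obtain n where "(LINT x|lborel. \<bar>v x - G n x\<bar>) < e" by (auto simp: eventually_sequentially)
  then show thesis by (intro that[of "G n"] Gc Gb G0)
qed

text \<open>Replace \<open>v\<close> by a continuous function \<open>g\<close> near it in \<open>L\<^sup>1\<close>. Mollification does not
  increase the \<open>L\<^sup>1\<close>-norm of \<open>v - g\<close>, and it moves the uniformly continuous \<open>g\<close> by at most
  \<open>d\<close> everywhere.\<close>

lemma mollified_L1_close:
  fixes v :: "'a::euclidean_space \<Rightarrow> real"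
  assumes [measurable]: "v \<in> borel_measurable borel" and bound: "\<And>x. \<bar>v x\<bar> \<le> C"
    and R: "\<And>x. x \<notin> ball 0 R \<Longrightarrow> v x = 0" and e: "0 < e"
    and S[measurable]: "S \<in> sets borel" and Sf: "emeasure lborel S < \<infinity>"
  obtains r where "0 < r" "r < e"
    "(LINT x|lborel. indicator S x * \<bar>(LINT t|lborel. v (x + t) * mollifier r t) - v x\<bar>) < e"
proof -
  define m where "m = measure lborel S"
  define d where "d = e / (m + 3)"
  have m0: "0 \<le> m" by (simp add: m_def)
  have d: "0 < d" "d * m + 2 * d < e"
  proof -
    show "0 < d" using e m0 by (simp add: d_def)
    moreover have "d * (m + 3) = e" using m0 by (simp add: d_def)
    ultimately show "d * m + 2 * d < e" by (simp add: algebra_simps)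
  qed
  obtain g where gc: "continuous_on UNIV g" and gC: "\<And>x. \<bar>g x\<bar> \<le> C"
    and g0: "\<And>x. x \<notin> cball 0 (R + 1) \<Longrightarrow> g x = 0" and close: "(LINT x|lborel. \<bar>v x - g x\<bar>) < d"
    using continuous_L1_approximation[OF assms(1) bound R d(1)] by blast
  have [measurable]: "g \<in> borel_measurable borel" by (rule borel_measurable_continuous_onI[OF gc])
  have "uniformly_continuous_on (cball 0 (R + 2)) g"
    by (intro compact_uniformly_continuous continuous_on_subset[OF gc]) auto
  then obtain s where s: "0 < s" "\<And>x y. x \<in> cball 0 (R + 2) \<Longrightarrow> y \<in> cball 0 (R + 2) \<Longrightarrow> dist y x < s \<Longrightarrow> dist (g y) (g x) < d"
    unfolding uniformly_continuous_on_def using d(1) by metis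
  \<comment> \<open>The bound \<open>r < 1\<close> keeps \<open>x\<close> and \<open>x + t\<close> inside the ball of uniform continuity.\<close>
  define r where "r = min (s / 2) (min (1/2) (e/2))"
  have r: "0 < r" "r < e" "r < s" "r < 1" using s(1) e by (auto simp: r_def)
  have gclose: "\<bar>g (x + t) - g x\<bar> \<le> d" if "t \<in> ball 0 r" for x t
  proof (cases "x \<in> cball 0 (R + 1) \<or> x + t \<in> cball 0 (R + 1)")
    case True
    then have "norm x \<le> R + 2 \<and> norm (x + t) \<le> R + 2"
      using that r(4) norm_triangle_ineq[of x t] norm_triangle_ineq4[of "x + t" t] by auto
    then have "x \<in> cball 0 (R + 2)" "x + t \<in> cball 0 (R + 2)" by (simp_all only: mem_cball_0)
    moreover have "dist (x + t) x < s" using that r(3) by (simp add: dist_norm)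
    ultimately have "dist (g (x + t)) (g x) < d" by (rule s(2))
    then show ?thesis by (simp add: dist_real_def)
  next
    case False
    then show ?thesis using g0 d(1) by simp
  qed
  have r0: "0 \<le> r" using r by simp
  define w where "w x = v x - g x" for x
  have [measurable]: "w \<in> borel_measurable borel" unfolding w_def by measurable
  have wb: "\<bar>w x\<bar> \<le> 2 * C" for x using bound[of x] gC[of x] by (simp add: w_def)
  have intw: "integrable lborel w"
  proof (rule Bochner_Integration.integrable_bound)
    show "integrable lborel (\<lambda>x. indicator (cball (0::'a) (R + 1)) x *\<^sub>R (2 * C))"
      by (intro borel_integrable_compact) auto
    show "AE x in lborel. norm (w x) \<le> norm (indicator (cball (0::'a) (R + 1)) x *\<^sub>R (2 * C))"
    proof (rule AE_I2)
      fix x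
      show "norm (w x) \<le> norm (indicator (cball (0::'a) (R + 1)) x *\<^sub>R (2 * C))"
      proof (cases "x \<in> cball 0 (R + 1)")
        case True
        then show ?thesis using wb[of x] by simp
      next
        case False
        then have "x \<notin> ball 0 R" by auto
        with False show ?thesis using R[of x] g0[of x] by (simp add: w_def)
      qed
    qed
  qed measurable
  define V where "V x = (LINT t|lborel. v (x + t) * mollifier r t)" for x
  define W where "W x = (LINT t|lborel. \<bar>w (x + t)\<bar> * mollifier r t)" for x
  have wi: "integrable lborel (\<lambda>t. \<bar>w (x + t)\<bar> * mollifier r t)" for x
    using integrable_translate_mollifier[of "\<lambda>x. \<bar>w x\<bar>" r "2 * C" x] wb r0 by simp
  have vi: "integrable lborel (\<lambda>t. v (x + t) * mollifier r t)" for x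
    by (rule integrable_translate_mollifier[OF _ r0 bound]) measurable
  have W0: "0 \<le> W x" for x
    unfolding W_def by (intro Bochner_Integration.integral_nonneg) (simp add: mollifier_nonneg)
  have pt: "\<bar>V x - v x\<bar> \<le> W x + d + \<bar>w x\<bar>" for x
  proof -
    have mi: "integrable lborel (mollifier r :: 'a \<Rightarrow> real)" by (rule integrable_mollifier[OF r0])
    have "V x - v x = (LINT t|lborel. v (x + t) * mollifier r t) - (LINT t|lborel. v x * mollifier r (t::'a))"
      using integral_mollifier[where 'a='a, OF r(1)] by (simp add: V_def)
    also have "\<dots> = (LINT t|lborel. (v (x + t) - v x) * mollifier r t)"
      using vi mi by (subst Bochner_Integration.integral_diff[symmetric]) (auto simp: left_diff_distrib)
    also have "\<bar>\<dots>\<bar> \<le> (LINT t|lborel. \<bar>w (x + t)\<bar> * mollifier r t + (d + \<bar>w x\<bar>) * mollifier r t)"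
    proof (rule order_trans[OF integral_abs_bound integral_mono])
      show "integrable lborel (\<lambda>t. \<bar>(v (x + t) - v x) * mollifier r t\<bar>)"
        using Bochner_Integration.integrable_diff[OF vi[of x] integrable_mult_right[OF mi, of "v x"]]
        by (intro integrable_abs) (simp add: left_diff_distrib)
      show "integrable lborel (\<lambda>t. \<bar>w (x + t)\<bar> * mollifier r t + (d + \<bar>w x\<bar>) * mollifier r t)"
        using wi mi by auto
      fix t
      show "\<bar>(v (x + t) - v x) * mollifier r t\<bar> \<le> \<bar>w (x + t)\<bar> * mollifier r t + (d + \<bar>w x\<bar>) * mollifier r t"
      proof (cases "t \<in> ball 0 r")
        case True
        have "\<bar>v (x + t) - v x\<bar> \<le> \<bar>w (x + t)\<bar> + (d + \<bar>w x\<bar>)"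
          using gclose[OF True, of x] by (simp add: w_def)
        from mult_right_mono[OF this mollifier_nonneg[of r t]] show ?thesis
          by (simp add: abs_mult mollifier_nonneg distrib_right)
      next
        case False
        then show ?thesis by (simp add: mollifier_eq_0[OF r0])
      qed
    qed
    also have "\<dots> = W x + (d + \<bar>w x\<bar>)"
      using wi mi integral_mollifier[where 'a='a, OF r(1)] by (simp add: W_def)
    finally show ?thesis by simp
  qed
  have Wm[measurable]: "W \<in> borel_measurable borel" unfolding W_def by measurable
  have Vm[measurable]: "V \<in> borel_measurable borel" unfolding V_def by measurable
  have W_nn: "(\<integral>\<^sup>+x. ennreal (W x) \<partial>lborel) = ennreal (LINT x|lborel. \<bar>w x\<bar>)"
  proof -
    have "(\<integral>\<^sup>+x. ennreal (W x) \<partial>lborel) = (\<integral>\<^sup>+x. \<integral>\<^sup>+t. ennreal \<bar>w (x + t)\<bar> * ennreal (mollifier r t) \<partial>lborel \<partial>lborel)"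
    proof (rule nn_integral_cong)
      fix x
      have "ennreal (W x) = (\<integral>\<^sup>+t. ennreal (\<bar>w (x + t)\<bar> * mollifier r t) \<partial>lborel)"
        unfolding W_def by (rule nn_integral_eq_integral[symmetric, OF wi]) (simp add: mollifier_nonneg)
      then show "ennreal (W x) = (\<integral>\<^sup>+t. ennreal \<bar>w (x + t)\<bar> * ennreal (mollifier r t) \<partial>lborel)"
        by (simp add: ennreal_mult mollifier_nonneg)
    qed
    also have "\<dots> = (\<integral>\<^sup>+x. ennreal \<bar>w x\<bar> \<partial>lborel)"
      by (rule nn_integral_mollified[OF _ r(1)]) measurable
    also have "\<dots> = ennreal (LINT x|lborel. \<bar>w x\<bar>)"
      using intw by (intro nn_integral_eq_integral) auto
    finally show ?thesis .
  qed
  have Wi: "integrable lborel W"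
    by (rule integrableI_nonneg) (auto simp: W0 W_nn)
  have "(LINT x|lborel. W x) = (LINT x|lborel. \<bar>w x\<bar>)"
    using W_nn Wi W0 by (subst (asm) nn_integral_eq_integral) (auto simp: integral_nonneg_AE)
  then have Wd: "(LINT x|lborel. W x) < d" using close by (simp add: w_def)
  have "(LINT x|lborel. indicator S x * \<bar>V x - v x\<bar>) \<le> (LINT x|lborel. W x + d * indicator S x + \<bar>w x\<bar>)"
  proof (rule integral_mono')
    show "integrable lborel (\<lambda>x. W x + d * indicator S x + \<bar>w x\<bar>)" using Wi intw Sf by auto
    fix x
    show "indicator S x * \<bar>V x - v x\<bar> \<le> W x + d * indicator S x + \<bar>w x\<bar>"
      using pt[of x] W0[of x] by (auto simp: indicator_def)
    show "0 \<le> W x + d * indicator S x + \<bar>w x\<bar>" using W0[of x] d(1) by (auto simp: indicator_def)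
  qed
  also have "\<dots> = (LINT x|lborel. W x) + d * m + (LINT x|lborel. \<bar>w x\<bar>)"
    using Wi intw Sf by (simp add: m_def)
  also have "\<dots> < e" using Wd d close by (simp add: w_def)
  finally show thesis using r that by (simp add: V_def)
qed

locale bounded_open_domain =
  fixes \<Omega> :: "'a::euclidean_space set"
  assumes open_domain: "open \<Omega>" and bounded_domain: "bounded \<Omega>" and nonempty_domain: "\<Omega> \<noteq> {}"

sublocale bounded_open_domain \<subseteq> finite_domain
proof
  show "\<Omega> \<in> sets lebesgue" using open_domain by (intro sets_completionI_sets) (simp add: borel_open)
  show "emeasure lebesgue \<Omega> < \<infinity>"
    using emeasure_bounded_finite[OF bounded_domain] open_domain by simp
  show "emeasure lebesgue \<Omega> \<noteq> 0"
  proof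
    assume "emeasure lebesgue \<Omega> = 0"
    then have "negligible \<Omega>" using open_domain by (auto simp: negligible_iff_emeasure0)
    then show False using open_not_negligible[OF open_domain nonempty_domain] by simp
  qed
qed

context bounded_open_domain
begin

definition mollify :: "real \<Rightarrow> ('a \<Rightarrow> real) \<Rightarrow> 'a \<Rightarrow> real" where
  "mollify r v x = (LINT y|lebesgue_on \<Omega>. v y * mollifier r (y - x))"

lemma domain_sets [simp]: "\<Omega> \<in> sets lebesgue" "\<Omega> \<in> sets borel"
  using open_domain measurable_domain by (auto simp: borel_open)

lemma AE_domain_iff: "(AE x in lebesgue_on \<Omega>. P x) \<longleftrightarrow> (AE x in lborel. x \<in> \<Omega> \<longrightarrow> P x)"
  by (subst AE_restrict_space_iff) (auto simp: AE_completion_iff)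

text \<open>Integration theory of translates takes place in \<open>lborel\<close> on the whole space, so a
  bounded function on \<open>\<Omega>\<close> is extended by zero and made Borel measurable.\<close>

lemma Linf_borel_representative:
  fixes v :: "'a \<Rightarrow> real"
  assumes v: "v \<in> Linf \<Omega>"
  obtains v0 C where "v0 \<in> borel_measurable borel" "\<And>x. \<bar>v0 x\<bar> \<le> C" "\<And>x. x \<notin> \<Omega> \<Longrightarrow> v0 x = 0"
    "AE x in lborel. v0 x = indicator \<Omega> x * v x"
proof -
  obtain C where C: "0 \<le> C" "AE x in lebesgue_on \<Omega>. norm (v x) \<le> C" using v by (rule Linf_boundE)
  have "(\<lambda>x. indicator \<Omega> x *\<^sub>R v x) \<in> borel_measurable lebesgue"
    using Linf_measurable[OF v] by (subst (asm) borel_measurable_restrict_space_iff) auto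
  then obtain g where g: "g \<in> borel_measurable lborel" "AE x in lborel. indicator \<Omega> x *\<^sub>R v x = g x"
    using completion_ex_borel_measurable_real by blast
  have [measurable]: "g \<in> borel_measurable borel" "\<Omega> \<in> sets borel" using g(1) by simp_all
  define v0 where "v0 x = indicator \<Omega> x * max (- C) (min C (g x))" for x
  show thesis
  proof (rule that[of v0 C])
    show "v0 \<in> borel_measurable borel" unfolding v0_def by measurable
    show "\<bar>v0 x\<bar> \<le> C" for x using C(1) by (auto simp: v0_def indicator_def)
    show "v0 x = 0" if "x \<notin> \<Omega>" for x using that by (simp add: v0_def)
    show "AE x in lborel. v0 x = indicator \<Omega> x * v x"
      using g(2) C(2)[unfolded AE_domain_iff]
    proof eventually_elim
      fix x assume "indicator \<Omega> x *\<^sub>R v x = g x" "x \<in> \<Omega> \<longrightarrow> norm (v x) \<le> C"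
      then show "v0 x = indicator \<Omega> x * v x" by (cases "x \<in> \<Omega>") (auto simp: v0_def)
    qed
  qed
qed

text \<open>\<open>L\<^sup>1\<close>-convergence of the mollifications gives almost everywhere convergence along
  a subsequence of radii.\<close>

lemma mollify_tendsto_AE:
  fixes v :: "'a \<Rightarrow> real"
  assumes v: "v \<in> Linf \<Omega>"
  obtains r :: "nat \<Rightarrow> real" where "\<And>n. 0 < r n" "r \<longlonglongrightarrow> 0" "AE x in lebesgue_on \<Omega>. (\<lambda>n. mollify (r n) v x) \<longlonglongrightarrow> v x"
proof -
  obtain v0 C where v0[measurable]: "v0 \<in> borel_measurable borel" and C: "\<And>x. \<bar>v0 x\<bar> \<le> C"
    and out: "\<And>x. x \<notin> \<Omega> \<Longrightarrow> v0 x = 0" and eq: "AE x in lborel. v0 x = indicator \<Omega> x * v x"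
    by (rule Linf_borel_representative[OF v]) (rule that)
  have mol: "mollify r v x = (LINT t|lborel. v0 (x + t) * mollifier r t)" for r x
  proof -
    have "mollify r v x = (LINT y|lebesgue. indicator \<Omega> y *\<^sub>R (v y * mollifier r (y - x)))"
      unfolding mollify_def by (subst integral_restrict_space) auto
    also have "\<dots> = (LINT y|lebesgue. v0 y * mollifier r (y - x))"
    proof (rule integral_cong_AE)
      show 1: "(\<lambda>y. v0 y * mollifier r (y - x)) \<in> borel_measurable lebesgue"
        by (rule measurable_completion) measurable
      show ae: "AE y in lebesgue. indicator \<Omega> y *\<^sub>R (v y * mollifier r (y - x)) = v0 y * mollifier r (y - x)"
        unfolding AE_completion_iff using eq by eventually_elim (simp add: mult.assoc)
      show "(\<lambda>y. indicator \<Omega> y *\<^sub>R (v y * mollifier r (y - x))) \<in> borel_measurable lebesgue"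
      proof (rule borel_measurable_AE[OF 1])
        show "AE y in lebesgue. v0 y * mollifier r (y - x) = indicator \<Omega> y *\<^sub>R (v y * mollifier r (y - x))"
          using ae by eventually_elim (rule sym)
      qed
    qed
    also have "\<dots> = (LINT y|lborel. v0 y * mollifier r (y - x))"
      by (rule integral_completion) measurable
    also have "\<dots> = (LINT t|lborel. v0 (x + t) * mollifier r (x + t - x))"
      by (rule integral_lborel_translate[symmetric]) measurable
    finally show ?thesis by simp
  qed
  obtain R where R: "\<Omega> \<subseteq> ball 0 R" using bounded_subset_ballD[OF bounded_domain] by blast
  have v0R: "v0 x = 0" if "x \<notin> ball 0 R" for x using that R out by blast
  have fin: "emeasure lborel \<Omega> < \<infinity>" using emeasure_bounded_finite[OF bounded_domain] by simp
  have "\<exists>r. 0 < r \<and> r < 1 / Suc n \<and> (LINT x|lborel. indicator \<Omega> x * \<bar>mollify r v x - v0 x\<bar>) < 1 / Suc n" for n :: nat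
  proof -
    have pos: "0 < 1 / real (Suc n)" by simp
    obtain r where "0 < r" "r < 1 / Suc n"
      "(LINT x|lborel. indicator \<Omega> x * \<bar>(LINT t|lborel. v0 (x + t) * mollifier r t) - v0 x\<bar>) < 1 / Suc n"
      by (rule mollified_L1_close[OF v0 C v0R pos domain_sets(2) fin], assumption) (rule that)
    then show ?thesis unfolding mol by blast
  qed
  then obtain r where r: "\<And>n. 0 < r n" "\<And>n. r n < 1 / Suc n"
    and L1: "\<And>n. (LINT x|lborel. indicator \<Omega> x * \<bar>mollify (r n) v x - v0 x\<bar>) < 1 / Suc n" by metis
  have lim0: "(\<lambda>n. 1 / real (Suc n)) \<longlonglongrightarrow> 0"
    using LIMSEQ_inverse_real_of_nat by (simp add: inverse_eq_divide)
  have r0: "r \<longlonglongrightarrow> 0"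
    by (rule tendsto_sandwich[OF _ _ tendsto_const lim0]; intro always_eventually allI less_imp_le r)
  have [measurable]: "mollify s v \<in> borel_measurable borel" for s
    unfolding mol by measurable
  note domain_sets(2)[measurable]
  define u where "u n x = indicator \<Omega> x * (mollify (r n) v x - v0 x)" for n x
  have um[measurable]: "u n \<in> borel_measurable borel" for n unfolding u_def by measurable
  have norm_u: "norm (u n x) = indicator \<Omega> x * \<bar>mollify (r n) v x - v0 x\<bar>" for n x
    by (simp add: u_def abs_mult)
  have ui: "integrable lborel (u n)" for n
  proof (rule Bochner_Integration.integrable_bound)
    show "integrable lborel (\<lambda>x. indicator \<Omega> x * (2 * C))" using fin by (intro integrable_mult_left) auto
    have molC: "\<bar>mollify (r n) v x\<bar> \<le> C" for x
    proof -
      have "\<bar>mollify (r n) v x\<bar> \<le> (LINT t|lborel. C * mollifier (r n) (t::'a))"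
        unfolding mol
      proof (rule order_trans[OF integral_abs_bound integral_mono])
        show "integrable lborel (\<lambda>t. \<bar>v0 (x + t) * mollifier (r n) t\<bar>)"
          using r(1)[of n] by (intro integrable_abs integrable_translate_mollifier[OF v0 _ C]) auto
        show "integrable lborel (\<lambda>t::'a. C * mollifier (r n) t)"
          using r(1)[of n] by (intro integrable_mult_right integrable_mollifier) auto
        fix t
        show "\<bar>v0 (x + t) * mollifier (r n) t\<bar> \<le> C * mollifier (r n) t"
          using mult_right_mono[OF C[of "x + t"] mollifier_nonneg[of "r n" t]] by (simp add: abs_mult mollifier_nonneg)
      qed
      then show ?thesis using integral_mollifier[where 'a='a, OF r(1)] by simp
    qed
    have "\<bar>mollify (r n) v x - v0 x\<bar> \<le> 2 * C" for x
      using molC[of x] C[of x] abs_triangle_ineq4[of "mollify (r n) v x" "v0 x"] by linarith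
    then show "AE x in lborel. norm (u n x) \<le> norm (indicator \<Omega> x * (2 * C))"
      unfolding norm_u by (intro AE_I2) (auto simp: indicator_def intro: order_trans[OF _ abs_ge_self])
  qed measurable
  have "(\<lambda>n. LINT x|lborel. norm (u n x)) \<longlonglongrightarrow> 0"
  proof (rule tendsto_sandwich[OF _ _ tendsto_const lim0])
    show "\<forall>\<^sub>F n in sequentially. (LINT x|lborel. norm (u n x)) \<le> 1 / real (Suc n)"
      unfolding norm_u using L1 by (intro always_eventually allI less_imp_le)
  qed (auto intro!: always_eventually)
  from tendsto_L1_AE_subseq[OF ui this]
  obtain k where k: "strict_mono k" "AE x in lborel. (\<lambda>n. u (k n) x) \<longlonglongrightarrow> 0"
    by (elim exE conjE)
  show thesis
  proof (rule that[of "r \<circ> k"])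
    show "0 < (r \<circ> k) n" for n using r(1) by simp
    show "(r \<circ> k) \<longlonglongrightarrow> 0" by (rule LIMSEQ_subseq_LIMSEQ[OF r0 k(1)])
    show "AE x in lebesgue_on \<Omega>. (\<lambda>n. mollify ((r \<circ> k) n) v x) \<longlonglongrightarrow> v x"
      unfolding AE_domain_iff using k(2) eq
    proof eventually_elim
      fix x assume x: "(\<lambda>n. u (k n) x) \<longlonglongrightarrow> 0" "v0 x = indicator \<Omega> x * v x"
      show "x \<in> \<Omega> \<longrightarrow> (\<lambda>n. mollify ((r \<circ> k) n) v x) \<longlonglongrightarrow> v x"
        using x by (auto simp: u_def intro: LIM_zero_cancel)
    qed
  qed
qed

section \<open>Weak gradients\<close>

text \<open>Lebesgue measure is complete, so changing a function on a null set preserves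
  measurability.\<close>

lemma measurable_AE_cong:
  fixes \<phi> \<psi> :: "'a \<Rightarrow> real"
  assumes m: "\<phi> \<in> borel_measurable (lebesgue_on \<Omega>)" and eq: "AE x in lebesgue_on \<Omega>. \<phi> x = \<psi> x"
  shows "\<psi> \<in> borel_measurable (lebesgue_on \<Omega>)"
proof -
  have "(\<lambda>x. indicator \<Omega> x *\<^sub>R \<phi> x) \<in> borel_measurable lebesgue"
    using m by (subst (asm) borel_measurable_restrict_space_iff) auto
  moreover have "AE x in lebesgue. indicator \<Omega> x *\<^sub>R \<phi> x = indicator \<Omega> x *\<^sub>R \<psi> x"
    using eq by (subst (asm) AE_restrict_space_iff) (auto elim!: eventually_mono simp: indicator_def)
  ultimately have "(\<lambda>x. indicator \<Omega> x *\<^sub>R \<psi> x) \<in> borel_measurable lebesgue" by (rule borel_measurable_AE)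
  then show ?thesis by (subst borel_measurable_restrict_space_iff) auto
qed

lemma integral_AE_cong:
  fixes \<phi> \<psi> :: "'a \<Rightarrow> real"
  assumes "\<phi> \<in> borel_measurable (lebesgue_on \<Omega>)" and "AE x in lebesgue_on \<Omega>. \<phi> x = \<psi> x"
  shows "(LINT x|lebesgue_on \<Omega>. \<phi> x) = (LINT x|lebesgue_on \<Omega>. \<psi> x)"
  by (rule integral_cong_AE[OF assms(1) measurable_AE_cong[OF assms] assms(2)])

lemma continuous_Linf:
  fixes \<psi> :: "'a \<Rightarrow> 'b::euclidean_space"
  assumes "continuous_on UNIV \<psi>"
  shows "\<psi> \<in> Linf \<Omega>"
proof -
  have "compact (\<psi> ` closure \<Omega>)"
    using bounded_domain by (intro compact_continuous_image continuous_on_subset[OF assms]) auto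
  then obtain B where B: "\<And>x. x \<in> closure \<Omega> \<Longrightarrow> norm (\<psi> x) \<le> B"
    by (meson bounded_iff compact_imp_bounded imageI)
  show ?thesis
  proof (rule LinfI[of _ B])
    show "\<psi> \<in> borel_measurable (lebesgue_on \<Omega>)"
      by (intro continuous_imp_measurable_on_sets_lebesgue continuous_on_subset[OF assms]) auto
    show "AE x in lebesgue_on \<Omega>. norm (\<psi> x) \<le> B"
      using B closure_subset by (intro AE_I2) auto
  qed
qed

lemma Linf_integrable:
  fixes y :: "'a \<Rightarrow> 'b::euclidean_space"
  assumes "y \<in> Linf \<Omega>" shows "integrable (lebesgue_on \<Omega>) y"
proof -
  obtain C where "AE x in lebesgue_on \<Omega>. norm (y x) \<le> C" using assms by (auto simp: Linf_iff)
  then show ?thesis using Linf_measurable[OF assms] by (rule integrable_const_bound)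
qed

lemma test_function_Linf:
  assumes "test_function \<Omega> \<psi> \<psi>'"
  shows "\<psi> \<in> Linf \<Omega>" "\<psi>' \<in> Linf \<Omega>"
proof -
  have "continuous_on UNIV \<psi>"
    using assms unfolding test_function_def gderiv_def
    by (intro continuous_at_imp_continuous_on ballI has_derivative_continuous) blast
  then show "\<psi> \<in> Linf \<Omega>" by (rule continuous_Linf)
  show "\<psi>' \<in> Linf \<Omega>" using assms unfolding test_function_def by (intro continuous_Linf) blast
qed

lemma weak_gradient_add:
  assumes "v \<in> Linf \<Omega>" "w \<in> Linf \<Omega>" "G \<in> Linf \<Omega>" "H \<in> Linf \<Omega>"
    and "weak_gradient \<Omega> v G" "weak_gradient \<Omega> w H"
  shows "weak_gradient \<Omega> (\<lambda>x. v x + w x) (\<lambda>x. G x + H x)"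
  unfolding weak_gradient_def
proof (intro allI impI)
  fix \<psi> \<psi>' assume \<psi>: "test_function \<Omega> \<psi> \<psi>'"
  note L = test_function_Linf[OF \<psi>]
  have i: "integrable (lebesgue_on \<Omega>) (\<lambda>x. v x *\<^sub>R \<psi>' x)" "integrable (lebesgue_on \<Omega>) (\<lambda>x. w x *\<^sub>R \<psi>' x)"
    "integrable (lebesgue_on \<Omega>) (\<lambda>x. \<psi> x *\<^sub>R G x)" "integrable (lebesgue_on \<Omega>) (\<lambda>x. \<psi> x *\<^sub>R H x)"
    by (intro Linf_integrable Linf_mult L assms)+
  show "(LINT x|lebesgue_on \<Omega>. (v x + w x) *\<^sub>R \<psi>' x) = - (LINT x|lebesgue_on \<Omega>. \<psi> x *\<^sub>R (G x + H x))"
    using assms(5,6) \<psi> unfolding weak_gradient_def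
    by (simp add: scaleR_add_left scaleR_add_right Bochner_Integration.integral_add[OF i(1,2)]
        Bochner_Integration.integral_add[OF i(3,4)])
qed

lemma weak_gradient_scaleR:
  assumes "weak_gradient \<Omega> v G"
  shows "weak_gradient \<Omega> (\<lambda>x. c * v x) (\<lambda>x. c *\<^sub>R G x)"
  unfolding weak_gradient_def
proof (intro allI impI)
  fix \<psi> \<psi>' assume \<psi>: "test_function \<Omega> \<psi> \<psi>'"
  have "(LINT x|lebesgue_on \<Omega>. (c * v x) *\<^sub>R \<psi>' x) = c *\<^sub>R (LINT x|lebesgue_on \<Omega>. v x *\<^sub>R \<psi>' x)"
    by (simp flip: scaleR_scaleR)
  moreover have "(LINT x|lebesgue_on \<Omega>. \<psi> x *\<^sub>R c *\<^sub>R G x) = c *\<^sub>R (LINT x|lebesgue_on \<Omega>. \<psi> x *\<^sub>R G x)"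
  proof -
    have "(\<lambda>x. \<psi> x *\<^sub>R c *\<^sub>R G x) = (\<lambda>x. c *\<^sub>R (\<psi> x *\<^sub>R G x))" by (simp add: fun_eq_iff mult.commute)
    then show ?thesis by (simp only: Bochner_Integration.integral_scaleR_right)
  qed
  ultimately show "(LINT x|lebesgue_on \<Omega>. (c * v x) *\<^sub>R \<psi>' x) = - (LINT x|lebesgue_on \<Omega>. \<psi> x *\<^sub>R c *\<^sub>R G x)"
    using assms \<psi> unfolding weak_gradient_def by simp
qed

text \<open>Mollifiers are test functions, so all mollifications with small radius vanish at a
  given point; they converge to \<open>v\<close> almost everywhere.\<close>

lemma fundamental_lemma:
  fixes v :: "'a \<Rightarrow> real"
  assumes v: "v \<in> Linf \<Omega>"
    and 0: "\<And>\<psi> \<psi>'. test_function \<Omega> \<psi> \<psi>' \<Longrightarrow> (LINT x|lebesgue_on \<Omega>. v x * \<psi> x) = 0"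
  shows "AE x in lebesgue_on \<Omega>. v x = 0"
proof -
  obtain r :: "nat \<Rightarrow> real" where r: "\<And>n. 0 < r n" "r \<longlonglongrightarrow> 0"
    and lim: "AE x in lebesgue_on \<Omega>. (\<lambda>n. mollify (r n) v x) \<longlonglongrightarrow> v x"
    by (rule mollify_tendsto_AE[OF v]) (rule that)
  show ?thesis
    using lim AE_space
  proof eventually_elim
    fix x assume lim: "(\<lambda>n. mollify (r n) v x) \<longlonglongrightarrow> v x" and "x \<in> space (lebesgue_on \<Omega>)"
    then have "x \<in> \<Omega>" by simp
    then obtain e where e: "0 < e" "cball x e \<subseteq> \<Omega>" using open_domain open_contains_cball by blast
    have "\<forall>\<^sub>F n in sequentially. r n < e" using r(2) e(1) by (rule order_tendstoD(2))
    then have "\<forall>\<^sub>F n in sequentially. mollify (r n) v x = 0"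
    proof eventually_elim
      fix n assume "r n < e"
      then have "cball x (r n) \<subseteq> \<Omega>" using e(2) by auto
      from 0[OF test_function_mollifier[OF r(1) this]] show "mollify (r n) v x = 0"
        by (simp add: mollify_def)
    qed
    then have "(\<lambda>n. mollify (r n) v x) \<longlonglongrightarrow> 0" by (rule tendsto_eventually)
    with lim show "v x = 0" by (rule LIMSEQ_unique)
  qed
qed

lemma weak_gradient_unique:
  assumes G: "G \<in> Linf \<Omega>" "weak_gradient \<Omega> v G" and H: "H \<in> Linf \<Omega>" "weak_gradient \<Omega> v H"
  shows "AE x in lebesgue_on \<Omega>. G x = H x"
proof -
  have "AE x in lebesgue_on \<Omega>. (G x - H x) \<bullet> b = 0" if b: "b \<in> Basis" for b
  proof (rule fundamental_lemma)
    have L: "(\<lambda>x. G x - H x) \<in> Linf \<Omega>" by (rule Linf_diff[OF G(1) H(1)])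
    then obtain C where C: "AE x in lebesgue_on \<Omega>. norm (G x - H x) \<le> C" by (auto simp: Linf_iff)
    show "(\<lambda>x. (G x - H x) \<bullet> b) \<in> Linf \<Omega>"
    proof (rule LinfI[of _ C])
      show "(\<lambda>x. (G x - H x) \<bullet> b) \<in> borel_measurable (lebesgue_on \<Omega>)"
        by (rule borel_measurable_inner[OF Linf_measurable[OF L]]) simp
      show "AE x in lebesgue_on \<Omega>. norm ((G x - H x) \<bullet> b) \<le> C"
        using C by eventually_elim (use Basis_le_norm[OF b] order_trans in \<open>auto\<close>)
    qed
    fix \<psi> \<psi>' assume \<psi>: "test_function \<Omega> \<psi> \<psi>'"
    have i: "integrable (lebesgue_on \<Omega>) (\<lambda>x. \<psi> x *\<^sub>R G x)" "integrable (lebesgue_on \<Omega>) (\<lambda>x. \<psi> x *\<^sub>R H x)"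
      by (intro Linf_integrable Linf_mult test_function_Linf[OF \<psi>] G H)+
    have "- (LINT x|lebesgue_on \<Omega>. \<psi> x *\<^sub>R G x) = - (LINT x|lebesgue_on \<Omega>. \<psi> x *\<^sub>R H x)"
      by (rule trans[OF G(2)[unfolded weak_gradient_def, rule_format, OF \<psi>, symmetric] H(2)[unfolded weak_gradient_def, rule_format, OF \<psi>]])
    then have "(LINT x|lebesgue_on \<Omega>. \<psi> x *\<^sub>R G x - \<psi> x *\<^sub>R H x) = 0"
      by (simp add: Bochner_Integration.integral_diff[OF i])
    then have "(LINT x|lebesgue_on \<Omega>. (\<psi> x *\<^sub>R G x - \<psi> x *\<^sub>R H x) \<bullet> b) = 0"
      by (subst integral_inner_left) (auto intro: Bochner_Integration.integrable_diff i)
    then show "(LINT x|lebesgue_on \<Omega>. (G x - H x) \<bullet> b * \<psi> x) = 0"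
      by (simp add: inner_diff_left algebra_simps)
  qed
  then have "AE x in lebesgue_on \<Omega>. \<forall>b\<in>Basis. (G x - H x) \<bullet> b = 0"
    by (subst AE_ball_countable) (auto intro: countable_finite)
  then show ?thesis
  proof eventually_elim
    fix x assume eq: "\<forall>b\<in>Basis. (G x - H x) \<bullet> b = 0"
    show "G x = H x" by (rule euclidean_eqI) (use eq in \<open>simp add: inner_diff_left\<close>)
  qed
qed

text \<open>Differentiation under the integral: the difference quotients of the mollifier
  along a line are bounded by the supremum of its gradient.\<close>

lemma mollify_has_derivative:
  fixes v :: "'a \<Rightarrow> real"
  assumes v: "v \<in> Linf \<Omega>" and r: "0 < r"
  shows "((\<lambda>t. mollify r v (x + t *\<^sub>R h)) has_real_derivative
    (LINT y|lebesgue_on \<Omega>. v y * - (mollifier_grad r (y - (x + t *\<^sub>R h)) \<bullet> h))) (at t)"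
proof -
  obtain C where C: "0 \<le> C" "AE y in lebesgue_on \<Omega>. norm (v y) \<le> C" using v by (rule Linf_boundE)
  obtain B where B: "0 \<le> B" "\<And>z::'a. norm (mollifier_grad r z) \<le> B"
    using mollifier_grad_bounded[of r] r by (metis less_imp_le)
  define e where "e y s = mollifier r (y - (x + s *\<^sub>R h))" for y s
  define d where "d y s = - (mollifier_grad r (y - (x + s *\<^sub>R h)) \<bullet> h)" for y s
  have der: "(e y has_real_derivative d y s) (at s)" for y s
  proof -
    have "((\<lambda>s. y - (x + s *\<^sub>R h)) has_derivative (\<lambda>k. - (k *\<^sub>R h))) (at s)"
      by (auto intro!: derivative_eq_intros)
    from has_derivative_compose[OF this GDERIV_mollifier[unfolded gderiv_def]]
    have "(e y has_derivative (\<lambda>k. - (k *\<^sub>R h) \<bullet> mollifier_grad r (y - (x + s *\<^sub>R h)))) (at s)"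
      unfolding e_def .
    then show ?thesis
      by (rule has_derivative_imp_has_field_derivative) (simp add: d_def inner_commute)
  qed
  have dB: "\<bar>d y s\<bar> \<le> B * norm h" for y s
  proof -
    have "\<bar>mollifier_grad r (y - (x + s *\<^sub>R h)) \<bullet> h\<bar> \<le> norm (mollifier_grad r (y - (x + s *\<^sub>R h))) * norm h"
      by (rule Cauchy_Schwarz_ineq2)
    also have "\<dots> \<le> B * norm h" by (intro mult_right_mono B) simp
    finally show ?thesis by (simp add: d_def)
  qed
  have lip: "\<bar>e y s - e y s'\<bar> \<le> B * norm h * \<bar>s - s'\<bar>" for y s s'
    using field_differentiable_bound[of UNIV "e y" "d y" "B * norm h" s s'] der dB by simp
  have eL: "(\<lambda>y. v y * e y s) \<in> Linf \<Omega>" for s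
  proof -
    have "(\<lambda>y. e y s) \<in> Linf \<Omega>" unfolding e_def by (intro continuous_Linf continuous_intros)
    from Linf_mult[OF v this] show ?thesis by simp
  qed
  have dm: "(\<lambda>y. v y * d y s) \<in> borel_measurable (lebesgue_on \<Omega>)" for s
  proof -
    have "(\<lambda>y. d y s) \<in> Linf \<Omega>" unfolding d_def by (intro continuous_Linf continuous_intros)
    from Linf_mult[OF v this] show ?thesis using Linf_measurable by simp
  qed
  have "((\<lambda>s. (mollify r v (x + s *\<^sub>R h) - mollify r v (x + t *\<^sub>R h)) / (s - t)) \<longlongrightarrow>
      (LINT y|lebesgue_on \<Omega>. v y * d y t)) (at t)"
    unfolding tendsto_at_iff_sequentially
  proof (intro allI impI)
    fix X assume X: "\<forall>i. X i \<in> UNIV - {t}" "X \<longlonglongrightarrow> t"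
    have "(\<lambda>i. LINT y|lebesgue_on \<Omega>. (v y * e y (X i) - v y * e y t) / (X i - t)) \<longlonglongrightarrow> (LINT y|lebesgue_on \<Omega>. v y * d y t)"
    proof (rule integral_dominated_convergence[where w="\<lambda>y. C * (B * norm h)"])
      show "(\<lambda>y. (v y * e y (X i) - v y * e y t) / (X i - t)) \<in> borel_measurable (lebesgue_on \<Omega>)" for i
        using eL[THEN Linf_measurable] by (intro borel_measurable_divide borel_measurable_diff) auto
      show "AE y in lebesgue_on \<Omega>. (\<lambda>i. (v y * e y (X i) - v y * e y t) / (X i - t)) \<longlonglongrightarrow> v y * d y t"
      proof (rule AE_I2)
        fix y
        have "((\<lambda>s. (e y s - e y t) / (s - t)) \<longlongrightarrow> d y t) (at t)"
          using der[of y t] by (simp add: has_field_derivative_iff)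
        then have "(\<lambda>i. (e y (X i) - e y t) / (X i - t)) \<longlonglongrightarrow> d y t"
          using X unfolding tendsto_at_iff_sequentially comp_def by blast
        from tendsto_mult_left[OF this, of "v y"]
        show "(\<lambda>i. (v y * e y (X i) - v y * e y t) / (X i - t)) \<longlonglongrightarrow> v y * d y t"
          by (simp add: right_diff_distrib)
      qed
      show "AE y in lebesgue_on \<Omega>. norm ((v y * e y (X i) - v y * e y t) / (X i - t)) \<le> C * (B * norm h)" for i
        using C(2)
      proof eventually_elim
        fix y assume y: "norm (v y) \<le> C"
        have "norm ((v y * e y (X i) - v y * e y t) / (X i - t)) = \<bar>v y\<bar> * (\<bar>e y (X i) - e y t\<bar> / \<bar>X i - t\<bar>)"
          by (simp add: right_diff_distrib[symmetric] abs_mult)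
        also have "\<dots> \<le> C * (B * norm h)"
          using y C(1) X(1) lip[of y "X i" t] by (intro mult_mono) (auto simp: pos_divide_le_eq)
        finally show "norm ((v y * e y (X i) - v y * e y t) / (X i - t)) \<le> C * (B * norm h)" .
      qed
    qed (auto simp: dm)
    moreover have "(LINT y|lebesgue_on \<Omega>. (v y * e y (X i) - v y * e y t) / (X i - t)) =
        (mollify r v (x + X i *\<^sub>R h) - mollify r v (x + t *\<^sub>R h)) / (X i - t)" for i
      using Linf_integrable[OF eL[of "X i"]] Linf_integrable[OF eL[of t]]
      by (simp add: mollify_def e_def)
    ultimately show "((\<lambda>s. (mollify r v (x + s *\<^sub>R h) - mollify r v (x + t *\<^sub>R h)) / (s - t)) \<circ> X) \<longlonglongrightarrow>
        (LINT y|lebesgue_on \<Omega>. v y * d y t)"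
      by (simp only: comp_def)
  qed
  then show ?thesis by (simp add: has_field_derivative_iff d_def)
qed

lemma integral_domain_mollifier_le:
  assumes r: "0 < r"
  shows "(LINT y|lebesgue_on \<Omega>. mollifier r (y - a)) \<le> 1"
proof -
  note domain_sets(2)[measurable]
  have m[measurable]: "(\<lambda>y. mollifier r (y - a)) \<in> borel_measurable borel" by measurable
  have t: "(LINT y|lborel. mollifier r (y - a)) = 1"
    using integral_lborel_translate[OF m, of a] integral_mollifier[where 'a='a, OF r] by simp
  have i: "integrable lborel (\<lambda>y. mollifier r (y - a))"
  proof (rule ccontr)
    assume "\<not> integrable lborel (\<lambda>y. mollifier r (y - a))"
    from not_integrable_integral_eq[OF this] t show False by simp
  qed
  have "(LINT y|lebesgue_on \<Omega>. mollifier r (y - a)) = (LINT y|lebesgue. indicator \<Omega> y *\<^sub>R mollifier r (y - a))"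
    by (subst integral_restrict_space) auto
  also have "\<dots> = (LINT y|lborel. indicator \<Omega> y *\<^sub>R mollifier r (y - a))"
    by (intro integral_completion) measurable
  also have "\<dots> \<le> (LINT y|lborel. mollifier r (y - a))"
    using i by (intro integral_mono') (auto simp: indicator_def mollifier_nonneg)
  finally show ?thesis using t by simp
qed

text \<open>Along a segment that keeps distance \<open>r\<close> from the boundary the derivative of the
  mollification is the mollification of the weak gradient, and averaging does not increase
  the bound \<open>B\<close>.\<close>

lemma mollify_lipschitz:
  assumes v: "v \<in> Linf \<Omega>" and G: "G \<in> Linf \<Omega>" "weak_gradient \<Omega> v G"
    and B: "AE x in lebesgue_on \<Omega>. norm (G x) \<le> B" and r: "0 < r"
    and seg: "\<And>t. 0 \<le> t \<Longrightarrow> t \<le> 1 \<Longrightarrow> cball (x + t *\<^sub>R h) r \<subseteq> \<Omega>"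
  shows "\<bar>mollify r v (x + h) - mollify r v x\<bar> \<le> B * norm h"
proof -
  define D where "D t = (LINT y|lebesgue_on \<Omega>. v y * - (mollifier_grad r (y - (x + t *\<^sub>R h)) \<bullet> h))" for t
  have B0: "0 \<le> B" by (rule AE_bound_nonneg[OF B])
  have "\<bar>D t\<bar> \<le> B * norm h" if t: "t \<in> {0..1}" for t
  proof -
    define a where "a = x + t *\<^sub>R h"
    have tf: "test_function \<Omega> (\<lambda>y. mollifier r (y - a)) (\<lambda>y. mollifier_grad r (y - a))"
      using seg[of t] t unfolding a_def by (intro test_function_mollifier r) simp
    note L = test_function_Linf[OF tf]
    have "D t = - (LINT y|lebesgue_on \<Omega>. (v y *\<^sub>R mollifier_grad r (y - a)) \<bullet> h)"
      by (simp add: D_def a_def)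
    also have "\<dots> = - ((LINT y|lebesgue_on \<Omega>. v y *\<^sub>R mollifier_grad r (y - a)) \<bullet> h)"
      by (subst integral_inner_left) (auto intro!: Linf_integrable Linf_mult v L)
    also have "\<dots> = (LINT y|lebesgue_on \<Omega>. mollifier r (y - a) *\<^sub>R G y) \<bullet> h"
      using G(2) tf unfolding weak_gradient_def by simp
    also have "\<dots> = (LINT y|lebesgue_on \<Omega>. (mollifier r (y - a) *\<^sub>R G y) \<bullet> h)"
      by (subst integral_inner_left) (auto intro!: Linf_integrable Linf_mult G L)
    also have "\<bar>\<dots>\<bar> \<le> (LINT y|lebesgue_on \<Omega>. mollifier r (y - a) * (B * norm h))"
    proof (rule order_trans[OF integral_abs_bound integral_mono_AE])
      have "integrable (lebesgue_on \<Omega>) (\<lambda>y. (mollifier r (y - a) *\<^sub>R G y) \<bullet> h)"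
        by (intro integrable_inner_left Linf_integrable Linf_mult G L)
      then show "integrable (lebesgue_on \<Omega>) (\<lambda>y. \<bar>(mollifier r (y - a) *\<^sub>R G y) \<bullet> h\<bar>)" by (rule integrable_abs)
      show "integrable (lebesgue_on \<Omega>) (\<lambda>y. mollifier r (y - a) * (B * norm h))"
        by (intro integrable_mult_left Linf_integrable L)
      show "AE y in lebesgue_on \<Omega>. \<bar>(mollifier r (y - a) *\<^sub>R G y) \<bullet> h\<bar> \<le> mollifier r (y - a) * (B * norm h)"
        using B
      proof eventually_elim
        fix y assume "norm (G y) \<le> B"
        then have "\<bar>G y \<bullet> h\<bar> \<le> B * norm h"
          by (meson Cauchy_Schwarz_ineq2 mult_right_mono norm_ge_zero order_trans)
        then show "\<bar>(mollifier r (y - a) *\<^sub>R G y) \<bullet> h\<bar> \<le> mollifier r (y - a) * (B * norm h)"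
          by (simp add: abs_mult mollifier_nonneg mult_left_mono)
      qed
    qed
    also have "\<dots> = (LINT y|lebesgue_on \<Omega>. mollifier r (y - a)) * (B * norm h)" by simp
    also have "\<dots> \<le> 1 * (B * norm h)"
      using B0 by (intro mult_right_mono integral_domain_mollifier_le r) auto
    finally show ?thesis by simp
  qed
  moreover have "((\<lambda>t. mollify r v (x + t *\<^sub>R h)) has_real_derivative D t) (at t within {0..1})" for t
    unfolding D_def using mollify_has_derivative[OF v r] by (rule has_field_derivative_at_within)
  ultimately have "norm (mollify r v (x + 1 *\<^sub>R h) - mollify r v (x + 0 *\<^sub>R h)) \<le> B * norm h * norm (1 - 0 :: real)"
    by (intro field_differentiable_bound[where S="{0..1}" and f'=D]) auto
  then show ?thesis by simp
qed

end

section \<open>Continuous representatives on Lipschitz domains\<close>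

text \<open>In a chart the domain lies above the graph of a Lipschitz function. Two points are
  lifted to the common height \<open>T\<close> and joined horizontally there; since \<open>T\<close> exceeds both
  heights by \<open>L\<close> times the horizontal distance, the horizontal segment stays above the
  graph.\<close>

lemma Lipschitz_epigraph_chain:
  fixes p e :: "'a::euclidean_space"
  assumes e: "norm e = 1" and r: "0 < r" and h: "0 < h" and \<gamma>: "L-lipschitz_on {y. y \<bullet> e = 0} \<gamma>"
    and chart: "\<And>y t. y \<bullet> e = 0 \<Longrightarrow> norm y < r \<Longrightarrow> \<bar>t\<bar> < h \<Longrightarrow> p + y + t *\<^sub>R e \<in> \<Omega> \<longleftrightarrow> \<gamma> y < (t::real)"
  shows "\<exists>\<epsilon>>0. \<forall>x\<in>\<Omega> \<inter> ball p \<epsilon>. \<forall>y\<in>\<Omega> \<inter> ball p \<epsilon>. \<exists>b c.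
    closed_segment x b \<subseteq> \<Omega> \<and> closed_segment b c \<subseteq> \<Omega> \<and> closed_segment c y \<subseteq> \<Omega> \<and>
    dist x b + dist b c + dist c y \<le> (4 + 4 * L) * dist x y"
proof -
  have L: "0 \<le> L" using \<gamma> by (rule lipschitz_on_nonneg)
  have ee: "e \<bullet> e = 1" using e by (simp add: dot_square_norm)
  \<comment> \<open>Both bounds keep the path inside the chart: horizontal parts are below \<open>2 * \<epsilon>\<close>,
    and the lifted height \<open>T\<close> is at most \<open>\<epsilon> + L * (4 * \<epsilon>)\<close>.\<close>
  define \<epsilon> where "\<epsilon> = min (r / 2) (h / (1 + 4 * L))"
  have \<epsilon>: "0 < \<epsilon>" "2 * \<epsilon> \<le> r" "\<epsilon> * (1 + 4 * L) \<le> h"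
  proof -
    have "0 < h / (1 + 4 * L)" using h L by (intro divide_pos_pos) auto
    then show "0 < \<epsilon>" using r by (simp add: \<epsilon>_def)
    show "2 * \<epsilon> \<le> r" by (simp add: \<epsilon>_def)
    have "\<epsilon> \<le> h / (1 + 4 * L)" by (simp add: \<epsilon>_def)
    then show "\<epsilon> * (1 + 4 * L) \<le> h" using L by (subst (asm) pos_le_divide_eq) auto
  qed
  define t where "t x = (x - p) \<bullet> e" for x
  define q where "q x = (x - p) - t x *\<^sub>R e" for x
  have rep: "x = p + q x + t x *\<^sub>R e" for x by (simp add: q_def)
  have qe: "q x \<bullet> e = 0" for x by (simp add: q_def t_def inner_diff_left ee)
  have td: "\<bar>t x - t y\<bar> \<le> dist x y" for x y
  proof -
    have "t x - t y = (x - y) \<bullet> e" by (simp add: t_def inner_diff_left)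
    then show ?thesis using Cauchy_Schwarz_ineq2[of "x - y" e] e by (simp add: dist_norm)
  qed
  have qd: "norm (q x - q y) \<le> 2 * dist x y" for x y
  proof -
    have "q x - q y = (x - y) - (t x - t y) *\<^sub>R e" by (simp add: q_def algebra_simps)
    then have "norm (q x - q y) \<le> norm (x - y) + norm ((t x - t y) *\<^sub>R e)"
      by (metis norm_triangle_ineq4)
    also have "norm ((t x - t y) *\<^sub>R e) \<le> dist x y" using td[of x y] e by simp
    finally show ?thesis by (simp add: dist_norm)
  qed
  have tp: "t p = 0" "q p = 0" by (simp_all add: t_def q_def)
  have near: "\<bar>t x\<bar> < \<epsilon>" "norm (q x) < 2 * \<epsilon>" if "x \<in> ball p \<epsilon>" for x
    using that td[of x p] qd[of x p] tp by (auto simp: dist_commute)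
  have "\<exists>b c. closed_segment x b \<subseteq> \<Omega> \<and> closed_segment b c \<subseteq> \<Omega> \<and> closed_segment c y \<subseteq> \<Omega> \<and>
      dist x b + dist b c + dist c y \<le> (4 + 4 * L) * dist x y"
    if xy: "x \<in> \<Omega> \<inter> ball p \<epsilon>" "y \<in> \<Omega> \<inter> ball p \<epsilon>" for x y
  proof -
    define \<delta> where "\<delta> = norm (q x - q y)"
    define T where "T = max (t x) (t y) + L * \<delta>"
    have \<delta>: "0 \<le> \<delta>" "\<delta> \<le> 2 * dist x y" "\<delta> \<le> 4 * \<epsilon>"
      using qd[of x y] near(2)[of x] near(2)[of y] xy norm_triangle_ineq4[of "q x" "q y"] by (auto simp: \<delta>_def)
    have L\<delta>: "0 \<le> L * \<delta>" "L * \<delta> \<le> L * (2 * dist x y)" "L * \<delta> \<le> L * (4 * \<epsilon>)"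
      using \<delta> L by (auto intro: mult_left_mono)
    have T: "t x \<le> T" "t y \<le> T" "T < h" "- h < t x" "- h < t y"
    proof -
      show "t x \<le> T" "t y \<le> T" using L\<delta>(1) by (auto simp: T_def)
      have "max (t x) (t y) < \<epsilon>" using near(1)[of x] near(1)[of y] xy by auto
      moreover have "\<epsilon> * (1 + 4 * L) = \<epsilon> + L * (4 * \<epsilon>)" by (simp add: algebra_simps)
      ultimately show "T < h" using L\<delta>(3) \<epsilon>(3) unfolding T_def by linarith
      have "\<epsilon> * 1 \<le> \<epsilon> * (1 + 4 * L)" using \<epsilon>(1) L by (intro mult_left_mono) auto
      then show "- h < t x" "- h < t y" using near(1)[of x] near(1)[of y] xy \<epsilon>(3) by auto
    qed
    have vert: "closed_segment z (p + q z + T *\<^sub>R e) \<subseteq> \<Omega>"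
      if z: "z \<in> \<Omega>" "z \<in> ball p \<epsilon>" "t z \<le> T" "- h < t z" for z
    proof
      fix w assume "w \<in> closed_segment z (p + q z + T *\<^sub>R e)"
      then obtain u where u: "0 \<le> u" "u \<le> 1" "w = (1 - u) *\<^sub>R z + u *\<^sub>R (p + q z + T *\<^sub>R e)"
        by (auto simp: in_segment)
      define s where "s = (1 - u) * t z + u * T"
      have w: "w = p + q z + s *\<^sub>R e"
        unfolding u(3) s_def by (subst (1) rep[of z]) (simp add: algebra_simps)
      have "u * t z \<le> u * T" using u z(3) by (intro mult_left_mono)
      moreover have "(1 - u) * t z \<le> (1 - u) * T" using u z(3) by (intro mult_left_mono) auto
      ultimately have s: "t z \<le> s" "s \<le> T" by (auto simp: s_def algebra_simps)
      have qr: "norm (q z) < r" using near(2)[OF z(2)] \<epsilon>(2) by simp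
      have "\<bar>t z\<bar> < h" using s z(4) T(3) by auto
      moreover have "p + q z + t z *\<^sub>R e \<in> \<Omega>" by (subst rep[of z, symmetric]) (rule z(1))
      ultimately have "\<gamma> (q z) < t z" using chart[OF qe qr] by blast
      then have "\<gamma> (q z) < s" using s by simp
      moreover have "\<bar>s\<bar> < h" using s z(4) T(3) by auto
      ultimately show "w \<in> \<Omega>" unfolding w using chart[OF qe qr] by blast
    qed
    have horiz: "closed_segment (p + q x + T *\<^sub>R e) (p + q y + T *\<^sub>R e) \<subseteq> \<Omega>"
    proof
      fix w assume "w \<in> closed_segment (p + q x + T *\<^sub>R e) (p + q y + T *\<^sub>R e)"
      then obtain u where u: "0 \<le> u" "u \<le> 1" "w = (1 - u) *\<^sub>R (p + q x + T *\<^sub>R e) + u *\<^sub>R (p + q y + T *\<^sub>R e)"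
        by (auto simp: in_segment)
      define z where "z = (1 - u) *\<^sub>R q x + u *\<^sub>R q y"
      have w: "w = p + z + T *\<^sub>R e" unfolding u(3) z_def by (simp add: algebra_simps)
      have ze: "z \<bullet> e = 0" by (simp add: z_def inner_add_left qe)
      have "q x \<in> ball 0 r" "q y \<in> ball 0 r" using near(2)[of x] near(2)[of y] xy \<epsilon>(2) by auto
      then have "z \<in> ball 0 r" unfolding z_def using u by (intro convexD[OF convex_ball]) auto
      then have zr: "norm z < r" by simp
      have "\<bar>t x\<bar> < h" using T by auto
      moreover have "norm (q x) < r" using near(2)[of x] xy \<epsilon>(2) by auto
      moreover have "p + q x + t x *\<^sub>R e \<in> \<Omega>" by (subst rep[of x, symmetric]) (use xy in blast)
      ultimately have "\<gamma> (q x) < t x" using chart[OF qe] by blast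
      moreover have "\<bar>\<gamma> z - \<gamma> (q x)\<bar> \<le> L * \<delta>"
      proof -
        have "z - q x = u *\<^sub>R (q y - q x)" by (simp add: z_def algebra_simps)
        then have "norm (z - q x) \<le> 1 * \<delta>"
          using u by (simp add: \<delta>_def norm_minus_commute mult_left_le_one_le)
        then have "L * norm (z - q x) \<le> L * \<delta>" using L by (intro mult_left_mono) auto
        moreover have "dist (\<gamma> z) (\<gamma> (q x)) \<le> L * dist z (q x)"
          using \<gamma> ze qe by (intro lipschitz_onD) auto
        ultimately show ?thesis by (simp add: dist_norm)
      qed
      ultimately have "\<gamma> z < T" unfolding T_def by auto
      moreover have "\<bar>T\<bar> < h" using T by auto
      ultimately show "w \<in> \<Omega>" unfolding w using chart[OF ze zr] by blast
    qed
    define b c where "b = p + q x + T *\<^sub>R e" and "c = p + q y + T *\<^sub>R e"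
    have "dist x b = T - t x"
    proof -
      have "b - x = (T - t x) *\<^sub>R e" unfolding b_def by (subst (2) rep[of x]) (simp add: algebra_simps)
      then show ?thesis using T(1) e by (simp add: dist_commute dist_norm)
    qed
    moreover have "dist c y = T - t y"
    proof -
      have "c - y = (T - t y) *\<^sub>R e" unfolding c_def by (subst (2) rep[of y]) (simp add: algebra_simps)
      then show ?thesis using T(2) e by (simp add: dist_norm)
    qed
    moreover have "dist b c = \<delta>" by (simp add: b_def c_def dist_norm \<delta>_def)
    moreover have "T - t x \<le> dist x y + L * (2 * dist x y)" "T - t y \<le> dist x y + L * (2 * dist x y)"
      using td[of x y] L\<delta>(2) unfolding T_def by auto
    ultimately have "dist x b + dist b c + dist c y \<le> (4 + 4 * L) * dist x y"
      using \<delta>(2) by (simp add: algebra_simps)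
    moreover have "closed_segment x b \<subseteq> \<Omega>" "closed_segment c y \<subseteq> \<Omega>"
      using vert[of x] vert[of y] xy T by (auto simp: b_def c_def closed_segment_commute)
    ultimately show ?thesis using horiz unfolding b_def c_def by blast
  qed
  with \<epsilon>(1) show ?thesis by blast
qed

text \<open>Interior points have convex neighbourhoods inside the domain; boundary points have
  charts.\<close>

lemma Lipschitz_domain_chain:
  fixes \<Omega> :: "'a::euclidean_space set"
  assumes \<Omega>: "lipschitz_domain \<Omega>" and p: "p \<in> closure \<Omega>"
  shows "\<exists>\<epsilon>>0. \<exists>K\<ge>0. \<forall>x\<in>\<Omega> \<inter> ball p \<epsilon>. \<forall>y\<in>\<Omega> \<inter> ball p \<epsilon>. \<exists>b c.
    closed_segment x b \<subseteq> \<Omega> \<and> closed_segment b c \<subseteq> \<Omega> \<and> closed_segment c y \<subseteq> \<Omega> \<and>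
    dist x b + dist b c + dist c y \<le> K * dist x y"
proof -
  have "open \<Omega>" using \<Omega> unfolding lipschitz_domain_def by (elim conjE)
  show ?thesis
  proof (cases "p \<in> \<Omega>")
    case True
    then obtain \<epsilon> where \<epsilon>: "0 < \<epsilon>" "ball p \<epsilon> \<subseteq> \<Omega>"
      using \<open>open \<Omega>\<close> open_contains_ball by blast
    show ?thesis
    proof (rule exI[of _ \<epsilon>], rule conjI[OF \<epsilon>(1)], rule exI[of _ "1::real"], intro conjI ballI zero_le_one)
      fix x y assume "x \<in> \<Omega> \<inter> ball p \<epsilon>" "y \<in> \<Omega> \<inter> ball p \<epsilon>"
      then have "closed_segment x y \<subseteq> \<Omega>" "closed_segment y y \<subseteq> \<Omega>"
        using \<epsilon>(2) closed_segment_subset[of x "ball p \<epsilon>" y] by auto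
      then show "\<exists>b c. closed_segment x b \<subseteq> \<Omega> \<and> closed_segment b c \<subseteq> \<Omega> \<and> closed_segment c y \<subseteq> \<Omega> \<and>
          dist x b + dist b c + dist c y \<le> 1 * dist x y"
        by (intro exI[of _ y] conjI) auto
    qed
  next
    case False
    with \<open>open \<Omega>\<close> have "p \<in> frontier \<Omega>" using p False by (simp add: frontier_def interior_open)
    have "\<forall>p\<in>frontier \<Omega>. \<exists>e r h L \<gamma>. norm e = 1 \<and> 0 < r \<and> 0 < h \<and> L-lipschitz_on {y. y \<bullet> e = 0} \<gamma> \<and>
        (\<forall>y t. y \<bullet> e = 0 \<and> norm y < r \<and> \<bar>t\<bar> < h \<longrightarrow> (p + y + t *\<^sub>R e \<in> \<Omega> \<longleftrightarrow> \<gamma> y < (t::real)))"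
      using \<Omega> unfolding lipschitz_domain_def by (elim conjE)
    from bspec[OF this \<open>p \<in> frontier \<Omega>\<close>]
    obtain e r h L \<gamma> where c: "norm e = 1" "0 < r" "0 < h" "L-lipschitz_on {y. y \<bullet> e = 0} \<gamma>"
      and ch: "\<forall>y t. y \<bullet> e = 0 \<and> norm y < r \<and> \<bar>t\<bar> < h \<longrightarrow> (p + y + t *\<^sub>R e \<in> \<Omega> \<longleftrightarrow> \<gamma> y < (t::real))"
      by (elim exE conjE)
    have L: "0 \<le> 4 + 4 * L" using lipschitz_on_nonneg[OF c(4)] by simp
    have "\<exists>\<epsilon>>0. \<forall>x\<in>\<Omega> \<inter> ball p \<epsilon>. \<forall>y\<in>\<Omega> \<inter> ball p \<epsilon>. \<exists>b c.
      closed_segment x b \<subseteq> \<Omega> \<and> closed_segment b c \<subseteq> \<Omega> \<and> closed_segment c y \<subseteq> \<Omega> \<and>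
      dist x b + dist b c + dist c y \<le> (4 + 4 * L) * dist x y"
      using ch by (intro Lipschitz_epigraph_chain[OF c]) simp
    then obtain \<epsilon> where \<epsilon>: "0 < \<epsilon>" "\<forall>x\<in>\<Omega> \<inter> ball p \<epsilon>. \<forall>y\<in>\<Omega> \<inter> ball p \<epsilon>. \<exists>b c.
      closed_segment x b \<subseteq> \<Omega> \<and> closed_segment b c \<subseteq> \<Omega> \<and> closed_segment c y \<subseteq> \<Omega> \<and>
      dist x b + dist b c + dist c y \<le> (4 + 4 * L) * dist x y" by (elim exE conjE)
    show ?thesis
      by (rule exI[of _ \<epsilon>], rule conjI[OF \<epsilon>(1)], rule exI[of _ "4 + 4 * L"], rule conjI[OF L \<epsilon>(2)])
  qed
qed

context bounded_open_domain
begin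

lemma AE_meets_open:
  assumes ae: "AE x in lebesgue_on \<Omega>. P x" and U: "open U" "U \<subseteq> \<Omega>" "U \<noteq> {}"
  shows "\<exists>x\<in>U. P x"
proof (rule ccontr)
  assume "\<not> ?thesis"
  then have "AE x in lborel. x \<notin> U" using ae[unfolded AE_domain_iff] U(2) by (auto elim!: eventually_mono)
  then have "U \<in> null_sets lborel" using U(1) by (subst AE_iff_null_sets) auto
  then have "negligible U" by (simp add: negligible_iff_null_sets null_sets_completionI)
  then show False using open_not_negligible[OF U(1,3)] by simp
qed

lemma mollify_lipschitz_segment:
  assumes v: "v \<in> Linf \<Omega>" and G: "G \<in> Linf \<Omega>" "weak_gradient \<Omega> v G"
    and B: "AE x in lebesgue_on \<Omega>. norm (G x) \<le> B" and seg: "closed_segment a b \<subseteq> \<Omega>"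
  shows "\<exists>e>0. \<forall>r. 0 < r \<and> r < e \<longrightarrow> \<bar>mollify r v b - mollify r v a\<bar> \<le> B * dist a b"
proof -
  obtain e where e: "0 < e" "(\<Union>x\<in>closed_segment a b. ball x e) \<subseteq> \<Omega>"
    using compact_subset_open_imp_ball_epsilon_subset[OF compact_segment open_domain seg] by metis
  have "\<bar>mollify r v b - mollify r v a\<bar> \<le> B * dist a b" if r: "0 < r" "r < e" for r
  proof -
    have "\<bar>mollify r v (a + (b - a)) - mollify r v a\<bar> \<le> B * norm (b - a)"
    proof (rule mollify_lipschitz[OF v G B r(1)])
      fix t :: real assume "0 \<le> t" "t \<le> 1"
      then have "a + t *\<^sub>R (b - a) \<in> closed_segment a b"
        by (auto simp: in_segment algebra_simps intro!: exI[of _ t])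
      then have "ball (a + t *\<^sub>R (b - a)) e \<subseteq> \<Omega>" using e(2) by blast
      moreover have "cball (a + t *\<^sub>R (b - a)) r \<subseteq> ball (a + t *\<^sub>R (b - a)) e" using r(2) by auto
      ultimately show "cball (a + t *\<^sub>R (b - a)) r \<subseteq> \<Omega>" by blast
    qed
    then show ?thesis by (simp add: dist_norm norm_minus_commute)
  qed
  with e(1) show ?thesis by blast
qed

text \<open>Mollification transports the gradient bound along each of the segments, since
  segments are compact in the open domain. The limit is taken only at the two end points,
  which have to belong to the convergence set \<open>A\<close>; the intermediate points are arbitrary.\<close>

lemma W1inf_chain_bound:
  assumes v: "v \<in> Linf \<Omega>" and G: "G \<in> Linf \<Omega>" "weak_gradient \<Omega> v G"
    and B: "AE x in lebesgue_on \<Omega>. norm (G x) \<le> B"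
  obtains A where "A \<subseteq> \<Omega>" "AE x in lebesgue_on \<Omega>. x \<in> A"
    "\<And>a b c d. a \<in> A \<Longrightarrow> d \<in> A \<Longrightarrow> closed_segment a b \<subseteq> \<Omega> \<Longrightarrow> closed_segment b c \<subseteq> \<Omega> \<Longrightarrow>
      closed_segment c d \<subseteq> \<Omega> \<Longrightarrow> \<bar>v a - v d\<bar> \<le> B * (dist a b + dist b c + dist c d)"
proof -
  \<comment> \<open>One sequence of radii serves all points at once.\<close>
  obtain r :: "nat \<Rightarrow> real" where r: "\<And>n. 0 < r n" "r \<longlonglongrightarrow> 0"
    and lim: "AE x in lebesgue_on \<Omega>. (\<lambda>n. mollify (r n) v x) \<longlonglongrightarrow> v x"
    by (rule mollify_tendsto_AE[OF v]) (rule that)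
  define A where "A = {x \<in> \<Omega>. (\<lambda>n. mollify (r n) v x) \<longlonglongrightarrow> v x}"
  have AE: "AE x in lebesgue_on \<Omega>. x \<in> A"
    using lim AE_space by eventually_elim (simp add: A_def)
  have chain: "\<bar>v a - v d\<bar> \<le> B * (dist a b + dist b c + dist c d)"
    if ad: "a \<in> A" "d \<in> A" and seg: "closed_segment a b \<subseteq> \<Omega>" "closed_segment b c \<subseteq> \<Omega>" "closed_segment c d \<subseteq> \<Omega>" for a b c d
  proof -
    note M = mollify_lipschitz_segment[OF v G B]
    obtain e1 e2 e3 where e: "0 < e1" "0 < e2" "0 < e3"
      and l: "\<And>r. 0 < r \<Longrightarrow> r < e1 \<Longrightarrow> \<bar>mollify r v b - mollify r v a\<bar> \<le> B * dist a b"
        "\<And>r. 0 < r \<Longrightarrow> r < e2 \<Longrightarrow> \<bar>mollify r v c - mollify r v b\<bar> \<le> B * dist b c"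
        "\<And>r. 0 < r \<Longrightarrow> r < e3 \<Longrightarrow> \<bar>mollify r v d - mollify r v c\<bar> \<le> B * dist c d"
      using M[OF seg(1)] M[OF seg(2)] M[OF seg(3)] by metis
    have "\<forall>\<^sub>F n in sequentially. r n < min e1 (min e2 e3)"
      using r(2) e by (intro order_tendstoD(2)[of r 0]) auto
    then have "\<forall>\<^sub>F n in sequentially. \<bar>mollify (r n) v a - mollify (r n) v d\<bar> \<le> B * (dist a b + dist b c + dist c d)"
    proof eventually_elim
      fix n assume "r n < min e1 (min e2 e3)"
      then have "r n < e1" "r n < e2" "r n < e3" by auto
      then show "\<bar>mollify (r n) v a - mollify (r n) v d\<bar> \<le> B * (dist a b + dist b c + dist c d)"
        using l[OF r(1)] by (smt (verit) distrib_left)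
    qed
    moreover have "(\<lambda>n. \<bar>mollify (r n) v a - mollify (r n) v d\<bar>) \<longlonglongrightarrow> \<bar>v a - v d\<bar>"
      using ad by (intro tendsto_intros) (auto simp: A_def)
    ultimately show ?thesis by (intro tendsto_upperbound[where F=sequentially]) auto
  qed
  show thesis by (rule that[of A]) (auto simp: A_def[symmetric] AE intro: chain, simp add: A_def)
qed

text \<open>By the chain condition the values on a full set \<open>A\<close> are locally Lipschitz up to
  the boundary. Compactness of the closure makes this uniform, so the values extend
  continuously from the dense set \<open>A\<close>. The Lipschitz bound for nearby points survives the
  extension, and it places the trace in \<open>W1inf_surface\<close>.\<close>

lemma W1inf_continuous_representative:
  assumes lip: "lipschitz_domain \<Omega>" and v: "v \<in> W1inf \<Omega>"
  shows "\<exists>w C \<delta>. 0 < \<delta> \<and> 0 \<le> C \<and> continuous_on (closure \<Omega>) w \<and> (AE x in lebesgue_on \<Omega>. w x = v x) \<and>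
    (\<forall>x\<in>closure \<Omega>. \<forall>y\<in>closure \<Omega>. dist x y < \<delta> \<longrightarrow> \<bar>w x - w y\<bar> \<le> C * dist x y)"
proof -
  obtain G where vL: "v \<in> Linf \<Omega>" and G: "G \<in> Linf \<Omega>" "weak_gradient \<Omega> v G"
    using v by (auto simp: W1inf_def)
  obtain B where B0: "0 \<le> B" and B: "AE x in lebesgue_on \<Omega>. norm (G x) \<le> B" using G(1) by (rule Linf_boundE)
  obtain A where A: "A \<subseteq> \<Omega>" and AE: "AE x in lebesgue_on \<Omega>. x \<in> A"
    and chain: "\<And>a b c d. a \<in> A \<Longrightarrow> d \<in> A \<Longrightarrow> closed_segment a b \<subseteq> \<Omega> \<Longrightarrow> closed_segment b c \<subseteq> \<Omega> \<Longrightarrow>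
      closed_segment c d \<subseteq> \<Omega> \<Longrightarrow> \<bar>v a - v d\<bar> \<le> B * (dist a b + dist b c + dist c d)"
    by (rule W1inf_chain_bound[OF vL G B]) (rule that)
  have clA: "closure A = closure \<Omega>"
  proof (rule antisym[OF closure_mono[OF A] closure_minimal])
    show "\<Omega> \<subseteq> closure A"
    proof
      fix x assume x: "x \<in> \<Omega>"
      show "x \<in> closure A"
        unfolding closure_approachable
      proof (intro allI impI)
        fix e :: real assume "0 < e"
        then have "\<exists>y\<in>\<Omega> \<inter> ball x e. y \<in> A" using x open_domain by (intro AE_meets_open[OF AE]) auto
        then show "\<exists>y\<in>A. dist y x < e" by (auto simp: dist_commute)
      qed
    qed
  qed simp
  have "\<exists>\<epsilon> C. 0 < \<epsilon> \<and> 0 \<le> C \<and> (\<forall>a\<in>A \<inter> ball p \<epsilon>. \<forall>d\<in>A \<inter> ball p \<epsilon>. \<bar>v a - v d\<bar> \<le> C * dist a d)"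
    if "p \<in> closure \<Omega>" for p
  proof -
    obtain \<epsilon> K where \<epsilon>: "0 < \<epsilon>" "0 \<le> K" and ch: "\<And>x y. x \<in> \<Omega> \<inter> ball p \<epsilon> \<Longrightarrow> y \<in> \<Omega> \<inter> ball p \<epsilon> \<Longrightarrow> \<exists>b c.
        closed_segment x b \<subseteq> \<Omega> \<and> closed_segment b c \<subseteq> \<Omega> \<and> closed_segment c y \<subseteq> \<Omega> \<and>
        dist x b + dist b c + dist c y \<le> K * dist x y"
      using Lipschitz_domain_chain[OF lip \<open>p \<in> closure \<Omega>\<close>] by metis
    have "\<bar>v a - v d\<bar> \<le> (B * K) * dist a d" if "a \<in> A \<inter> ball p \<epsilon>" "d \<in> A \<inter> ball p \<epsilon>" for a d
    proof -
      have "a \<in> \<Omega> \<inter> ball p \<epsilon>" "d \<in> \<Omega> \<inter> ball p \<epsilon>" using that A by auto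
      from ch[OF this] obtain b c where bc: "closed_segment a b \<subseteq> \<Omega>" "closed_segment b c \<subseteq> \<Omega>" "closed_segment c d \<subseteq> \<Omega>"
        and len: "dist a b + dist b c + dist c d \<le> K * dist a d" by blast
      have "\<bar>v a - v d\<bar> \<le> B * (dist a b + dist b c + dist c d)" using that bc by (intro chain) auto
      also have "\<dots> \<le> B * (K * dist a d)" using len B0 by (rule mult_left_mono)
      finally show ?thesis by (simp add: mult.assoc)
    qed
    moreover have "0 \<le> B * K" using B0 \<epsilon>(2) by simp
    ultimately show ?thesis using \<epsilon>(1) by blast
  qed
  then obtain \<epsilon> K where \<epsilon>: "\<And>p. p \<in> closure \<Omega> \<Longrightarrow> 0 < \<epsilon> p" and K: "\<And>p. p \<in> closure \<Omega> \<Longrightarrow> 0 \<le> K p"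
    and loc: "\<And>p a d. p \<in> closure \<Omega> \<Longrightarrow> a \<in> A \<inter> ball p (\<epsilon> p) \<Longrightarrow> d \<in> A \<inter> ball p (\<epsilon> p) \<Longrightarrow> \<bar>v a - v d\<bar> \<le> K p * dist a d"
    by metis
  have comp: "compact (closure \<Omega>)" using bounded_domain by simp
  have "closure \<Omega> \<subseteq> (\<Union>p\<in>closure \<Omega>. ball p (\<epsilon> p / 2))" using \<epsilon> by force
  then obtain F where F: "F \<subseteq> closure \<Omega>" "finite F" "closure \<Omega> \<subseteq> (\<Union>p\<in>F. ball p (\<epsilon> p / 2))"
    using compactE_image[OF comp, of "closure \<Omega>" "\<lambda>p. ball p (\<epsilon> p / 2)"] by (metis open_ball)
  define C where "C = (\<Sum>p\<in>F. K p)"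
  \<comment> \<open>A Lebesgue number of the cover; the \<open>1\<close> only keeps the minimum defined.\<close>
  define \<delta> where "\<delta> = Min (insert 1 ((\<lambda>p. \<epsilon> p / 2) ` F))"
  have C0: "0 \<le> C" unfolding C_def using F(1) K by (intro sum_nonneg) auto
  have \<delta>0: "0 < \<delta>" unfolding \<delta>_def using F \<epsilon> by (subst Min_gr_iff) auto
  have \<delta>le: "\<delta> \<le> \<epsilon> p / 2" if "p \<in> F" for p unfolding \<delta>_def using F(2) that by (intro Min_le) auto
  have lipA: "\<bar>v a - v d\<bar> \<le> C * dist a d" if ad: "a \<in> A" "d \<in> A" "dist a d < \<delta>" for a d
  proof -
    have "a \<in> closure \<Omega>" using ad A closure_subset by blast
    then obtain p where p: "p \<in> F" "a \<in> ball p (\<epsilon> p / 2)" using F(3) by blast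
    have "dist p d \<le> dist p a + dist a d" by (rule dist_triangle)
    then have "d \<in> ball p (\<epsilon> p)" using p \<delta>le[OF p(1)] ad(3) by auto
    moreover have "a \<in> ball p (\<epsilon> p)" using p(2) \<epsilon>[of p] F(1) p(1) by auto
    ultimately have "\<bar>v a - v d\<bar> \<le> K p * dist a d" using loc[of p a d] p(1) F(1) ad by blast
    also have "\<dots> \<le> C * dist a d"
      unfolding C_def using F p(1) K by (intro mult_right_mono member_le_sum) auto
    finally show ?thesis .
  qed
  have "uniformly_continuous_on A v"
    unfolding uniformly_continuous_on_def
  proof (intro allI impI)
    fix e :: real assume e: "0 < e"
    show "\<exists>d>0. \<forall>x\<in>A. \<forall>x'\<in>A. dist x' x < d \<longrightarrow> dist (v x') (v x) < e"
    proof (intro exI[of _ "min \<delta> (e / (C + 1))"] conjI ballI impI)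
      show "0 < min \<delta> (e / (C + 1))" using \<delta>0 e C0 by simp
      fix x x' assume x: "x \<in> A" "x' \<in> A" "dist x' x < min \<delta> (e / (C + 1))"
      then have "dist x' x * (C + 1) < e" using C0 by (simp add: pos_less_divide_eq)
      moreover have "\<bar>v x' - v x\<bar> \<le> C * dist x' x" using x by (intro lipA) auto
      moreover have "C * dist x' x \<le> dist x' x * (C + 1)" by (simp add: algebra_simps)
      ultimately show "dist (v x') (v x) < e" unfolding dist_real_def by linarith
    qed
  qed
  then obtain w where w: "uniformly_continuous_on (closure A) w" "\<And>x. x \<in> A \<Longrightarrow> v x = w x"
    by (metis uniformly_continuous_on_extension_on_closure)
  have wc: "continuous_on (closure \<Omega>) w"
    using w(1) clA by (metis uniformly_continuous_imp_continuous)
  have "\<bar>w x - w y\<bar> \<le> C * dist x y" if xy: "x \<in> closure \<Omega>" "y \<in> closure \<Omega>" "dist x y < \<delta>" for x y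
  proof -
    obtain a b where a: "\<And>n. a n \<in> A" "a \<longlonglongrightarrow> x" and b: "\<And>n. b n \<in> A" "b \<longlonglongrightarrow> y"
    proof -
      have "x \<in> closure A" "y \<in> closure A" using xy clA by simp_all
      then show thesis using that unfolding closure_sequential by blast
    qed
    have cl: "a n \<in> closure \<Omega>" "b n \<in> closure \<Omega>" for n using a(1) b(1) A closure_subset by blast+
    have wa: "(\<lambda>n. w (a n)) \<longlonglongrightarrow> w x" "(\<lambda>n. w (b n)) \<longlonglongrightarrow> w y"
      using continuous_on_tendsto_compose[OF wc a(2) xy(1)] continuous_on_tendsto_compose[OF wc b(2) xy(2)] cl
      by simp_all
    have "\<forall>\<^sub>F n in sequentially. dist (a n) (b n) < \<delta>"
      by (rule order_tendstoD(2)[OF tendsto_dist[OF a(2) b(2)] xy(3)])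
    then have "\<forall>\<^sub>F n in sequentially. \<bar>w (a n) - w (b n)\<bar> \<le> C * dist (a n) (b n)"
      by eventually_elim (use lipA a(1) b(1) w(2) in metis)
    moreover have "(\<lambda>n. \<bar>w (a n) - w (b n)\<bar>) \<longlonglongrightarrow> \<bar>w x - w y\<bar>" by (intro tendsto_intros wa)
    moreover have "(\<lambda>n. C * dist (a n) (b n)) \<longlonglongrightarrow> C * dist x y" by (intro tendsto_intros a b)
    ultimately show ?thesis by (intro tendsto_le[OF sequentially_bot])
  qed
  note lipw = this
  have AEw: "AE x in lebesgue_on \<Omega>. w x = v x" using AE by eventually_elim (simp add: w(2))
  show ?thesis
    by (rule exI[of _ w], rule exI[of _ C], rule exI[of _ \<delta>]) (intro conjI ballI impI \<delta>0 C0 wc AEw lipw)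
qed

end

section \<open>Boundary traces and the load\<close>

text \<open>Two countable covers are interlaced, one at the even and one at the odd indices.\<close>

lemma hausdorff_premeasure_Un_null:
  fixes A B :: "'a::metric_space set"
  assumes "hausdorff_premeasure k \<delta> A = 0" "hausdorff_premeasure k \<delta> B = 0"
  shows "hausdorff_premeasure k \<delta> (A \<union> B) = 0"
proof -
  define c where "c U = (if U = {} then 0 else ennreal (diameter U ^ k))" for U :: "'a set"
  define S where "S A = {U :: nat \<Rightarrow> 'a set. A \<subseteq> (\<Union>i. U i) \<and> (\<forall>i. bounded (U i) \<and> diameter (U i) \<le> \<delta>)}" for A
  have H: "hausdorff_premeasure k \<delta> A = (INF U\<in>S A. \<Sum>i. c (U i))" for A
    unfolding hausdorff_premeasure_def S_def c_def ..
  have le: "hausdorff_premeasure k \<delta> (A \<union> B) \<le> (\<Sum>i. c (U i)) + (\<Sum>i. c (V i))"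
    if U: "U \<in> S A" and V: "V \<in> S B" for U V
  proof -
    define W where "W n = (if even n then U (n div 2) else V (n div 2))" for n
    have "W \<in> S (A \<union> B)"
    proof -
      have "U i = W (2 * i)" "V i = W (2 * i + 1)" for i by (simp_all add: W_def)
      then have "(\<Union>i. U i) \<subseteq> (\<Union>i. W i)" "(\<Union>i. V i) \<subseteq> (\<Union>i. W i)" by auto
      then have "A \<union> B \<subseteq> (\<Union>i. W i)" using U V unfolding S_def by blast
      moreover have "bounded (W i) \<and> diameter (W i) \<le> \<delta>" for i
        using U V unfolding S_def W_def by auto
      ultimately show ?thesis unfolding S_def by blast
    qed
    then have "hausdorff_premeasure k \<delta> (A \<union> B) \<le> (\<Sum>i. c (W i))" unfolding H by (rule INF_lower)
    also have "\<dots> \<le> (\<Sum>i. c (U i)) + (\<Sum>i. c (V i))"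
    proof (rule suminf_le_const)
      fix n
      have split: "(\<Sum>i<2 * m. c (W i)) = (\<Sum>i<m. c (U i)) + (\<Sum>i<m. c (V i))" for m
        by (induction m) (simp_all add: W_def ac_simps)
      have "(\<Sum>i<n. c (W i)) \<le> (\<Sum>i<2 * n. c (W i))" by (intro sum_mono2) auto
      also have "\<dots> \<le> (\<Sum>i. c (U i)) + (\<Sum>i. c (V i))"
        unfolding split by (intro add_mono sum_le_suminf) auto
      finally show "(\<Sum>i<n. c (W i)) \<le> (\<Sum>i. c (U i)) + (\<Sum>i. c (V i))" .
    qed simp
    finally show ?thesis .
  qed
  have "hausdorff_premeasure k \<delta> (A \<union> B) \<le> 0"
  proof (rule ennreal_le_epsilon)
    fix e :: real assume "0 < e"
    then have e: "0 < ennreal (e / 2)" by simp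
    obtain U where U: "U \<in> S A" "(\<Sum>i. c (U i)) < ennreal (e / 2)"
      using assms(1) e unfolding H by (metis INF_less_iff)
    obtain V where V: "V \<in> S B" "(\<Sum>i. c (V i)) < ennreal (e / 2)"
      using assms(2) e unfolding H by (metis INF_less_iff)
    have "hausdorff_premeasure k \<delta> (A \<union> B) \<le> ennreal (e / 2) + ennreal (e / 2)"
      using le[OF U(1) V(1)] U(2) V(2) by (meson add_mono less_imp_le order_trans)
    then show "hausdorff_premeasure k \<delta> (A \<union> B) \<le> 0 + ennreal e"
      using \<open>0 < e\<close> by (simp add: ennreal_plus[symmetric] del: ennreal_plus)
  qed
  then show ?thesis by simp
qed

lemma hausdorff_premeasure_mono: "A \<subseteq> B \<Longrightarrow> hausdorff_premeasure k \<delta> A \<le> hausdorff_premeasure k \<delta> B"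
  unfolding hausdorff_premeasure_def by (rule INF_superset_mono) auto

lemma hausdorff_premeasure_empty: "0 \<le> \<delta> \<Longrightarrow> hausdorff_premeasure k \<delta> {} = 0"
proof -
  assume "0 \<le> \<delta>"
  then have "hausdorff_premeasure k \<delta> ({} :: 'a set) \<le> (\<Sum>i::nat. if {} = ({} :: 'a set) then 0 else ennreal (diameter ({} :: 'a set) ^ k))"
    unfolding hausdorff_premeasure_def by (intro INF_lower2[of "\<lambda>i. {}"]) auto
  then show ?thesis by simp
qed

lemma surface_measure_eq_0_iff:
  "surface_measure A = 0 \<longleftrightarrow> (\<forall>\<delta>>0. hausdorff_premeasure (DIM('a) - 1) \<delta> (A :: 'a::euclidean_space set) = 0)"
  unfolding surface_measure_def hausdorff_measure_def
  by (subst bot_ennreal[symmetric], subst SUP_eq_iff) (auto intro!: exI[of _ "1::real"] simp: bot_ennreal)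

lemma surface_ae_empty: "surface_ae \<Gamma> (\<lambda>x. True)"
  by (simp add: surface_ae_def surface_measure_eq_0_iff hausdorff_premeasure_empty)

text \<open>Surface null sets are closed under unions and subsets, so two almost everywhere
  statements may be combined.\<close>

lemma surface_ae_elim2:
  assumes "surface_ae \<Gamma> P" "surface_ae \<Gamma> Q" "\<And>x. x \<in> \<Gamma> \<Longrightarrow> P x \<Longrightarrow> Q x \<Longrightarrow> R x"
  shows "surface_ae \<Gamma> R"
  unfolding surface_ae_def surface_measure_eq_0_iff
proof (intro allI impI)
  fix \<delta> :: real assume \<delta>: "0 < \<delta>"
  let ?h = "hausdorff_premeasure (DIM('a) - 1) \<delta>"
  have "?h {x \<in> \<Gamma>. \<not> R x} \<le> ?h ({x \<in> \<Gamma>. \<not> P x} \<union> {x \<in> \<Gamma>. \<not> Q x})"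
    using assms(3) by (intro hausdorff_premeasure_mono) auto
  also have "\<dots> = 0"
    using assms(1,2) \<delta> unfolding surface_ae_def surface_measure_eq_0_iff
    by (intro hausdorff_premeasure_Un_null) simp_all
  finally show "?h {x \<in> \<Gamma>. \<not> R x} = 0" by simp
qed

lemma surface_ae_I: "(\<And>x. x \<in> \<Gamma> \<Longrightarrow> P x) \<Longrightarrow> surface_ae \<Gamma> P"
  by (rule surface_ae_elim2[OF surface_ae_empty surface_ae_empty]) auto

lemma W1inf_surface_add_cmult:
  assumes v: "v \<in> W1inf_surface \<Gamma>" and w: "w \<in> W1inf_surface \<Gamma>"
  shows "(\<lambda>x. v x + c * w x) \<in> W1inf_surface \<Gamma>"
proof -
  obtain B L v' where v': "0 \<le> B" "0 \<le> L" "surface_ae \<Gamma> (\<lambda>x. v' x = v x)" "\<forall>x\<in>\<Gamma>. \<bar>v' x\<bar> \<le> B"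
    "\<forall>x\<in>\<Gamma>. \<exists>\<epsilon>>0. L-lipschitz_on (\<Gamma> \<inter> ball x \<epsilon>) v'"
    using v unfolding W1inf_surface_def W1inf_surface_bounds_def mem_Collect_eq by (elim exE conjE)
  obtain D M w' where w': "0 \<le> D" "0 \<le> M" "surface_ae \<Gamma> (\<lambda>x. w' x = w x)" "\<forall>x\<in>\<Gamma>. \<bar>w' x\<bar> \<le> D"
    "\<forall>x\<in>\<Gamma>. \<exists>\<epsilon>>0. M-lipschitz_on (\<Gamma> \<inter> ball x \<epsilon>) w'"
    using w unfolding W1inf_surface_def W1inf_surface_bounds_def mem_Collect_eq by (elim exE conjE)
  have "W1inf_surface_bounds \<Gamma> (\<lambda>x. v x + c * w x) (B + \<bar>c\<bar> * D) (L + \<bar>c\<bar> * M)"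
    unfolding W1inf_surface_bounds_def
  proof (intro conjI exI[of _ "\<lambda>x. v' x + c * w' x"] ballI)
    show "0 \<le> B + \<bar>c\<bar> * D" "0 \<le> L + \<bar>c\<bar> * M" using v'(1,2) w'(1,2) by simp_all
    show "surface_ae \<Gamma> (\<lambda>x. v' x + c * w' x = v x + c * w x)" by (rule surface_ae_elim2[OF v'(3) w'(3)]) simp
    fix x assume x: "x \<in> \<Gamma>"
    have "\<bar>c\<bar> * \<bar>w' x\<bar> \<le> \<bar>c\<bar> * D" using w'(4) x by (intro mult_left_mono) auto
    then show "\<bar>v' x + c * w' x\<bar> \<le> B + \<bar>c\<bar> * D"
      using v'(4) x abs_triangle_ineq[of "v' x" "c * w' x"] by (fastforce simp: abs_mult)
    obtain \<epsilon> where \<epsilon>: "0 < \<epsilon>" "L-lipschitz_on (\<Gamma> \<inter> ball x \<epsilon>) v'" using bspec[OF v'(5) x] by (elim exE conjE)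
    obtain \<eta> where \<eta>: "0 < \<eta>" "M-lipschitz_on (\<Gamma> \<inter> ball x \<eta>) w'" using bspec[OF w'(5) x] by (elim exE conjE)
    have sub: "\<Gamma> \<inter> ball x (min \<epsilon> \<eta>) \<subseteq> \<Gamma> \<inter> ball x \<epsilon>" "\<Gamma> \<inter> ball x (min \<epsilon> \<eta>) \<subseteq> \<Gamma> \<inter> ball x \<eta>" by auto
    show "\<exists>\<epsilon>>0. (L + \<bar>c\<bar> * M)-lipschitz_on (\<Gamma> \<inter> ball x \<epsilon>) (\<lambda>x. v' x + c * w' x)"
      by (rule exI[of _ "min \<epsilon> \<eta>"])
        (intro conjI lipschitz_on_add lipschitz_on_cmult_real lipschitz_on_subset[OF \<epsilon>(2) sub(1)]
          lipschitz_on_subset[OF \<eta>(2) sub(2)], use \<epsilon>(1) \<eta>(1) in simp)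
  qed
  then show ?thesis unfolding W1inf_surface_def by blast
qed

lemma W1inf_surface_dualD:
  assumes "g \<in> W1inf_surface_dual \<Gamma>"
  shows "v \<in> W1inf_surface \<Gamma> \<Longrightarrow> w \<in> W1inf_surface \<Gamma> \<Longrightarrow> g (\<lambda>x. v x + w x) = g v + g w"
    and "v \<in> W1inf_surface \<Gamma> \<Longrightarrow> g (\<lambda>x. c * v x) = c * g v"
    and "\<exists>C. \<forall>w\<in>W1inf_surface \<Gamma>. \<bar>g w\<bar> \<le> C * W1inf_surface_norm \<Gamma> w"
  using assms unfolding W1inf_surface_dual_def by blast+

text \<open>The difference of two functions that agree on \<open>\<Gamma>\<close> has norm zero, so a bounded
  functional cannot distinguish them.\<close>

lemma W1inf_surface_dual_cong:
  assumes g: "g \<in> W1inf_surface_dual \<Gamma>" and v: "v \<in> W1inf_surface \<Gamma>" and w: "w \<in> W1inf_surface \<Gamma>"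
    and eq: "\<And>x. x \<in> \<Gamma> \<Longrightarrow> v x = w x"
  shows "g v = g w"
proof -
  let ?d = "\<lambda>x. v x + - 1 * w x"
  have d: "?d \<in> W1inf_surface \<Gamma>" by (rule W1inf_surface_add_cmult[OF v w])
  have "W1inf_surface_bounds \<Gamma> ?d 0 0"
    unfolding W1inf_surface_bounds_def
  proof (intro conjI exI[of _ "\<lambda>x. 0"] ballI)
    show "surface_ae \<Gamma> (\<lambda>x. 0 = ?d x)" using eq by (intro surface_ae_I) simp
    show "\<exists>\<epsilon>>0. 0-lipschitz_on (\<Gamma> \<inter> ball x \<epsilon>) (\<lambda>x. 0::real)" for x
      by (intro exI[of _ "1::real"]) (simp add: lipschitz_on_def)
  qed auto
  then have 0: "0 \<in> {B + L | B L. W1inf_surface_bounds \<Gamma> ?d B L}" by (intro CollectI exI[of _ 0]) simp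
  have "W1inf_surface_norm \<Gamma> ?d \<le> 0"
    unfolding W1inf_surface_norm_def
    by (rule cInf_lower[OF 0]) (auto intro!: bdd_belowI[of _ 0] simp: W1inf_surface_bounds_def)
  moreover have "0 \<le> W1inf_surface_norm \<Gamma> ?d"
    unfolding W1inf_surface_norm_def
  proof (rule cInf_greatest)
    show "{B + L | B L. W1inf_surface_bounds \<Gamma> ?d B L} \<noteq> {}" using 0 by blast
  qed (auto simp: W1inf_surface_bounds_def)
  moreover obtain C where "\<And>w. w \<in> W1inf_surface \<Gamma> \<Longrightarrow> \<bar>g w\<bar> \<le> C * W1inf_surface_norm \<Gamma> w"
    using W1inf_surface_dualD(3)[OF g] by blast
  ultimately have "\<bar>g ?d\<bar> \<le> C * 0" using d by (metis order_antisym)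
  then have "g ?d = 0" by simp
  have s: "(\<lambda>x. - 1 * w x) \<in> W1inf_surface \<Gamma>"
    using W1inf_surface_add_cmult[OF w w, of "- 2"] by simp
  have "g ?d = g v + g (\<lambda>x. - 1 * w x)" by (rule W1inf_surface_dualD(1)[OF g v s])
  moreover have "g (\<lambda>x. - 1 * w x) = - 1 * g w" by (rule W1inf_surface_dualD(2)[OF g w])
  ultimately show ?thesis using \<open>g ?d = 0\<close> by simp
qed

locale bounded_Lipschitz_domain = bounded_open_domain +
  assumes Lipschitz: "lipschitz_domain \<Omega>"
begin

text \<open>A nonempty open set has positive measure, so continuous functions that agree
  almost everywhere agree on the domain and by continuity on its closure. This makes traces
  unique.\<close>

lemma continuous_AE_eq_imp_eq:
  assumes c: "continuous_on (closure \<Omega>) w" "continuous_on (closure \<Omega>) w'"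
    and ae: "AE x in lebesgue_on \<Omega>. w x = (w' x :: real)" and x: "x \<in> closure \<Omega>"
  shows "w x = w' x"
proof -
  have cd: "continuous_on (closure \<Omega>) (\<lambda>x. w x - w' x)" by (intro continuous_intros c)
  have "w y - w' y = 0" if y: "y \<in> \<Omega>" for y
  proof (rule ccontr)
    assume ne: "w y - w' y \<noteq> 0"
    define U where "U = \<Omega> \<inter> (\<lambda>x. w x - w' x) -` (- {0})"
    have "open U"
      unfolding U_def using continuous_on_subset[OF cd closure_subset] open_domain
      by (intro continuous_open_preimage) auto
    moreover have "y \<in> U" using y ne by (simp add: U_def)
    ultimately have "\<exists>x\<in>U. w x = w' x" by (intro AE_meets_open[OF ae]) (auto simp: U_def)
    then show False by (auto simp: U_def)
  qed
  then have "w x - w' x = 0" by (rule continuous_constant_on_closure[OF cd _ x])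
  then show ?thesis by simp
qed

text \<open>The trace, defined as an arbitrary continuous representative, agrees on the
  closure with the one constructed above and inherits its Lipschitz bound.\<close>

lemma boundary_trace_representative:
  assumes v: "v \<in> W1inf \<Omega>"
  shows "continuous_on (closure \<Omega>) (boundary_trace \<Omega> v)" "AE x in lebesgue_on \<Omega>. boundary_trace \<Omega> v x = v x"
    and "\<exists>C \<delta>. 0 < \<delta> \<and> 0 \<le> C \<and> (\<forall>x\<in>closure \<Omega>. \<forall>y\<in>closure \<Omega>. dist x y < \<delta> \<longrightarrow>
      \<bar>boundary_trace \<Omega> v x - boundary_trace \<Omega> v y\<bar> \<le> C * dist x y)"
proof -
  obtain w C \<delta> where w: "0 < \<delta>" "0 \<le> C" "continuous_on (closure \<Omega>) w" "AE x in lebesgue_on \<Omega>. w x = v x"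
    "\<forall>x\<in>closure \<Omega>. \<forall>y\<in>closure \<Omega>. dist x y < \<delta> \<longrightarrow> \<bar>w x - w y\<bar> \<le> C * dist x y"
    using W1inf_continuous_representative[OF Lipschitz v] by (elim exE conjE)
  have "continuous_on (closure \<Omega>) (boundary_trace \<Omega> v) \<and> (AE x in lebesgue_on \<Omega>. boundary_trace \<Omega> v x = v x)"
    unfolding boundary_trace_def
    by (rule someI[of "\<lambda>w. continuous_on (closure \<Omega>) w \<and> (AE x in lebesgue_on \<Omega>. w x = v x)" w]) (intro conjI w)
  then show c: "continuous_on (closure \<Omega>) (boundary_trace \<Omega> v)" and ae: "AE x in lebesgue_on \<Omega>. boundary_trace \<Omega> v x = v x"
    by blast+
  have "AE x in lebesgue_on \<Omega>. boundary_trace \<Omega> v x = w x" using ae w(4) by eventually_elim simp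
  from continuous_AE_eq_imp_eq[OF c w(3) this]
  have eq: "boundary_trace \<Omega> v x = w x" if "x \<in> closure \<Omega>" for x using that .
  show "\<exists>C \<delta>. 0 < \<delta> \<and> 0 \<le> C \<and> (\<forall>x\<in>closure \<Omega>. \<forall>y\<in>closure \<Omega>. dist x y < \<delta> \<longrightarrow>
      \<bar>boundary_trace \<Omega> v x - boundary_trace \<Omega> v y\<bar> \<le> C * dist x y)"
    by (rule exI[of _ C], rule exI[of _ \<delta>]) (use w eq in simp)
qed

lemma boundary_trace_surface:
  assumes v: "v \<in> W1inf \<Omega>" and \<Gamma>: "\<Gamma> \<subseteq> frontier \<Omega>"
  shows "boundary_trace \<Omega> v \<in> W1inf_surface \<Gamma>"
proof -
  have \<Gamma>c: "\<Gamma> \<subseteq> closure \<Omega>" using \<Gamma> by (auto simp: frontier_def)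
  obtain C \<delta> where C: "0 < \<delta>" "0 \<le> C"
    and lip: "\<And>x y. x \<in> closure \<Omega> \<Longrightarrow> y \<in> closure \<Omega> \<Longrightarrow> dist x y < \<delta> \<Longrightarrow>
      \<bar>boundary_trace \<Omega> v x - boundary_trace \<Omega> v y\<bar> \<le> C * dist x y"
    using boundary_trace_representative(3)[OF v] by blast
  have "compact (boundary_trace \<Omega> v ` closure \<Omega>)"
    using bounded_domain by (intro compact_continuous_image boundary_trace_representative(1)[OF v]) simp
  then obtain B where B: "\<And>x. x \<in> closure \<Omega> \<Longrightarrow> norm (boundary_trace \<Omega> v x) \<le> B"
    by (meson bounded_iff compact_imp_bounded imageI)
  have "W1inf_surface_bounds \<Gamma> (boundary_trace \<Omega> v) \<bar>B\<bar> C"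
    unfolding W1inf_surface_bounds_def
  proof (intro conjI exI[of _ "boundary_trace \<Omega> v"] ballI C(2))
    show "surface_ae \<Gamma> (\<lambda>x. boundary_trace \<Omega> v x = boundary_trace \<Omega> v x)" by (rule surface_ae_I) simp
    show "\<bar>boundary_trace \<Omega> v x\<bar> \<le> \<bar>B\<bar>" if "x \<in> \<Gamma>" for x using B[of x] that \<Gamma>c by auto
    show "\<exists>\<epsilon>>0. C-lipschitz_on (\<Gamma> \<inter> ball x \<epsilon>) (boundary_trace \<Omega> v)" for x
    proof (intro exI[of _ "\<delta> / 2"] conjI lipschitz_onI C(2))
      show "0 < \<delta> / 2" using C by simp
      fix y z assume "y \<in> \<Gamma> \<inter> ball x (\<delta> / 2)" "z \<in> \<Gamma> \<inter> ball x (\<delta> / 2)"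
      then show "dist (boundary_trace \<Omega> v y) (boundary_trace \<Omega> v z) \<le> C * dist y z"
        using lip[of y z] \<Gamma>c dist_triangle_half_r[of x y \<delta> z] by (auto simp: dist_real_def)
    qed
  qed simp
  then show ?thesis unfolding W1inf_surface_def by blast
qed

lemma W1inf_grad:
  assumes v: "v \<in> W1inf \<Omega>"
  shows "grad \<Omega> v \<in> Linf \<Omega>" "weak_gradient \<Omega> v (grad \<Omega> v)"
proof -
  have "\<exists>G. G \<in> Linf \<Omega> \<and> weak_gradient \<Omega> v G" using v unfolding W1inf_def by blast
  from someI_ex[OF this] show "grad \<Omega> v \<in> Linf \<Omega>" "weak_gradient \<Omega> v (grad \<Omega> v)"
    unfolding grad_def by blast+
qed

lemma W1inf_Linf: "v \<in> W1inf \<Omega> \<Longrightarrow> v \<in> Linf \<Omega>" by (simp add: W1inf_def)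

lemma Linf_cmult: "v \<in> Linf \<Omega> \<Longrightarrow> (\<lambda>x. c * v x) \<in> Linf \<Omega>" for v :: "'a \<Rightarrow> real"
  using Linf_scaleR[of v c] by simp

lemma
  assumes v: "v \<in> W1inf \<Omega>" and w: "w \<in> W1inf \<Omega>"
  shows W1inf_add_cmult: "(\<lambda>x. v x + c * w x) \<in> W1inf \<Omega>"
    and grad_add_cmult: "AE x in lebesgue_on \<Omega>. grad \<Omega> (\<lambda>x. v x + c * w x) x = grad \<Omega> v x + c *\<^sub>R grad \<Omega> w x"
proof -
  note L = W1inf_Linf[OF v] Linf_cmult[OF W1inf_Linf[OF w], of c]
  have G: "(\<lambda>x. grad \<Omega> v x + c *\<^sub>R grad \<Omega> w x) \<in> Linf \<Omega>"
    by (intro Linf_add Linf_scaleR W1inf_grad v w)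
  have wg: "weak_gradient \<Omega> (\<lambda>x. v x + c * w x) (\<lambda>x. grad \<Omega> v x + c *\<^sub>R grad \<Omega> w x)"
    by (intro weak_gradient_add L W1inf_grad v w Linf_scaleR weak_gradient_scaleR)
  have vw: "(\<lambda>x. v x + c * w x) \<in> Linf \<Omega>" by (intro Linf_add L)
  show W: "(\<lambda>x. v x + c * w x) \<in> W1inf \<Omega>"
    unfolding W1inf_def by (rule CollectI, rule conjI[OF vw], rule bexI, rule wg, rule G)
  show "AE x in lebesgue_on \<Omega>. grad \<Omega> (\<lambda>x. v x + c * w x) x = grad \<Omega> v x + c *\<^sub>R grad \<Omega> w x"
    by (rule weak_gradient_unique[OF W1inf_grad(1)[OF W] W1inf_grad(2)[OF W] G wg])
qed

lemma boundary_trace_add_cmult: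
  assumes v: "v \<in> W1inf \<Omega>" and w: "w \<in> W1inf \<Omega>" and x: "x \<in> closure \<Omega>"
  shows "boundary_trace \<Omega> (\<lambda>x. v x + c * w x) x = boundary_trace \<Omega> v x + c * boundary_trace \<Omega> w x"
proof (rule continuous_AE_eq_imp_eq[OF _ _ _ x])
  show "continuous_on (closure \<Omega>) (boundary_trace \<Omega> (\<lambda>x. v x + c * w x))"
    by (intro boundary_trace_representative W1inf_add_cmult v w)
  show "continuous_on (closure \<Omega>) (\<lambda>x. boundary_trace \<Omega> v x + c * boundary_trace \<Omega> w x)"
    by (intro continuous_intros boundary_trace_representative v w)
  show "AE x in lebesgue_on \<Omega>. boundary_trace \<Omega> (\<lambda>x. v x + c * w x) x = boundary_trace \<Omega> v x + c * boundary_trace \<Omega> w x"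
    using boundary_trace_representative(2)[OF v] boundary_trace_representative(2)[OF w] boundary_trace_representative(2)[OF W1inf_add_cmult[OF v w, of c]]
    by eventually_elim simp
qed

lemma surface_ae_trace_add_cmult:
  assumes v: "v \<in> W1inf \<Omega>" and w: "w \<in> W1inf \<Omega>" and \<Gamma>: "\<Gamma> \<subseteq> frontier \<Omega>"
    and "surface_ae \<Gamma> (\<lambda>x. boundary_trace \<Omega> v x = \<alpha> x)" "surface_ae \<Gamma> (\<lambda>x. boundary_trace \<Omega> w x = \<beta> x)"
  shows "surface_ae \<Gamma> (\<lambda>x. boundary_trace \<Omega> (\<lambda>x. v x + c * w x) x = \<alpha> x + c * \<beta> x)"
proof (rule surface_ae_elim2[OF assms(4,5)])
  fix x assume "x \<in> \<Gamma>"
  then have "x \<in> closure \<Omega>" using \<Gamma> by (auto simp: frontier_def)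
  then show "boundary_trace \<Omega> v x = \<alpha> x \<Longrightarrow> boundary_trace \<Omega> w x = \<beta> x \<Longrightarrow>
      boundary_trace \<Omega> (\<lambda>x. v x + c * w x) x = \<alpha> x + c * \<beta> x"
    by (simp add: boundary_trace_add_cmult[OF v w])
qed

text \<open>The trace of a combination equals the combination of traces only on the closure of
  \<open>\<Omega>\<close>; \<open>W1inf_surface_dual_cong\<close> allows this exchange inside \<open>g\<close>.\<close>

lemma load_add_cmult:
  assumes f: "integrable (lebesgue_on \<Omega>) f" and g: "g \<in> W1inf_surface_dual \<Gamma>" and \<Gamma>: "\<Gamma> \<subseteq> frontier \<Omega>"
    and v: "v \<in> W1inf \<Omega>" and w: "w \<in> W1inf \<Omega>"
  shows "load \<Omega> f g (\<lambda>x. v x + c * w x) = load \<Omega> f g v + c * load \<Omega> f g w"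
proof -
  note S = boundary_trace_surface[OF _ \<Gamma>]
  let ?t = "boundary_trace \<Omega>"
  have fi: "integrable (lebesgue_on \<Omega>) (\<lambda>x. f x * u x)" if u: "u \<in> W1inf \<Omega>" for u
  proof -
    obtain C where C: "0 \<le> C" "AE x in lebesgue_on \<Omega>. norm (u x) \<le> C" using W1inf_Linf[OF u] by (rule Linf_boundE)
    show ?thesis
    proof (rule Bochner_Integration.integrable_bound)
      show "integrable (lebesgue_on \<Omega>) (\<lambda>x. C * f x)" using f by simp
      show "(\<lambda>x. f x * u x) \<in> borel_measurable (lebesgue_on \<Omega>)"
        by (intro borel_measurable_times borel_measurable_integrable[OF f] Linf_measurable[OF W1inf_Linf[OF u]])
      show "AE x in lebesgue_on \<Omega>. norm (f x * u x) \<le> norm (C * f x)"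
        using C(2)
      proof eventually_elim
        fix x assume "norm (u x) \<le> C"
        then have "\<bar>f x\<bar> * \<bar>u x\<bar> \<le> \<bar>f x\<bar> * C" by (intro mult_left_mono) auto
        then show "norm (f x * u x) \<le> norm (C * f x)" using C(1) by (simp add: abs_mult mult.commute)
      qed
    qed
  qed
  have "(LINT x|lebesgue_on \<Omega>. f x * (v x + c * w x)) = (LINT x|lebesgue_on \<Omega>. f x * v x + c * (f x * w x))"
    by (simp add: algebra_simps)
  also have "\<dots> = (LINT x|lebesgue_on \<Omega>. f x * v x) + c * (LINT x|lebesgue_on \<Omega>. f x * w x)"
    using fi[OF v] fi[OF w] by simp
  finally have 1: "(LINT x|lebesgue_on \<Omega>. f x * (v x + c * w x)) = \<dots>" .
  note add = W1inf_surface_dualD(1)[OF g] and mult = W1inf_surface_dualD(2)[OF g]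
  have "g (?t (\<lambda>x. v x + c * w x)) = g (\<lambda>x. ?t v x + c * ?t w x)"
  proof (rule W1inf_surface_dual_cong[OF g])
    show "?t (\<lambda>x. v x + c * w x) \<in> W1inf_surface \<Gamma>" by (intro S W1inf_add_cmult v w)
    show "(\<lambda>x. ?t v x + c * ?t w x) \<in> W1inf_surface \<Gamma>" by (intro W1inf_surface_add_cmult S v w)
    fix x assume "x \<in> \<Gamma>"
    then have "x \<in> closure \<Omega>" using \<Gamma> by (auto simp: frontier_def)
    then show "?t (\<lambda>x. v x + c * w x) x = ?t v x + c * ?t w x" by (rule boundary_trace_add_cmult[OF v w])
  qed
  also have "\<dots> = g (?t v) + g (\<lambda>x. c * ?t w x)"
    using W1inf_surface_add_cmult[OF S[OF w] S[OF w], of "c - 1"] by (intro add S v) (simp add: algebra_simps)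
  also have "g (\<lambda>x. c * ?t w x) = c * g (?t w)" by (intro mult S w)
  finally show ?thesis unfolding load_def 1 by (simp add: algebra_simps)
qed

end

section \<open>The conjugate integrand\<close>

text \<open>The gradient of \<open>phi_star\<close> in its second argument, which is also the projection
  onto the ball of radius \<open>\<zeta> x\<close>. The single formula shows its continuity and measurability.\<close>

definition flux :: "('a::euclidean_space \<Rightarrow> real) \<Rightarrow> 'a \<Rightarrow> 'a \<Rightarrow> 'a" where
  "flux \<zeta> x s = (\<zeta> x / max (\<zeta> x) (norm s)) *\<^sub>R s"

lemma flux_cases:
  assumes "0 < \<zeta> x"
  shows "norm s \<le> \<zeta> x \<Longrightarrow> flux \<zeta> x s = s"
    and "\<zeta> x < norm s \<Longrightarrow> flux \<zeta> x s = (\<zeta> x / norm s) *\<^sub>R s"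
  using assms by (auto simp: flux_def max_def)

lemma norm_flux:
  assumes "0 < \<zeta> x"
  shows "norm (flux \<zeta> x s) = min (\<zeta> x) (norm s)"
  using assms by (auto simp: flux_def max_def min_def)

lemma phi_star_min:
  "phi_star \<zeta> x s = 1/2 * (min (\<zeta> x) (norm s))\<^sup>2 + \<zeta> x * (norm s - min (\<zeta> x) (norm s))"
  by (auto simp: phi_star_def min_def power2_eq_square algebra_simps)

text \<open>The supremum of \<open>s \<bullet> U - 1/2 |U|\<^sup>2\<close> over \<open>|U| \<le> \<zeta> x\<close>, whose value is \<open>phi_star \<zeta> x
  s\<close>, is attained at the flux.\<close>

lemma phi_star_flux:
  assumes "0 < \<zeta> x"
  shows "phi_star \<zeta> x s = s \<bullet> flux \<zeta> x s - 1/2 * (norm (flux \<zeta> x s))\<^sup>2"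
proof (cases "norm s \<le> \<zeta> x")
  case True
  then show ?thesis using assms by (simp add: flux_cases phi_star_def power2_norm_eq_inner)
next
  case False
  then have "s \<noteq> 0" "\<zeta> x < norm s" using assms by auto
  then have "s \<bullet> flux \<zeta> x s = \<zeta> x * norm s"
    using assms by (simp add: flux_cases(2) power2_norm_eq_inner[symmetric] power2_eq_square)
  then show ?thesis using False assms by (simp add: norm_flux phi_star_def)
qed

lemma phi_star_bounds:
  assumes "0 < \<zeta> x"
  shows "0 \<le> phi_star \<zeta> x s" "phi_star \<zeta> x s \<le> \<zeta> x * norm s"
proof -
  show "0 \<le> phi_star \<zeta> x s" using assms unfolding phi_star_min by simp
  have "1/2 * (min (\<zeta> x) (norm s))\<^sup>2 \<le> \<zeta> x * min (\<zeta> x) (norm s)"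
  proof -
    have "min (\<zeta> x) (norm s) * min (\<zeta> x) (norm s) \<le> \<zeta> x * min (\<zeta> x) (norm s)"
      using assms by (intro mult_right_mono) auto
    moreover have "0 \<le> min (\<zeta> x) (norm s) * min (\<zeta> x) (norm s)" by simp
    ultimately show ?thesis unfolding power2_eq_square by linarith
  qed
  then show "phi_star \<zeta> x s \<le> \<zeta> x * norm s" unfolding phi_star_min by (simp add: algebra_simps)
qed

text \<open>Inside the ball the defect is \<open>1/2 |U - z|\<^sup>2\<close>. Outside it the defect is the sum of
  the Cauchy--Schwarz defect and \<open>(\<zeta> - |U|) (|z| - (\<zeta> + |U|) / 2)\<close>, where the second factor
  is positive; both summands vanish only if \<open>U\<close> is the multiple of \<open>z\<close> of length \<open>\<zeta>\<close>.\<close>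

lemma Fenchel_inequality:
  assumes c: "0 < \<zeta> x" and U: "norm U \<le> \<zeta> x"
  shows "z \<bullet> U \<le> 1/2 * (norm U)\<^sup>2 + phi_star \<zeta> x z"
    and "z \<bullet> U = 1/2 * (norm U)\<^sup>2 + phi_star \<zeta> x z \<Longrightarrow> U = flux \<zeta> x z"
proof -
  have *: "z \<bullet> U \<le> 1/2 * (norm U)\<^sup>2 + phi_star \<zeta> x z \<and>
      (z \<bullet> U = 1/2 * (norm U)\<^sup>2 + phi_star \<zeta> x z \<longrightarrow> U = flux \<zeta> x z)"
  proof (cases "norm z \<le> \<zeta> x")
    case True
    have "1/2 * (norm U)\<^sup>2 + phi_star \<zeta> x z - z \<bullet> U = 1/2 * (norm (U - z))\<^sup>2"
      using True by (simp add: phi_star_def power2_norm_eq_inner inner_diff_left inner_diff_right inner_commute)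
    moreover have "0 \<le> (norm (U - z))\<^sup>2" by simp
    ultimately have "z \<bullet> U \<le> 1/2 * (norm U)\<^sup>2 + phi_star \<zeta> x z"
      and "z \<bullet> U = 1/2 * (norm U)\<^sup>2 + phi_star \<zeta> x z \<Longrightarrow> (norm (U - z))\<^sup>2 = 0" by linarith+
    then show ?thesis using flux_cases(1)[of \<zeta> x, OF c True] by simp
  next
    case False
    define t where "t = norm U"
    have t: "0 \<le> t" "t \<le> \<zeta> x" using U by (simp_all add: t_def)
    have pos: "0 < norm z - (\<zeta> x + t) / 2" using False t by simp
    have gap: "1/2 * t\<^sup>2 + phi_star \<zeta> x z - norm z * t = (\<zeta> x - t) * (norm z - (\<zeta> x + t) / 2)"
      using False by (simp add: phi_star_def power2_eq_square field_simps)
    have cs: "z \<bullet> U \<le> norm z * t" unfolding t_def by (rule norm_cauchy_schwarz)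
    have nn: "0 \<le> (\<zeta> x - t) * (norm z - (\<zeta> x + t) / 2)" using t pos by (intro mult_nonneg_nonneg) auto
    have "U = flux \<zeta> x z" if eq: "z \<bullet> U = 1/2 * t\<^sup>2 + phi_star \<zeta> x z"
    proof -
      have "(\<zeta> x - t) * (norm z - (\<zeta> x + t) / 2) = 0" using gap cs nn eq by linarith
      then have tc: "t = \<zeta> x" using pos by simp
      have "z \<bullet> U = norm z * norm U" using gap cs nn eq by (simp add: t_def)
      then have "norm z *\<^sub>R U = norm U *\<^sub>R z" by (simp add: norm_cauchy_schwarz_eq)
      then have nz: "norm z *\<^sub>R U = \<zeta> x *\<^sub>R z" using tc by (simp add: t_def)
      have "norm z \<noteq> 0" using False c by auto
      then have "U = (1 / norm z) *\<^sub>R (norm z *\<^sub>R U)" by simp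
      also have "\<dots> = (\<zeta> x / norm z) *\<^sub>R z" unfolding nz by simp
      finally show ?thesis using flux_cases(2)[of \<zeta> x z] False c by simp
    qed
    moreover have "z \<bullet> U \<le> 1/2 * t\<^sup>2 + phi_star \<zeta> x z" using gap cs nn by linarith
    ultimately show ?thesis unfolding t_def by blast
  qed
  then show "z \<bullet> U \<le> 1/2 * (norm U)\<^sup>2 + phi_star \<zeta> x z"
    and "z \<bullet> U = 1/2 * (norm U)\<^sup>2 + phi_star \<zeta> x z \<Longrightarrow> U = flux \<zeta> x z" by blast+
qed

text \<open>If \<open>|z| \<le> \<zeta>\<close>, then \<open>U = z\<close> and both sides vanish, on the contact set because \<open>|z|
  / \<zeta> = 1\<close> there. Otherwise \<open>|U| = \<zeta>\<close> and \<open>z = (|z| / \<zeta>) U\<close>.\<close>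

lemma flux_contact:
  assumes c: "0 < \<zeta> x" and U: "U = flux \<zeta> x z"
  shows "(z - U) \<bullet> (U - V) = (if norm U = \<zeta> x then (norm z / \<zeta> x - 1) * ((\<zeta> x)\<^sup>2 - U \<bullet> V) else 0)"
proof (cases "norm z \<le> \<zeta> x")
  case True
  then show ?thesis using c by (auto simp: U flux_cases)
next
  case False
  then have nU: "norm U = \<zeta> x" using c by (simp add: U norm_flux)
  have "(norm z / \<zeta> x) *\<^sub>R U = z" using False c by (auto simp: U flux_cases)
  then have "z - U = (norm z / \<zeta> x - 1) *\<^sub>R U" by (simp add: scaleR_diff_left)
  then have "(z - U) \<bullet> (U - V) = (norm z / \<zeta> x - 1) * (U \<bullet> U - U \<bullet> V)"
    by (simp only: inner_scaleR_left inner_diff_right right_diff_distrib)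
  then show ?thesis using nU by (simp add: power2_norm_eq_inner[symmetric])
qed

lemma outer_product_mult: "outer_product s t *v w = (t \<bullet> w) *\<^sub>R s"
  by (simp add: vec_eq_iff outer_product_def matrix_vector_mult_def inner_vec_def sum_distrib_left sum_distrib_right mult_ac)

lemma norm_outer_product_le: "norm (outer_product t t) \<le> of_nat CARD('d) * (norm t)\<^sup>2" for t :: "real ^ 'd"
proof -
  have row: "outer_product t t $ i = (t $ i) *\<^sub>R t" for i
    by (simp add: outer_product_def vec_eq_iff)
  have "norm (outer_product t t) \<le> (\<Sum>i\<in>UNIV. norm (outer_product t t $ i))"
    unfolding norm_vec_def[of "outer_product t t"] by (rule L2_set_le_sum) simp
  also have "\<dots> \<le> (\<Sum>i\<in>(UNIV :: 'd set). norm t * norm t)"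
    unfolding row by (intro sum_mono) (simp add: mult_right_mono component_le_norm_cart)
  finally show ?thesis by (simp add: power2_eq_square)
qed

lemma phi_star_hessian_quadratic:
  assumes "0 < \<zeta> x"
  shows "norm p \<le> \<zeta> x \<Longrightarrow> (phi_star_hessian \<zeta> x p *v w) \<bullet> w = w \<bullet> w"
    and "\<zeta> x < norm p \<Longrightarrow> (phi_star_hessian \<zeta> x p *v w) \<bullet> w =
      \<zeta> x * ((w \<bullet> w) / norm p - (p \<bullet> w)\<^sup>2 / (norm p)^3)"
proof -
  show "norm p \<le> \<zeta> x \<Longrightarrow> (phi_star_hessian \<zeta> x p *v w) \<bullet> w = w \<bullet> w" by (simp add: phi_star_hessian_def)
  assume a: "\<zeta> x < norm p"
  then have p: "norm p \<noteq> 0" using assms by auto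
  have "phi_star_hessian \<zeta> x p *v w = (\<zeta> x / norm p) *\<^sub>R (w - (1 / (norm p)\<^sup>2) *\<^sub>R ((p \<bullet> w) *\<^sub>R p))"
    using a by (simp add: phi_star_hessian_def matrix_vector_mult_diff_rdistrib scaleR_matrix_vector_assoc[symmetric] outer_product_mult)
  then have "(phi_star_hessian \<zeta> x p *v w) \<bullet> w = (\<zeta> x / norm p) * (w \<bullet> w - (1 / (norm p)\<^sup>2) * ((p \<bullet> w) * (p \<bullet> w)))"
    by (simp add: inner_diff_left)
  then show "(phi_star_hessian \<zeta> x p *v w) \<bullet> w = \<zeta> x * ((w \<bullet> w) / norm p - (p \<bullet> w)\<^sup>2 / (norm p)^3)"
    using p by (simp add: power2_eq_square power3_eq_cube field_simps)
qed

lemma norm_phi_star_hessian_le: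
  assumes "0 < \<zeta> x"
  shows "norm (phi_star_hessian \<zeta> x (p :: real ^ 'd)) \<le> norm (mat 1 :: real ^ 'd ^ 'd) + of_nat CARD('d)"
proof (cases "norm p \<le> \<zeta> x")
  case True then show ?thesis by (simp add: phi_star_hessian_def)
next
  case False
  then have p: "\<zeta> x < norm p" "0 < norm p" using assms by auto
  have "norm (mat 1 - (1 / (norm p)\<^sup>2) *\<^sub>R outer_product p p) \<le>
      norm (mat 1 :: real ^ 'd ^ 'd) + norm ((1 / (norm p)\<^sup>2) *\<^sub>R outer_product p p)" by (rule norm_triangle_ineq4)
  also have "norm ((1 / (norm p)\<^sup>2) *\<^sub>R outer_product p p) \<le> of_nat CARD('d)"
    using norm_outer_product_le[of p] p(2) by (simp add: divide_le_eq mult.commute)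
  finally have 1: "norm (mat 1 - (1 / (norm p)\<^sup>2) *\<^sub>R outer_product p p) \<le> norm (mat 1 :: real ^ 'd ^ 'd) + of_nat CARD('d)" by simp
  have "norm (phi_star_hessian \<zeta> x p) = (\<zeta> x / norm p) * norm (mat 1 - (1 / (norm p)\<^sup>2) *\<^sub>R outer_product p p)"
    using False assms by (simp add: phi_star_hessian_def)
  also have "\<dots> \<le> 1 * norm (mat 1 - (1 / (norm p)\<^sup>2) *\<^sub>R outer_product p p)"
    using p by (intro mult_right_mono) auto
  finally show ?thesis using 1 by simp
qed

lemma measurable_phi_star_hessian [measurable]:
  "phi_star_hessian \<zeta> x \<in> borel_measurable borel"
proof -
  have "continuous_on UNIV (\<lambda>t :: real ^ 'd. outer_product t t)"
    unfolding outer_product_def by (intro continuous_intros)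
  then have [measurable]: "(\<lambda>t :: real ^ 'd. outer_product t t) \<in> borel_measurable borel"
    by (rule borel_measurable_continuous_onI)
  have "(\<lambda>t. if norm t \<le> \<zeta> x then mat 1
      else (\<zeta> x / norm t) *\<^sub>R (mat 1 - (1 / (norm t)\<^sup>2) *\<^sub>R outer_product t t)) \<in> borel_measurable borel"
    by measurable
  then show ?thesis unfolding phi_star_hessian_def[abs_def] .
qed

text \<open>Taking the quadratic form commutes with the matrix-valued integral in
  \<open>phi_star_hessian_mean\<close>.\<close>

lemma bounded_linear_quadratic_form: "bounded_linear (\<lambda>A :: real ^ 'd ^ 'd. (A *v w) \<bullet> w)"
proof -
  have "linear (\<lambda>A :: real ^ 'd ^ 'd. (A *v w) \<bullet> w)"
    by (rule linearI) (simp_all add: matrix_vector_mult_add_rdistrib inner_add_left scaleR_matrix_vector_assoc[symmetric])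
  then show ?thesis by (simp add: linear_linear)
qed

text \<open>Along the segment \<open>p\<close> from \<open>z\<close> to \<open>y\<close> the function \<open>F\<close> has derivative \<open>(1 - l)\<close>
  times the quadratic form of the Hessian, except where \<open>p\<close> meets the sphere of radius \<open>\<zeta>
  x\<close>. As \<open>F\<close> is continuous there and these parameters are among the roots of a quadratic
  polynomial, the fundamental theorem of calculus applies.\<close>

lemma phi_star_Taylor:
  fixes y z :: "real ^ 'd"
  assumes c: "0 < \<zeta> x"
  shows "(phi_star_hessian_mean \<zeta> x y z *v (y - z)) \<bullet> (y - z) =
    phi_star \<zeta> x y - phi_star \<zeta> x z - flux \<zeta> x z \<bullet> (y - z)"
proof (cases "y = z")
  case True then show ?thesis by simp
next
  case False
  define w where "w = y - z"
  have w: "w \<noteq> 0" using False by (simp add: w_def)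
  define p where "p l = l *\<^sub>R y + (1 - l) *\<^sub>R z" for l :: real
  have p: "p l = z + l *\<^sub>R w" for l by (simp add: p_def w_def algebra_simps)
  \<comment> \<open>The linearisation at \<open>p l\<close> in direction \<open>w\<close>, extrapolated to \<open>y\<close>: \<open>F 1 = \<phi>\<^sup>*(y)\<close>,
    and \<open>F 0\<close> is the linearisation at \<open>z\<close>.\<close>
  define F where "F l = (1 - l) * (flux \<zeta> x (p l) \<bullet> w) + phi_star \<zeta> x (p l)" for l
  define F' where "F' l = (1 - l) * ((phi_star_hessian \<zeta> x (p l) *v w) \<bullet> w)" for l
  define S where "S = {l. norm (p l) = \<zeta> x}"
  have "finite S"
  proof -
    define q where "q = [:z \<bullet> z - (\<zeta> x)\<^sup>2, 2 * (z \<bullet> w), w \<bullet> w:]"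
    have "q \<noteq> 0" using w by (simp add: q_def)
    then have "finite {l. poly q l = 0}" by (rule poly_roots_finite)
    moreover have "S \<subseteq> {l. poly q l = 0}"
    proof
      fix l assume "l \<in> S"
      then have "p l \<bullet> p l = (\<zeta> x)\<^sup>2" by (simp add: S_def power2_norm_eq_inner[symmetric])
      then show "l \<in> {l. poly q l = 0}"
        by (simp add: q_def p inner_add_left inner_add_right inner_commute algebra_simps)
    qed
    ultimately show ?thesis by (rule rev_finite_subset)
  qed
  have pc: "continuous_on A p" for A unfolding p by (intro continuous_intros)
  have pd: "(p has_vector_derivative w) (at l)" for l
    unfolding p has_vector_derivative_def by (auto intro!: derivative_eq_intros)
  have nd: "((\<lambda>l. norm (p l)) has_real_derivative (p l \<bullet> w) / norm (p l)) (at l)" if "p l \<noteq> 0" for l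
  proof -
    have "(p has_derivative (\<lambda>h. h *\<^sub>R w)) (at l)" using pd by (simp add: has_vector_derivative_def)
    from has_derivative_compose[OF this has_derivative_norm[OF that]]
    have "((\<lambda>l. norm (p l)) has_derivative (\<lambda>h. (h *\<^sub>R w) \<bullet> sgn (p l))) (at l)" .
    then show ?thesis
      by (rule has_derivative_imp_has_field_derivative)
        (simp add: sgn_div_norm inner_commute divide_inverse mult_ac)
  qed
  have id: "((\<lambda>l. p l \<bullet> w) has_real_derivative w \<bullet> w) (at l)" for l
    unfolding p inner_add_left inner_scaleR_left by (auto intro!: derivative_eq_intros)
  have sq: "((\<lambda>l. p l \<bullet> p l) has_real_derivative 2 * (p l \<bullet> w)) (at l)" for l
  proof -
    have "(\<lambda>l. p l \<bullet> p l) = (\<lambda>l. z \<bullet> z + 2 * l * (z \<bullet> w) + l\<^sup>2 * (w \<bullet> w))"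
      by (rule ext) (simp add: p inner_add_left inner_add_right inner_commute power2_eq_square algebra_simps)
    moreover have "((\<lambda>l. z \<bullet> z + 2 * l * (z \<bullet> w) + l\<^sup>2 * (w \<bullet> w)) has_real_derivative 2 * (p l \<bullet> w)) (at l)"
      by (auto intro!: derivative_eq_intros simp: p inner_add_left)
    ultimately show ?thesis by simp
  qed
  have np: "continuous_on A (\<lambda>l. norm (p l))" for A by (intro continuous_intros pc)
  have "(F' has_integral (F 1 - F 0)) {0..1}"
  proof (rule fundamental_theorem_of_calculus_interior_strong[OF \<open>finite S\<close>])
    show "continuous_on {0..1} F"
      unfolding F_def flux_def phi_star_min using c by (intro continuous_intros pc) auto
    fix l :: real assume l: "l \<in> {0<..<1} - S"
    consider "norm (p l) < \<zeta> x" | "\<zeta> x < norm (p l)" using l by (force simp: S_def)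
    then have "(F has_real_derivative F' l) (at l)"
    proof cases
      case 1
      have "open {l. norm (p l) < \<zeta> x}" by (intro open_Collect_less np continuous_on_const)
      then have ev: "\<forall>\<^sub>F k in nhds l. norm (p k) < \<zeta> x" using eventually_nhds_in_open 1 by fastforce
      have eq: "\<forall>\<^sub>F k in nhds l. F k = (1 - k) * (p k \<bullet> w) + 1/2 * (p k \<bullet> p k)"
        using ev by eventually_elim (simp add: F_def flux_cases[of \<zeta> x, OF c] phi_star_def power2_norm_eq_inner)
      have "((\<lambda>k. (1 - k) * (p k \<bullet> w) + 1/2 * (p k \<bullet> p k)) has_real_derivative F' l) (at l)"
        using 1 by (auto intro!: derivative_eq_intros id sq simp: F'_def phi_star_hessian_quadratic(1)[of \<zeta> x, OF c])
      then show ?thesis by (subst DERIV_cong_ev[OF refl eq refl])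
    next
      case 2
      have "open {l. \<zeta> x < norm (p l)}" by (intro open_Collect_less np continuous_on_const)
      then have ev: "\<forall>\<^sub>F k in nhds l. \<zeta> x < norm (p k)" using eventually_nhds_in_open 2 by fastforce
      have eq: "\<forall>\<^sub>F k in nhds l. F k = (1 - k) * (\<zeta> x * (p k \<bullet> w) / norm (p k)) + (\<zeta> x * norm (p k) - 1/2 * (\<zeta> x)\<^sup>2)"
        using ev by eventually_elim (simp add: F_def flux_cases[of \<zeta> x, OF c] phi_star_def)
      have p0: "p l \<noteq> 0" "norm (p l) \<noteq> 0" using 2 c by auto
      have "((\<lambda>k. (1 - k) * (\<zeta> x * (p k \<bullet> w) / norm (p k)) + (\<zeta> x * norm (p k) - 1/2 * (\<zeta> x)\<^sup>2)) has_real_derivative F' l) (at l)"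
        unfolding F'_def phi_star_hessian_quadratic(2)[of \<zeta> x, OF c 2]
        by (rule derivative_eq_intros id nd p0 refl)+
           (use p0 in \<open>simp add: field_simps power2_eq_square power3_eq_cube\<close>)
      then show ?thesis by (subst DERIV_cong_ev[OF refl eq refl])
    qed
    then show "(F has_vector_derivative F' l) (at l)" by (simp add: has_real_derivative_iff_has_vector_derivative)
  qed simp
  then have hi: "integral {0..1} F' = F 1 - F 0" by (rule integral_unique)
  define K where "K = norm (mat 1 :: real ^ 'd ^ 'd) + of_nat CARD('d)"
  define M where "M l = (1 - l) *\<^sub>R phi_star_hessian \<zeta> x (p l)" for l
  have [measurable]: "p \<in> borel_measurable borel" by (intro borel_measurable_continuous_onI pc)
  have Mi: "set_integrable lborel {0..1} M"
    unfolding set_integrable_def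
  proof (rule Bochner_Integration.integrable_bound)
    show "integrable lborel (\<lambda>l. indicator {0..1::real} l *\<^sub>R K)" by (intro borel_integrable_compact) auto
    show "(\<lambda>l. indicator {0..1} l *\<^sub>R M l) \<in> borel_measurable lborel" unfolding M_def by measurable
    show "AE l in lborel. norm (indicator {0..1} l *\<^sub>R M l) \<le> norm (indicator {0..1::real} l *\<^sub>R K)"
    proof (rule AE_I2)
      fix l :: real
      have K: "norm (phi_star_hessian \<zeta> x (p l)) \<le> K" "0 \<le> K"
        unfolding K_def by (rule norm_phi_star_hessian_le[of \<zeta> x, OF c]) simp
      show "norm (indicator {0..1} l *\<^sub>R M l) \<le> norm (indicator {0..1::real} l *\<^sub>R K)"
        using mult_mono[of "\<bar>1 - l\<bar>" 1 "norm (phi_star_hessian \<zeta> x (p l))" K] K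
        by (auto simp: M_def indicator_def)
    qed
  qed
  note bl = bounded_linear_quadratic_form[of w]
  have "(phi_star_hessian_mean \<zeta> x y z *v w) \<bullet> w = ((LINT l:{0..1}|lborel. M l) *v w) \<bullet> w"
    by (simp add: phi_star_hessian_mean_def M_def p_def)
  also have "\<dots> = (LINT l|lborel. ((indicator {0..1} l *\<^sub>R M l) *v w) \<bullet> w)"
    unfolding set_lebesgue_integral_def
    by (rule integral_bounded_linear[OF bl Mi[unfolded set_integrable_def], symmetric])
  also have "\<dots> = (LINT l:{0..1}|lborel. F' l)"
    unfolding set_lebesgue_integral_def
    by (intro Bochner_Integration.integral_cong refl) (simp add: M_def F'_def scaleR_matrix_vector_assoc[symmetric])
  also have "\<dots> = integral {0..1} F'"
  proof (rule set_borel_integral_eq_integral(2))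
    have "integrable lborel (\<lambda>l. ((indicator {0..1} l *\<^sub>R M l) *v w) \<bullet> w)"
      by (rule integrable_bounded_linear[OF bl Mi[unfolded set_integrable_def]])
    then show "set_integrable lborel {0..1} F'"
      unfolding set_integrable_def by (simp add: M_def F'_def scaleR_matrix_vector_assoc[symmetric] mult.assoc)
  qed
  also have "\<dots> = phi_star \<zeta> x y - phi_star \<zeta> x z - flux \<zeta> x z \<bullet> w"
    unfolding hi by (simp add: F_def p_def)
  finally show ?thesis by (simp add: w_def)
qed

section \<open>A Hahn--Banach theorem with a convex majorant on a convex set\<close>

text \<open>Pointwise operations make the bounded fields a subspace of a real vector space, so
  that the Hahn--Banach theorem applies to them.\<close>

instantiation "fun" :: (type, real_vector) real_vector
begin

definition scaleR_fun :: "real \<Rightarrow> ('a \<Rightarrow> 'b) \<Rightarrow> 'a \<Rightarrow> 'b" where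
  "scaleR_fun c f = (\<lambda>x. c *\<^sub>R f x)"

instance
  by standard (simp_all add: scaleR_fun_def plus_fun_def fun_eq_iff algebra_simps)

end

text \<open>The two points \<open>m - s x\<^sub>0\<close> and \<open>m' + t x\<^sub>0\<close> have a convex combination in which
  \<open>x\<^sub>0\<close> cancels, so the bound on \<open>M\<close> and convexity of \<open>p\<close> separate the lower from the upper
  slopes in direction \<open>x\<^sub>0\<close>.\<close>

lemma convex_combination_separation:
  fixes p :: "'v::real_vector \<Rightarrow> real"
  assumes M: "subspace M"
    and C: "convex C" and p: "convex_on C p"
    and le: "\<And>x a. (x, a) \<in> M \<Longrightarrow> x \<in> C \<Longrightarrow> a \<le> p x"
    and 1: "(m, a) \<in> M" "0 < s" "m - s *\<^sub>R x0 \<in> C"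
    and 2: "(m', a') \<in> M" "0 < t" "m' + t *\<^sub>R x0 \<in> C"
  shows "(a - p (m - s *\<^sub>R x0)) / s \<le> (p (m' + t *\<^sub>R x0) - a') / t"
proof -
  define \<alpha> \<beta> where "\<alpha> = t / (s + t)" and "\<beta> = s / (s + t)"
  have ab: "0 \<le> \<alpha>" "0 \<le> \<beta>" "\<alpha> + \<beta> = 1"
    using 1(2) 2(2) by (auto simp: \<alpha>_def \<beta>_def add_divide_distrib[symmetric])
  have eq: "\<alpha> *\<^sub>R (m - s *\<^sub>R x0) + \<beta> *\<^sub>R (m' + t *\<^sub>R x0) = \<alpha> *\<^sub>R m + \<beta> *\<^sub>R m'"
  proof -
    have "\<alpha> * s = \<beta> * t" by (simp add: \<alpha>_def \<beta>_def)
    then show ?thesis by (simp add: scaleR_diff_right scaleR_add_right)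
  qed
  have inM: "(\<alpha> *\<^sub>R m + \<beta> *\<^sub>R m', \<alpha> * a + \<beta> * a') \<in> M"
    using subspace_add[OF M subspace_scale[OF M 1(1), of \<alpha>] subspace_scale[OF M 2(1), of \<beta>]]
    by simp
  have inC: "\<alpha> *\<^sub>R m + \<beta> *\<^sub>R m' \<in> C"
    using convexD[OF C 1(3) 2(3) ab] eq by simp
  have "\<alpha> * a + \<beta> * a' \<le> p (\<alpha> *\<^sub>R (m - s *\<^sub>R x0) + \<beta> *\<^sub>R (m' + t *\<^sub>R x0))"
    using le[OF inM inC] eq by simp
  also have "\<dots> \<le> \<alpha> * p (m - s *\<^sub>R x0) + \<beta> * p (m' + t *\<^sub>R x0)"
    using p 1(3) 2(3) ab unfolding convex_on_def by blast
  finally have "\<alpha> * (a - p (m - s *\<^sub>R x0)) \<le> \<beta> * (p (m' + t *\<^sub>R x0) - a')"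
    by (simp add: algebra_simps)
  then have "t * (a - p (m - s *\<^sub>R x0)) \<le> s * (p (m' + t *\<^sub>R x0) - a')"
    using 1(2) 2(2) by (simp add: \<alpha>_def \<beta>_def divide_simps split: if_splits)
  then show ?thesis using 1(2) 2(2) by (simp add: field_simps)
qed

text \<open>A partial linear functional is represented by its graph \<open>M\<close>, a subspace of \<open>'v \<times>
  real\<close>. Zorn's lemma gives a maximal graph below the majorant, and
  \<open>convex_combination_separation\<close> leaves room for a value at each further point. Every graph
  below the majorant is single-valued, since a nonzero value over \<open>0 \<in> C\<close> could be scaled
  beyond \<open>p 0\<close>.\<close>

lemma Hahn_Banach_convex_majorant:
  fixes p :: "'v::real_vector \<Rightarrow> real"
  assumes V: "subspace V" and CV: "C \<subseteq> V"
    and C: "convex C" and p: "convex_on C p"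
    and absorbing: "\<And>x. x \<in> V \<Longrightarrow> \<exists>t>0. t *\<^sub>R x \<in> C"
    and M: "subspace M" "fst ` M \<subseteq> V"
    and le: "\<And>x a. (x, a) \<in> M \<Longrightarrow> x \<in> C \<Longrightarrow> a \<le> p x"
  obtains l where "\<And>x y. x \<in> V \<Longrightarrow> y \<in> V \<Longrightarrow> l (x + y) = l x + l y"
    and "\<And>c x. x \<in> V \<Longrightarrow> l (c *\<^sub>R x) = c * l x"
    and "\<And>x. x \<in> C \<Longrightarrow> l x \<le> p x"
    and "\<And>x a. (x, a) \<in> M \<Longrightarrow> l x = a"
proof -
  define \<G> where "\<G> = {N :: ('v \<times> real) set. subspace N \<and> fst ` N \<subseteq> V \<and> M \<subseteq> N \<and>
      (\<forall>x a. (x, a) \<in> N \<longrightarrow> x \<in> C \<longrightarrow> a \<le> p x)}"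
  have "\<exists>N\<in>\<G>. \<forall>X\<in>\<G>. N \<subseteq> X \<longrightarrow> X = N"
  proof (rule subset_Zorn_nonempty)
    show "\<G> \<noteq> {}" using M le by (auto simp: \<G>_def)
    fix \<C> assume "\<C> \<noteq> {}" and ch: "subset.chain \<G> \<C>"
    then have sub: "\<C> \<subseteq> \<G>" and tot: "\<And>X Y. X \<in> \<C> \<Longrightarrow> Y \<in> \<C> \<Longrightarrow> X \<subseteq> Y \<or> Y \<subseteq> X"
      by (auto simp: subset_chain_def)
    have subG: "subspace X" "M \<subseteq> X" "fst ` X \<subseteq> V" "\<forall>x a. (x, a) \<in> X \<longrightarrow> x \<in> C \<longrightarrow> a \<le> p x"
      if "X \<in> \<C>" for X using sub that unfolding \<G>_def by blast+
    have "subspace (\<Union>\<C>)"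
    proof (rule subspaceI)
      obtain X where "X \<in> \<C>" using \<open>\<C> \<noteq> {}\<close> by blast
      then have "0 \<in> X" using subG subspace_0 by blast
      then show "0 \<in> \<Union>\<C>" using \<open>X \<in> \<C>\<close> by blast
      fix x y assume "x \<in> \<Union>\<C>" "y \<in> \<Union>\<C>"
      then obtain X Y where XY: "X \<in> \<C>" "Y \<in> \<C>" "x \<in> X" "y \<in> Y" by auto
      then obtain Z where "Z \<in> \<C>" "x \<in> Z" "y \<in> Z" using tot[of X Y] by blast
      then have "x + y \<in> Z" using subG(1) subspace_add by blast
      then show "x + y \<in> \<Union>\<C>" using \<open>Z \<in> \<C>\<close> by auto
    next
      fix c x assume "x \<in> \<Union>\<C>"
      then obtain X where X: "X \<in> \<C>" "x \<in> X" by auto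
      then have "c *\<^sub>R x \<in> X" using subG(1) subspace_scale[of X x c] by blast
      then show "c *\<^sub>R x \<in> \<Union>\<C>" using X by auto
    qed
    moreover have "M \<subseteq> \<Union>\<C>" using \<open>\<C> \<noteq> {}\<close> subG(2) by blast
    moreover have "fst ` \<Union>\<C> \<subseteq> V" using subG(3) by blast
    moreover have "\<forall>x a. (x, a) \<in> \<Union>\<C> \<longrightarrow> x \<in> C \<longrightarrow> a \<le> p x" using subG(4) by blast
    ultimately show "\<Union>\<C> \<in> \<G>" unfolding \<G>_def by blast
  qed
  then obtain N where N: "N \<in> \<G>" and max: "\<And>X. X \<in> \<G> \<Longrightarrow> N \<subseteq> X \<Longrightarrow> X = N" by blast
  have sN: "subspace N" and NV: "fst ` N \<subseteq> V" and MN: "M \<subseteq> N"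
    and leN: "\<And>x a. (x, a) \<in> N \<Longrightarrow> x \<in> C \<Longrightarrow> a \<le> p x"
    using N by (auto simp: \<G>_def)
  have 0: "0 \<in> C" using absorbing[OF subspace_0[OF V]] by auto
  have zero: "a = 0" if "(0, a) \<in> N" for a
  proof (rule ccontr)
    assume "a \<noteq> 0"
    have "(0, (\<bar>p 0\<bar> + 1) / a * a) \<in> N"
      using subspace_scale[OF sN that, of "(\<bar>p 0\<bar> + 1) / a"] by simp
    from leN[OF this 0] \<open>a \<noteq> 0\<close> show False by simp
  qed
  have uniq: "a = b" if "(x, a) \<in> N" "(x, b) \<in> N" for x a b
    using zero[of "a - b"] subspace_diff[OF sN that] by simp
  have dom: "\<exists>a. (x0, a) \<in> N" if x0: "x0 \<in> V" for x0
  proof -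
    \<comment> \<open>The value at \<open>x0\<close> must lie above all of \<open>L\<close> and below all of \<open>U\<close> to respect the
      majorant on \<open>m - s *\<^sub>R x0\<close> and \<open>m + s *\<^sub>R x0\<close>.\<close>
    define L where "L = {(a - p (m - s *\<^sub>R x0)) / s | m a s. (m, a) \<in> N \<and> 0 < s \<and> m - s *\<^sub>R x0 \<in> C}"
    define U where "U = {(p (m + s *\<^sub>R x0) - a) / s | m a s. (m, a) \<in> N \<and> 0 < s \<and> m + s *\<^sub>R x0 \<in> C}"
    have LU: "l \<le> u" if "l \<in> L" "u \<in> U" for l u
      using that convex_combination_separation[OF sN C p leN] unfolding L_def U_def by force
    have 00: "(0, 0) \<in> N" using subspace_0[OF sN] by (simp add: zero_prod_def)
    obtain s where s: "0 < s" "s *\<^sub>R x0 \<in> C" using absorbing[OF x0] by auto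
    then have "0 + s *\<^sub>R x0 \<in> C" by simp
    with s 00 have "U \<noteq> {}" unfolding U_def by blast
    obtain t where t: "0 < t" "t *\<^sub>R (- x0) \<in> C" using absorbing[OF subspace_neg[OF V x0]] by auto
    then have "0 - t *\<^sub>R x0 \<in> C" by simp
    with t 00 have "L \<noteq> {}" unfolding L_def by blast
    define \<gamma> where "\<gamma> = Sup L"
    obtain u0 where "u0 \<in> U" using \<open>U \<noteq> {}\<close> by blast
    then have "bdd_above L" using LU by (intro bdd_aboveI[of L u0])
    then have Lg: "l \<le> \<gamma>" if "l \<in> L" for l
      unfolding \<gamma>_def using that by (intro cSup_upper)
    have gU: "\<gamma> \<le> u" if "u \<in> U" for u
      unfolding \<gamma>_def using that \<open>L \<noteq> {}\<close> LU by (intro cSup_least) auto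
    define N' where "N' = {(m + s *\<^sub>R x0, a + s * \<gamma>) | m a s. (m, a) \<in> N}"
    have "subspace N'"
    proof (rule subspaceI)
      show "0 \<in> N'" unfolding N'_def using 00
        by (intro CollectI exI[of _ 0] exI[of _ "0::real"]) (simp add: zero_prod_def)
    next
      fix x y assume "x \<in> N'" "y \<in> N'"
      then obtain m a s m' a' s' where "x = (m + s *\<^sub>R x0, a + s * \<gamma>)" "(m, a) \<in> N"
          "y = (m' + s' *\<^sub>R x0, a' + s' * \<gamma>)" "(m', a') \<in> N" by (auto simp: N'_def)
      moreover from this have "(m + m', a + a') \<in> N" using subspace_add[OF sN] by fastforce
      ultimately show "x + y \<in> N'" unfolding N'_def
        by (intro CollectI exI[of _ "m + m'"] exI[of _ "a + a'"] exI[of _ "s + s'"]) (simp add: algebra_simps)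
    next
      fix c x assume "x \<in> N'"
      then obtain m a s where "x = (m + s *\<^sub>R x0, a + s * \<gamma>)" "(m, a) \<in> N" by (auto simp: N'_def)
      moreover from this have "(c *\<^sub>R m, c * a) \<in> N" using subspace_scale[OF sN, of "(m, a)" c] by simp
      ultimately show "c *\<^sub>R x \<in> N'" unfolding N'_def
        by (intro CollectI exI[of _ "c *\<^sub>R m"] exI[of _ "c * a"] exI[of _ "c * s"]) (simp add: algebra_simps)
    qed
    moreover have "fst ` N' \<subseteq> V"
    proof
      fix x assume "x \<in> fst ` N'"
      then obtain m a s where "x = m + s *\<^sub>R x0" "(m, a) \<in> N" by (auto simp: N'_def)
      then show "x \<in> V" using NV x0 by (force intro!: subspace_add[OF V] subspace_scale[OF V])
    qed
    moreover have NN': "N \<subseteq> N'"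
    proof (rule subrelI)
      fix m a assume "(m, a) \<in> N"
      then show "(m, a) \<in> N'" unfolding N'_def
        by (intro CollectI exI[of _ m] exI[of _ a] exI[of _ "0::real"]) simp
    qed
    moreover have "b \<le> p x" if xN: "(x, b) \<in> N'" and xC: "x \<in> C" for x b
    proof -
      obtain m a s where x: "x = m + s *\<^sub>R x0" "b = a + s * \<gamma>" and ma: "(m, a) \<in> N"
        using xN by (auto simp: N'_def)
      consider "s = 0" | "0 < s" | "s < 0" by linarith
      then show ?thesis
      proof cases
        case 1 then show ?thesis using leN ma x xC by simp
      next
        case 2
        then have "\<gamma> \<le> (p (m + s *\<^sub>R x0) - a) / s"
          using ma xC x by (intro gU) (auto simp: U_def)
        then show ?thesis using 2 x by (simp add: field_simps)
      next
        case 3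
        then have "(a - p (m - (-s) *\<^sub>R x0)) / (-s) \<le> \<gamma>"
          unfolding L_def using ma xC x
          by (intro Lg[unfolded L_def] CollectI exI[of _ m] exI[of _ a] exI[of _ "-s"]) simp
        then show ?thesis using 3 x by (simp add: field_simps)
      qed
    qed
    ultimately have "N' \<in> \<G>" using MN by (auto simp: \<G>_def)
    from max[OF this NN'] have "N' = N" .
    moreover have "(0 + 1 *\<^sub>R x0, 0 + 1 * \<gamma>) \<in> N'" unfolding N'_def using 00 by blast
    ultimately show ?thesis by auto
  qed
  define l where "l x = (THE a. (x, a) \<in> N)" for x
  have l: "l x = a" if "(x, a) \<in> N" for x a
    unfolding l_def using that uniq by blast
  have lN: "(x, l x) \<in> N" if "x \<in> V" for x
    using dom[OF that] l by auto
  show thesis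
  proof
    show "l (x + y) = l x + l y" if "x \<in> V" "y \<in> V" for x y
      using subspace_add[OF sN lN[OF that(1)] lN[OF that(2)]] by (intro l) simp
    show "l (c *\<^sub>R x) = c * l x" if "x \<in> V" for c x
      using subspace_scale[OF sN lN[OF that], of c] by (intro l) simp
    show "l x \<le> p x" if "x \<in> C" for x
      using leN[OF lN that] that CV by auto
    show "l x = a" if "(x, a) \<in> M" for x a
      using that MN by (intro l) auto
  qed
qed

section \<open>Existence of a multiplier\<close>

locale gradient_constrained_problem = bounded_Lipschitz_domain \<Omega>
  for \<Omega> :: "'a::euclidean_space set" +
  fixes \<Gamma>D \<Gamma>N :: "'a set" and f \<zeta> uD uhat :: "'a \<Rightarrow> real" and g :: "('a \<Rightarrow> real) \<Rightarrow> real"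
  assumes \<Gamma>D: "\<Gamma>D \<subseteq> frontier \<Omega>" and \<Gamma>N: "\<Gamma>N \<subseteq> frontier \<Omega>"
    and f: "integrable (lebesgue_on \<Omega>) f" and g: "g \<in> W1inf_surface_dual \<Gamma>N"
    and \<zeta>: "\<zeta> \<in> Linf \<Omega>" and \<zeta>_lower: "\<exists>c>0. AE x in lebesgue_on \<Omega>. c \<le> \<zeta> x"
    and uhat: "uhat \<in> W1inf \<Omega>" "surface_ae \<Gamma>D (\<lambda>x. boundary_trace \<Omega> uhat x = uD x)"
    and uhat_strict: "esssup (lebesgue_on \<Omega>) (\<lambda>x. ereal (norm (grad \<Omega> uhat x /\<^sub>R \<zeta> x))) < 1"
begin

abbreviation "M \<equiv> lebesgue_on \<Omega>"
abbreviation "K \<equiv> primal_set \<Omega> \<Gamma>D \<zeta> uD"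

definition energy :: "('a \<Rightarrow> real) \<Rightarrow> real" where
  "energy v = 1/2 * (LINT x|M. (norm (grad \<Omega> v x))\<^sup>2) - load \<Omega> f g v"

lemma \<zeta>_measurable [measurable]: "\<zeta> \<in> borel_measurable M" using \<zeta> by blast

lemma \<zeta>_pos: "AE x in M. 0 < \<zeta> x"
proof -
  obtain c where c: "0 < c" "AE x in M. c \<le> \<zeta> x" using \<zeta>_lower by blast
  from c(2) show ?thesis by eventually_elim (use c(1) in simp)
qed

lemma \<zeta>_nonneg: "AE x in M. 0 \<le> \<zeta> x"
  using \<zeta>_pos by eventually_elim simp

text \<open>Strict admissibility is relative to \<open>\<zeta>\<close>; the positive lower bound on \<open>\<zeta>\<close> turns it
  into an absolute margin. It is the Slater condition behind \<open>multiplier\<close>.\<close>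

lemma slack: obtains \<delta> where "0 < \<delta>" "AE x in M. norm (grad \<Omega> uhat x) + \<delta> \<le> \<zeta> x"
proof -
  obtain c where c: "0 < c" "AE x in M. c \<le> \<zeta> x" using \<zeta>_lower by blast
  let ?s = "esssup M (\<lambda>x. ereal (norm (grad \<Omega> uhat x /\<^sub>R \<zeta> x)))"
  obtain e where e: "?s < ereal e" "ereal e < 1" using ereal_dense2[OF uhat_strict] by blast
  have e1: "0 < 1 - e" using e(2) by simp
  have "AE x in M. ereal (norm (grad \<Omega> uhat x /\<^sub>R \<zeta> x)) \<le> ?s" by (rule esssup_AE)
  then have "AE x in M. norm (grad \<Omega> uhat x) + (1 - e) * c \<le> \<zeta> x"
    using c(2)
  proof eventually_elim
    fix x assume "ereal (norm (grad \<Omega> uhat x /\<^sub>R \<zeta> x)) \<le> ?s" and cx: "c \<le> \<zeta> x"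
    then have "ereal (norm (grad \<Omega> uhat x /\<^sub>R \<zeta> x)) \<le> ereal e" using e(1) by (meson less_imp_le order_trans)
    then have "norm (grad \<Omega> uhat x) \<le> e * \<zeta> x" using cx c(1) by (simp add: divide_le_eq field_simps)
    moreover have "(1 - e) * c \<le> (1 - e) * \<zeta> x" using cx e1 by (intro mult_left_mono) auto
    ultimately show "norm (grad \<Omega> uhat x) + (1 - e) * c \<le> \<zeta> x" by (simp add: left_diff_distrib)
  qed
  moreover have "0 < (1 - e) * c" using e1 c(1) by simp
  ultimately show thesis using that by blast
qed

lemmas load_add = load_add_cmult[OF f g \<Gamma>N]

lemma W1inf_D_D: "w \<in> W1inf_D \<Omega> \<Gamma>D \<Longrightarrow> w \<in> W1inf \<Omega>"
  "w \<in> W1inf_D \<Omega> \<Gamma>D \<Longrightarrow> surface_ae \<Gamma>D (\<lambda>x. boundary_trace \<Omega> w x = 0)"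
  by (simp_all add: W1inf_D_def)

lemma W1inf_D_I:
  assumes "v \<in> W1inf \<Omega>" "w \<in> W1inf \<Omega>"
    and "surface_ae \<Gamma>D (\<lambda>x. boundary_trace \<Omega> v x = a x)" "surface_ae \<Gamma>D (\<lambda>x. boundary_trace \<Omega> w x = b x)"
    and "\<And>x. a x + c * b x = 0"
  shows "(\<lambda>x. v x + c * w x) \<in> W1inf_D \<Omega> \<Gamma>D"
  using surface_ae_trace_add_cmult[OF assms(1,2) \<Gamma>D assms(3,4), of c] W1inf_add_cmult[OF assms(1,2), of c]
  unfolding W1inf_D_def assms(5) by simp

text \<open>Feasibility only concerns functions that vanish on \<open>\<Gamma>D\<close>, such as the difference of
  two functions with the same boundary values.\<close>

lemma dual_pairing_diff:
  assumes \<nu>: "\<nu> \<in> dual_set \<Omega> \<Gamma>D f g" and v: "v \<in> W1inf \<Omega>" "surface_ae \<Gamma>D (\<lambda>x. boundary_trace \<Omega> v x = uD x)"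
    and w: "w \<in> W1inf \<Omega>" "surface_ae \<Gamma>D (\<lambda>x. boundary_trace \<Omega> w x = uD x)"
  shows "ba_integral \<Omega> \<nu> (grad \<Omega> v) - ba_integral \<Omega> \<nu> (grad \<Omega> w) = load \<Omega> f g v - load \<Omega> f g w"
proof -
  have ba: "\<nu> \<in> ba \<Omega>" and eq: "\<And>v. v \<in> W1inf_D \<Omega> \<Gamma>D \<Longrightarrow> ba_integral \<Omega> \<nu> (grad \<Omega> v) = load \<Omega> f g v"
    using \<nu> unfolding dual_set_def by blast+
  let ?d = "\<lambda>x. v x + - 1 * w x"
  have d: "?d \<in> W1inf_D \<Omega> \<Gamma>D" by (rule W1inf_D_I[OF v(1) w(1) v(2) w(2)]) simp
  have "ba_integral \<Omega> \<nu> (grad \<Omega> v) - ba_integral \<Omega> \<nu> (grad \<Omega> w) = ba_integral \<Omega> \<nu> (\<lambda>x. grad \<Omega> v x - grad \<Omega> w x)"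
    by (rule ba_integral_diff[OF ba W1inf_grad(1)[OF v(1)] W1inf_grad(1)[OF w(1)], symmetric])
  also have "\<dots> = ba_integral \<Omega> \<nu> (grad \<Omega> ?d)"
  proof (rule ba_integral_AE_cong[OF ba])
    show "(\<lambda>x. grad \<Omega> v x - grad \<Omega> w x) \<in> Linf \<Omega>" by (intro Linf_diff W1inf_grad v w)
    show "grad \<Omega> ?d \<in> Linf \<Omega>" by (intro W1inf_grad W1inf_D_D(1) d)
    show "AE x in M. grad \<Omega> v x - grad \<Omega> w x = grad \<Omega> ?d x"
      using grad_add_cmult[OF v(1) w(1), of "- 1"] by eventually_elim simp
  qed
  also have "\<dots> = load \<Omega> f g ?d" by (rule eq[OF d])
  also have "\<dots> = load \<Omega> f g v + - 1 * load \<Omega> f g w" by (rule load_add[OF v(1) w(1)])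
  finally show ?thesis by simp
qed

lemma integrable_norm_square:
  "G \<in> Linf \<Omega> \<Longrightarrow> integrable M (\<lambda>x. (norm (G x))\<^sup>2)" for G :: "'a \<Rightarrow> 'a"
  using integrable_inner_Linf[OF Linf_integrable, of G G] by (simp add: power2_norm_eq_inner)

lemma subspaceI_combination:
  assumes "S \<noteq> {}" and comb: "\<And>x y c. x \<in> S \<Longrightarrow> y \<in> S \<Longrightarrow> x + c *\<^sub>R y \<in> S"
  shows "subspace (S :: 'b::real_vector set)"
proof (rule subspaceI)
  obtain x where x: "x \<in> S" using assms(1) by blast
  show "0 \<in> S" using comb[OF x x, of "-1"] by simp
  show "x + y \<in> S" if "x \<in> S" "y \<in> S" for x y using comb[OF that, of 1] by simp
  show "c *\<^sub>R x \<in> S" if "x \<in> S" for c x using comb[OF that that, of "c - 1"] by (simp add: scaleR_diff_left)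
qed

text \<open>The functional is extended from the subspace of gradients by
  \<open>Hahn_Banach_convex_majorant\<close>. The graph \<open>L\<close> contains every representative \<open>G\<close> of a
  gradient, since fields are functions and not equivalence classes. The admissible set \<open>C\<close>
  contains the ball of radius \<open>\<delta>\<close> and the majorant is at most \<open>N\<close> on it, which gives the
  bound \<open>N / \<delta>\<close> for the extension.\<close>

lemma multiplier:
  assumes u: "u \<in> K" and min: "\<And>v. v \<in> K \<Longrightarrow> energy u \<le> energy v"
  obtains \<nu> where "\<nu> \<in> dual_set \<Omega> \<Gamma>D f g"
    and "\<And>H. H \<in> Linf \<Omega> \<Longrightarrow> AE x in M. norm (H x) \<le> \<zeta> x \<Longrightarrow>
      ba_integral \<Omega> \<nu> H - 1/2 * (LINT x|M. (norm (H x))\<^sup>2) \<le>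
      ba_integral \<Omega> \<nu> (grad \<Omega> uhat) - load \<Omega> f g uhat - energy u"
proof -
  let ?U = "grad \<Omega> uhat"
  define V :: "('a \<Rightarrow> 'a) set" where "V = Linf \<Omega>"
  define C where "C = {G \<in> V. AE x in M. norm (?U x + G x) \<le> \<zeta> x}"
  define p where "p G = 1/2 * (LINT x|M. (norm (?U x + G x))\<^sup>2) - load \<Omega> f g uhat - energy u" for G
  define L where "L = {(G, load \<Omega> f g w) | G w. w \<in> W1inf_D \<Omega> \<Gamma>D \<and> G \<in> V \<and> weak_gradient \<Omega> w G}"
  have Ug: "?U \<in> Linf \<Omega>" by (rule W1inf_grad[OF uhat(1)])
  have uW: "u \<in> W1inf \<Omega>" "surface_ae \<Gamma>D (\<lambda>x. boundary_trace \<Omega> u x = uD x)"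
    using u by (auto simp: primal_set_def)
  obtain \<delta> where \<delta>: "0 < \<delta>" "AE x in M. norm (?U x) + \<delta> \<le> \<zeta> x" using slack by blast
  have sV: "subspace V"
    by (rule subspaceI) (auto simp: V_def plus_fun_def scaleR_fun_def zero_fun_def intro: Linf_add Linf_scaleR)
  have intp: "integrable M (\<lambda>x. (norm (?U x + G x))\<^sup>2)" if "G \<in> V" for G
    using that by (intro integrable_norm_square Linf_add Ug) (simp add: V_def)
  have norm_comb: "?U x + ((1 - t) *\<^sub>R G + t *\<^sub>R H) x = (1 - t) *\<^sub>R (?U x + G x) + t *\<^sub>R (?U x + H x)" for t x and G H :: "'a \<Rightarrow> 'a"
    by (simp add: plus_fun_def scaleR_fun_def algebra_simps)
  have cC: "convex C"
    unfolding convex_alt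
  proof (intro ballI allI impI)
    fix G H and t :: real assume GH: "G \<in> C" "H \<in> C" and t: "0 \<le> t \<and> t \<le> 1"
    have "(1 - t) *\<^sub>R G + t *\<^sub>R H \<in> V"
      using GH by (intro subspace_add[OF sV] subspace_scale[OF sV]) (auto simp: C_def)
    moreover have "AE x in M. norm (?U x + ((1 - t) *\<^sub>R G + t *\<^sub>R H) x) \<le> \<zeta> x"
    proof -
      have "AE x in M. norm (?U x + G x) \<le> \<zeta> x" "AE x in M. norm (?U x + H x) \<le> \<zeta> x"
        using GH by (auto simp: C_def)
      then show ?thesis
      proof eventually_elim
        fix x assume x: "norm (?U x + G x) \<le> \<zeta> x" "norm (?U x + H x) \<le> \<zeta> x"
        have "?U x + G x \<in> cball 0 (\<zeta> x)" "?U x + H x \<in> cball 0 (\<zeta> x)" using x by simp_all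
        then have "(1 - t) *\<^sub>R (?U x + G x) + t *\<^sub>R (?U x + H x) \<in> cball 0 (\<zeta> x)"
          using t by (intro convexD[OF convex_cball]) auto
        then show "norm (?U x + ((1 - t) *\<^sub>R G + t *\<^sub>R H) x) \<le> \<zeta> x" unfolding norm_comb by simp
      qed
    qed
    ultimately show "(1 - t) *\<^sub>R G + t *\<^sub>R H \<in> C" by (simp add: C_def)
  qed
  have pC: "convex_on C p"
  proof (rule convex_onI[OF _ cC])
    fix t :: real and G H assume t: "0 < t" "t < 1" and GH: "G \<in> C" "H \<in> C"
    then have V: "G \<in> V" "H \<in> V" "(1 - t) *\<^sub>R G + t *\<^sub>R H \<in> V"
      using cC by (auto simp: C_def intro!: subspace_add[OF sV] subspace_scale[OF sV])
    have "(LINT x|M. (norm (?U x + ((1 - t) *\<^sub>R G + t *\<^sub>R H) x))\<^sup>2) \<le>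
        (LINT x|M. (1 - t) * (norm (?U x + G x))\<^sup>2 + t * (norm (?U x + H x))\<^sup>2)"
    proof (rule integral_mono[OF intp[OF V(3)]])
      show "integrable M (\<lambda>x. (1 - t) * (norm (?U x + G x))\<^sup>2 + t * (norm (?U x + H x))\<^sup>2)"
        using intp[OF V(1)] intp[OF V(2)] by simp
      fix x
      have "norm ((1 - t) *\<^sub>R (?U x + G x) + t *\<^sub>R (?U x + H x)) \<le> (1 - t) * norm (?U x + G x) + t * norm (?U x + H x)"
        using norm_triangle_ineq[of "(1 - t) *\<^sub>R (?U x + G x)" "t *\<^sub>R (?U x + H x)"] t by simp
      then have "(norm ((1 - t) *\<^sub>R (?U x + G x) + t *\<^sub>R (?U x + H x)))\<^sup>2 \<le> ((1 - t) * norm (?U x + G x) + t * norm (?U x + H x))\<^sup>2"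
        by (intro power_mono) auto
      also have "\<dots> \<le> (1 - t) * (norm (?U x + G x))\<^sup>2 + t * (norm (?U x + H x))\<^sup>2"
      proof -
        have "(1 - t) * a\<^sup>2 + t * b\<^sup>2 - ((1 - t) * a + t * b)\<^sup>2 = t * (1 - t) * (a - b)\<^sup>2" for a b :: real
          by (simp add: power2_eq_square algebra_simps)
        moreover have "0 \<le> t * (1 - t) * (a - b)\<^sup>2" for a b :: real using t by simp
        ultimately show ?thesis by (metis diff_ge_0_iff_ge)
      qed
      finally show "(norm (?U x + ((1 - t) *\<^sub>R G + t *\<^sub>R H) x))\<^sup>2 \<le> (1 - t) * (norm (?U x + G x))\<^sup>2 + t * (norm (?U x + H x))\<^sup>2"
        unfolding norm_comb .
    qed
    also have "\<dots> = (1 - t) * (LINT x|M. (norm (?U x + G x))\<^sup>2) + t * (LINT x|M. (norm (?U x + H x))\<^sup>2)"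
      using intp[OF V(1)] intp[OF V(2)] by simp
    finally have le: "(LINT x|M. (norm (?U x + ((1 - t) *\<^sub>R G + t *\<^sub>R H) x))\<^sup>2) \<le> \<dots>" .
    have "1/2 * X - a - b \<le> (1 - t) * (1/2 * Y - a - b) + t * (1/2 * Z - a - b)"
      if "X \<le> (1 - t) * Y + t * Z" for X Y Z a b :: real
    proof -
      have eq: "(1 - t) * (1/2 * Y - a - b) + t * (1/2 * Z - a - b) = 1/2 * ((1 - t) * Y + t * Z) - a - b"
        by (simp add: field_simps)
      show ?thesis unfolding eq by (intro diff_right_mono mult_left_mono that) simp
    qed
    from this[OF le] show "p ((1 - t) *\<^sub>R G + t *\<^sub>R H) \<le> (1 - t) * p G + t * p H" unfolding p_def .
  qed
  have small: "G \<in> C" if "G \<in> V" "AE x in M. norm (G x) \<le> \<delta>" for G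
    unfolding C_def
  proof (rule CollectI, rule conjI[OF that(1)])
    show "AE x in M. norm (?U x + G x) \<le> \<zeta> x"
      using that(2) \<delta>(2)
    proof eventually_elim
      fix x assume "norm (G x) \<le> \<delta>" "norm (?U x) + \<delta> \<le> \<zeta> x"
      then show "norm (?U x + G x) \<le> \<zeta> x" using norm_triangle_ineq[of "?U x" "G x"] by linarith
    qed
  qed
  have absorbing: "\<exists>t>0. t *\<^sub>R G \<in> C" if GV: "G \<in> V" for G
  proof -
    obtain B where B: "0 \<le> B" "AE x in M. norm (G x) \<le> B" using GV unfolding V_def by (rule Linf_boundE)
    \<comment> \<open>The summand \<open>1\<close> covers \<open>B = 0\<close>.\<close>
    define t where "t = \<delta> / (B + 1)"
    have t: "0 < t" "t * B \<le> \<delta>"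
      using \<delta>(1) B(1) mult_left_mono[of B "B + 1" \<delta>] by (simp_all add: t_def divide_le_eq)
    have "AE x in M. norm ((t *\<^sub>R G) x) \<le> \<delta>"
      using B(2)
    proof eventually_elim
      fix x assume "norm (G x) \<le> B"
      then have "t * norm (G x) \<le> t * B" using t(1) by (intro mult_left_mono) auto
      moreover have "norm ((t *\<^sub>R G) x) = t * norm (G x)" using t(1) by (simp add: scaleR_fun_def)
      ultimately show "norm ((t *\<^sub>R G) x) \<le> \<delta>" using t(2) by linarith
    qed
    then have "t *\<^sub>R G \<in> C" using GV by (intro small subspace_scale[OF sV])
    with t(1) show ?thesis by blast
  qed
  have sL: "subspace L"
  proof (rule subspaceI_combination)
    have d: "(\<lambda>x. u x + - 1 * uhat x) \<in> W1inf_D \<Omega> \<Gamma>D" by (rule W1inf_D_I[OF uW(1) uhat(1) uW(2) uhat(2)]) simp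
    then have "(grad \<Omega> (\<lambda>x. u x + - 1 * uhat x), load \<Omega> f g (\<lambda>x. u x + - 1 * uhat x)) \<in> L"
      unfolding L_def V_def using W1inf_grad[OF W1inf_D_D(1)[OF d]] by blast
    then show "L \<noteq> {}" by blast
    fix P Q c assume "P \<in> L" "Q \<in> L"
    then obtain G w H v where P: "P = (G, load \<Omega> f g w)" "w \<in> W1inf_D \<Omega> \<Gamma>D" "G \<in> V" "weak_gradient \<Omega> w G"
      and Q: "Q = (H, load \<Omega> f g v)" "v \<in> W1inf_D \<Omega> \<Gamma>D" "H \<in> V" "weak_gradient \<Omega> v H" unfolding L_def by blast
    let ?s = "\<lambda>x. w x + c * v x"
    note W = W1inf_D_D[OF P(2)] W1inf_D_D[OF Q(2)]
    have "?s \<in> W1inf_D \<Omega> \<Gamma>D" by (rule W1inf_D_I[OF W(1) W(3) W(2) W(4)]) simp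
    moreover have "G + c *\<^sub>R H \<in> V" using P(3) Q(3) by (intro subspace_add[OF sV] subspace_scale[OF sV])
    moreover have "weak_gradient \<Omega> ?s (G + c *\<^sub>R H)"
      unfolding plus_fun_def scaleR_fun_def
      using P(3) Q(3) unfolding V_def
      by (intro weak_gradient_add weak_gradient_scaleR P(4) Q(4) Linf_scaleR Linf_cmult W1inf_Linf W)
    moreover have "P + c *\<^sub>R Q = (G + c *\<^sub>R H, load \<Omega> f g ?s)"
      unfolding P(1) Q(1) by (simp add: load_add[OF W(1) W(3)])
    ultimately show "P + c *\<^sub>R Q \<in> L" unfolding L_def by blast
  qed
  have LV: "fst ` L \<subseteq> V" by (auto simp: L_def)
  have leL: "a \<le> p G" if Ga: "(G, a) \<in> L" and GC: "G \<in> C" for G a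
  proof -
    obtain w where a: "a = load \<Omega> f g w" and w: "w \<in> W1inf_D \<Omega> \<Gamma>D" and G: "G \<in> Linf \<Omega>" "weak_gradient \<Omega> w G"
      using Ga unfolding L_def V_def by blast
    note W = W1inf_D_D[OF w]
    let ?v = "\<lambda>x. uhat x + 1 * w x"
    have vW: "?v \<in> W1inf \<Omega>" by (rule W1inf_add_cmult[OF uhat(1) W(1)])
    have gv: "AE x in M. grad \<Omega> ?v x = ?U x + G x"
      using grad_add_cmult[OF uhat(1) W(1), of 1] weak_gradient_unique[OF W1inf_grad[OF W(1)] G]
      by eventually_elim simp
    have "AE x in M. norm (?U x + G x) \<le> \<zeta> x" using GC by (simp add: C_def)
    with gv have "AE x in M. norm (grad \<Omega> ?v x) \<le> \<zeta> x" by eventually_elim simp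
    moreover have "surface_ae \<Gamma>D (\<lambda>x. boundary_trace \<Omega> ?v x = uD x)"
      using surface_ae_trace_add_cmult[OF uhat(1) W(1) \<Gamma>D uhat(2) W(2), of 1] by simp
    ultimately have "?v \<in> K" using vW by (simp add: primal_set_def)
    from min[OF this] have "energy u \<le> 1/2 * (LINT x|M. (norm (grad \<Omega> ?v x))\<^sup>2) - load \<Omega> f g ?v" by (simp add: energy_def)
    also have "(LINT x|M. (norm (grad \<Omega> ?v x))\<^sup>2) = (LINT x|M. (norm (?U x + G x))\<^sup>2)"
    proof (rule integral_cong_AE)
      show "(\<lambda>x. (norm (grad \<Omega> ?v x))\<^sup>2) \<in> borel_measurable M"
        using integrable_norm_square[OF W1inf_grad(1)[OF vW]] by (rule borel_measurable_integrable)
      show "(\<lambda>x. (norm (?U x + G x))\<^sup>2) \<in> borel_measurable M"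
        using intp[of G] G(1) by (auto simp: V_def intro: borel_measurable_integrable)
      show "AE x in M. (norm (grad \<Omega> ?v x))\<^sup>2 = (norm (?U x + G x))\<^sup>2" using gv by eventually_elim simp
    qed
    also have "load \<Omega> f g ?v = load \<Omega> f g uhat + 1 * load \<Omega> f g w" by (rule load_add[OF uhat(1) W(1)])
    finally show ?thesis unfolding a p_def by simp
  qed
  have CV: "C \<subseteq> V" by (auto simp: C_def)
  obtain l where l: "\<And>G H. G \<in> V \<Longrightarrow> H \<in> V \<Longrightarrow> l (G + H) = l G + l H"
    "\<And>c G. G \<in> V \<Longrightarrow> l (c *\<^sub>R G) = c * l G" "\<And>G. G \<in> C \<Longrightarrow> l G \<le> p G" "\<And>G a. (G, a) \<in> L \<Longrightarrow> l G = a"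
  proof (rule Hahn_Banach_convex_majorant[OF sV CV cC pC])
    show "\<exists>t>0. t *\<^sub>R G \<in> C" if "G \<in> V" for G by (rule absorbing[OF that])
    show "subspace L" "fst ` L \<subseteq> V" by (rule sL, rule LV)
    show "a \<le> p G" if "(G, a) \<in> L" "G \<in> C" for G a by (rule leL[OF that])
  qed (rule that)
  define N where "N = \<bar>1/2 * (LINT x|M. (\<zeta> x)\<^sup>2) - load \<Omega> f g uhat - energy u\<bar>"
  have \<zeta>2: "integrable M (\<lambda>x. (\<zeta> x)\<^sup>2)"
    using Linf_integrable[OF Linf_mult[OF \<zeta> \<zeta>]] by (simp add: power2_eq_square)
  have lC: "l G \<le> N" if "G \<in> C" for G
  proof -
    have "(LINT x|M. (norm (?U x + G x))\<^sup>2) \<le> (LINT x|M. (\<zeta> x)\<^sup>2)"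
    proof (rule integral_mono_AE[OF intp \<zeta>2])
      have "AE x in M. norm (?U x + G x) \<le> \<zeta> x" using that by (simp add: C_def)
      then show "AE x in M. (norm (?U x + G x))\<^sup>2 \<le> (\<zeta> x)\<^sup>2" by eventually_elim (rule power_mono, auto)
    qed (use that in \<open>simp add: C_def\<close>)
    then show ?thesis using l(3)[OF that] unfolding p_def N_def by linarith
  qed
  have bf: "bounded_functional (N / \<delta>) l"
    unfolding bounded_functional_def
  proof (intro conjI ballI allI impI)
    show "l (\<lambda>x. G x + H x) = l G + l H" if "G \<in> Linf \<Omega>" "H \<in> Linf \<Omega>" for G H
      using l(1)[of G H] that by (simp add: V_def plus_fun_def)
    show hom: "l (\<lambda>x. c *\<^sub>R G x) = c * l G" if "G \<in> Linf \<Omega>" for c G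
      using l(2)[of G c] that by (simp add: V_def scaleR_fun_def)
    fix G :: "'a \<Rightarrow> 'a" and B assume G: "G \<in> Linf \<Omega>" and B: "AE x in M. norm (G x) \<le> B"
    have B0: "0 \<le> B" by (rule AE_bound_nonneg[OF B])
    have t: "t * l G \<le> N" if "\<bar>t\<bar> * B \<le> \<delta>" for t
    proof -
      have "AE x in M. norm ((t *\<^sub>R G) x) \<le> \<delta>"
        using B
      proof eventually_elim
        fix x assume "norm (G x) \<le> B"
        then have "\<bar>t\<bar> * norm (G x) \<le> \<bar>t\<bar> * B" by (intro mult_left_mono) auto
        moreover have "norm ((t *\<^sub>R G) x) = \<bar>t\<bar> * norm (G x)" by (simp add: scaleR_fun_def)
        ultimately show "norm ((t *\<^sub>R G) x) \<le> \<delta>" using that by linarith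
      qed
      then have "t *\<^sub>R G \<in> C" using G by (intro small subspace_scale[OF sV]) (auto simp: V_def)
      from lC[OF this] show ?thesis using l(2)[of G t] G by (simp add: V_def)
    qed
    show "\<bar>l G\<bar> \<le> N / \<delta> * B"
    proof (cases "B = 0")
      case True
      have "l G = 0"
      proof (rule ccontr)
        assume "l G \<noteq> 0"
        \<comment> \<open>For \<open>B = 0\<close> every multiple of \<open>G\<close> is small, so a nonzero value could be scaled
          beyond \<open>N\<close>.\<close>
        with t[of "(N + 1) / l G"] True \<delta>(1) show False by simp
      qed
      then show ?thesis using True by simp
    next
      case False
      with B0 have "0 < B" by simp
      then have "\<delta> / B * l G \<le> N" "- (\<delta> / B) * l G \<le> N" using \<delta>(1) by (intro t; simp)+
      then show ?thesis using \<open>0 < B\<close> \<delta>(1) by (simp add: field_simps abs_if)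
    qed
  qed
  define \<nu> where "\<nu> A = (if A \<in> sets M then \<Sum>b\<in>Basis. l (\<lambda>x. indicator A x *\<^sub>R b) *\<^sub>R b else 0)" for A
  have rep: "l (\<lambda>x. indicator A x *\<^sub>R b) = \<nu> A \<bullet> b" if "A \<in> sets M" "b \<in> Basis" for A b
    using that by (simp add: \<nu>_def del: sets_restrict_space_iff)
  have out: "\<nu> A = 0" if "A \<notin> sets M" for A using that by (simp add: \<nu>_def)
  have \<nu>ba: "\<nu> \<in> ba \<Omega>" by (rule functional_representation(1)[OF bf rep out])
  have \<nu>_int: "ba_integral \<Omega> \<nu> G = l G" if "G \<in> Linf \<Omega>" for G
    by (rule functional_representation(3)[OF bf rep out that])
  show thesis
  proof (rule that[of \<nu>])
    show "\<nu> \<in> dual_set \<Omega> \<Gamma>D f g"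
      unfolding dual_set_def
    proof (rule CollectI, rule conjI[OF \<nu>ba], rule ballI)
      fix w assume w: "w \<in> W1inf_D \<Omega> \<Gamma>D"
      note gw = W1inf_grad[OF W1inf_D_D(1)[OF w]]
      have "(grad \<Omega> w, load \<Omega> f g w) \<in> L" unfolding L_def V_def using w gw by blast
      then show "ba_integral \<Omega> \<nu> (grad \<Omega> w) = load \<Omega> f g w" using \<nu>_int[OF gw(1)] l(4) by simp
    qed
    fix H :: "'a \<Rightarrow> 'a" assume H: "H \<in> Linf \<Omega>" "AE x in M. norm (H x) \<le> \<zeta> x"
    define G where "G = (\<lambda>x. H x - ?U x)"
    have GL: "G \<in> Linf \<Omega>" unfolding G_def by (intro Linf_diff H Ug)
    have "G \<in> C" using H(2) GL by (simp add: C_def V_def G_def)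
    from l(3)[OF this] have "ba_integral \<Omega> \<nu> G \<le> 1/2 * (LINT x|M. (norm (H x))\<^sup>2) - load \<Omega> f g uhat - energy u"
      using \<nu>_int[OF GL] by (simp add: p_def G_def)
    moreover have "ba_integral \<Omega> \<nu> G = ba_integral \<Omega> \<nu> H - ba_integral \<Omega> \<nu> ?U"
      unfolding G_def by (rule ba_integral_diff[OF \<nu>ba H(1) Ug])
    ultimately show "ba_integral \<Omega> \<nu> H - 1/2 * (LINT x|M. (norm (H x))\<^sup>2) \<le>
        ba_integral \<Omega> \<nu> ?U - load \<Omega> f g uhat - energy u" by linarith
  qed
qed

section \<open>Strong duality, optimality conditions and error identities\<close>

lemma measurable_flux:
  assumes [measurable]: "y \<in> borel_measurable M"
  shows "(\<lambda>x. flux \<zeta> x (y x)) \<in> borel_measurable M"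
  unfolding flux_def by measurable

lemma flux_admissible:
  assumes "y \<in> borel_measurable M"
  shows "AE x in M. norm (flux \<zeta> x (y x)) \<le> \<zeta> x" "(\<lambda>x. flux \<zeta> x (y x)) \<in> Linf \<Omega>"
proof -
  show 1: "AE x in M. norm (flux \<zeta> x (y x)) \<le> \<zeta> x"
    using \<zeta>_pos by eventually_elim (simp add: norm_flux)
  obtain C where "AE x in M. norm (\<zeta> x) \<le> C" using \<zeta> by (auto simp: Linf_iff)
  with 1 have "AE x in M. norm (flux \<zeta> x (y x)) \<le> C" by eventually_elim auto
  then show "(\<lambda>x. flux \<zeta> x (y x)) \<in> Linf \<Omega>" by (rule LinfI[OF measurable_flux[OF assms]])
qed

lemma measurable_phi_star:
  assumes [measurable]: "y \<in> borel_measurable M"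
  shows "(\<lambda>x. phi_star \<zeta> x (y x)) \<in> borel_measurable M"
  unfolding phi_star_min by measurable

lemma integrable_phi_star:
  assumes y: "integrable M y"
  shows "integrable M (\<lambda>x. phi_star \<zeta> x (y x))"
proof -
  obtain C where C: "0 \<le> C" "AE x in M. norm (\<zeta> x) \<le> C" using \<zeta> by (rule Linf_boundE)
  show ?thesis
  proof (rule Bochner_Integration.integrable_bound)
    show "integrable M (\<lambda>x. C * norm (y x))" using y by simp
    show "(\<lambda>x. phi_star \<zeta> x (y x)) \<in> borel_measurable M"
      by (rule measurable_phi_star[OF borel_measurable_integrable[OF y]])
    show "AE x in M. norm (phi_star \<zeta> x (y x)) \<le> norm (C * norm (y x))"
      using C(2) \<zeta>_pos
    proof eventually_elim
      fix x assume x: "norm (\<zeta> x) \<le> C" "0 < \<zeta> x"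
      have "phi_star \<zeta> x (y x) \<le> \<zeta> x * norm (y x)" by (rule phi_star_bounds(2)[of \<zeta> x, OF x(2)])
      also have "\<dots> \<le> C * norm (y x)" using x by (intro mult_right_mono) auto
      finally show "norm (phi_star \<zeta> x (y x)) \<le> norm (C * norm (y x))"
        using phi_star_bounds(1)[of \<zeta> x, OF x(2)] C(1) by simp
    qed
  qed
qed

lemma ba_decompositionD:
  assumes "ba_decomposition \<Omega> \<nu> y \<nu>s"
  shows "integrable M y" "ba_singular \<Omega> \<nu>s" "\<nu>s \<in> ba \<Omega>"
    and "H \<in> Linf \<Omega> \<Longrightarrow> ba_integral \<Omega> \<nu> H = (LINT x|M. y x \<bullet> H x) + ba_integral \<Omega> \<nu>s H"
proof -
  show y: "integrable M y" and s: "ba_singular \<Omega> \<nu>s" using assms unfolding ba_decomposition_def by blast+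
  show \<nu>s: "\<nu>s \<in> ba \<Omega>" using s unfolding ba_singular_def by blast
  have "\<nu> = (\<lambda>A. ac_ba \<Omega> y A + \<nu>s A)" using assms unfolding ba_decomposition_def by blast
  then show "ba_integral \<Omega> \<nu> H = (LINT x|M. y x \<bullet> H x) + ba_integral \<Omega> \<nu>s H" if "H \<in> Linf \<Omega>"
    using ba_add(2)[OF ac_ba_pairing(1)[OF y] \<nu>s that] ac_ba_pairing(2)[OF y that] by simp
qed

lemma dual_energy_eq:
  assumes \<nu>: "\<nu> \<in> dual_set \<Omega> \<Gamma>D f g" and dec: "ba_decomposition \<Omega> \<nu> y \<nu>s"
  shows "dual_energy \<Omega> \<Gamma>D \<zeta> uhat f g \<nu> = ereal (- (LINT x|M. phi_star \<zeta> x (y x)) - weighted_variation \<Omega> \<zeta> \<nu>s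
    + ba_integral \<Omega> \<nu> (grad \<Omega> uhat) - load \<Omega> f g uhat)"
proof -
  have "(LINT x|M. phi_star \<zeta> x (ba_density \<Omega> \<nu> x)) = (LINT x|M. phi_star \<zeta> x (y x))"
  proof (rule integral_AE_cong[symmetric])
    show "(\<lambda>x. phi_star \<zeta> x (y x)) \<in> borel_measurable M"
      by (rule measurable_phi_star[OF borel_measurable_integrable[OF ba_decompositionD(1)[OF dec]]])
    show "AE x in M. phi_star \<zeta> x (y x) = phi_star \<zeta> x (ba_density \<Omega> \<nu> x)"
      using AE_ba_density_eq[OF dec] by eventually_elim simp
  qed
  then show ?thesis using \<nu> by (simp add: dual_energy_def ba_singular_part_eq[OF dec])
qed

text \<open>Evaluation of the conjugate of \<open>H \<mapsto> 1/2 \<parallel>H\<parallel>\<^sup>2\<close> under the constraint \<open>|H| \<le> \<zeta>\<close> at a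
  measure with singular part. The singular part only sees \<open>H\<close> on the sets \<open>E n\<close>, where \<open>H\<close>
  may be any admissible \<open>G\<close>; since almost every point leaves \<open>E n\<close> eventually, the density
  part converges to its pointwise optimum.\<close>

lemma conjugate_le:
  assumes dec: "ba_decomposition \<Omega> \<nu> y \<nu>s"
    and le: "\<And>H. H \<in> Linf \<Omega> \<Longrightarrow> AE x in M. norm (H x) \<le> \<zeta> x \<Longrightarrow>
      ba_integral \<Omega> \<nu> H - 1/2 * (LINT x|M. (norm (H x))\<^sup>2) \<le> R"
  shows "(LINT x|M. phi_star \<zeta> x (y x)) + weighted_variation \<Omega> \<zeta> \<nu>s \<le> R"
proof -
  note D = ba_decompositionD[OF dec]
  have ym: "y \<in> borel_measurable M" by (rule borel_measurable_integrable[OF D(1)])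
  define F where "F x = flux \<zeta> x (y x)" for x
  have F: "AE x in M. norm (F x) \<le> \<zeta> x" "F \<in> Linf \<Omega>" unfolding F_def using flux_admissible[OF ym] by auto
  obtain E where E: "range E \<subseteq> sets M" "decseq E" "(\<lambda>n. emeasure lebesgue (E n)) \<longlonglongrightarrow> 0"
    "\<And>n. total_variation \<Omega> \<nu>s (\<Omega> - E n) = 0"
    using D(2) unfolding ba_singular_def by blast
  have Em: "E n \<in> sets M" "\<Omega> - E n \<in> sets M" for n
  proof -
    show 1: "E n \<in> sets M" using E(1) by blast
    show "\<Omega> - E n \<in> sets M" using sets.compl_sets[OF 1] by simp
  qed
  have AE_E: "AE x in M. \<exists>n. x \<notin> E n"
  proof -
    have "(\<Inter>n. E n) \<in> null_sets M"
    proof (rule null_setsI)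
      show m: "(\<Inter>n. E n) \<in> sets M" by (rule sets.countable_INT[OF E(1)]) simp
      have em: "emeasure M B = emeasure lebesgue B" if "B \<in> sets M" for B
        unfolding measure_domain_eq[OF that] by (rule emeasure_eq_measure)
      have "emeasure M (\<Inter>n. E n) \<le> emeasure lebesgue (E n)" for n
        unfolding em[OF Em(1), symmetric] by (rule emeasure_mono[OF _ Em(1)]) blast
      then have "emeasure M (\<Inter>n. E n) \<le> 0" using E(3) by (intro LIMSEQ_le_const) auto
      then show "emeasure M (\<Inter>n. E n) = 0" by simp
    qed
    from AE_not_in[OF this] show ?thesis by eventually_elim blast
  qed
  have "weighted_variation \<Omega> \<zeta> \<nu>s \<le> R - (LINT x|M. phi_star \<zeta> x (y x))"
  proof (rule weighted_variation_le[OF D(3) \<zeta> \<zeta>_nonneg])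
    fix G :: "'a \<Rightarrow> 'a" assume G: "G \<in> Linf \<Omega>" "AE x in M. norm (G x) \<le> \<zeta> x"
    define H where "H n x = G x + indicator (\<Omega> - E n) x *\<^sub>R (F x - G x)" for n x
    have FG: "(\<lambda>x. F x - G x) \<in> Linf \<Omega>" by (intro Linf_diff F G)
    have I: "(\<lambda>x. indicator (\<Omega> - E n) x *\<^sub>R (F x - G x)) \<in> Linf \<Omega>" for n by (rule Linf_restrict[OF Em(2) FG])
    have HL: "H n \<in> Linf \<Omega>" for n unfolding H_def by (intro Linf_add G(1) I)
    have Hle: "AE x in M. norm (H n x) \<le> \<zeta> x" for n
      using F(1) G(2) by eventually_elim (auto simp: H_def indicator_def)
    have Hs: "ba_integral \<Omega> \<nu>s (H n) = ba_integral \<Omega> \<nu>s G" for n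
      unfolding H_def ba_integral_add[OF D(3) G(1) I] ba_integral_restrict_eq_0[OF D(3) Em(2) E(4) FG] by simp
    define q where "q n x = y x \<bullet> H n x - 1/2 * (norm (H n x))\<^sup>2" for n x
    have "ba_integral \<Omega> \<nu>s G \<le> R - (LINT x|M. q n x)" for n
    proof -
      have "(LINT x|M. q n x) = (LINT x|M. y x \<bullet> H n x) - 1/2 * (LINT x|M. (norm (H n x))\<^sup>2)"
        unfolding q_def using integrable_inner_Linf[OF D(1) HL[of n]] integrable_norm_square[OF HL[of n]] by simp
      then show ?thesis using le[OF HL Hle, of n] D(4)[OF HL, of n] Hs[of n] by simp
    qed
    moreover have "(\<lambda>n. R - (LINT x|M. q n x)) \<longlonglongrightarrow> R - (LINT x|M. phi_star \<zeta> x (y x))"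
    proof (intro tendsto_diff tendsto_const)
      obtain C where C: "0 \<le> C" "AE x in M. norm (\<zeta> x) \<le> C" using \<zeta> by (rule Linf_boundE)
      show "(\<lambda>n. LINT x|M. q n x) \<longlonglongrightarrow> (LINT x|M. phi_star \<zeta> x (y x))"
      proof (rule integral_dominated_convergence[where w="\<lambda>x. norm (y x) * C + C\<^sup>2"])
        show "(\<lambda>x. phi_star \<zeta> x (y x)) \<in> borel_measurable M" by (rule measurable_phi_star[OF ym])
        show "q n \<in> borel_measurable M" for n
          unfolding q_def using integrable_inner_Linf[OF D(1) HL[of n]] integrable_norm_square[OF HL[of n]]
          by (intro borel_measurable_diff borel_measurable_times borel_measurable_integrable) auto
        show "integrable M (\<lambda>x. norm (y x) * C + C\<^sup>2)" using D(1) by simp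
        show "AE x in M. (\<lambda>n. q n x) \<longlonglongrightarrow> phi_star \<zeta> x (y x)"
          using AE_E \<zeta>_pos AE_space
        proof eventually_elim
          fix x assume "\<exists>n. x \<notin> E n" and pos: "0 < \<zeta> x" and "x \<in> space M"
          then obtain n where n: "x \<notin> E n" and x: "x \<in> \<Omega>" by auto
          have "q k x = phi_star \<zeta> x (y x)" if "n \<le> k" for k
          proof -
            have "x \<notin> E k" using decseqD[OF E(2) that] n by blast
            then have "H k x = F x" using x by (simp add: H_def)
            then show ?thesis by (simp add: q_def F_def phi_star_flux[of \<zeta> x, OF pos])
          qed
          then have "\<forall>\<^sub>F k in sequentially. q k x = phi_star \<zeta> x (y x)"
            unfolding eventually_sequentially by blast
          then show "(\<lambda>n. q n x) \<longlonglongrightarrow> phi_star \<zeta> x (y x)" by (rule tendsto_eventually)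
        qed
        show "AE x in M. norm (q n x) \<le> norm (y x) * C + C\<^sup>2" for n
          using Hle[of n] C(2)
        proof eventually_elim
          fix x assume "norm (H n x) \<le> \<zeta> x" "norm (\<zeta> x) \<le> C"
          then have h: "norm (H n x) \<le> C" by auto
          then have "\<bar>y x \<bullet> H n x\<bar> \<le> norm (y x) * C"
            by (meson Cauchy_Schwarz_ineq2 mult_left_mono norm_ge_zero order_trans)
          moreover have "(norm (H n x))\<^sup>2 \<le> C\<^sup>2" using h by (intro power_mono) auto
          moreover have "0 \<le> (norm (H n x))\<^sup>2" by simp
          ultimately show "norm (q n x) \<le> norm (y x) * C + C\<^sup>2" unfolding q_def real_norm_def by linarith
        qed
      qed
    qed
    ultimately show "ba_integral \<Omega> \<nu>s G \<le> R - (LINT x|M. phi_star \<zeta> x (y x))"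
      by (intro LIMSEQ_le_const) auto
  qed
  then show ?thesis by simp
qed

text \<open>The multiplier yields \<open>I(u) \<le> D(\<mu>)\<close>. The difference \<open>I(u) - D(\<mu>)\<close> is the sum of
  the integral of the Fenchel defect \<open>d \<ge> 0\<close> and of \<open>|\<zeta>\<mu>\<^sup>s|(\<Omega>) - \<langle>\<mu>\<^sup>s, \<nabla>u\<rangle> \<ge> 0\<close>, so both
  vanish. Finiteness of \<open>D(\<mu>)\<close> includes the feasibility of \<open>\<mu>\<close>.\<close>

theorem optimality:
  assumes u: "u \<in> K" and min: "\<And>v. v \<in> K \<Longrightarrow> energy u \<le> energy v"
    and max: "\<And>\<nu>. \<nu> \<in> ba \<Omega> \<Longrightarrow> dual_energy \<Omega> \<Gamma>D \<zeta> uhat f g \<nu> \<le> dual_energy \<Omega> \<Gamma>D \<zeta> uhat f g \<mu>"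
    and dec: "ba_decomposition \<Omega> \<mu> z \<mu>s"
  shows "\<mu> \<in> dual_set \<Omega> \<Gamma>D f g" "AE x in M. grad \<Omega> u x = flux \<zeta> x (z x)"
    "weighted_variation \<Omega> \<zeta> \<mu>s = ba_integral \<Omega> \<mu>s (grad \<Omega> u)"
proof -
  let ?D = "dual_energy \<Omega> \<Gamma>D \<zeta> uhat f g" and ?U = "grad \<Omega> u"
  have uW: "u \<in> W1inf \<Omega>" "surface_ae \<Gamma>D (\<lambda>x. boundary_trace \<Omega> u x = uD x)" and Ule: "AE x in M. norm (?U x) \<le> \<zeta> x"
    using u by (auto simp: primal_set_def)
  note U = W1inf_grad(1)[OF uW(1)]
  obtain \<nu> where \<nu>: "\<nu> \<in> dual_set \<Omega> \<Gamma>D f g"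
    and le: "\<And>H. H \<in> Linf \<Omega> \<Longrightarrow> AE x in M. norm (H x) \<le> \<zeta> x \<Longrightarrow>
      ba_integral \<Omega> \<nu> H - 1/2 * (LINT x|M. (norm (H x))\<^sup>2) \<le>
      ba_integral \<Omega> \<nu> (grad \<Omega> uhat) - load \<Omega> f g uhat - energy u"
    by (rule multiplier[OF u min], assumption) (rule that)
  have \<nu>ba: "\<nu> \<in> ba \<Omega>" using \<nu> by (simp add: dual_set_def)
  obtain y \<nu>s where decn: "ba_decomposition \<Omega> \<nu> y \<nu>s" using Yosida_Hewitt_decomposition[OF \<nu>ba] by blast
  have "(LINT x|M. phi_star \<zeta> x (y x)) + weighted_variation \<Omega> \<zeta> \<nu>s \<le>
      ba_integral \<Omega> \<nu> (grad \<Omega> uhat) - load \<Omega> f g uhat - energy u"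
    by (rule conjugate_le[OF decn le])
  then have "ereal (energy u) \<le> ?D \<nu>" unfolding dual_energy_eq[OF \<nu> decn] by simp
  also have "\<dots> \<le> ?D \<mu>" by (rule max[OF \<nu>ba])
  finally have low: "ereal (energy u) \<le> ?D \<mu>" .
  show \<mu>: "\<mu> \<in> dual_set \<Omega> \<Gamma>D f g"
  proof (rule ccontr)
    assume "\<mu> \<notin> dual_set \<Omega> \<Gamma>D f g"
    then have "?D \<mu> = - \<infinity>" by (simp add: dual_energy_def)
    with low show False by simp
  qed
  note D = ba_decompositionD[OF dec]
  have low': "energy u \<le> - (LINT x|M. phi_star \<zeta> x (z x)) - weighted_variation \<Omega> \<zeta> \<mu>s
      + ba_integral \<Omega> \<mu> (grad \<Omega> uhat) - load \<Omega> f g uhat"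
    using low unfolding dual_energy_eq[OF \<mu> dec] by simp
  have pair: "ba_integral \<Omega> \<mu> ?U - ba_integral \<Omega> \<mu> (grad \<Omega> uhat) = load \<Omega> f g u - load \<Omega> f g uhat"
    by (rule dual_pairing_diff[OF \<mu> uW uhat])
  have wv: "ba_integral \<Omega> \<mu>s ?U \<le> weighted_variation \<Omega> \<zeta> \<mu>s"
    by (rule ba_integral_le_weighted_variation[OF D(3) \<zeta> \<zeta>_nonneg U Ule])
  define d where "d x = 1/2 * (norm (?U x))\<^sup>2 + phi_star \<zeta> x (z x) - z x \<bullet> ?U x" for x
  have di: "integrable M d"
    unfolding d_def using integrable_norm_square[OF U] integrable_phi_star[OF D(1)] integrable_inner_Linf[OF D(1) U] by simp
  have d0: "AE x in M. 0 \<le> d x"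
    using Ule \<zeta>_pos
  proof eventually_elim
    fix x assume "norm (?U x) \<le> \<zeta> x" "0 < \<zeta> x"
    from Fenchel_inequality(1)[of \<zeta> x, OF this(2,1), of "z x"] show "0 \<le> d x" by (simp add: d_def)
  qed
  have "(LINT x|M. d x) = 1/2 * (LINT x|M. (norm (?U x))\<^sup>2) + (LINT x|M. phi_star \<zeta> x (z x)) - (LINT x|M. z x \<bullet> ?U x)"
    unfolding d_def using integrable_norm_square[OF U] integrable_phi_star[OF D(1)] integrable_inner_Linf[OF D(1) U] by simp
  then have sum: "(LINT x|M. d x) + (weighted_variation \<Omega> \<zeta> \<mu>s - ba_integral \<Omega> \<mu>s ?U) \<le> 0"
    using low' pair D(4)[OF U] unfolding energy_def by linarith
  have dn: "0 \<le> (LINT x|M. d x)" by (rule integral_nonneg_AE[OF d0])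
  show "weighted_variation \<Omega> \<zeta> \<mu>s = ba_integral \<Omega> \<mu>s ?U" using sum dn wv by linarith
  have "(LINT x|M. d x) = 0" using sum dn wv by linarith
  then have "AE x in M. d x = 0" using integral_nonneg_eq_0_iff_AE[OF di d0] by simp
  then show "AE x in M. ?U x = flux \<zeta> x (z x)"
    using Ule \<zeta>_pos
  proof eventually_elim
    fix x assume "d x = 0" "norm (?U x) \<le> \<zeta> x" "0 < \<zeta> x"
    then show "?U x = flux \<zeta> x (z x)"
      by (intro Fenchel_inequality(2)[of \<zeta> x]) (simp_all add: d_def)
  qed
qed

text \<open>Pointwise \<open>1/2 |V|\<^sup>2 - 1/2 |U|\<^sup>2 - z \<bullet> (V - U) = 1/2 |V - U|\<^sup>2 + (z - U) \<bullet> (U -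
  V)\<close>, and \<open>flux_contact\<close> restricts the last term to the contact set.\<close>

lemma primal_error_identity:
  assumes u: "u \<in> K" and \<mu>: "\<mu> \<in> dual_set \<Omega> \<Gamma>D f g" and dec: "ba_decomposition \<Omega> \<mu> z \<mu>s"
    and flux: "AE x in M. grad \<Omega> u x = flux \<zeta> x (z x)"
    and sing: "weighted_variation \<Omega> \<zeta> \<mu>s = ba_integral \<Omega> \<mu>s (grad \<Omega> u)"
    and v: "v \<in> K"
  shows "energy v - energy u = 1/2 * (LINT x|M. (norm (grad \<Omega> v x - grad \<Omega> u x))\<^sup>2)
    + (LINT x:{x \<in> \<Omega>. norm (grad \<Omega> u x) = \<zeta> x}|M. (norm (z x) / \<zeta> x - 1) * ((\<zeta> x)\<^sup>2 - grad \<Omega> u x \<bullet> grad \<Omega> v x))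
    + weighted_variation \<Omega> \<zeta> \<mu>s - ba_integral \<Omega> \<mu>s (grad \<Omega> v)"
proof -
  let ?U = "grad \<Omega> u" and ?V = "grad \<Omega> v"
  have uW: "u \<in> W1inf \<Omega>" "surface_ae \<Gamma>D (\<lambda>x. boundary_trace \<Omega> u x = uD x)"
    and vW: "v \<in> W1inf \<Omega>" "surface_ae \<Gamma>D (\<lambda>x. boundary_trace \<Omega> v x = uD x)"
    using u v by (auto simp: primal_set_def)
  note U = W1inf_grad(1)[OF uW(1)] and V = W1inf_grad(1)[OF vW(1)] and D = ba_decompositionD[OF dec]
  let ?s = "\<lambda>x. (z x - ?U x) \<bullet> (?U x - ?V x)"
  have zU: "integrable M (\<lambda>x. z x - ?U x)" using D(1) Linf_integrable[OF U] by simp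
  have si: "integrable M ?s" by (rule integrable_inner_Linf[OF zU Linf_diff[OF U V]])
  have contact: "(LINT x:{x \<in> \<Omega>. norm (?U x) = \<zeta> x}|M. (norm (z x) / \<zeta> x - 1) * ((\<zeta> x)\<^sup>2 - ?U x \<bullet> ?V x)) = (LINT x|M. ?s x)"
    unfolding set_lebesgue_integral_def
  proof (rule integral_AE_cong[symmetric, OF borel_measurable_integrable[OF si]])
    show "AE x in M. ?s x = indicator {x \<in> \<Omega>. norm (?U x) = \<zeta> x} x *\<^sub>R ((norm (z x) / \<zeta> x - 1) * ((\<zeta> x)\<^sup>2 - ?U x \<bullet> ?V x))"
      using flux \<zeta>_pos AE_space
    proof eventually_elim
      fix x assume "?U x = flux \<zeta> x (z x)" "0 < \<zeta> x" "x \<in> space M"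
      then show "?s x = indicator {x \<in> \<Omega>. norm (?U x) = \<zeta> x} x *\<^sub>R ((norm (z x) / \<zeta> x - 1) * ((\<zeta> x)\<^sup>2 - ?U x \<bullet> ?V x))"
        using flux_contact[of \<zeta> x "?U x" "z x" "?V x"] by (auto simp: indicator_def)
    qed
  qed
  have pair: "ba_integral \<Omega> \<mu> ?V - ba_integral \<Omega> \<mu> ?U = load \<Omega> f g v - load \<Omega> f g u"
    by (rule dual_pairing_diff[OF \<mu> vW uW])
  have ident: "1/2 * (norm (?V x))\<^sup>2 - 1/2 * (norm (?U x))\<^sup>2 - z x \<bullet> ?V x + z x \<bullet> ?U x =
      1/2 * (norm (?V x - ?U x))\<^sup>2 + ?s x" for x
    unfolding power2_norm_eq_inner by (simp add: inner_diff_left inner_diff_right inner_commute field_simps)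
  have "1/2 * (LINT x|M. (norm (?V x))\<^sup>2) - 1/2 * (LINT x|M. (norm (?U x))\<^sup>2) - (LINT x|M. z x \<bullet> ?V x) + (LINT x|M. z x \<bullet> ?U x)
      = (LINT x|M. 1/2 * (norm (?V x))\<^sup>2 - 1/2 * (norm (?U x))\<^sup>2 - z x \<bullet> ?V x + z x \<bullet> ?U x)"
    using integrable_norm_square[OF U] integrable_norm_square[OF V] integrable_inner_Linf[OF D(1) U] integrable_inner_Linf[OF D(1) V]
    by simp
  also have "\<dots> = (LINT x|M. 1/2 * (norm (?V x - ?U x))\<^sup>2 + ?s x)" unfolding ident ..
  also have "\<dots> = 1/2 * (LINT x|M. (norm (?V x - ?U x))\<^sup>2) + (LINT x|M. ?s x)"
    using integrable_norm_square[OF Linf_diff[OF V U]] si by (subst Bochner_Integration.integral_add) auto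
  finally show ?thesis
    unfolding contact energy_def using pair D(4)[OF U] D(4)[OF V] sing by linarith
qed

text \<open>Both measures are feasible, so testing with \<open>u - uhat\<close> replaces \<open>uhat\<close> by \<open>u\<close> in
  either dual energy. The Taylor remainder appears as an abstract function \<open>q\<close>, because the
  Hessian is a matrix and presupposes coordinates.\<close>

lemma dual_gap:
  assumes u: "u \<in> K" and \<mu>: "\<mu> \<in> dual_set \<Omega> \<Gamma>D f g" and decm: "ba_decomposition \<Omega> \<mu> z \<mu>s"
    and flux: "AE x in M. grad \<Omega> u x = flux \<zeta> x (z x)"
    and sing: "weighted_variation \<Omega> \<zeta> \<mu>s = ba_integral \<Omega> \<mu>s (grad \<Omega> u)"
    and \<nu>: "\<nu> \<in> dual_set \<Omega> \<Gamma>D f g" and dec: "ba_decomposition \<Omega> \<nu> y \<nu>s"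
    and q: "AE x in M. q x = phi_star \<zeta> x (y x) - phi_star \<zeta> x (z x) - flux \<zeta> x (z x) \<bullet> (y x - z x)"
  shows "- dual_energy \<Omega> \<Gamma>D \<zeta> uhat f g \<nu> + dual_energy \<Omega> \<Gamma>D \<zeta> uhat f g \<mu> =
    ereal ((LINT x|M. q x) + weighted_variation \<Omega> \<zeta> \<nu>s - ba_integral \<Omega> \<nu>s (grad \<Omega> u))"
proof -
  let ?U = "grad \<Omega> u"
  have uW: "u \<in> W1inf \<Omega>" "surface_ae \<Gamma>D (\<lambda>x. boundary_trace \<Omega> u x = uD x)"
    using u by (auto simp: primal_set_def)
  note U = W1inf_grad(1)[OF uW(1)] and D = ba_decompositionD[OF decm] and E = ba_decompositionD[OF dec]
  let ?q = "\<lambda>x. phi_star \<zeta> x (y x) - phi_star \<zeta> x (z x) - (y x \<bullet> ?U x - z x \<bullet> ?U x)"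
  note i = integrable_phi_star[OF D(1)] integrable_phi_star[OF E(1)] integrable_inner_Linf[OF D(1) U] integrable_inner_Linf[OF E(1) U]
  have qi: "integrable M ?q" using i by simp
  have "(LINT x|M. q x) = (LINT x|M. ?q x)"
  proof (rule integral_AE_cong[symmetric, OF borel_measurable_integrable[OF qi]])
    show "AE x in M. ?q x = q x"
      using q flux by eventually_elim (simp add: inner_diff_left inner_commute[of "flux \<zeta> _ (z _)"])
  qed
  also have "\<dots> = (LINT x|M. phi_star \<zeta> x (y x)) - (LINT x|M. phi_star \<zeta> x (z x)) - ((LINT x|M. y x \<bullet> ?U x) - (LINT x|M. z x \<bullet> ?U x))"
    using i by simp
  finally have "(LINT x|M. q x) = \<dots>" .
  moreover have "ba_integral \<Omega> \<mu> ?U - ba_integral \<Omega> \<mu> (grad \<Omega> uhat) = load \<Omega> f g u - load \<Omega> f g uhat"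
    by (rule dual_pairing_diff[OF \<mu> uW uhat])
  moreover have "ba_integral \<Omega> \<nu> ?U - ba_integral \<Omega> \<nu> (grad \<Omega> uhat) = load \<Omega> f g u - load \<Omega> f g uhat"
    by (rule dual_pairing_diff[OF \<nu> uW uhat])
  ultimately show ?thesis
    unfolding dual_energy_eq[OF \<mu> decm] dual_energy_eq[OF \<nu> dec]
    using D(4)[OF U] E(4)[OF U] sing by simp
qed

end

theorem lemma4p3:
  fixes \<Omega> \<Gamma>D \<Gamma>N :: "(real ^ 'd) set"
    and f \<zeta> uD uhat u :: "real ^ 'd \<Rightarrow> real"
    and g :: "(real ^ 'd \<Rightarrow> real) \<Rightarrow> real"
    and \<mu> \<mu>s :: "(real ^ 'd) set \<Rightarrow> real ^ 'd"
    and z :: "real ^ 'd \<Rightarrow> real ^ 'd"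
  assumes domain: "bounded \<Omega>" "lipschitz_domain \<Omega>" "simplicial \<Omega>"
    and parts: "boundary_parts \<Omega> \<Gamma>D \<Gamma>N"
    and f: "integrable (lebesgue_on \<Omega>) f"
    and g: "g \<in> W1inf_surface_dual \<Gamma>N"
    and \<zeta>: "\<zeta> \<in> Linf \<Omega>" "\<exists>c>0. AE x in lebesgue_on \<Omega>. c \<le> \<zeta> x"
    and uD: "uD \<in> W1inf_surface \<Gamma>D"
    and uhat: "uhat \<in> W1inf \<Omega>" "surface_ae \<Gamma>D (\<lambda>x. boundary_trace \<Omega> uhat x = uD x)"
      "esssup (lebesgue_on \<Omega>) (\<lambda>x. ereal (norm (grad \<Omega> uhat x /\<^sub>R \<zeta> x))) < 1"
    and primal_solution: "u \<in> primal_set \<Omega> \<Gamma>D \<zeta> uD"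
      "\<forall>v\<in>W1inf \<Omega>. primal_energy \<Omega> \<Gamma>D \<zeta> uD f g u \<le> primal_energy \<Omega> \<Gamma>D \<zeta> uD f g v"
    and dual_solution: "\<mu> \<in> ba \<Omega>"
      "\<forall>\<nu>\<in>ba \<Omega>. dual_energy \<Omega> \<Gamma>D \<zeta> uhat f g \<nu> \<le> dual_energy \<Omega> \<Gamma>D \<zeta> uhat f g \<mu>"
      "ba_decomposition \<Omega> \<mu> z \<mu>s"
  shows "(\<forall>v\<in>primal_set \<Omega> \<Gamma>D \<zeta> uD.
      primal_energy \<Omega> \<Gamma>D \<zeta> uD f g v - primal_energy \<Omega> \<Gamma>D \<zeta> uD f g u =
      ereal (1/2 * (LINT x|lebesgue_on \<Omega>. (norm (grad \<Omega> v x - grad \<Omega> u x))\<^sup>2)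
        + (LINT x:{x \<in> \<Omega>. norm (grad \<Omega> u x) = \<zeta> x}|lebesgue_on \<Omega>.
             (norm (z x) / \<zeta> x - 1) * ((\<zeta> x)\<^sup>2 - grad \<Omega> u x \<bullet> grad \<Omega> v x))
        + weighted_variation \<Omega> \<zeta> \<mu>s - ba_integral \<Omega> \<mu>s (grad \<Omega> v)))
    \<and> (\<forall>\<nu>\<in>dual_set \<Omega> \<Gamma>D f g. \<forall>y \<nu>s. ba_decomposition \<Omega> \<nu> y \<nu>s \<longrightarrow>
      - dual_energy \<Omega> \<Gamma>D \<zeta> uhat f g \<nu> + dual_energy \<Omega> \<Gamma>D \<zeta> uhat f g \<mu> =
      ereal ((LINT x|lebesgue_on \<Omega>.
             (phi_star_hessian_mean \<zeta> x (y x) (z x) *v (y x - z x)) \<bullet> (y x - z x))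
        + weighted_variation \<Omega> \<zeta> \<nu>s - ba_integral \<Omega> \<nu>s (grad \<Omega> u)))"
proof -
  have open_dom: "open \<Omega>" using domain(2) unfolding lipschitz_domain_def by (elim conjE)
  have ne_dom: "\<Omega> \<noteq> {}" using domain(2) unfolding lipschitz_domain_def by (elim conjE)
  have "openin (top_of_set (frontier \<Omega>)) \<Gamma>D" "openin (top_of_set (frontier \<Omega>)) \<Gamma>N"
    using parts unfolding boundary_parts_def by blast+
  then have sub: "\<Gamma>D \<subseteq> frontier \<Omega>" "\<Gamma>N \<subseteq> frontier \<Omega>" by (auto dest: openin_imp_subset)
  interpret gradient_constrained_problem \<Omega> \<Gamma>D \<Gamma>N f \<zeta> uD uhat g
    by (unfold_locales; fact open_dom ne_dom domain sub f g \<zeta> uhat)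
  have pe: "primal_energy \<Omega> \<Gamma>D \<zeta> uD f g v = ereal (energy v)" if "v \<in> primal_set \<Omega> \<Gamma>D \<zeta> uD" for v
    using that by (simp add: primal_energy_def energy_def)
  have min: "energy u \<le> energy v" if v: "v \<in> primal_set \<Omega> \<Gamma>D \<zeta> uD" for v
  proof -
    have "v \<in> W1inf \<Omega>" using v by (simp add: primal_set_def)
    from bspec[OF primal_solution(2) this] show ?thesis by (simp add: pe v primal_solution(1))
  qed
  note opt = optimality[OF primal_solution(1) min bspec[OF dual_solution(2)] dual_solution(3)]
  show ?thesis
  proof (intro conjI ballI allI impI)
    fix v assume v: "v \<in> primal_set \<Omega> \<Gamma>D \<zeta> uD"
    show "primal_energy \<Omega> \<Gamma>D \<zeta> uD f g v - primal_energy \<Omega> \<Gamma>D \<zeta> uD f g u =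
      ereal (1/2 * (LINT x|lebesgue_on \<Omega>. (norm (grad \<Omega> v x - grad \<Omega> u x))\<^sup>2)
        + (LINT x:{x \<in> \<Omega>. norm (grad \<Omega> u x) = \<zeta> x}|lebesgue_on \<Omega>.
             (norm (z x) / \<zeta> x - 1) * ((\<zeta> x)\<^sup>2 - grad \<Omega> u x \<bullet> grad \<Omega> v x))
        + weighted_variation \<Omega> \<zeta> \<mu>s - ba_integral \<Omega> \<mu>s (grad \<Omega> v))"
      unfolding pe[OF v] pe[OF primal_solution(1)] ereal_minus(1)
      by (simp only: primal_error_identity[OF primal_solution(1) opt(1) dual_solution(3) opt(2,3) v])
  next
    fix \<nu> y \<nu>s assume \<nu>: "\<nu> \<in> dual_set \<Omega> \<Gamma>D f g" and dec: "ba_decomposition \<Omega> \<nu> y \<nu>s"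
    show "- dual_energy \<Omega> \<Gamma>D \<zeta> uhat f g \<nu> + dual_energy \<Omega> \<Gamma>D \<zeta> uhat f g \<mu> =
      ereal ((LINT x|lebesgue_on \<Omega>.
             (phi_star_hessian_mean \<zeta> x (y x) (z x) *v (y x - z x)) \<bullet> (y x - z x))
        + weighted_variation \<Omega> \<zeta> \<nu>s - ba_integral \<Omega> \<nu>s (grad \<Omega> u))"
    proof (rule dual_gap[OF primal_solution(1) opt(1) dual_solution(3) opt(2,3) \<nu> dec])
      show "AE x in lebesgue_on \<Omega>. (phi_star_hessian_mean \<zeta> x (y x) (z x) *v (y x - z x)) \<bullet> (y x - z x) =
          phi_star \<zeta> x (y x) - phi_star \<zeta> x (z x) - flux \<zeta> x (z x) \<bullet> (y x - z x)"
        using \<zeta>_pos by eventually_elim (rule phi_star_Taylor)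
    qed
  qed
qed

end
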